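(* Let $1\le p,q\le\infty$, $a,b\in\mathbb{R}$ with $b\ge a-1$, $\alpha>-D\left(1-\frac1p\right)$ and $\beta<1-D\left(1-\frac1p\right)$. Let $f(x,v)\in\dot B^{a,\alpha}_{1,p,q}(\mathbb{R}^D_x\times\mathbb{R}^D_v)$ be such that $$v\cdot\nabla_xf=g$$ for some $g(x,v)\in\dot B^{b,\beta}_{1,p,q}(\mathbb{R}^D_x\times\mathbb{R}^D_v)$. Then $\int_{\mathbb{R}^D}f(x,v)\,dv\in\dot B^s_{p,q}(\mathbb{R}^D_x)$, where $s=(1+b-a)\frac{\alpha+D(1-\frac1p)}{1+\alpha-\beta}+a-D\left(1-\frac1p\right)$, and $$\left\|\int_{\mathbb{R}^D}f(x,v)\,dv\right\|_{\dot B^s_{p,q}(\mathbb{R}^D_x)}\le C\,\|f\|_{\dot B^{a,\alpha}_{1,p,q}(\mathbb{R}^D_x\times\mathbb{R}^D_v)}^{\frac{1-\beta-D(1-\frac1p)}{1+\alpha-\beta}}\;\|g\|_{\dot B^{b,\beta}_{1,p,q}(\mathbb{R}^D_x\times\mathbb{R}^D_v)}^{\frac{\alpha+D(1-\frac1p)}{1+\alpha-\beta}},$$ where the constant $C>0$ depends only on the fixed parameters ($D,p,q,a,b,\alpha,\beta$ and the chosen Littlewood-Paley functions). Furthermore, if (instead of $\beta<1-D(1-\frac1p)$) one has $\beta+D\left(1-\frac1p\right)=1$ and $q=1$, then, with $s=(1+b-a)\frac{\alpha+D(1-\frac1p)}{1+\alpha-\beta}+a-D\left(1-\frac1p\right)$,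 the estimate $$\left\|\int_{\mathbb{R}^D}f(x,v)\,dv\right\|_{\dot B^s_{p,1}(\mathbb{R}^D_x)}\le C\,\|f\|_{\dot B^{a,\alpha}_{1,p,1}(\mathbb{R}^D_x\times\mathbb{R}^D_v)}^{\frac{1-\beta-D(1-\frac1p)}{1+\alpha-\beta}}\;\|g\|_{\dot B^{b,\beta}_{1,p,1}(\mathbb{R}^D_x\times\mathbb{R}^D_v)}^{\frac{\alpha+D(1-\frac1p)}{1+\alpha-\beta}}$$ remains valid, where the constant $C>0$ depends only on the fixed parameters.
   Context: $D\ge1$ is the dimension. Fourier transform: $\mathcal{F}f(\xi)=\int e^{-i\xi\cdot v}f(v)\,dv$. Fix radial $\psi,\varphi\in C_0^\infty(\mathbb{R}^D)$, $\psi,\varphi\ge0$, with $\mathrm{supp}\,\psi\subset\{|\xi|\le1\}$, $\mathrm{supp}\,\varphi\subset\{\frac12\le|\xi|\le2\}$ and $1=\psi(\xi)+\sum_{k\ge0}\varphi(2^{-k}\xi)$ for all $\xi$. For $\delta>0$, $\Delta_\delta$ is the Fourier multiplier with symbol $\varphi(\xi/\delta)$; a superscript $x$ or $v$ indicates the variable on which it acts. Homogeneous Besov semi-norm: $\|f\|_{\dot B^s_{p,q}(\mathbb{R}^D)}=\left(\sum_{k=-\infty}^\infty2^{ksq}\|\Delta_{2^k}f\|_{L^p}^q\right)^{1/q}$ (supremum if $q=\infty$); $\dot B^s_{p,q}$ is the space of tempered distributions for which it is finite. $\dot B^{t,s}_{r,p,q}(\mathbb{R}^D_x\times\mathbb{R}^D_v)$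 is the space of tempered distributions with finite semi-norm $\left(\sum_{k,l\in\mathbb{Z}}2^{ktq}2^{lsq}\|\Delta_{2^k}^x\Delta_{2^l}^vf\|_{L^r(\mathbb{R}^D_x;L^p(\mathbb{R}^D_v))}^q\right)^{1/q}$ (obvious modification if $q=\infty$). The transport equation holds in the sense of distributions. When $f$ is not a priori globally integrable in $v$, the velocity average $\int f\,dv$ is understood through its dyadic blocks, defined (for $t>0$, $k\in\mathbb{Z}$) by $\Delta_{2^k}^x\int f\,dv=\int(\Delta_{t2^k}^vf)(x-tv,v)\,dv+\int_0^t\int(\Delta_{s2^k}^vg)(x-sv,v)\,dv\,ds$. *)

theory Defs
  imports "HOL-Analysis.Analysis" "HOL-Probability.Essential_Supremum"
begin

section \<open>Schwartz functions and tempered distributions\<close>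

primrec iter_deriv :: "'a list \<Rightarrow> ('a::euclidean_space \<Rightarrow> 'b::real_normed_vector) \<Rightarrow> 'a \<Rightarrow> 'b" where
  "iter_deriv [] f = f"
| "iter_deriv (e # es) f = (\<lambda>x. frechet_derivative (iter_deriv es f) (at x) e)"

definition smooth :: "('a::euclidean_space \<Rightarrow> 'b::real_normed_vector) \<Rightarrow> bool" where
  "smooth f \<longleftrightarrow> (\<forall>es. set es \<subseteq> Basis \<longrightarrow> (\<forall>x. iter_deriv es f differentiable (at x)))"

definition schwartz :: "('a::euclidean_space \<Rightarrow> complex) \<Rightarrow> bool" where
  "schwartz f \<longleftrightarrow> smooth f \<and>
     (\<forall>es N. set es \<subseteq> Basis \<longrightarrow> bounded (range (\<lambda>x. (1 + norm x) ^ N *\<^sub>R iter_deriv es f x)))"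

definition schwartz_seminorm :: "nat \<Rightarrow> ('a::euclidean_space \<Rightarrow> complex) \<Rightarrow> real" where
  "schwartz_seminorm N f =
     (SUP (es, x) \<in> {es. set es \<subseteq> Basis \<and> length es \<le> N} \<times> UNIV.
        (1 + norm x) ^ N * norm (iter_deriv es f x))"

definition test_function :: "('a::euclidean_space \<Rightarrow> 'b::real_normed_vector) \<Rightarrow> bool" where
  "test_function f \<longleftrightarrow> smooth f \<and> compact (closure {x. f x \<noteq> 0})"

text \<open>
  A distribution is a functional on complex-valued functions on the space; only its values on
  Schwartz functions are meaningful, and everything below depends on those values only.
\<close>

type_synonym 'a distr = "('a \<Rightarrow> complex) \<Rightarrow> complex"

definition tempered :: "('a::euclidean_space) distr \<Rightarrow> bool" where
  "tempered T \<longleftrightarrow>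
     (\<forall>f g. schwartz f \<longrightarrow> schwartz g \<longrightarrow> T (\<lambda>x. f x + g x) = T f + T g) \<and>
     (\<forall>c f. schwartz f \<longrightarrow> T (\<lambda>x. c * f x) = c * T f) \<and>
     (\<exists>C N. \<forall>f. schwartz f \<longrightarrow> norm (T f) \<le> C * schwartz_seminorm N f)"

text \<open>The tempered distribution \<open>T\<close> is (integration against) the function \<open>u\<close>.\<close>

definition represents :: "('a::euclidean_space \<Rightarrow> complex) \<Rightarrow> 'a distr \<Rightarrow> bool" where
  "represents u T \<longleftrightarrow> u \<in> borel_measurable borel \<and>
     (\<forall>\<eta>. schwartz \<eta> \<longrightarrow>
        integrable lborel (\<lambda>x. u x * \<eta> x) \<and> T \<eta> = (LINT x|lborel. u x * \<eta> x))"

section \<open>Fourier multipliers and Littlewood--Paley blocks\<close>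

definition fourier :: "('a::euclidean_space \<Rightarrow> complex) \<Rightarrow> 'a \<Rightarrow> complex" where
  "fourier f \<xi> = (LINT v|lborel. exp (- \<i> * complex_of_real (\<xi> \<bullet> v)) * f v)"

definition inv_fourier :: "('a::euclidean_space \<Rightarrow> complex) \<Rightarrow> 'a \<Rightarrow> complex" where
  "inv_fourier f v =
     (LINT \<xi>|lborel. exp (\<i> * complex_of_real (\<xi> \<bullet> v)) * f \<xi>) / complex_of_real ((2 * pi) ^ DIM('a))"

definition fourier_distr :: "('a::euclidean_space) distr \<Rightarrow> 'a distr" where
  "fourier_distr T = (\<lambda>\<eta>. T (fourier \<eta>))"

definition inv_fourier_distr :: "('a::euclidean_space) distr \<Rightarrow> 'a distr" where
  "inv_fourier_distr T = (\<lambda>\<eta>. T (inv_fourier \<eta>))"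

definition mult_distr :: "('a \<Rightarrow> complex) \<Rightarrow> 'a distr \<Rightarrow> 'a distr" where
  "mult_distr m T = (\<lambda>\<eta>. T (\<lambda>x. m x * \<eta> x))"

definition fourier_multiplier :: "('a::euclidean_space \<Rightarrow> complex) \<Rightarrow> 'a distr \<Rightarrow> 'a distr" where
  "fourier_multiplier m T = inv_fourier_distr (mult_distr m (fourier_distr T))"

definition radial :: "('a::real_normed_vector \<Rightarrow> real) \<Rightarrow> bool" where
  "radial f \<longleftrightarrow> (\<forall>x y. norm x = norm y \<longrightarrow> f x = f y)"

definition littlewood_paley :: "('a::euclidean_space \<Rightarrow> real) \<Rightarrow> ('a \<Rightarrow> real) \<Rightarrow> bool" where
  "littlewood_paley \<psi> \<phi> \<longleftrightarrow>
     test_function \<psi> \<and> test_function \<phi> \<and> radial \<psi> \<and> radial \<phi> \<and>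
     (\<forall>\<xi>. 0 \<le> \<psi> \<xi>) \<and> (\<forall>\<xi>. 0 \<le> \<phi> \<xi>) \<and>
     closure {\<xi>. \<psi> \<xi> \<noteq> 0} \<subseteq> {\<xi>. norm \<xi> \<le> 1} \<and>
     closure {\<xi>. \<phi> \<xi> \<noteq> 0} \<subseteq> {\<xi>. 1 / 2 \<le> norm \<xi> \<and> norm \<xi> \<le> 2} \<and>
     (\<forall>\<xi>. (\<lambda>k::nat. \<phi> ((1 / 2 ^ k) *\<^sub>R \<xi>)) sums (1 - \<psi> \<xi>))"

definition block :: "('a::euclidean_space \<Rightarrow> real) \<Rightarrow> real \<Rightarrow> 'a distr \<Rightarrow> 'a distr" where
  "block \<phi> \<delta> = fourier_multiplier (\<lambda>\<xi>. complex_of_real (\<phi> ((1 / \<delta>) *\<^sub>R \<xi>)))"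

definition block_x :: "('a::euclidean_space \<Rightarrow> real) \<Rightarrow> real \<Rightarrow> ('a \<times> 'a) distr \<Rightarrow> ('a \<times> 'a) distr" where
  "block_x \<phi> \<delta> = fourier_multiplier (\<lambda>(\<xi>, \<zeta>). complex_of_real (\<phi> ((1 / \<delta>) *\<^sub>R \<xi>)))"

definition block_v :: "('a::euclidean_space \<Rightarrow> real) \<Rightarrow> real \<Rightarrow> ('a \<times> 'a) distr \<Rightarrow> ('a \<times> 'a) distr" where
  "block_v \<phi> \<delta> = fourier_multiplier (\<lambda>(\<xi>, \<zeta>). complex_of_real (\<phi> ((1 / \<delta>) *\<^sub>R \<zeta>)))"

section \<open>Lebesgue and Besov norms\<close>

text \<open>Powers with exponent \<open>a \<ge> 0\<close>, with \<open>x\<^sup>0 = 1\<close> for every \<open>x\<close> (unlike \<open>0 powr 0 = 0\<close>).\<close>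

definition epowr :: "ennreal \<Rightarrow> real \<Rightarrow> ennreal" where
  "epowr x a = (if a = 0 then 1 else if x = top then top else ennreal (enn2real x powr a))"

text \<open>
  Exponents \<open>p \<in> [1, \<infinity>]\<close> are extended nonnegative reals. The same norm is used for functions
  (Lebesgue measure) and for sequences (counting measure, where the essential supremum is
  the supremum).
\<close>

definition Lp_norm :: "ennreal \<Rightarrow> 'a measure \<Rightarrow> ('a \<Rightarrow> ennreal) \<Rightarrow> ennreal" where
  "Lp_norm p M f =
     (if p = top then esssup M f
      else epowr (\<integral>\<^sup>+ x. epowr (f x) (enn2real p) \<partial>M) (1 / enn2real p))"

text \<open>
  Norms of distributions: the representing function is unique up to null sets, and the norm is
  \<open>\<infinity>\<close> (infimum of the empty set) if there is none.
\<close>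

definition Lp_norm_distr :: "ennreal \<Rightarrow> ('a::euclidean_space) distr \<Rightarrow> ennreal" where
  "Lp_norm_distr p T = (INF u \<in> {u. represents u T}. Lp_norm p lborel (\<lambda>x. ennreal (norm (u x))))"

definition mixed_norm_distr :: "ennreal \<Rightarrow> ennreal \<Rightarrow> ('a::euclidean_space \<times> 'a) distr \<Rightarrow> ennreal" where
  "mixed_norm_distr r p T = (INF u \<in> {u. represents u T}.
     Lp_norm r lborel (\<lambda>x. Lp_norm p lborel (\<lambda>v. ennreal (norm (u (x, v))))))"

definition besov_norm ::
  "('a::euclidean_space \<Rightarrow> real) \<Rightarrow> real \<Rightarrow> ennreal \<Rightarrow> ennreal \<Rightarrow> 'a distr \<Rightarrow> ennreal" where
  "besov_norm \<phi> s p q T = Lp_norm q (count_space (UNIV :: int set))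
     (\<lambda>k. ennreal (2 powr (of_int k * s)) * Lp_norm_distr p (block \<phi> (2 powi k) T))"

definition besov ::
  "('a::euclidean_space \<Rightarrow> real) \<Rightarrow> real \<Rightarrow> ennreal \<Rightarrow> ennreal \<Rightarrow> 'a distr set" where
  "besov \<phi> s p q = {T. tempered T \<and> besov_norm \<phi> s p q T < top}"

definition besov_xv_norm ::
  "('a::euclidean_space \<Rightarrow> real) \<Rightarrow> real \<Rightarrow> real \<Rightarrow> ennreal \<Rightarrow> ennreal \<Rightarrow> ennreal \<Rightarrow> ('a \<times> 'a) distr \<Rightarrow> ennreal" where
  "besov_xv_norm \<phi> t s r p q T = Lp_norm q (count_space (UNIV :: (int \<times> int) set))
     (\<lambda>(k, l). ennreal (2 powr (of_int k * t)) * ennreal (2 powr (of_int l * s)) *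
        mixed_norm_distr r p (block_x \<phi> (2 powi k) (block_v \<phi> (2 powi l) T)))"

definition besov_xv ::
  "('a::euclidean_space \<Rightarrow> real) \<Rightarrow> real \<Rightarrow> real \<Rightarrow> ennreal \<Rightarrow> ennreal \<Rightarrow> ennreal \<Rightarrow> ('a \<times> 'a) distr set" where
  "besov_xv \<phi> t s r p q = {T. tempered T \<and> besov_xv_norm \<phi> t s r p q T < top}"

section \<open>The transport equation and velocity averages\<close>

text \<open>
  \<open>v \<cdot> \<nabla>\<^sub>x f = g\<close> in the sense of distributions; the derivative of \<open>\<zeta>\<close> at \<open>(x, v)\<close> in
  the direction \<open>(v, 0)\<close> is \<open>v \<cdot> \<nabla>\<^sub>x \<zeta> (x, v)\<close>.
\<close>

definition transport_eq :: "('a::euclidean_space \<times> 'a) distr \<Rightarrow> ('a \<times> 'a) distr \<Rightarrow> bool" where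
  "transport_eq f g \<longleftrightarrow> (\<forall>\<zeta>. test_function \<zeta> \<longrightarrow>
     - f (\<lambda>(x, v). frechet_derivative \<zeta> (at (x, v)) (v, 0)) = g \<zeta>)"

text \<open>The distribution \<open>h (x - t v, v)\<close>.\<close>

definition shear :: "real \<Rightarrow> ('a::euclidean_space \<times> 'a) distr \<Rightarrow> ('a \<times> 'a) distr" where
  "shear t h = (\<lambda>\<zeta>. h (\<lambda>(x, v). \<zeta> (x + t *\<^sub>R v, v)))"

text \<open>
  \<open>R = \<integral> T dv\<close> for a distribution \<open>T\<close> on phase space: \<open>T\<close> is tested against \<open>\<eta> \<otimes> 1\<close>, the
  constant \<open>1\<close> being approximated by \<open>\<kappa> (\<epsilon> v)\<close>, and the limit must not depend on the cutoff
  \<open>\<kappa>\<close>. If \<open>T\<close> is a function such that \<open>T (x, v) \<eta> x\<close> is integrable, this is the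
  usual integral, by dominated convergence. A distributional definition is needed because
  \<open>\<Delta>\<^sup>v f\<close> is localized in the frequencies of \<open>v\<close> only, so it need not be a function.
\<close>

definition has_v_integral :: "('a::euclidean_space \<times> 'a) distr \<Rightarrow> 'a distr \<Rightarrow> bool" where
  "has_v_integral T R \<longleftrightarrow> (\<forall>\<kappa> \<eta>. schwartz \<kappa> \<longrightarrow> \<kappa> 0 = 1 \<longrightarrow> schwartz \<eta> \<longrightarrow>
     ((\<lambda>\<epsilon>::real. T (\<lambda>(x, v). \<eta> x * \<kappa> (\<epsilon> *\<^sub>R v))) \<longlongrightarrow> R \<eta>) (at_right 0))"

text \<open>
  The formula defining the block of frequency \<open>2\<^sup>k\<close> of \<open>\<rho> = \<integral> f dv\<close>, with \<open>k\<close> and \<open>t\<close> given.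
  Restricting the \<open>v\<close>-frequency to \<open>t 2\<^sup>k\<close> localizes the \<open>x\<close>-frequency of the right-hand side
  at \<open>2\<^sup>k\<close>, since the Fourier transform of \<open>\<integral> h (x - t v, v) dv\<close> at \<open>\<xi>\<close> is that of \<open>h\<close> at
  \<open>(\<xi>, t \<xi>)\<close>; this is why no block in \<open>x\<close> occurs there.
\<close>

definition v_average_block ::
  "('a::euclidean_space \<Rightarrow> real) \<Rightarrow> ('a \<times> 'a) distr \<Rightarrow> ('a \<times> 'a) distr \<Rightarrow> 'a distr \<Rightarrow> int \<Rightarrow> real \<Rightarrow> bool" where
  "v_average_block \<phi> f g \<rho> k t \<longleftrightarrow> (\<exists>F G.
     has_v_integral (shear t (block_v \<phi> (t * 2 powi k) f)) F \<and>
     (\<forall>s\<in>{0<..<t}. has_v_integral (shear s (block_v \<phi> (s * 2 powi k) g)) (G s)) \<and>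
     (\<forall>\<eta>. schwartz \<eta> \<longrightarrow>
        set_integrable lborel {0<..<t} (\<lambda>s. G s \<eta>) \<and>
        block \<phi> (2 powi k) \<rho> \<eta> = F \<eta> + (LINT s:{0<..<t}|lborel. G s \<eta>)))"

text \<open>
  \<open>f\<close> is the function \<open>u\<close>, which is globally integrable in \<open>v\<close>, locally integrably in \<open>x\<close>
  and with at most polynomial growth, so that \<open>\<integral> u dv\<close> is a tempered distribution.
\<close>

definition v_integrable :: "('a::euclidean_space \<times> 'a \<Rightarrow> complex) \<Rightarrow> ('a \<times> 'a) distr \<Rightarrow> bool" where
  "v_integrable u f \<longleftrightarrow> represents u f \<and>
     (\<exists>N::nat. integrable lborel (\<lambda>(x, v). u (x, v) / complex_of_real ((1 + norm x) ^ N)))"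

text \<open>
  \<open>\<rho> = \<integral> f dv\<close>, where \<open>v \<cdot> \<nabla>\<^sub>x f = g\<close>. In the second case \<open>\<rho>\<close> is determined by its dyadic blocks
  only up to polynomials, which no homogeneous Besov semi-norm sees; hence a relation.
\<close>

definition velocity_average ::
  "('a::euclidean_space \<Rightarrow> real) \<Rightarrow> ('a \<times> 'a) distr \<Rightarrow> ('a \<times> 'a) distr \<Rightarrow> 'a distr \<Rightarrow> bool" where
  "velocity_average \<phi> f g \<rho> \<longleftrightarrow> tempered \<rho> \<and>
     (if \<exists>u. v_integrable u f
      then \<exists>u. v_integrable u f \<and> represents (\<lambda>x. LINT v|lborel. u (x, v)) \<rho>
      else \<forall>k. \<forall>t>0. v_average_block \<phi> f g \<rho> k t)"

end

theory Submission
  imports Defs "HOL-Probability.Probability"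
begin

text \<open>
The dispersive mechanism behind the theorem is this. Fix a frequency 2^k in x and test f against
\<open>\<theta> (x + r v)\<close>, where \<open>\<theta>\<close> has frequencies of size 2^k. In phase space this test function lives at
frequencies \<open>(\<xi>, r \<xi>)\<close>, hence sees only the blocks of f with frequency about 2^k in x and about \<open>r 2^k\<close>
in v. By the transport equation its r-derivative is minus the same pairing with g. Letting r run
from 0 (where the pairing is that of the velocity average with \<open>\<theta>\<close>) to t gives the block of the average as

 \<open>\<integral> (block of f at t 2^k) (x - t v, v) dv + \<integral>\<^sub>0\<^sup>t \<integral> (block of g at r 2^k) (x - r v, v) dv dr\<close>.

The substitution \<open>y = x - r v\<close> shows that \<open>h \<mapsto> \<integral> h (x - r v, v) dv\<close> has norm at most a constant times
\<open>r^(-d)\<close> from \<open>L^1\<^sub>x L^p\<^sub>v\<close> to \<open>L^p\<^sub>x\<close>, where \<open>d = D (1 - 1/p)\<close> (\<open>dispersive\<close>, \<open>block_bound\<close>).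
The choice \<open>t 2^k = 2^(L + m k)\<close> with \<open>m = (1 + b - a) / (1 + \<alpha> - \<beta>)\<close> makes the weights on the two sides
cancel. What remains is a matrix acting on the \<open>l^q\<close> sequence of weighted blocks, whose rows and columns
are summable: banded for f (\<open>lq_first\<close>), and a one-sided geometric series of ratio \<open>2^(1 - d - \<beta>)\<close> for g
(\<open>lq_second\<close>). In the critical case \<open>\<beta> + d = 1\<close> that ratio is one and only the columns
are summable, which suffices for \<open>q = 1\<close>. The resulting bound \<open>2^(-(\<alpha>+d) L) X + 2^((1-d-\<beta>) L) Y\<close> holds for every real L,
and the choice of L interpolates between the two norms (\<open>interpolate\<close>).

Since f and g are distributions, the blocks enter only through functions representing sums of
neighbouring blocks (\<open>locrep\<close>), and every pairing is regularized by a cutoff \<open>\<kappa> (\<epsilon> v)\<close> with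
band-limited \<open>\<kappa>\<close>, which keeps the test functions Schwartz and their spectra near \<open>(\<xi>, r \<xi>)\<close>. The
derivative in r is taken for fixed \<open>\<epsilon>\<close> (\<open>transport_gm\<close>), and then \<open>\<epsilon> \<rightarrow> 0\<close>. That the regularized averages of the
full velocity block converge, for every cutoff, to the same limit is \<open>has_v_integral_Av\<close>.

If f is integrable in v, its average is an integral, and the identity for its blocks follows by
letting the lower endpoint of r tend to 0 with \<open>\<epsilon>\<close> (\<open>v_integrable_RR\<close>). Otherwise a tempered distribution
with the prescribed blocks has to be constructed (\<open>realize\<close>). The series over high frequencies converges, because the blocks
grow at most exponentially in \<open>|k|\<close> while those of a Schwartz function decay faster; at low frequencies
the same holds after the Taylor polynomial of the Fourier transform at 0 has been removed, by a
projection that does not affect test functions whose spectrum avoids 0.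

Tempered distributions are handled through bounded families: a linear functional on Schwartz functions is tempered
iff it is bounded on every bounded family (\<open>tempered_bounded\<close>, \<open>temperedI\<close>). Norm inequalities are used with
constants (mostly powers of 2) that are not sharp; the statement allows any constant.
\<close>

section \<open>Notation\<close>

abbreviation "cr \<equiv> complex_of_real"
abbreviation "bmeas \<equiv> borel_measurable borel"
lemmas LINT_cong = Bochner_Integration.integral_cong

abbreviation nn_lborel :: "('a::euclidean_space => ennreal) => ennreal" (binder "NN " 10) where
 "nn_lborel f == integral\<^sup>N lborel f"

abbreviation stream :: "real => 'a::real_vector \<times> 'a => 'a" where "stream r z == fst z + r *\<^sub>R snd z"

abbreviation pd :: "'a => ('a::euclidean_space => 'b::real_normed_vector) => 'a => 'b" where
 "pd e f == (%x. frechet_derivative f (at x) e)"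

section \<open>Families of functions with uniformly bounded derivatives\<close>

text \<open>Uniform boundedness of a family, with all derivatives up to order n, against all the weights \<open>w N\<close>. The
recursion peels off the innermost derivative, so that inductions on n may change the family.\<close>

primrec lev :: "(nat => 'a::euclidean_space => real) => nat => ('j => 'a => complex) => 'j set => bool" where
 "lev w 0 F J \<longleftrightarrow> (\<forall>N. \<exists>C. \<forall>j\<in>J. \<forall>x. w N x * norm (F j x) <= C)"
| "lev w (Suc n) F J \<longleftrightarrow> (\<forall>N. \<exists>C. \<forall>j\<in>J. \<forall>x. w N x * norm (F j x) <= C) \<and>
   (\<forall>j\<in>J. \<forall>x. F j differentiable (at x)) \<and> (\<forall>e\<in>Basis. lev w n (%j. pd e (F j)) J)"

lemma lev_0: "lev w n F J ==> lev w 0 F J"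
 by (cases n) auto

lemma lev_SucD: "lev w (Suc n) F J ==> lev w n F J"
proof (induction n arbitrary: F)
 case 0 then show ?case by (auto simp: lev.simps(2))
next
 case (Suc n)
 show ?case unfolding lev.simps(2)[of w n] using Suc.prems Suc.IH unfolding lev.simps(2)[of w "Suc n"] by blast
qed

lemma lev_le: "lev w n F J ==> m <= n ==> lev w m F J"
 by (induction n) (auto simp: le_Suc_eq simp del: lev.simps dest: lev_SucD)

lemma lev_cong: "(\<And>j. j \<in> J ==> F j = G j) ==> lev w n F J = lev w n G J"
proof (induction n arbitrary: F G)
 case 0 then show ?case by simp
next
 case (Suc n)
 have "lev w n (%j. pd e (F j)) J = lev w n (%j. pd e (G j)) J" for e
  by (rule Suc.IH) (simp add: Suc.prems)
 then show ?case unfolding lev.simps using Suc.prems by simp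
qed

lemma lev_reindex: "lev w n F J ==> h ` K \<subseteq> J ==> lev w n (%k. F (h k)) K"
proof (induction n arbitrary: F)
 case 0
 then have "\<forall>N. \<exists>C. \<forall>j\<in>J. \<forall>x. w N x * norm (F j x) <= C" by simp
 then have "\<exists>C. \<forall>k\<in>K. \<forall>x. w N x * norm (F (h k) x) <= C" for N
  using 0(2) by (metis image_subset_iff)
 then show ?case by simp
next
 case (Suc n)
 have "lev w n (%k. pd e (F (h k))) K" if "e \<in> Basis" for e
  using Suc.IH[of "%j. pd e (F j)"] Suc.prems that by auto
 moreover have "\<exists>C. \<forall>k\<in>K. \<forall>x. w N x * norm (F (h k) x) <= C" for N
  using Suc.prems unfolding lev.simps by (metis image_subset_iff)
 ultimately show ?case using Suc.prems by (auto simp: image_subset_iff)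
qed

lemma lev_SucI:
 assumes "lev w 0 F J" and D: "\<And>j x. j \<in> J ==> (F j has_derivative D j x) (at x)"
  and "\<And>e. e \<in> Basis ==> lev w n (%j x. D j x e) J"
 shows "lev w (Suc n) F J"
proof -
 have "pd e (F j) = (%x. D j x e)" if "j \<in> J" for e j
  using frechet_derivative_at[OF D[OF that]] by metis
 then have "lev w n (%j. pd e (F j)) J" if "e \<in> Basis" for e
  using assms(3)[OF that] lev_cong[of J "%j. pd e (F j)" "%j x. D j x e"] by auto
 moreover have "F j differentiable (at x)" if "j \<in> J" for j x using D[OF that] by (rule differentiableI)
 ultimately show ?thesis using assms(1) by auto
qed

lemma lev_has_derivative:
 "lev w (Suc n) F J ==> j \<in> J ==> (F j has_derivative frechet_derivative (F j) (at x)) (at x)"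
 using frechet_derivative_works[of "F j" "at x"] by auto

lemma lev_zero: "lev w n (%j x. 0) J"
 by (induction n) (auto intro: exI[of _ 0])

lemma lev_add:
 assumes w: "\<And>N x. 0 <= w N x"
 shows "lev w n F J ==> lev w n G J ==> lev w n (%j x. F j x + G j x) J"
proof (induction n arbitrary: F G)
 case 0
 show ?case unfolding lev.simps
 proof
  fix N
  obtain C D where "\<forall>j\<in>J. \<forall>x. w N x * norm (F j x) <= C" "\<forall>j\<in>J. \<forall>x. w N x * norm (G j x) <= D"
   using 0 by (simp, meson)
  moreover have "w N x * norm (F j x + G j x) <= w N x * norm (F j x) + w N x * norm (G j x)" for j x
   using mult_left_mono[OF norm_triangle_ineq[of "F j x" "G j x"] w[of N x]] by (simp add: algebra_simps)
  ultimately show "\<exists>C. \<forall>j\<in>J. \<forall>x. w N x * norm (F j x + G j x) <= C"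
   by (intro exI[of _ "C + D"]) (meson add_mono order_trans)
 qed
next
 case (Suc n)
 note F = lev_has_derivative[OF Suc.prems(1)] note G = lev_has_derivative[OF Suc.prems(2)]
 have z: "lev w 0 (%j x. F j x + G j x) J" using Suc.IH[OF lev_SucD[OF Suc.prems(1)] lev_SucD[OF Suc.prems(2)]] lev_0 by blast
 show ?case
  by (rule lev_SucI[OF z has_derivative_add[OF F G]]) (use Suc in auto)
qed

lemma lev_sum:
 assumes w: "\<And>N x. 0 <= w N x" and I: "finite I" "\<And>i. i \<in> I ==> lev w n (F i) J"
 shows "lev w n (%j x. \<Sum>i\<in>I. F i j x) J"
 using I
proof (induction I)
 case empty show ?case using lev_zero by simp
next
 case (insert i I)
 then show ?case using lev_add[where w=w and n=n and F="F i" and J=J and G="%j x. \<Sum>i\<in>I. F i j x"] w by simp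
qed

text \<open>Leibniz' rule. The weight of the product may be distributed over the factors in any way.\<close>

lemma lev_mult:
 assumes w: "\<And>N x. 0 <= w1 N x" "\<And>N x. 0 <= w2 N x" "\<And>N x. 0 <= w3 N x"
  and w3: "\<And>N. \<exists>N1 N2 K. 0 <= K \<and> (\<forall>x. w3 N x <= K * (w1 N1 x * w2 N2 x))"
 shows "lev w1 n F J ==> lev w2 n G J ==> lev w3 n (%j x. F j x * G j x) J"
proof (induction n arbitrary: F G)
 case 0
 show ?case unfolding lev.simps
 proof
  fix N
  obtain N1 N2 K where K: "0 <= K" "\<And>x. w3 N x <= K * (w1 N1 x * w2 N2 x)" using w3 by blast
  obtain C D where CD: "\<forall>j\<in>J. \<forall>x. w1 N1 x * norm (F j x) <= C" "\<forall>j\<in>J. \<forall>x. w2 N2 x * norm (G j x) <= D"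
   using 0 by (simp, meson)
  have "w3 N x * norm (F j x * G j x) <= K * (C * D)" if "j \<in> J" for j x
  proof -
   have C0: "0 <= C" using CD(1) that w(1)[of N1 x] by (meson mult_nonneg_nonneg norm_ge_zero order_trans)
   have "w3 N x * norm (F j x * G j x) <= (K * (w1 N1 x * w2 N2 x)) * norm (F j x * G j x)"
    using K by (intro mult_right_mono) auto
   also have "\<dots> = K * ((w1 N1 x * norm (F j x)) * (w2 N2 x * norm (G j x)))"
    by (simp add: norm_mult algebra_simps)
   also have "\<dots> <= K * (C * D)"
    using CD that K w C0 by (intro mult_left_mono mult_mono) auto
   finally show ?thesis .
  qed
  then show "\<exists>C. \<forall>j\<in>J. \<forall>x. w3 N x * norm (F j x * G j x) <= C" by blast
 qed
next
 case (Suc n)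
 note F = lev_has_derivative[OF Suc.prems(1)] note G = lev_has_derivative[OF Suc.prems(2)]
 have z: "lev w3 0 (%j x. F j x * G j x) J" using Suc.IH[OF lev_SucD[OF Suc.prems(1)] lev_SucD[OF Suc.prems(2)]] lev_0 by blast
 show ?case
 proof (rule lev_SucI[OF z has_derivative_mult[OF F G]], assumption, assumption)
  fix e :: 'a assume e: "e \<in> Basis"
  show "lev w3 n (%j x. F j x * pd e (G j) x + pd e (F j) x * G j x) J"
   by (intro lev_add w Suc.IH lev_SucD[OF Suc.prems(1)] lev_SucD[OF Suc.prems(2)]) (use Suc.prems e in auto)
 qed
qed

lemma lev_const:
 assumes "\<And>j. j \<in> J ==> norm (c j) <= M"
 shows "lev (%N x. 1) n (%j x. c j) J"
proof (cases n)
 case 0 then show ?thesis using assms by (auto intro: exI[of _ M])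
next
 case (Suc m) show ?thesis unfolding Suc
  by (rule lev_SucI[where D="%j x e. 0"]) (use assms lev_zero in \<open>auto intro: exI[of _ M]\<close>)
qed

lemma lev_cmult:
 assumes w: "\<And>N x. 0 <= w N x" and "\<And>j. j \<in> J ==> norm (c j) <= M" and "lev w n F J"
 shows "lev w n (%j x. c j * F j x) J"
proof -
 have ex: "\<exists>(N1::nat) N2 K. 0 <= K \<and> (\<forall>x. w N x <= K * ((1::real) * w N2 x))" for N
  by (rule exI[of _ 0], rule exI[of _ N], rule exI[of _ 1]) simp
 show ?thesis
  by (rule lev_mult[where ?w1.0="%N x. 1" and ?w2.0=w, OF _ w w ex lev_const[OF assms(2)] assms(3)]) auto
qed

lemma linear_sum_Basis:
 fixes D :: "'a::euclidean_space => complex"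
 assumes "linear D" shows "D v = (\<Sum>b\<in>Basis. cr (v \<bullet> b) * D b)"
proof -
 have "D v = D (\<Sum>b\<in>Basis. (v \<bullet> b) *\<^sub>R b)" by (simp add: euclidean_representation)
 also have "\<dots> = (\<Sum>b\<in>Basis. (v \<bullet> b) *\<^sub>R D b)" using assms by (simp add: linear_sum linear_scale)
 finally show ?thesis by (simp add: scaleR_conv_of_real)
qed

text \<open>Derivatives of \<open>F \<circ> L\<close> are combinations of derivatives of F with coefficients bounded by the norm
of L.\<close>

lemma lev_comp:
 fixes L :: "'b::euclidean_space => 'a::euclidean_space"
 assumes L: "bounded_linear L"
  and w: "\<And>N x. 0 <= w1 N x" "\<And>N x. 0 <= w2 N x"
  and w2: "\<And>N. \<exists>N1 K. 0 <= K \<and> (\<forall>z. w2 N z <= K * w1 N1 (L z))"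
 shows "lev w1 n F J ==> lev w2 n (%j z. F j (L z)) J"
proof (induction n arbitrary: F)
 case 0
 show ?case unfolding lev.simps
 proof
  fix N
  obtain N1 K where K: "0 <= K" "\<And>z. w2 N z <= K * w1 N1 (L z)" using w2 by blast
  obtain C where C: "\<forall>j\<in>J. \<forall>x. w1 N1 x * norm (F j x) <= C" using 0 by (simp, meson)
  have "w2 N z * norm (F j (L z)) <= K * C" if "j \<in> J" for j z
  proof -
   have "w2 N z * norm (F j (L z)) <= K * w1 N1 (L z) * norm (F j (L z))"
    using K by (intro mult_right_mono) auto
   also have "\<dots> <= K * C" using K C that by (simp add: mult.assoc mult_left_mono)
   finally show ?thesis .
  qed
  then show "\<exists>C. \<forall>j\<in>J. \<forall>x. w2 N x * norm (F j (L x)) <= C" by blast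
 qed
next
 case (Suc n)
 note F = lev_has_derivative[OF Suc.prems]
 have z: "lev w2 0 (%j z. F j (L z)) J" using Suc.IH[OF lev_SucD[OF Suc.prems]] lev_0 by blast
 show ?case
 proof (rule lev_SucI[OF z, where D="%j z e. frechet_derivative (F j) (at (L z)) (L e)"])
  show "((%z. F j (L z)) has_derivative (%e. frechet_derivative (F j) (at (L z)) (L e))) (at z)" if "j \<in> J" for j z
   using has_derivative_compose[OF bounded_linear_imp_has_derivative[OF L] F[OF that]] .
  fix e :: 'b assume e: "e \<in> Basis"
  have "lev w2 n (%j z. \<Sum>b\<in>Basis. cr (L e \<bullet> b) * pd b (F j) (L z)) J"
   by (intro lev_sum w lev_cmult[where M="norm (L e)"] Suc.IH) (use Suc.prems in \<open>auto simp: Basis_le_norm\<close>)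
  moreover have "frechet_derivative (F j) (at (L z)) (L e) = (\<Sum>b\<in>Basis. cr (L e \<bullet> b) * pd b (F j) (L z))"
   if "j \<in> J" for j z
   by (rule linear_sum_Basis) (use F[OF that, of "L z"] has_derivative_linear in blast)
  ultimately show "lev w2 n (%j z. frechet_derivative (F j) (at (L z)) (L e)) J"
   by (subst lev_cong) auto
 qed
qed

section \<open>Schwartz bounded families\<close>

abbreviation sw :: "nat => 'a::real_normed_vector => real" where "sw N x == (1 + norm x) ^ N"

text \<open>The bounded sets of the Schwartz space, as indexed families.\<close>

definition sbdd :: "('j => 'a::euclidean_space => complex) => 'j set => bool" where
 "sbdd F J \<longleftrightarrow> (\<forall>n. lev sw n F J)"

lemma iter_deriv_snoc: "iter_deriv (es @ [e]) f = iter_deriv es (pd e f)"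
 by (induction es) auto

lemma lev_iter:
 "(\<forall>n. lev w n F J) \<longleftrightarrow> (\<forall>es. set es \<subseteq> Basis -->
   (\<forall>j\<in>J. \<forall>x. iter_deriv es (F j) differentiable (at x)) \<and>
   (\<forall>N. \<exists>C. \<forall>j\<in>J. \<forall>x. w N x * norm (iter_deriv es (F j) x) <= C))" (is "?L F \<longleftrightarrow> ?R F")
proof
 assume "?L F"
 then have "set es \<subseteq> Basis -->
   (\<forall>j\<in>J. \<forall>x. iter_deriv es (F j) differentiable (at x)) \<and>
   (\<forall>N. \<exists>C. \<forall>j\<in>J. \<forall>x. w N x * norm (iter_deriv es (F j) x) <= C)" for es
 proof (induction es arbitrary: F rule: rev_induct)
  case Nil
  have "lev w (Suc 0) F J" using Nil by blast
  then have "(\<forall>j\<in>J. \<forall>x. F j differentiable (at x)) \<and> (\<forall>N. \<exists>C. \<forall>j\<in>J. \<forall>x. w N x * norm (F j x) <= C)"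
   unfolding lev.simps by blast
  then show ?case by simp
 next
  case (snoc e es)
  show ?case
  proof
   assume "set (es @ [e]) \<subseteq> Basis"
   then have e: "e \<in> Basis" "set es \<subseteq> Basis" by auto
   have "\<forall>n. lev w n (%j. pd e (F j)) J" using snoc.prems e by (metis lev.simps(2))
   from snoc.IH[OF this] e show "(\<forall>j\<in>J. \<forall>x. iter_deriv (es @ [e]) (F j) differentiable (at x)) \<and>
     (\<forall>N. \<exists>C. \<forall>j\<in>J. \<forall>x. w N x * norm (iter_deriv (es @ [e]) (F j) x) <= C)"
    by (simp add: iter_deriv_snoc)
  qed
 qed
 then show "?R F" by blast
next
 assume "?R F"
 then have "lev w n F J" for n
 proof (induction n arbitrary: F)
  case 0
  from 0[rule_format, of "[]"] show ?case by simp
 next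
  case (Suc n)
  have "lev w n (%j. pd e (F j)) J" if e: "e \<in> Basis" for e
  proof (rule Suc.IH, intro allI impI)
   fix es :: "'a list" assume "set es \<subseteq> Basis"
   with e Suc.prems[rule_format, of "es @ [e]"]
   show "(\<forall>j\<in>J. \<forall>x. iter_deriv es (pd e (F j)) differentiable (at x)) \<and>
     (\<forall>N. \<exists>C. \<forall>j\<in>J. \<forall>x. w N x * norm (iter_deriv es (pd e (F j)) x) <= C)"
    by (simp add: iter_deriv_snoc)
  qed
  with Suc.prems[rule_format, of "[]"] show ?case by simp
 qed
 then show "?L F" by blast
qed

lemma sbdd_iter: "sbdd F J \<longleftrightarrow> (\<forall>j\<in>J. smooth (F j)) \<and>
  (\<forall>es N. set es \<subseteq> Basis --> (\<exists>C. \<forall>j\<in>J. \<forall>x. sw N x * norm (iter_deriv es (F j) x) <= C))"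
 unfolding sbdd_def lev_iter smooth_def by blast

lemma schwartz_iff: "schwartz f \<longleftrightarrow> sbdd (%_::unit. f) UNIV"
proof -
 have "norm (sw N x *\<^sub>R y) = sw N x * norm y" for N and x :: 'a and y :: complex
  by (simp add: abs_of_nonneg)
 then show ?thesis unfolding sbdd_iter schwartz_def bounded_iff by auto
qed

lemma schwartz_lev: "schwartz f ==> lev sw n (%_. f) J"
 unfolding schwartz_iff sbdd_def using lev_reindex[of sw n "%_. f" UNIV "%_. ()" J] by auto

lemma sbdd_schwartz: "sbdd F J ==> j \<in> J ==> schwartz (F j)"
 unfolding schwartz_iff sbdd_def using lev_reindex[of sw _ F J "%_. j" UNIV] by auto

lemma iter_deriv_cmult:
 fixes f :: "'a::euclidean_space => complex"
 assumes "smooth f" "set es \<subseteq> Basis"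
 shows "iter_deriv es (%x. c * f x) = (%x. c * iter_deriv es f x)"
 using assms(2)
proof (induction es)
 case (Cons e es)
 then have d: "iter_deriv es f differentiable (at x)" for x using assms by (auto simp: smooth_def)
 have "frechet_derivative (%x. c * iter_deriv es f x) (at x) e = c * frechet_derivative (iter_deriv es f) (at x) e" for x
  using has_derivative_mult_right[OF d[unfolded frechet_derivative_works], of c x] frechet_derivative_at by metis
 with Cons show ?case by auto
qed simp

lemma finite_dlists: "finite {es :: 'a::euclidean_space list. set es \<subseteq> Basis \<and> length es <= N}"
 using finite_lists_length_le[OF finite_Basis] by auto

lemma sbdd_seminorm_bounded:
 fixes F :: "'j => 'a::euclidean_space => complex"
 assumes "sbdd F J" shows "\<exists>C. \<forall>j\<in>J. \<forall>es x. set es \<subseteq> Basis \<and> length es <= N --> sw N x * norm (iter_deriv es (F j) x) <= C"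
proof -
 obtain c where c: "\<And>es. set es \<subseteq> Basis ==> \<forall>j\<in>J. \<forall>x. sw N x * norm (iter_deriv es (F j) x) <= c es"
 proof -
  have "\<forall>es. \<exists>c. set es \<subseteq> Basis --> (\<forall>j\<in>J. \<forall>x. sw N x * norm (iter_deriv es (F j) x) <= c)"
   using assms unfolding sbdd_iter by blast
  then show thesis using that by metis
 qed
 let ?E = "{es :: 'a list. set es \<subseteq> Basis \<and> length es <= N}"
 have "sw N x * norm (iter_deriv es (F j) x) <= (\<Sum>es\<in>?E. \<bar>c es\<bar>)" if "j \<in> J" "es \<in> ?E" for j es x
 proof -
  have "sw N x * norm (iter_deriv es (F j) x) <= \<bar>c es\<bar>" using c[of es] that by (auto intro: order_trans[OF _ abs_ge_self])
  also have "\<dots> <= (\<Sum>es\<in>?E. \<bar>c es\<bar>)" using that(2) by (intro member_le_sum finite_dlists) auto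
  finally show ?thesis .
 qed
 then show ?thesis by blast
qed

text \<open>Each Schwartz seminorm involves finitely many derivatives, hence is bounded on a bounded family.\<close>

lemma tempered_bounded:
 assumes T: "tempered T" and F: "sbdd F J" shows "\<exists>C. \<forall>j\<in>J. norm (T (F j)) <= C"
proof -
 obtain C N where CN: "\<And>f. schwartz f ==> norm (T f) <= C * schwartz_seminorm N f" using T unfolding tempered_def by blast
 obtain B where B: "\<forall>j\<in>J. \<forall>es x. set es \<subseteq> Basis \<and> length es <= N --> sw N x * norm (iter_deriv es (F j) x) <= B"
  using sbdd_seminorm_bounded[OF F] by blast
 have "norm (T (F j)) <= \<bar>C\<bar> * \<bar>B\<bar>" if "j \<in> J" for j
 proof -
  have "schwartz_seminorm N (F j) <= B" unfolding schwartz_seminorm_def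
   using B that by (intro cSUP_least) (auto intro!: exI[of _ "[]"])
  moreover have "0 <= schwartz_seminorm N (F j)"
  proof -
   have "sw N (0::'a) * norm (iter_deriv [] (F j) 0) <= schwartz_seminorm N (F j)"
    unfolding schwartz_seminorm_def
    by (rule cSUP_upper2[where x="([],0)"]) (use B that in \<open>auto intro!: bdd_aboveI2[where M=B]\<close>)
   then show ?thesis by (auto intro: order_trans[OF norm_ge_zero])
  qed
  ultimately have "C * schwartz_seminorm N (F j) <= \<bar>C\<bar> * \<bar>B\<bar>"
   by (intro mult_mono) auto
  then show ?thesis using CN[OF sbdd_schwartz[OF F that]] by linarith
 qed
 then show ?thesis by blast
qed

text \<open>The Schwartz space is bornological: if no seminorm dominated T, there would be functions f n with \<open>|T (f
n)|\<close> larger than n times the n-th seminorm, and suitable multiples of them would form a bounded sequence on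
which T is unbounded.\<close>

lemma temperedI:
 fixes T :: "'a::euclidean_space distr"
 assumes add: "\<And>f g. schwartz f ==> schwartz g ==> T (%x. f x + g x) = T f + T g"
  and scale: "\<And>c f. schwartz f ==> T (%x. c * f x) = c * T f"
  and bdd: "\<And>F :: nat => 'a => complex. sbdd F UNIV ==> \<exists>C. \<forall>j. norm (T (F j)) <= C"
 shows "tempered T"
proof -
 have "\<exists>C N. \<forall>f. schwartz f --> norm (T f) <= C * schwartz_seminorm N f"
 proof (rule ccontr)
  assume "\<not> ?thesis"
  then have "\<exists>f. schwartz f \<and> norm (T f) > real n * schwartz_seminorm n f" for n by (meson not_le)
  then obtain f where f: "\<And>n. schwartz (f n)" "\<And>n. norm (T (f n)) > real n * schwartz_seminorm n (f n)" by metis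
  have sem: "sw n x * norm (iter_deriv es (f n) x) <= schwartz_seminorm n (f n)"
   if "set es \<subseteq> Basis" "length es <= n" for n es x
  proof -
   obtain B where B: "\<forall>es x. set es \<subseteq> Basis \<and> length es <= n --> sw n x * norm (iter_deriv es (f n) x) <= B"
    using sbdd_seminorm_bounded[of "%_::unit. f n" UNIV n] f(1)[of n] unfolding schwartz_iff by auto
   show ?thesis unfolding schwartz_seminorm_def
    by (rule cSUP_upper2[where x="(es,x)"]) (use B that in \<open>auto intro!: bdd_aboveI2[where M=B]\<close>)
  qed
  have sem0: "0 <= schwartz_seminorm n (f n)" for n
   using sem[of "[]" n 0] by (auto intro: order_trans[OF norm_ge_zero])
  have pos: "norm (T (f n)) > 0" for n
   using f(2)[of n] sem0[of n] by (smt (verit) mult_nonneg_nonneg of_nat_0_le_iff)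
  \<comment> \<open>With this factor \<open>norm (T (g n)) = n\<close>, while the n-th seminorm of \<open>g n\<close> is at most 1.\<close>
  define a where "a n = real n / norm (T (f n))" for n
  define g where "g n x = cr (a n) * f n x" for n x
  have a0: "0 <= a n" for n by (simp add: a_def)
  have sg: "sw n x * norm (iter_deriv es (g n) x) <= 1" if "set es \<subseteq> Basis" "length es <= n" for n es x
  proof -
   have "iter_deriv es (g n) x = cr (a n) * iter_deriv es (f n) x"
    unfolding g_def using iter_deriv_cmult[of "f n" es] f(1)[of n] that(1) by (simp add: schwartz_def)
   then have "sw n x * norm (iter_deriv es (g n) x) = a n * (sw n x * norm (iter_deriv es (f n) x))"
    using a0[of n] by (simp add: norm_mult)
   also have "\<dots> <= a n * schwartz_seminorm n (f n)" using sem[OF that] a0 by (intro mult_left_mono) auto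
   also have "\<dots> <= 1" using f(2)[of n] pos[of n] by (simp add: a_def field_simps)
   finally show ?thesis .
  qed
  have gs: "schwartz (g n)" for n
   using lev_cmult[of sw UNIV "%_::unit. cr (a n)" "\<bar>a n\<bar>" _ "%_. f n"] f(1)[of n]
   unfolding schwartz_iff sbdd_def g_def by auto
  have "sbdd g UNIV" unfolding sbdd_iter
  proof (intro conjI ballI allI impI)
   show "smooth (g n)" for n using gs by (simp add: schwartz_def)
   fix es :: "'a list" and N assume es: "set es \<subseteq> Basis"
   define M where "M = max N (length es)"
   have "\<exists>C. \<forall>x. sw N x * norm (iter_deriv es (g n) x) <= C" for n
    using gs[of n] es unfolding schwartz_iff sbdd_iter by auto
   then obtain c where c: "\<And>n x. sw N x * norm (iter_deriv es (g n) x) <= c n" by metis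
   have "sw N x * norm (iter_deriv es (g n) x) <= (\<Sum>n<M. \<bar>c n\<bar>) + 1" for n x
   proof (cases "n < M")
    case True
    then have "\<bar>c n\<bar> <= (\<Sum>n<M. \<bar>c n\<bar>)" by (intro member_le_sum) auto
    then show ?thesis using c[of x n] by linarith
   next
    case False
    then have "sw N x * norm (iter_deriv es (g n) x) <= sw n x * norm (iter_deriv es (g n) x)"
     unfolding M_def by (intro mult_right_mono power_increasing) auto
    also have "\<dots> <= 1" using sg[OF es] False by (auto simp: M_def)
    finally show ?thesis by (simp add: add_increasing sum_nonneg)
   qed
   then show "\<exists>C. \<forall>j\<in>UNIV. \<forall>x. sw N x * norm (iter_deriv es (g j) x) <= C" by blast
  qed
  then obtain C where C: "\<And>n. norm (T (g n)) <= C" using bdd by blast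
  have "norm (T (g n)) = real n" for n
  proof -
   have "g n = (%x. cr (a n) * f n x)" by (simp add: g_def fun_eq_iff)
   then have "norm (T (g n)) = a n * norm (T (f n))"
    using scale[OF f(1), of "cr (a n)" n] a0[of n] by (simp add: norm_mult)
   then show ?thesis using pos[of n] by (simp add: a_def)
  qed
  then have "real n <= C" for n using C[of n] by simp
  then show False by (meson not_le reals_Archimedean2)
 qed
 with add scale show ?thesis unfolding tempered_def by blast
qed

section \<open>Changes of variables and dominated convergence\<close>

lemma integral_affine:
 fixes f :: "'a::euclidean_space => 'b::{banach, second_countable_topology}"
 assumes "c ~= 0" and f: "f \<in> bmeas"
 shows "(LINT x|lborel. f (t + c *\<^sub>R x)) = (1 / \<bar>c\<bar> ^ DIM('a)) *\<^sub>R (LINT x|lborel. f x)"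
  and "integrable lborel (%x. f (t + c *\<^sub>R x)) \<longleftrightarrow> integrable lborel f"
proof -
 note A = lborel_affine[OF assms(1), of t]
 have "(LINT x|lborel. f x) = \<bar>c\<bar> ^ DIM('a) *\<^sub>R (LINT x|lborel. f (t + c *\<^sub>R x))"
  apply (subst A) using f by (subst integral_density) (auto simp: integral_distr)
 then show "(LINT x|lborel. f (t + c *\<^sub>R x)) = (1 / \<bar>c\<bar> ^ DIM('a)) *\<^sub>R (LINT x|lborel. f x)"
  using assms(1) by simp
 have "integrable lborel f \<longleftrightarrow> integrable lborel (%x. (\<bar>c\<bar> ^ DIM('a)) *\<^sub>R f (t + c *\<^sub>R x))"
  apply (subst A) using f assms(1) by (subst integrable_density) (auto simp: integrable_distr_eq)
 moreover have "integrable lborel (%x. f (t + c *\<^sub>R x))" if "integrable lborel (%x. (\<bar>c\<bar> ^ DIM('a)) *\<^sub>R f (t + c *\<^sub>R x))"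
  using integrable_scaleR_right[OF that, of "1 / \<bar>c\<bar> ^ DIM('a)"] assms(1) by simp
 ultimately show "integrable lborel (%x. f (t + c *\<^sub>R x)) \<longleftrightarrow> integrable lborel f"
  by auto
qed

lemma nn_integral_affine:
 fixes f :: "'a::euclidean_space => ennreal"
 assumes "c ~= 0" and f: "f \<in> bmeas"
 shows "(NN x. f (t + c *\<^sub>R x)) = ennreal (1 / \<bar>c\<bar> ^ DIM('a)) * (NN x. f x)"
proof -
 note A = lborel_affine[OF assms(1), of t]
 have "(NN x. f x) = ennreal (\<bar>c\<bar> ^ DIM('a)) * (NN x. f (t + c *\<^sub>R x))"
  apply (subst A) using f by (subst nn_integral_density) (auto simp: nn_integral_distr nn_integral_cmult)
 then have "ennreal (1 / \<bar>c\<bar> ^ DIM('a)) * (NN x. f x)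
  = ennreal (1 / \<bar>c\<bar> ^ DIM('a)) * ennreal (\<bar>c\<bar> ^ DIM('a)) * (NN x. f (t + c *\<^sub>R x))"
  by (simp add: mult.assoc)
 also have "ennreal (1 / \<bar>c\<bar> ^ DIM('a)) * ennreal (\<bar>c\<bar> ^ DIM('a)) = 1"
  using assms(1) by (subst ennreal_mult[symmetric]) auto
 finally show ?thesis by simp
qed

lemma integral_translation:
 fixes f :: "'a::euclidean_space => 'b::{banach, second_countable_topology}"
 assumes f: "f \<in> bmeas"
 shows "(LINT x|lborel. f (x + t)) = (LINT x|lborel. f x)"
 using integral_affine(1)[of 1 f t] f by (simp add: add.commute)

lemma norm_integral_le:
 fixes F :: "'a => 'b::{banach, second_countable_topology}"
 assumes F: "F \<in> borel_measurable M" and G: "integrable M G" and le: "\<And>x. x \<in> space M ==> norm (F x) <= G x"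
 shows "integrable M F" "norm (integral\<^sup>L M F) <= integral\<^sup>L M G"
proof -
 show i: "integrable M F"
  by (rule Bochner_Integration.integrable_bound[OF G F]) (auto intro!: AE_I2 order_trans[OF le])
 have "norm (integral\<^sup>L M F) <= (LINT x|M. norm (F x))" by (rule integral_norm_bound)
 also have "\<dots> <= integral\<^sup>L M G" by (intro integral_mono integrable_norm i G le)
 finally show "norm (integral\<^sup>L M F) <= integral\<^sup>L M G" .
qed

lemma dominated_convergence_at_right:
 fixes s :: "real => 'a => 'b::{banach, second_countable_topology}"
 assumes "f \<in> borel_measurable M" "\<And>\<epsilon>. \<epsilon> > 0 ==> s \<epsilon> \<in> borel_measurable M" "integrable M w"
  and lim: "\<And>x. x \<in> space M ==> ((%\<epsilon>. s \<epsilon> x) \<longlongrightarrow> f x) (at_right 0)"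
  and bound: "\<And>\<epsilon> x. x \<in> space M ==> \<epsilon> > 0 ==> norm (s \<epsilon> x) <= w x"
 shows "((%\<epsilon>. integral\<^sup>L M (s \<epsilon>)) \<longlongrightarrow> integral\<^sup>L M f) (at_right 0)"
 unfolding tendsto_at_iff_sequentially
proof (intro allI impI)
 fix X :: "nat => real" assume X: "\<forall>i. X i \<in> {0<..} - {0}" "X \<longlonglongrightarrow> 0"
 show "((%\<epsilon>. integral\<^sup>L M (s \<epsilon>)) \<circ> X) \<longlonglongrightarrow> integral\<^sup>L M f" unfolding o_def
 proof (rule integral_dominated_convergence[where w=w])
  show "AE x in M. (%i. s (X i) x) \<longlonglongrightarrow> f x"
   using lim X unfolding tendsto_at_iff_sequentially o_def by (intro AE_I2) auto
  show "AE x in M. norm (s (X i) x) <= w x" for i using bound X by (intro AE_I2) auto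
 qed (use assms X in auto)
qed

section \<open>Integrability of weights\<close>

lemma nn_integral_inverse_1_plus_square: "(NN x. ennreal (1 / (1 + x\<^sup>2))) < (\<infinity>::ennreal)"
proof -
 have ftc: "(NN x. ennreal (1 / (1 + x\<^sup>2)) * indicator {0::real..} x) = ennreal (pi / 2 - arctan 0)"
  by (rule nn_integral_FTC_atLeast[where F=arctan])
    (auto intro!: derivative_eq_intros tendsto_arctan_at_top simp: inverse_eq_divide add_nonneg_eq_0_iff)
 have "(NN x. ennreal (1 / (1 + x\<^sup>2)) * indicator {..0::real} x)
   = (NN x. ennreal (1 / (1 + x\<^sup>2)) * indicator {0::real..} x)"
  by (subst nn_integral_real_affine[where c="-1" and t=0]) (auto intro!: nn_integral_cong simp: indicator_def)
 then have ftc2: "(NN x. ennreal (1 / (1 + x\<^sup>2)) * indicator {..0::real} x) = ennreal (pi / 2 - arctan 0)"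
  using ftc by simp
 have "(NN x. ennreal (1 / (1 + x\<^sup>2))) <= (NN x. ennreal (1 / (1 + x\<^sup>2)) * indicator {0::real..} x + ennreal (1 / (1 + x\<^sup>2)) * indicator {..0::real} x)"
  by (intro nn_integral_mono) (auto simp: indicator_def)
 also have "\<dots> = ennreal (pi / 2 - arctan 0) + ennreal (pi / 2 - arctan 0)"
  by (subst nn_integral_add) (auto simp: ftc ftc2)
 also have "\<dots> < \<infinity>" by (simp add: ennreal_plus[symmetric] del: ennreal_plus)
 finally show ?thesis .
qed

text \<open>An exponent for which the weight is integrable, by \<open>integrable_weight\<close>.\<close>

definition swN :: "'a::euclidean_space itself => nat" where "swN _ = 2 * DIM('a)"

definition swc :: "'a::euclidean_space itself => real" where
 "swc _ = (LINT x|(lborel::'a measure). 1 / (1 + norm x) ^ swN TYPE('a))"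

text \<open>The weight is dominated by a product of the one-dimensional functions \<open>1 / (1 + t^2)\<close>.\<close>

lemma integrable_weight: "integrable lborel (%x::'a::euclidean_space. 1 / (1 + norm x) ^ swN TYPE('a))"
proof (rule integrableI_nonneg)
 have pt: "1 / (1 + norm x) ^ swN TYPE('a) <= (\<Prod>b\<in>Basis. 1 / (1 + (x \<bullet> b)\<^sup>2))" for x :: 'a
 proof -
  have "(\<Prod>b\<in>(Basis::'a set). 1 / (1 + norm x)\<^sup>2) <= (\<Prod>b\<in>Basis. 1 / (1 + (x \<bullet> b)\<^sup>2))"
  proof (rule prod_mono)
   fix b :: 'a assume "b \<in> Basis"
   then have "\<bar>x \<bullet> b\<bar> <= norm x" by (rule Basis_le_norm)
   then have "(x \<bullet> b)\<^sup>2 <= (norm x)\<^sup>2" by (simp add: abs_le_square_iff[symmetric])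
   then have "1 + (x \<bullet> b)\<^sup>2 <= (1 + norm x)\<^sup>2" by (simp add: power2_sum add_increasing2)
   then show "0 <= 1 / (1 + norm x)\<^sup>2 \<and> 1 / (1 + norm x)\<^sup>2 <= 1 / (1 + (x \<bullet> b)\<^sup>2)"
    by (auto intro!: divide_left_mono mult_pos_pos add_pos_nonneg simp: add_nonneg_eq_0_iff)
  qed
  then show ?thesis by (simp add: swN_def power_mult power_divide)
 qed
 have "(\<integral>\<^sup>+x. ennreal (1 / (1 + norm x) ^ swN TYPE('a)) \<partial>(lborel::'a measure))
   <= (\<integral>\<^sup>+x. (\<Prod>b\<in>Basis. ennreal (1 / (1 + (x \<bullet> b)\<^sup>2))) \<partial>(lborel::'a measure))"
  by (intro nn_integral_mono) (subst prod_ennreal, auto intro: ennreal_leI pt)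
 also have "\<dots> = (\<Prod>b\<in>(Basis::'a set). (NN x. ennreal (1 / (1 + x\<^sup>2))))"
  by (rule nn_integral_lborel_prod) auto
 also have "\<dots> < \<infinity>" using nn_integral_inverse_1_plus_square by (simp add: power_less_top_ennreal)
 finally show "(\<integral>\<^sup>+x. ennreal (1 / (1 + norm x) ^ swN TYPE('a)) \<partial>(lborel::'a measure)) < \<infinity>" .
qed auto

lemma swc_nonneg: "0 <= swc TYPE('a::euclidean_space)"
 unfolding swc_def by (intro integral_nonneg_AE) auto

lemma weight_bound_integrable:
 fixes f :: "'a::euclidean_space => complex"
 assumes [measurable]: "f \<in> bmeas" and b: "\<And>x. sw (swN TYPE('a)) x * norm (f x) <= C"
 shows "integrable lborel f" "norm (integral\<^sup>L lborel f) <= C * swc TYPE('a)"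
  "(LINT x|lborel. norm (f x)) <= C * swc TYPE('a)"
proof -
 have b': "norm (f x) <= C * (1 / (1 + norm x) ^ swN TYPE('a))" for x
  using b[of x] by (simp add: field_simps add_pos_nonneg)
 show i: "integrable lborel f"
  by (rule Bochner_Integration.integrable_bound[OF integrable_mult_right[OF integrable_weight, of C]])
    (auto intro!: AE_I2 order_trans[OF b'] divide_right_mono)
 show le: "(LINT x|lborel. norm (f x)) <= C * swc TYPE('a)" unfolding swc_def integral_mult_right_zero[symmetric]
  by (intro integral_mono integrable_norm i integrable_mult_right integrable_weight b')
 then show "norm (integral\<^sup>L lborel f) <= C * swc TYPE('a)"
  using integral_norm_bound[of lborel f] by linarith
qed

lemma lev_bound: "lev w n F J ==> \<exists>C. \<forall>j\<in>J. \<forall>x. w N x * norm (F j x) <= C"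
 using lev_0 by fastforce

lemma lev_continuous: "lev w (Suc n) F J ==> j \<in> J ==> continuous_on UNIV (F j)"
 by (intro continuous_at_imp_continuous_on ballI has_derivative_continuous[OF lev_has_derivative])

lemma lev_measurable: "lev w (Suc n) F J ==> j \<in> J ==> F j \<in> bmeas"
 by (rule borel_measurable_continuous_onI[OF lev_continuous])

lemma lev_integrable:
 fixes F :: "'j => 'b::euclidean_space => complex"
 shows "lev sw (Suc n) F J ==> j \<in> J ==> integrable lborel (F j)"
proof -
 assume F: "lev sw (Suc n) F J" "j \<in> J"
 obtain C where "\<forall>j\<in>J. \<forall>x. sw (swN TYPE('b)) x * norm (F j x) <= C" using lev_bound[OF F(1)] by metis
 then show ?thesis using F(2) by (intro weight_bound_integrable(1)[OF lev_measurable[OF F], of C]) auto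
qed

lemma lev_coord:
 fixes F :: "'j => 'a::euclidean_space => complex"
 assumes F: "lev sw n F J"
 shows "lev sw n (%j x. cr (x \<bullet> h) * F j x) J"
proof -
 let ?w = "%(N::nat) (x::'a). 1 / (1 + norm x)"
 have w0: "0 <= ?w N x" for N x by (simp add: add_nonneg_nonneg)
 have b: "?w N x * norm (cr (x \<bullet> h)) <= norm h" for N x
 proof -
  have "\<bar>x \<bullet> h\<bar> <= norm x * norm h" by (rule Cauchy_Schwarz_ineq2)
  also have "\<dots> <= (1 + norm x) * norm h" by (intro mult_right_mono) auto
  finally show ?thesis by (simp add: field_simps add_pos_nonneg)
 qed
 have ?thesis if "lev ?w n (%j x. cr (x \<bullet> h)) J"
 proof (rule lev_mult[OF _ _ _ _ that F])
  show "\<exists>(N1::nat) N2 K. 0 <= K \<and> (\<forall>x::'a. sw N x <= K * (1 / (1 + norm x) * sw N2 x))" for N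
   by (rule exI[of _ 0], rule exI[of _ "Suc N"], rule exI[of _ 1]) (auto simp: add_pos_nonneg add_nonneg_eq_0_iff)
 qed (auto intro: add_nonneg_nonneg)
 moreover have "lev ?w n (%j x. cr (x \<bullet> h)) J"
 proof (cases n)
  case 0 then show ?thesis using b by auto
 next
  case (Suc m)
  have c: "lev ?w m (%j x. cr (e \<bullet> h)) J" for e
  proof (rule lev_comp[OF bounded_linear_ident, where ?w1.0="%N x. 1"])
   show "\<exists>(N1::nat) K. 0 <= K \<and> (\<forall>z::'a. 1 / (1 + norm z) <= K * 1)"
    by (rule exI, rule exI[of _ 1]) (auto simp: divide_le_eq add_pos_nonneg)
  qed (auto intro: lev_const add_nonneg_nonneg)
  show ?thesis unfolding Suc
   by (rule lev_SucI[where D="%j x e. cr (e \<bullet> h)"])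
     (use b c in \<open>auto intro!: derivative_eq_intros\<close>)
 qed
 ultimately show ?thesis by blast
qed

lemma lev_pd: "lev w (Suc n) F J ==> e \<in> Basis ==> lev w n (%j. pd e (F j)) J"
 by simp

lemma sw_nonneg[simp]: "0 <= sw N x"
 by simp

section \<open>The Fourier transform of Schwartz functions\<close>

text \<open>The character of the Fourier transform; it enters mostly through its modulus 1 and its functional equation.\<close>

definition fexp :: "real => complex" where "fexp t = exp (- \<i> * cr t)"

lemma fexp_simps: "norm (fexp t) = 1" "fexp (s + t) = fexp s * fexp t" "fexp 0 = 1"
 by (auto simp: fexp_def norm_exp_eq_Re exp_add[symmetric] algebra_simps)

lemma fexp_cont[continuous_intros]: "continuous_on S f ==> continuous_on S (%x. fexp (f x))"
 unfolding fexp_def by (intro continuous_intros)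

lemma fexp_meas[measurable]: "fexp \<in> bmeas"
 by (intro borel_measurable_continuous_onI continuous_intros)

lemma fexp_approx: "norm (fexp t - 1 + \<i> * cr t) <= t\<^sup>2 / 2"
proof -
 have "fexp t = iexp (- t)" by (simp add: fexp_def)
 moreover have "(\<Sum>k\<le>Suc 0. (\<i> * cr (- t)) ^ k / fact k) = 1 - \<i> * cr t" by simp
 ultimately show ?thesis using iexp_approx1[of "- t" "Suc 0"] by (simp add: algebra_simps power2_eq_square numeral_2_eq_2)
qed

lemma fourier_fexp: "fourier f \<xi> = (LINT v|lborel. fexp (\<xi> \<bullet> v) * f v)"
 by (simp add: fourier_def fexp_def)

lemma integrable_fexp:
 fixes f :: "'a::euclidean_space => complex"
 assumes "integrable lborel f" shows "integrable lborel (%v. fexp (\<xi> \<bullet> v) * f v)"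
 by (rule Bochner_Integration.integrable_bound[OF integrable_norm[OF assms]]) (use assms in \<open>auto simp: norm_mult fexp_simps\<close>)

lemma fourier_cmult: "fourier (%x. c * f x) \<xi> = c * fourier f \<xi>"
proof -
 have "fourier (%x. c * f x) \<xi> = (LINT v|lborel. c * (fexp (\<xi> \<bullet> v) * f v))"
  unfolding fourier_fexp by (intro LINT_cong) (auto simp: mult_ac)
 then show ?thesis by (simp add: fourier_fexp)
qed

lemma fourier_add: "integrable lborel f ==> integrable lborel g ==>
  fourier (%x. f x + g x) \<xi> = fourier f \<xi> + fourier (g :: 'a::euclidean_space => complex) \<xi>"
 unfolding fourier_fexp distrib_left
 by (rule Bochner_Integration.integral_add) (auto intro: integrable_fexp)

lemma fourier_norm_le:
 fixes f :: "'a::euclidean_space => complex"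
 shows "norm (fourier f \<xi>) <= (LINT v|lborel. norm (f v))"
 using integral_norm_bound[of lborel "%v. fexp (\<xi> \<bullet> v) * f v"] by (simp add: fourier_fexp norm_mult fexp_simps)

lemma fourier_has_derivative:
 fixes f :: "'a::euclidean_space => complex"
 assumes f: "integrable lborel f" and f1: "\<And>h. integrable lborel (%v. cr (v \<bullet> h) * f v)"
  and f2: "integrable lborel (%v. (norm v)\<^sup>2 * norm (f v))"
 shows "(fourier f has_derivative (%h. fourier (%v. - \<i> * (cr (v \<bullet> h) * f v)) \<xi>)) (at \<xi>)"
proof -
 let ?D = "%h. fourier (%v. - \<i> * (cr (v \<bullet> h) * f v)) \<xi>"
 let ?C = "LINT v|lborel. (norm v)\<^sup>2 * norm (f v)"
 have D: "?D h = - \<i> * fourier (%v. cr (v \<bullet> h) * f v) \<xi>" for h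
  using fourier_cmult[of "-\<i>" "%v. cr (v \<bullet> h) * f v"] by simp
 have "linear ?D"
 proof (rule linearI)
  show "?D (h + k) = ?D h + ?D k" for h k
  proof -
   have "?D (h + k) = - \<i> * fourier (%v. cr (v \<bullet> (h + k)) * f v) \<xi>" by (rule D)
   also have "\<dots> = - \<i> * (fourier (%v. cr (v \<bullet> h) * f v) \<xi> + fourier (%v. cr (v \<bullet> k) * f v) \<xi>)"
    by (simp only: inner_add_right of_real_add distrib_right fourier_add[OF f1 f1])
   finally show ?thesis unfolding D distrib_left .
  qed
  show "?D (r *\<^sub>R h) = r *\<^sub>R ?D h" for r h
  proof -
   have "?D (r *\<^sub>R h) = - \<i> * fourier (%v. cr (v \<bullet> (r *\<^sub>R h)) * f v) \<xi>" by (rule D)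
   also have "\<dots> = - \<i> * (cr r * fourier (%v. cr (v \<bullet> h) * f v) \<xi>)"
    by (simp only: inner_scaleR_right of_real_mult mult.assoc fourier_cmult)
   finally show ?thesis unfolding D by (simp add: scaleR_conv_of_real)
  qed
 qed
 then have bl: "bounded_linear ?D" by (simp add: linear_conv_bounded_linear)
 have le: "norm (fourier f (\<xi> + h) - fourier f \<xi> - ?D h) <= (norm h)\<^sup>2 * ?C" for h
 proof -
  have i1: "integrable lborel (%v. fexp (\<xi> \<bullet> v) * (- \<i> * (cr (v \<bullet> h) * f v)))"
   by (intro integrable_fexp integrable_mult_right f1)
  have "fourier f (\<xi> + h) - fourier f \<xi> - ?D h = (LINT v|lborel. fexp ((\<xi> + h) \<bullet> v) * f v - fexp (\<xi> \<bullet> v) * f v -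
    fexp (\<xi> \<bullet> v) * (- \<i> * (cr (v \<bullet> h) * f v)))"
   unfolding fourier_fexp
   by (simp only: Bochner_Integration.integral_diff[OF Bochner_Integration.integrable_diff[OF integrable_fexp[OF f] integrable_fexp[OF f]] i1]
     Bochner_Integration.integral_diff[OF integrable_fexp[OF f] integrable_fexp[OF f]])
  also have "\<dots> = (LINT v|lborel. fexp (\<xi> \<bullet> v) * (fexp (v \<bullet> h) - 1 + \<i> * cr (v \<bullet> h)) * f v)"
   by (intro LINT_cong) (auto simp: inner_add_left fexp_simps algebra_simps inner_commute)
  finally have eq: "fourier f (\<xi> + h) - fourier f \<xi> - ?D h = \<dots>" .
  have pt: "norm (fexp (\<xi> \<bullet> v) * (fexp (v \<bullet> h) - 1 + \<i> * cr (v \<bullet> h)) * f v) <= (norm h)\<^sup>2 * ((norm v)\<^sup>2 * norm (f v))" for v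
  proof -
   have "\<bar>v \<bullet> h\<bar> <= norm v * norm h" by (rule Cauchy_Schwarz_ineq2)
   then have "(v \<bullet> h)\<^sup>2 <= (norm v * norm h)\<^sup>2" using abs_le_square_iff by fastforce
   then have "norm (fexp (v \<bullet> h) - 1 + \<i> * cr (v \<bullet> h)) <= (norm v)\<^sup>2 * (norm h)\<^sup>2"
    using fexp_approx[of "v \<bullet> h"] zero_le_power2[of "v \<bullet> h"] unfolding power_mult_distrib by linarith
   then have "norm (fexp (v \<bullet> h) - 1 + \<i> * cr (v \<bullet> h)) * norm (f v) <= (norm v)\<^sup>2 * (norm h)\<^sup>2 * norm (f v)"
    by (intro mult_right_mono) auto
   moreover have "norm (fexp (\<xi> \<bullet> v) * (fexp (v \<bullet> h) - 1 + \<i> * cr (v \<bullet> h)) * f v) =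
     norm (fexp (v \<bullet> h) - 1 + \<i> * cr (v \<bullet> h)) * norm (f v)"
    by (simp add: norm_mult fexp_simps)
   ultimately show ?thesis by (simp only: mult_ac)
  qed
  have [measurable]: "f \<in> bmeas" using f borel_measurable_integrable by simp
  from pt show ?thesis unfolding eq integral_mult_right_zero[symmetric]
   by (intro norm_integral_le(2) integrable_mult_right f2) simp_all
 qed
 have "(%h. norm (fourier f (\<xi> + h) - fourier f \<xi> - ?D h) / norm h) \<midarrow>0\<rightarrow> 0"
 proof (rule tendsto_sandwich)
  show "\<forall>\<^sub>F h in at 0. 0 <= norm (fourier f (\<xi> + h) - fourier f \<xi> - ?D h) / norm h" by simp
  show "\<forall>\<^sub>F h in at 0. norm (fourier f (\<xi> + h) - fourier f \<xi> - ?D h) / norm h <= norm h * ?C"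
   using le by (intro eventually_at_topological[THEN iffD2] exI[of _ UNIV]) (auto simp: divide_le_eq power2_eq_square mult_ac)
  show "((%h. norm h * ?C) \<longlongrightarrow> 0) (at 0)" by (auto intro!: tendsto_eq_intros)
 qed simp
 with bl show ?thesis unfolding has_derivative_at by blast
qed

text \<open>Difference quotients inherit weighted bounds from the derivative, because a shift by at most 1 changes the weight by a
bounded factor; they dominate in the next differentiation under the integral.\<close>

lemma shift_bound:
 fixes f :: "'a::euclidean_space => complex"
 assumes f: "\<And>x. (f has_derivative frechet_derivative f (at x)) (at x)" and e: "norm e = 1" and h: "0 < h" "h <= 1"
  and C: "\<And>x. sw N x * norm (pd e f x) <= C"
 shows "sw N x * norm ((f (x + h *\<^sub>R e) - f x) /\<^sub>R h) <= 2 ^ N * C"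
proof -
 let ?g = "%t. f (x + t *\<^sub>R e)"
 have "norm (?g h - ?g 0) <= (2 ^ N * C / sw N x) * norm (h - 0)"
 proof (rule differentiable_bound[where S="{0..h}" and f'="%t s. s *\<^sub>R pd e f (x + t *\<^sub>R e)"])
  fix t assume t: "t \<in> {0..h}"
  have lin: "linear (frechet_derivative f (at (x + t *\<^sub>R e)))" using f has_derivative_linear by blast
  have "((%t. f (x + t *\<^sub>R e)) has_derivative (%s. frechet_derivative f (at (x + t *\<^sub>R e)) (s *\<^sub>R e))) (at t within {0..h})"
   by (rule has_derivative_compose[OF _ f]) (auto intro!: derivative_eq_intros)
  then show "(?g has_derivative (%s. s *\<^sub>R pd e f (x + t *\<^sub>R e))) (at t within {0..h})"
   by (simp add: linear_scale[OF lin])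
  have C0: "0 <= C" using C[of x] by (meson mult_nonneg_nonneg norm_ge_zero order_trans sw_nonneg)
  have "norm x <= norm (x + t *\<^sub>R e) + norm (t *\<^sub>R e)" by (metis add_diff_cancel_right' norm_triangle_ineq4)
  then have "1 + norm x <= 2 * (1 + norm (x + t *\<^sub>R e))" using t h e norm_ge_zero[of "x + t *\<^sub>R e"] by (simp del: norm_ge_zero)
  then have "sw N x <= (2 * (1 + norm (x + t *\<^sub>R e))) ^ N" by (intro power_mono) auto
  then have "sw N x * norm (pd e f (x + t *\<^sub>R e)) <= 2 ^ N * sw N (x + t *\<^sub>R e) * norm (pd e f (x + t *\<^sub>R e))"
   unfolding power_mult_distrib by (intro mult_right_mono) auto
  also have "\<dots> <= 2 ^ N * C" unfolding mult.assoc by (intro mult_left_mono C) auto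
  finally have "norm (pd e f (x + t *\<^sub>R e)) <= 2 ^ N * C / sw N x" by (simp add: field_simps add_pos_nonneg)
  note le = this
  show "onorm (%s. s *\<^sub>R pd e f (x + t *\<^sub>R e)) <= 2 ^ N * C / sw N x"
  proof (rule onorm_le)
   fix s :: real
   show "norm (s *\<^sub>R pd e f (x + t *\<^sub>R e)) <= 2 ^ N * C / sw N x * norm s"
    using mult_right_mono[OF le, of "\<bar>s\<bar>"] by (simp add: mult.commute)
  qed
 qed (use h in auto)
 then have "sw N x * norm (f (x + h *\<^sub>R e) - f x) <= 2 ^ N * C * h" using h by (simp add: field_simps add_pos_nonneg)
 then have "sw N x * norm (f (x + h *\<^sub>R e) - f x) / h <= 2 ^ N * C" using h by (simp add: field_simps)
 then show ?thesis using h by (simp only: norm_scaleR) (simp add: divide_inverse mult_ac)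
qed

lemma vector_derivative_quotient:
 assumes "(f has_vector_derivative D) (at (0::real))"
 shows "((%t. (f t - f 0) /\<^sub>R t) \<longlongrightarrow> D) (at 0)"
proof (rule LIM_zero_cancel, rule tendsto_norm_zero_cancel)
 have "((%y. norm ((f y - f 0) - (y - 0) *\<^sub>R D) / norm (y - 0)) \<longlongrightarrow> 0) (at 0)"
  using assms unfolding has_vector_derivative_def has_derivative_iff_norm by blast
 moreover have "\<forall>\<^sub>F y in at 0. norm ((f y - f 0) - (y - 0) *\<^sub>R D) / norm (y - 0) = norm ((f y - f 0) /\<^sub>R y - D)"
 proof (unfold eventually_at_filter, intro always_eventually allI impI)
  fix y :: real assume y: "y ~= 0"
  have "(f y - f 0) /\<^sub>R y - D = ((f y - f 0) - y *\<^sub>R D) /\<^sub>R y" using y by (simp add: scaleR_right_diff_distrib)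
  then show "norm ((f y - f 0) - (y - 0) *\<^sub>R D) / norm (y - 0) = norm ((f y - f 0) /\<^sub>R y - D)"
   by (simp add: divide_inverse mult.commute)
 qed
 ultimately show "((%y. norm ((f y - f 0) /\<^sub>R y - D)) \<longlongrightarrow> 0) (at 0)"
  by (rule Lim_transform_eventually)
qed

text \<open>The Fourier transform of a difference quotient is explicit, and the quotients converge dominatedly. This needs no
integration by parts.\<close>

lemma fourier_pd:
 fixes f :: "'a::euclidean_space => complex"
 assumes f: "lev sw (Suc 0) (%_::unit. f) UNIV" and e: "e \<in> Basis"
 shows "fourier (pd e f) \<xi> = \<i> * cr (\<xi> \<bullet> e) * fourier f \<xi>"
proof -
 note fd = lev_has_derivative[OF f UNIV_I]
 have [measurable]: "f \<in> bmeas" using lev_measurable[OF f UNIV_I] .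
 have fi: "integrable lborel f" using lev_integrable[OF f UNIV_I] .
 have e1: "norm e = 1" using e by simp
 let ?N = "swN TYPE('a)"
 obtain C where C: "\<And>x. sw ?N x * norm (pd e f x) <= C" using lev_bound[OF lev_pd[OF f e], of ?N] by auto
 define h where "h n = 1 / real (Suc n)" for n
 have h: "0 < h n" "h n <= 1" for n by (auto simp: h_def)
 have h0: "h \<longlonglongrightarrow> 0" unfolding h_def using LIMSEQ_inverse_real_of_nat by (simp add: inverse_eq_divide)
 define s where "s n x = (f (x + h n *\<^sub>R e) - f x) /\<^sub>R h n" for n x
 have sl: "(%n. s n x) \<longlonglongrightarrow> pd e f x" for x
 proof -
  have lin: "linear (frechet_derivative f (at x))" using fd has_derivative_linear by blast
  have "((%t. f (x + t *\<^sub>R e)) has_derivative (%s. frechet_derivative f (at (x + 0 *\<^sub>R e)) (s *\<^sub>R e))) (at 0)"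
   by (rule has_derivative_compose[OF _ fd]) (auto intro!: derivative_eq_intros)
  then have "((%t. f (x + t *\<^sub>R e)) has_vector_derivative pd e f x) (at 0)"
   by (simp add: linear_scale[OF lin] has_vector_derivative_def)
  from vector_derivative_quotient[OF this] have "((%t. (f (x + t *\<^sub>R e) - f x) /\<^sub>R t) \<longlongrightarrow> pd e f x) (at 0)" by simp
  then show ?thesis unfolding s_def using h0 h unfolding tendsto_at_iff_sequentially o_def
   by (auto simp: less_imp_neq[symmetric] dest!: spec[of _ h])
 qed
 have sb: "sw ?N x * norm (s n x) <= 2 ^ ?N * C" for n x
  unfolding s_def by (rule shift_bound[OF fd e1 h C])
 have [measurable]: "pd e f \<in> bmeas"
  by (rule borel_measurable_LIMSEQ_metric[OF _ sl]) (auto simp: s_def)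
 have "(%n. fourier (s n) \<xi>) \<longlonglongrightarrow> fourier (pd e f) \<xi>" unfolding fourier_fexp
 proof (rule integral_dominated_convergence[where w="%x. 2 ^ ?N * C * (1 / (1 + norm x) ^ ?N)"])
  show "AE x in lborel. (%i. fexp (\<xi> \<bullet> x) * s i x) \<longlonglongrightarrow> fexp (\<xi> \<bullet> x) * pd e f x"
   by (intro AE_I2 tendsto_intros sl)
  show "AE x in lborel. norm (fexp (\<xi> \<bullet> x) * s i x) <= 2 ^ ?N * C * (1 / (1 + norm x) ^ ?N)" for i
  proof (rule AE_I2)
   fix x show "norm (fexp (\<xi> \<bullet> x) * s i x) <= 2 ^ ?N * C * (1 / (1 + norm x) ^ ?N)"
    using sb[of x i] by (simp add: norm_mult fexp_simps field_simps add_pos_nonneg)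
  qed
 qed (use integrable_mult_right[OF integrable_weight, of "2 ^ ?N * C"] in \<open>auto simp: s_def\<close>)
 moreover have "fourier (s n) \<xi> = ((fexp (- h n * (\<xi> \<bullet> e)) - 1) /\<^sub>R h n) * fourier f \<xi>" for n
 proof -
  have "fourier (s n) \<xi> = (LINT x|lborel. (fexp (- h n * (\<xi> \<bullet> e)) * (fexp (\<xi> \<bullet> (x + h n *\<^sub>R e)) * f (x + h n *\<^sub>R e)) - fexp (\<xi> \<bullet> x) * f x) /\<^sub>R h n)"
   unfolding fourier_fexp s_def
  proof (intro LINT_cong refl)
   fix x
   have "fexp (- h n * (\<xi> \<bullet> e)) * fexp (\<xi> \<bullet> (x + h n *\<^sub>R e)) = fexp (\<xi> \<bullet> x)"
    by (simp add: fexp_simps(2)[symmetric] inner_add_right)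
   then show "fexp (\<xi> \<bullet> x) * ((f (x + h n *\<^sub>R e) - f x) /\<^sub>R h n) =
     (fexp (- h n * (\<xi> \<bullet> e)) * (fexp (\<xi> \<bullet> (x + h n *\<^sub>R e)) * f (x + h n *\<^sub>R e)) - fexp (\<xi> \<bullet> x) * f x) /\<^sub>R h n"
    by (simp add: scaleR_right_diff_distrib right_diff_distrib mult.assoc[symmetric])
  qed
  also have "\<dots> = (fexp (- h n * (\<xi> \<bullet> e)) * (LINT x|lborel. fexp (\<xi> \<bullet> (x + h n *\<^sub>R e)) * f (x + h n *\<^sub>R e)) - (LINT x|lborel. fexp (\<xi> \<bullet> x) * f x)) /\<^sub>R h n"
   using integrable_fexp[OF fi, of \<xi>] integral_affine(2)[of 1 "%x. fexp (\<xi> \<bullet> x) * f x" "h n *\<^sub>R e"]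
   by (subst integral_scaleR_right, subst Bochner_Integration.integral_diff) (auto simp: add.commute)
  also have "(LINT x|lborel. fexp (\<xi> \<bullet> (x + h n *\<^sub>R e)) * f (x + h n *\<^sub>R e)) = fourier f \<xi>"
   unfolding fourier_fexp by (rule integral_translation[of "%x. fexp (\<xi> \<bullet> x) * f x"]) simp
  finally show ?thesis by (simp add: fourier_fexp algebra_simps)
 qed
 moreover have "(%n. ((fexp (- h n * (\<xi> \<bullet> e)) - 1) /\<^sub>R h n) * fourier f \<xi>) \<longlonglongrightarrow> (\<i> * cr (\<xi> \<bullet> e)) * fourier f \<xi>"
 proof (intro tendsto_mult tendsto_const)
  have "((%t. fexp (- t * (\<xi> \<bullet> e))) has_vector_derivative (\<i> * cr (\<xi> \<bullet> e))) (at 0)"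
  proof -
   have "((%z. exp (\<i> * cr (\<xi> \<bullet> e) * z)) has_field_derivative \<i> * cr (\<xi> \<bullet> e)) (at (cr 0))"
    by (auto intro!: derivative_eq_intros)
   from has_vector_derivative_real_field[OF this] show ?thesis by (simp add: fexp_def mult_ac)
  qed
  from vector_derivative_quotient[OF this] have "((%t. (fexp (- t * (\<xi> \<bullet> e)) - 1) /\<^sub>R t) \<longlongrightarrow> \<i> * cr (\<xi> \<bullet> e)) (at 0)"
   by (simp add: fexp_simps)
  then show "(%n. (fexp (- h n * (\<xi> \<bullet> e)) - 1) /\<^sub>R h n) \<longlonglongrightarrow> \<i> * cr (\<xi> \<bullet> e)"
   using h0 h unfolding tendsto_at_iff_sequentially o_def by (auto simp: less_imp_neq[symmetric] dest!: spec[of _ h])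
 qed
 ultimately show ?thesis using LIMSEQ_unique by auto
qed

lemma lev_single: "lev w n F J ==> j \<in> J ==> lev w n (%_::unit. F j) UNIV"
 by (rule lev_reindex) auto

section \<open>Decay and smoothness of Fourier transforms\<close>

text \<open>Each derivative of F gives one factor \<open>1 / norm \<xi>\<close>. Only finitely many derivatives are needed for a
given decay; this is used for families that are not bounded in the Schwartz space.\<close>

lemma fourier_decay:
 fixes F :: "'j => 'a::euclidean_space => complex"
 shows "lev sw (Suc n) F J ==> \<exists>C. \<forall>j\<in>J. \<forall>\<xi>. sw n \<xi> * norm (fourier (F j) \<xi>) <= C"
proof (induction n arbitrary: F)
 case 0
 obtain C where C: "\<forall>j\<in>J. \<forall>x. sw (swN TYPE('a)) x * norm (F j x) <= C" using lev_bound[OF 0] by metis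
 have "sw 0 \<xi> * norm (fourier (F j) \<xi>) <= C * swc TYPE('a)" if "j \<in> J" for j \<xi>
  using fourier_norm_le[of "F j" \<xi>] weight_bound_integrable(3)[OF lev_measurable[OF 0 that], of C] C that by fastforce
 then show ?case by blast
next
 case (Suc n)
 obtain C where C: "\<forall>j\<in>J. \<forall>\<xi>. sw n \<xi> * norm (fourier (F j) \<xi>) <= C" using Suc.IH[OF lev_SucD[OF Suc.prems]] by blast
 have "\<forall>e. \<exists>c. e \<in> Basis --> (\<forall>j\<in>J. \<forall>\<xi>. sw n \<xi> * norm (fourier (pd e (F j)) \<xi>) <= c)"
  using Suc.IH[OF lev_pd[OF Suc.prems]] by blast
 then obtain c where c: "\<And>e j \<xi>. e \<in> Basis ==> j \<in> J ==> sw n \<xi> * norm (fourier (pd e (F j)) \<xi>) <= c e" by metis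
 have "sw (Suc n) \<xi> * norm (fourier (F j) \<xi>) <= C + (\<Sum>e\<in>Basis. c e)" if j: "j \<in> J" for j \<xi>
 proof -
  have "norm \<xi> * norm (fourier (F j) \<xi>) <= (\<Sum>e\<in>Basis. \<bar>\<xi> \<bullet> e\<bar>) * norm (fourier (F j) \<xi>)"
   by (intro mult_right_mono norm_le_l1) auto
  also have "\<dots> = (\<Sum>e\<in>Basis. norm (fourier (pd e (F j)) \<xi>))" unfolding sum_distrib_right
  proof (intro sum.cong refl)
   fix e :: 'a assume e: "e \<in> Basis"
   have "lev sw (Suc 0) (%_::unit. F j) UNIV" using lev_le[OF lev_single[OF Suc.prems j], of "Suc 0"] by simp
   from fourier_pd[OF this e] show "\<bar>\<xi> \<bullet> e\<bar> * norm (fourier (F j) \<xi>) = norm (fourier (pd e (F j)) \<xi>)"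
    by (simp add: norm_mult)
  qed
  finally have "sw n \<xi> * (norm \<xi> * norm (fourier (F j) \<xi>)) <= sw n \<xi> * (\<Sum>e\<in>Basis. norm (fourier (pd e (F j)) \<xi>))"
   by (intro mult_left_mono) auto
  also have "\<dots> <= (\<Sum>e\<in>Basis. c e)" unfolding sum_distrib_left using c j by (intro sum_mono) auto
  finally show ?thesis using C j by (auto simp: algebra_simps intro: add_mono)
 qed
 then show ?case by blast
qed

section \<open>Closure properties of Schwartz bounded families\<close>

lemma sbddD: "sbdd F J ==> lev sw n F J" by (simp add: sbdd_def)

lemma sbdd_reindex: "sbdd F J ==> h ` K \<subseteq> J ==> sbdd (%k. F (h k)) K"
 using lev_reindex[of sw _ F J h K] by (auto simp: sbdd_def)

lemma schwartz_sbdd: "schwartz f ==> sbdd (%_. f) J" by (simp add: sbdd_def schwartz_lev)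

lemma sbdd_add: "sbdd F J ==> sbdd G J ==> sbdd (%j x. F j x + G j x) J"
 by (simp add: sbdd_def lev_add)

lemma sbdd_sum: "finite I ==> (\<And>i. i \<in> I ==> sbdd (F i) J) ==> sbdd (%j x. \<Sum>i\<in>I. F i j x) J"
 by (simp add: sbdd_def lev_sum)

lemma sbdd_cmult: "(\<And>j. j \<in> J ==> norm (c j) <= M) ==> sbdd F J ==> sbdd (%j x. c j * F j x) J"
 using lev_cmult[where w=sw and J=J and c=c and M=M and F=F] by (simp add: sbdd_def)

lemma sbdd_pd: "sbdd F J ==> e \<in> Basis ==> sbdd (%j. pd e (F j)) J"
 unfolding sbdd_def using lev_pd by blast

lemma sbdd_coord: "sbdd F J ==> sbdd (%j x. cr (x \<bullet> h) * F j x) J"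
 by (simp add: sbdd_def lev_coord)

lemma sbdd_mult:
 assumes A: "\<And>n. lev (%N x. 1) n A J" and F: "sbdd F J"
 shows "sbdd (%j x. A j x * F j x) J"
proof -
 have ex: "\<exists>(N1::nat) N2 K. 0 <= K \<and> (\<forall>x::'a. sw N x <= K * ((1::real) * sw N2 x))" for N
  by (rule exI[of _ 0], rule exI[of _ N], rule exI[of _ 1]) simp
 show ?thesis unfolding sbdd_def
  by (intro allI lev_mult[where ?w1.0="%N x. 1" and ?w2.0=sw, OF _ sw_nonneg sw_nonneg ex A sbddD[OF F]]) auto
qed

text \<open>Products of functions of different linear images of z, as long as the two images together control z.\<close>

lemma sbdd_pair:
 fixes L1 :: "'c::euclidean_space => 'a::euclidean_space" and L2 :: "'c => 'b::euclidean_space"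
 assumes F: "sbdd F J" and G: "sbdd G J" and L: "bounded_linear L1" "bounded_linear L2"
  and K: "\<And>z. norm z <= K * (norm (L1 z) + norm (L2 z))"
 shows "sbdd (%j z. F j (L1 z) * G j (L2 z)) J"
 unfolding sbdd_def
proof
 fix n
 have ex: "\<exists>N1 N2 K'. 0 <= K' \<and> (\<forall>z. sw N z <= K' * (sw N1 (L1 z) * sw N2 (L2 z)))" for N
 proof (intro exI conjI allI)
  show "0 <= (1 + \<bar>K\<bar>) ^ N" by simp
  fix z
  have "K * (norm (L1 z) + norm (L2 z)) <= \<bar>K\<bar> * (norm (L1 z) + norm (L2 z))" by (intro mult_right_mono) auto
  then have a: "1 + norm z <= 1 + \<bar>K\<bar> * (norm (L1 z) + norm (L2 z))" using K[of z] by linarith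
  have "0 <= norm (L1 z) * norm (L2 z)" "0 <= \<bar>K\<bar> * (norm (L1 z) * norm (L2 z))" by auto
  then have "1 + norm z <= (1 + \<bar>K\<bar>) * ((1 + norm (L1 z)) * (1 + norm (L2 z)))"
   unfolding distrib_left distrib_right mult_1_left mult_1_right
   using a abs_ge_zero[of K] norm_ge_zero[of "L1 z"] norm_ge_zero[of "L2 z"]
   by (simp only: distrib_left)
  from power_mono[OF this, of N] show "sw N z <= (1 + \<bar>K\<bar>) ^ N * (sw N (L1 z) * sw N (L2 z))"
   by (simp add: power_mult_distrib)
 qed
 have e1: "\<exists>N1 K. 0 <= K \<and> (\<forall>z. sw N (L1 z) <= K * sw N1 (L1 z))" for N by (intro exI[of _ N] exI[of _ 1]) auto
 have e2: "\<exists>N1 K. 0 <= K \<and> (\<forall>z. sw N (L2 z) <= K * sw N1 (L2 z))" for N by (intro exI[of _ N] exI[of _ 1]) auto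
 show "lev sw n (%j z. F j (L1 z) * G j (L2 z)) J"
  by (rule lev_mult[where ?w1.0="%N z. sw N (L1 z)" and ?w2.0="%N z. sw N (L2 z)", OF sw_nonneg sw_nonneg sw_nonneg ex
    lev_comp[OF L(1) sw_nonneg sw_nonneg e1 sbddD[OF F]] lev_comp[OF L(2) sw_nonneg sw_nonneg e2 sbddD[OF G]]])
qed

lemma sbdd_comp:
 fixes L :: "'b::euclidean_space => 'a::euclidean_space"
 assumes F: "sbdd F J" and L: "bounded_linear L" and K: "\<And>z. norm z <= K * norm (L z)"
 shows "sbdd (%j z. F j (L z)) J"
 unfolding sbdd_def
proof
 fix n
 have ex: "\<exists>N1 K'. 0 <= K' \<and> (\<forall>z. sw N z <= K' * sw N1 (L z))" for N
 proof (intro exI conjI allI)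
  show "0 <= (1 + \<bar>K\<bar>) ^ N" by simp
  fix z
  have "K * norm (L z) <= \<bar>K\<bar> * norm (L z)" by (intro mult_right_mono) auto
  then have "1 + norm z <= (1 + \<bar>K\<bar>) * (1 + norm (L z))"
   using K[of z] abs_ge_zero[of K] norm_ge_zero[of "L z"]
   by (simp only: distrib_left distrib_right mult_1_left mult_1_right)
  from power_mono[OF this, of N] show "sw N z <= (1 + \<bar>K\<bar>) ^ N * sw N (L z)"
   by (simp add: power_mult_distrib)
 qed
 show "lev sw n (%j z. F j (L z)) J" by (rule lev_comp[OF L sw_nonneg sw_nonneg ex sbddD[OF F]])
qed

lemma fourier_sbdd:
 fixes F :: "'j => 'a::euclidean_space => complex"
 assumes "sbdd F J" shows "sbdd (%j. fourier (F j)) J"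
proof -
 have "sbdd F J ==> lev sw n (%j. fourier (F j)) J" for n
 proof (induction n arbitrary: F)
  case 0
  show ?case using fourier_decay[OF sbddD[OF 0]] by simp
 next
  case (Suc n)
  have xF: "sbdd (%j v. - \<i> * (cr (v \<bullet> h) * F j v)) J" for h
   by (intro sbdd_cmult[where M=1] sbdd_coord Suc.prems) auto
  show ?case
  proof (rule lev_SucI)
   show "lev sw 0 (%j. fourier (F j)) J" using fourier_decay[OF sbddD[OF Suc.prems]] by simp
   show "lev sw n (%j \<xi>. fourier (%v. - \<i> * (cr (v \<bullet> h) * F j v)) \<xi>) J" for h
    by (rule Suc.IH[OF xF])
   fix j \<xi> assume j: "j \<in> J"
   show "(fourier (F j) has_derivative (%h. fourier (%v. - \<i> * (cr (v \<bullet> h) * F j v)) \<xi>)) (at \<xi>)"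
   proof (rule fourier_has_derivative)
    show "integrable lborel (F j)" by (rule lev_integrable[OF sbddD[OF Suc.prems] j])
    show "integrable lborel (%v. cr (v \<bullet> h) * F j v)" for h
     by (rule lev_integrable[OF sbddD[OF sbdd_coord[OF Suc.prems]] j])
    let ?N = "swN TYPE('a)"
    obtain C where C: "\<forall>j\<in>J. \<forall>x. sw (?N + 2) x * norm (F j x) <= C" using lev_bound[OF sbddD[OF Suc.prems]] by metis
    have [measurable]: "F j \<in> bmeas" by (rule lev_measurable[OF sbddD[OF Suc.prems] j])
    have "integrable lborel (%v. cr ((norm v)\<^sup>2) * F j v)"
    proof (rule weight_bound_integrable(1)[where C=C])
     fix x :: 'a
     have "(norm x)\<^sup>2 <= (1 + norm x)\<^sup>2" by (intro power_mono) auto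
     then have "sw ?N x * ((norm x)\<^sup>2 * norm (F j x)) <= sw ?N x * ((1 + norm x)\<^sup>2 * norm (F j x))"
      by (intro mult_left_mono mult_right_mono) auto
     also have "\<dots> = sw (?N + 2) x * norm (F j x)" by (simp only: power_add mult.assoc)
     also have "\<dots> <= C" using C j by blast
     finally show "sw ?N x * norm (cr ((norm x)\<^sup>2) * F j x) <= C" by (simp add: norm_mult norm_power)
    qed measurable
    from integrable_norm[OF this] show "integrable lborel (%v. (norm v)\<^sup>2 * norm (F j v))" by (simp add: norm_mult norm_power)
   qed
  qed
 qed
 with assms show ?thesis by (simp add: sbdd_def)
qed

lemma inv_fourier_eq:
 fixes f :: "'a::euclidean_space => complex"
 shows "inv_fourier f v = cr (1 / (2 * pi) ^ DIM('a)) * fourier f (- v)"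
proof -
 have "(LINT \<xi>|lborel. exp (\<i> * cr (\<xi> \<bullet> v)) * f \<xi>) = fourier f (- v)"
  unfolding fourier_fexp fexp_def by (intro LINT_cong) (auto simp: inner_commute)
 then show ?thesis by (simp add: inv_fourier_def)
qed

lemma inv_fourier_sbdd:
 fixes F :: "'j => 'a::euclidean_space => complex"
 assumes "sbdd F J" shows "sbdd (%j. inv_fourier (F j)) J"
proof -
 have "sbdd (%j v. cr (1 / (2 * pi) ^ DIM('a)) * fourier (F j) (- v)) J"
  by (intro sbdd_cmult[where M="norm (cr (1 / (2 * pi) ^ DIM('a)))"] sbdd_comp[where L=uminus and K=1] fourier_sbdd assms)
    (auto intro: bounded_linear_minus bounded_linear_ident)
 then show ?thesis by (simp add: inv_fourier_eq[abs_def])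
qed

lemma fourier_schwartz: "schwartz f ==> schwartz (fourier f)"
 using fourier_sbdd[OF schwartz_sbdd, of f "UNIV :: unit set"] schwartz_iff by blast

lemma inv_fourier_schwartz: "schwartz f ==> schwartz (inv_fourier f)"
 using inv_fourier_sbdd[OF schwartz_sbdd, of f "UNIV :: unit set"] schwartz_iff by blast

lemma schwartz_measurable: "schwartz f ==> f \<in> bmeas"
 using lev_measurable[OF schwartz_lev, of f "()" UNIV] by auto

lemma schwartz_integrable: "schwartz f ==> integrable lborel f"
 using lev_integrable[OF schwartz_lev, of f "()" UNIV] by auto

lemma schwartz_continuous: "schwartz f ==> continuous_on UNIV f"
 using lev_continuous[OF schwartz_lev, of f "()" UNIV] by auto

lemma schwartz_bound: "schwartz f ==> \<exists>C\<ge>0. \<forall>x. sw N x * norm (f x) <= C"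
proof -
 assume "schwartz f"
 then obtain C where "\<forall>j\<in>(UNIV::unit set). \<forall>x. sw N x * norm (f x) <= C" using lev_bound[OF schwartz_lev[of f _ UNIV]] by metis
 then show ?thesis by (intro exI[of _ "\<bar>C\<bar>"]) (auto intro: order_trans[OF _ abs_ge_self])
qed

lemma schwartz_sup: "schwartz \<theta> ==> \<exists>C>0. \<forall>w. norm (\<theta> w) <= C"
proof -
 assume "schwartz \<theta>"
 then obtain C where "0 <= C" "\<And>w. sw 0 w * norm (\<theta> w) <= C" using schwartz_bound[of \<theta> 0] by blast
 then have "0 < C + 1" "\<And>w. norm (\<theta> w) <= C + 1" by (auto intro: add_increasing2)
 then show ?thesis by blast
qed

section \<open>Gaussians and the inversion formula\<close>

text \<open>The Gaussian serves as the summability kernel of the inversion formula.\<close>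

definition gau :: "'a::euclidean_space => complex" where "gau x = cr (exp (- (norm x)\<^sup>2 / 2))"

lemma power_le_fact_exp: assumes "0 <= (x::real)" shows "x ^ N <= fact N * exp x"
proof -
 have "(\<Sum>n\<in>{N}. x ^ n /\<^sub>R fact n) <= (\<Sum>n. x ^ n /\<^sub>R fact n)"
  using assms summable_exp_generic[of x] by (intro sum_le_suminf) auto
 then show ?thesis by (simp add: exp_def field_simps)
qed

lemma gau_decay: "sw N x * norm (gau x) <= fact N * exp (3/2)"
proof -
 have "sw N x * norm (gau x) <= fact N * exp (1 + norm x) * exp (- (norm x)\<^sup>2 / 2)"
  unfolding gau_def by (simp add: mult_right_mono power_le_fact_exp)
 also have "\<dots> = fact N * exp (1 + norm x - (norm x)\<^sup>2 / 2)" by (simp add: exp_add[symmetric])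
 also have "\<dots> <= fact N * exp (3/2)"
  using zero_le_power2[of "norm x - 1"] by (simp add: power2_diff field_simps)
 finally show ?thesis .
qed

lemma gau_has_derivative: "(gau has_derivative (%h. - cr (x \<bullet> h) * gau x)) (at x)"
proof -
 have "((%x. exp (- (x \<bullet> x) / 2)) has_derivative (%h. - (x \<bullet> h) * exp (- (x \<bullet> x) / 2))) (at x)"
  by (auto intro!: derivative_eq_intros simp: inner_commute)
 from has_derivative_of_real[OF this] show ?thesis
  unfolding gau_def[abs_def] power2_norm_eq_inner by simp
qed

lemma gau_pd: "pd (e::'a::euclidean_space) gau = (%x. - (cr (x \<bullet> e) * gau x))"
proof
 fix x :: 'a
 have "(%h. - cr (x \<bullet> h) * gau x) = frechet_derivative gau (at x)"
  by (rule frechet_derivative_at[OF gau_has_derivative])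
 from fun_cong[OF this, of e] show "pd e gau x = - (cr (x \<bullet> e) * gau x)" by simp
qed

lemma gau_lev: "lev sw (Suc 0) (%_::unit. gau) UNIV"
proof (rule lev_SucI[OF _ gau_has_derivative])
 show z: "lev sw 0 (%_::unit. gau) UNIV" using gau_decay by auto
 show "lev sw 0 (%(_::unit) x. - cr (x \<bullet> e) * gau x) UNIV" for e
  using lev_cmult[OF sw_nonneg _ lev_coord[OF z, of e], where c="%_. -1" and M=1] by simp
qed

lemma gau_measurable[measurable]: "gau \<in> bmeas"
 using lev_measurable[OF gau_lev UNIV_I] .

lemma gau_integrable: "integrable lborel gau"
 using lev_integrable[OF gau_lev UNIV_I] .

lemma gau_integral: "(LINT x|(lborel::'a::euclidean_space measure). gau x) = cr (sqrt (2 * pi) ^ DIM('a))"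
proof -
 have one: "(NN t. ennreal (exp (- t\<^sup>2 / 2))) = ennreal (sqrt (2 * pi))"
 proof -
  have "(NN t. ennreal (exp (- t\<^sup>2 / 2))) = (NN t. ennreal (sqrt (2 * pi)) * ennreal (normal_density 0 1 t))"
   by (intro nn_integral_cong) (simp add: normal_density_def ennreal_mult[symmetric])
  also have "\<dots> = ennreal (sqrt (2 * pi)) * ennreal (LINT t|lborel. normal_density 0 1 t)"
   by (subst nn_integral_cmult) (auto simp: nn_integral_eq_integral normal_density_nonneg integrable_normal_density)
  finally show ?thesis by simp
 qed
 have "(\<integral>\<^sup>+x. ennreal (exp (- (norm x)\<^sup>2 / 2)) \<partial>(lborel::'a measure)) = (\<integral>\<^sup>+x. (\<Prod>b\<in>Basis. ennreal (exp (- (x \<bullet> b)\<^sup>2 / 2))) \<partial>(lborel::'a measure))"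
 proof (intro nn_integral_cong)
  fix x :: 'a
  have "(norm x)\<^sup>2 = (\<Sum>b\<in>Basis. (x \<bullet> b)\<^sup>2)" unfolding power2_norm_eq_inner by (subst euclidean_inner) (simp add: power2_eq_square)
  then have "exp (- (norm x)\<^sup>2 / 2) = (\<Prod>b\<in>Basis. exp (- (x \<bullet> b)\<^sup>2 / 2))"
   by (simp add: exp_sum[symmetric] sum_negf sum_divide_distrib)
  then show "ennreal (exp (- (norm x)\<^sup>2 / 2)) = (\<Prod>b\<in>Basis. ennreal (exp (- (x \<bullet> b)\<^sup>2 / 2)))" by (simp add: prod_ennreal)
 qed
 also have "\<dots> = (\<Prod>b\<in>(Basis::'a set). (NN t. ennreal (exp (- t\<^sup>2 / 2))))"
  by (rule nn_integral_lborel_prod) auto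
 also have "\<dots> = ennreal (sqrt (2 * pi) ^ DIM('a))" by (simp only: one prod_constant) (simp add: ennreal_power)
 finally have "(LINT x|(lborel::'a measure). exp (- (norm x)\<^sup>2 / 2)) = sqrt (2 * pi) ^ DIM('a)"
  by (subst integral_eq_nn_integral) auto
 then show ?thesis unfolding gau_def by (subst integral_complex_of_real) simp
qed

lemma fourier_gau: "fourier gau (\<xi>::'a::euclidean_space) = cr (sqrt (2 * pi) ^ DIM('a)) * gau \<xi>"
proof -
 have decay2: "integrable lborel (%v::'a. (norm v)\<^sup>2 * norm (gau v))"
 proof -
  let ?N = "swN TYPE('a)"
  have "integrable lborel (%v::'a. cr ((norm v)\<^sup>2) * gau v)"
  proof (rule weight_bound_integrable(1)[where C="fact (?N + 2) * exp (3/2)"])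
   fix x :: 'a
   have "(norm x)\<^sup>2 <= (1 + norm x)\<^sup>2" by (intro power_mono) auto
   then have "sw ?N x * ((norm x)\<^sup>2 * norm (gau x)) <= sw ?N x * ((1 + norm x)\<^sup>2 * norm (gau x))"
    by (intro mult_left_mono mult_right_mono) auto
   also have "\<dots> = sw (?N + 2) x * norm (gau x)" by (simp only: power_add mult.assoc)
   also have "\<dots> <= fact (?N + 2) * exp (3/2)" by (rule gau_decay)
   finally show "sw ?N x * norm (cr ((norm x)\<^sup>2) * gau x) <= fact (?N + 2) * exp (3/2)" by (simp add: norm_mult norm_power del: fact_Suc)
  qed measurable
  from integrable_norm[OF this] show ?thesis by (simp add: norm_mult norm_power)
 qed
 have int1: "integrable lborel (%v::'a. cr (v \<bullet> h) * gau v)" for h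
 proof (rule weight_bound_integrable(1)[where C="norm h * (fact (Suc (swN TYPE('a))) * exp (3/2))"])
  fix x :: 'a let ?N = "swN TYPE('a)"
  have "\<bar>x \<bullet> h\<bar> <= norm x * norm h" by (rule Cauchy_Schwarz_ineq2)
  also have "\<dots> <= (1 + norm x) * norm h" by (intro mult_right_mono) auto
  finally have "sw ?N x * (\<bar>x \<bullet> h\<bar> * norm (gau x)) <= sw ?N x * ((1 + norm x) * norm h * norm (gau x))"
   by (intro mult_left_mono mult_right_mono) auto
  also have "\<dots> = norm h * (sw (Suc ?N) x * norm (gau x))" by simp
  also have "\<dots> <= norm h * (fact (Suc ?N) * exp (3/2))" by (intro mult_left_mono gau_decay) auto
  finally show "sw ?N x * norm (cr (x \<bullet> h) * gau x) <= norm h * (fact (Suc ?N) * exp (3/2))" by (simp add: norm_mult)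
 qed measurable
 have der: "(fourier gau has_derivative (%h. - cr (\<xi> \<bullet> h) * fourier gau \<xi>)) (at \<xi>)" for \<xi> :: 'a
 proof -
  let ?D = "%h. fourier (%v. - \<i> * (cr (v \<bullet> h) * gau v)) \<xi>"
  have d: "(fourier gau has_derivative ?D) (at \<xi>)"
   by (rule fourier_has_derivative[OF gau_integrable int1 decay2])
  have b: "?D b = - cr (\<xi> \<bullet> b) * fourier gau \<xi>" if "b \<in> Basis" for b
  proof -
   have "?D b = fourier (%v. \<i> * pd b gau v) \<xi>" by (simp add: fun_cong[OF gau_pd])
   also have "\<dots> = \<i> * (\<i> * cr (\<xi> \<bullet> b) * fourier gau \<xi>)"
    unfolding fourier_cmult fourier_pd[OF gau_lev that] ..
   finally show ?thesis by (simp add: mult.assoc[symmetric])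
  qed
  have "?D h = - cr (\<xi> \<bullet> h) * fourier gau \<xi>" for h
  proof -
   have "?D h = (\<Sum>b\<in>Basis. cr (h \<bullet> b) * ?D b)"
    by (rule linear_sum_Basis) (use d has_derivative_linear in blast)
   also have "\<dots> = (\<Sum>b\<in>Basis. cr (h \<bullet> b) * (- cr (\<xi> \<bullet> b) * fourier gau \<xi>))"
    using b by simp
   also have "\<dots> = - cr (\<Sum>b\<in>Basis. (\<xi> \<bullet> b) * (h \<bullet> b)) * fourier gau \<xi>"
    by (simp add: sum_distrib_left sum_negf mult_ac)
   finally show ?thesis by (simp add: euclidean_inner[of \<xi> h])
  qed
  then have "?D = (%h. - cr (\<xi> \<bullet> h) * fourier gau \<xi>)" by blast
  with d show ?thesis by simp
 qed
 let ?e = "%x::'a. cr (exp ((x \<bullet> x) / 2))"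
 have "((%x. fourier gau x * ?e x) has_derivative (%h. 0)) (at x)" for x :: 'a
 proof -
  have "((%x. exp ((x \<bullet> x) / 2)) has_derivative (%h. (x \<bullet> h) * exp ((x \<bullet> x) / 2))) (at x)"
   by (auto intro!: derivative_eq_intros simp: inner_commute)
  from has_derivative_mult[OF der has_derivative_of_real[OF this]] show ?thesis
   by (simp add: algebra_simps)
 qed
 then obtain c where c: "\<And>x::'a. fourier gau x * ?e x = c"
  using has_derivative_zero_constant[of UNIV "%x. fourier gau x * ?e x"] by auto
 have "c = fourier gau (0::'a)" using c[of 0] by simp
 also have "\<dots> = cr (sqrt (2 * pi) ^ DIM('a))" by (simp add: fourier_fexp fexp_simps gau_integral)
 finally have "fourier gau \<xi> * ?e \<xi> = cr (sqrt (2 * pi) ^ DIM('a))" using c by simp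
 then have "fourier gau \<xi> * (?e \<xi> * gau \<xi>) = cr (sqrt (2 * pi) ^ DIM('a)) * gau \<xi>"
  unfolding mult.assoc[symmetric] by simp
 moreover have "?e \<xi> * gau \<xi> = 1"
  unfolding gau_def of_real_mult[symmetric] exp_add[symmetric] power2_norm_eq_inner by simp
 ultimately show ?thesis by simp
qed

lemma integrable_prod_mult:
 fixes f :: "'a::euclidean_space => complex" and g :: "'b::euclidean_space => complex"
 assumes f: "integrable lborel f" and g: "integrable lborel g"
 shows "integrable (lborel \<Otimes>\<^sub>M lborel) (%(x, y). f x * g y)"
proof -
 have [measurable]: "f \<in> bmeas" "g \<in> bmeas" using f g by auto
 show ?thesis
  by (rule lborel_pair.Fubini_integrable) (use f g in \<open>auto simp: norm_mult\<close>)
qed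

text \<open>Gaussian summation: insert \<open>gau (\<delta> \<xi>)\<close>, apply Fubini and let \<delta> tend to 0.\<close>

lemma fourier_inversion_aux:
 fixes f :: "'a::euclidean_space => complex"
 assumes f: "schwartz f"
 shows "(LINT \<xi>|lborel. fexp (- (\<xi> \<bullet> x)) * fourier f \<xi>) = cr ((2 * pi) ^ DIM('a)) * f x"
proof -
 have [measurable]: "f \<in> bmeas" using schwartz_measurable[OF f] .
 have [measurable]: "fourier f \<in> bmeas" using schwartz_measurable[OF fourier_schwartz[OF f]] .
 have fi: "integrable lborel f" "integrable lborel (fourier f)" using f schwartz_integrable fourier_schwartz by auto
 let ?c = "cr (sqrt (2 * pi) ^ DIM('a))"
 let ?E = "%\<delta>. LINT \<xi>|lborel. fexp (- (\<xi> \<bullet> x)) * fourier f \<xi> * gau (\<delta> *\<^sub>R \<xi>)"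
 have g1: "norm (gau y) <= 1" for y :: 'a by (simp add: gau_def)
 have g0: "((%\<delta>. gau (\<delta> *\<^sub>R y)) \<longlongrightarrow> 1) (at_right 0)" for y :: 'a
  unfolding gau_def by (auto intro!: tendsto_eq_intros)
 have lim1: "(?E \<longlongrightarrow> (LINT \<xi>|lborel. fexp (- (\<xi> \<bullet> x)) * fourier f \<xi>)) (at_right 0)"
 proof (rule dominated_convergence_at_right[where w="%\<xi>. norm (fourier f \<xi>)"])
  show "((%\<delta>. fexp (- (\<xi> \<bullet> x)) * fourier f \<xi> * gau (\<delta> *\<^sub>R \<xi>)) \<longlongrightarrow> fexp (- (\<xi> \<bullet> x)) * fourier f \<xi>) (at_right 0)" for \<xi>
   using tendsto_mult[OF tendsto_const g0[of \<xi>], of "fexp (- (\<xi> \<bullet> x)) * fourier f \<xi>"] by simp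
  show "norm (fexp (- (\<xi> \<bullet> x)) * fourier f \<xi> * gau (\<delta> *\<^sub>R \<xi>)) <= norm (fourier f \<xi>)" for \<xi> \<delta>
   using mult_left_mono[OF g1[of "\<delta> *\<^sub>R \<xi>"], of "norm (fourier f \<xi>)"] by (simp add: norm_mult fexp_simps)
 qed (use fi in auto)
 have E: "?E \<delta> = ?c * (LINT w|lborel. f (x + \<delta> *\<^sub>R w) * gau w)" if \<delta>: "\<delta> > 0" for \<delta>
 proof -
  let ?P = "%\<xi> y. fexp (- (\<xi> \<bullet> x)) * (fexp (\<xi> \<bullet> y) * f y) * gau (\<delta> *\<^sub>R \<xi>)"
  have gi: "integrable lborel (%\<xi>::'a. gau (\<delta> *\<^sub>R \<xi>))"
   using integral_affine(2)[of \<delta> gau "0::'a"] \<delta> gau_integrable by simp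
  have Pi: "integrable (lborel \<Otimes>\<^sub>M lborel) (%(\<xi>, y). ?P \<xi> y)"
   by (rule Bochner_Integration.integrable_bound[OF integrable_norm[OF integrable_prod_mult[OF gi fi(1)]]])
     (auto simp: norm_mult fexp_simps)
  have "(LINT y|lborel. ?P \<xi> y) = fexp (- (\<xi> \<bullet> x)) * fourier f \<xi> * gau (\<delta> *\<^sub>R \<xi>)" for \<xi>
   unfolding fourier_fexp by (simp only: integral_mult_left_zero integral_mult_right_zero)
  then have "?E \<delta> = (LINT \<xi>|lborel. LINT y|lborel. ?P \<xi> y)" by (simp only:)
  also have "\<dots> = (LINT y|lborel. LINT \<xi>|lborel. ?P \<xi> y)"
   by (rule lborel_pair.Fubini_integral[symmetric, OF Pi])
  also have "\<dots> = (LINT y|lborel. (1 / \<delta> ^ DIM('a)) *\<^sub>R (f y * (?c * gau ((1 / \<delta>) *\<^sub>R (y - x)))))"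
  proof (intro LINT_cong refl)
   fix y
   have "(LINT \<xi>|lborel. ?P \<xi> y) = (LINT \<xi>|lborel. f y * (%\<zeta>. fexp (((1 / \<delta>) *\<^sub>R (y - x)) \<bullet> \<zeta>) * gau \<zeta>) (0 + \<delta> *\<^sub>R \<xi>))"
   proof (intro LINT_cong refl)
    fix \<xi>
    have "fexp (- (\<xi> \<bullet> x)) * fexp (\<xi> \<bullet> y) = fexp (((1 / \<delta>) *\<^sub>R (y - x)) \<bullet> (\<delta> *\<^sub>R \<xi>))"
     using \<delta> by (simp add: fexp_simps(2)[symmetric] inner_diff_right inner_commute)
    then show "?P \<xi> y = f y * (%\<zeta>. fexp (((1 / \<delta>) *\<^sub>R (y - x)) \<bullet> \<zeta>) * gau \<zeta>) (0 + \<delta> *\<^sub>R \<xi>)"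
     by (simp add: mult_ac)
   qed
   also have "\<dots> = f y * (LINT \<xi>|lborel. (%\<zeta>. fexp (((1 / \<delta>) *\<^sub>R (y - x)) \<bullet> \<zeta>) * gau \<zeta>) (0 + \<delta> *\<^sub>R \<xi>))"
    by (rule integral_mult_right_zero)
   also have "\<dots> = f y * ((1 / \<delta> ^ DIM('a)) *\<^sub>R fourier gau ((1 / \<delta>) *\<^sub>R (y - x)))"
    by (subst integral_affine(1)) (use \<delta> in \<open>auto simp: fourier_fexp\<close>)
   finally show "(LINT \<xi>|lborel. ?P \<xi> y) = (1 / \<delta> ^ DIM('a)) *\<^sub>R (f y * (?c * gau ((1 / \<delta>) *\<^sub>R (y - x))))"
    by (simp add: fourier_gau)
  qed
  also have "\<dots> = (1 / \<bar>\<delta>\<bar> ^ DIM('a)) *\<^sub>R (LINT y|lborel. (%y. f y * (?c * gau ((1 / \<delta>) *\<^sub>R (y - x)))) y)"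
   using \<delta> by simp
  also have "\<dots> = (LINT w|lborel. (%y. f y * (?c * gau ((1 / \<delta>) *\<^sub>R (y - x)))) (x + \<delta> *\<^sub>R w))"
   by (rule integral_affine(1)[symmetric]) (use \<delta> in auto)
  also have "\<dots> = (LINT w|lborel. ?c * (f (x + \<delta> *\<^sub>R w) * gau w))"
   using \<delta> by (intro LINT_cong refl) simp
  finally show ?thesis by simp
 qed
 obtain B where B: "\<And>y. norm (f y) <= B" using schwartz_bound[OF f, of 0] by auto
 have "((%\<delta>. LINT w|lborel. f (x + \<delta> *\<^sub>R w) * gau w) \<longlongrightarrow> (LINT w|lborel. f x * gau (w::'a))) (at_right 0)"
 proof (rule dominated_convergence_at_right[where w="%w::'a. B * norm (gau w)" and M=lborel
    and s="%\<delta> w. f (x + \<delta> *\<^sub>R w) * gau w" and f="%w. f x * gau w"])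
  show "((%\<delta>. f (x + \<delta> *\<^sub>R w) * gau w) \<longlongrightarrow> f x * gau w) (at_right 0)" for w
  proof (intro tendsto_mult tendsto_const)
   have "((%\<delta>::real. x + \<delta> *\<^sub>R w) \<longlongrightarrow> x) (at_right 0)" by (auto intro!: tendsto_eq_intros)
   moreover have "isCont f x" using schwartz_continuous[OF f] continuous_on_eq_continuous_at by blast
   ultimately show "((%\<delta>. f (x + \<delta> *\<^sub>R w)) \<longlongrightarrow> f x) (at_right 0)" by (rule isCont_tendsto_compose[rotated])
  qed
  show "norm (f (x + \<delta> *\<^sub>R w) * gau w) <= B * norm (gau w)" for \<delta> w
   using B by (simp add: norm_mult mult_right_mono)
 qed (auto intro: integrable_norm gau_integrable)
 then have "((%\<delta>. ?c * (LINT w|lborel. f (x + \<delta> *\<^sub>R w) * gau w)) \<longlongrightarrow> ?c * (f x * ?c)) (at_right 0)"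
  by (intro tendsto_mult tendsto_const) (simp add: gau_integral)
 moreover have "\<forall>\<^sub>F \<delta> in at_right 0. ?c * (LINT w|lborel. f (x + \<delta> *\<^sub>R w) * gau w) = ?E \<delta>"
  using E by (auto simp: eventually_at_right_less eventually_at_filter)
 ultimately have "(?E \<longlongrightarrow> ?c * (f x * ?c)) (at_right 0)" by (rule Lim_transform_eventually)
 from tendsto_unique[OF _ lim1 this] have "(LINT \<xi>|lborel. fexp (- (\<xi> \<bullet> x)) * fourier f \<xi>) = (?c * ?c) * f x" by (simp add: mult_ac)
 also have "?c * ?c = cr ((2 * pi) ^ DIM('a))"
 proof -
  have "sqrt (2 * pi) ^ DIM('a) * sqrt (2 * pi) ^ DIM('a) = (2 * pi) ^ DIM('a)"
   by (subst power_mult_distrib[symmetric]) simp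
  then show ?thesis by (simp only: of_real_mult[symmetric])
 qed
 finally show ?thesis .
qed

lemma inv_fourier_fourier:
 fixes f :: "'a::euclidean_space => complex"
 assumes f: "schwartz f" shows "inv_fourier (fourier f) = f"
proof
 fix x
 have "(LINT \<xi>|lborel. exp (\<i> * cr (\<xi> \<bullet> x)) * fourier f \<xi>) = cr ((2 * pi) ^ DIM('a)) * f x"
  using fourier_inversion_aux[OF f, of x] by (simp add: fexp_def)
 then show "inv_fourier (fourier f) x = f x" by (simp add: inv_fourier_def)
qed

lemma fourier_inv_fourier:
 fixes f :: "'a::euclidean_space => complex"
 assumes f: "schwartz f" shows "fourier (inv_fourier f) = f"
proof
 fix x
 have m: "fourier f \<in> bmeas" using schwartz_measurable[OF fourier_schwartz[OF f]] .
 have "fourier (inv_fourier f) x = cr (1 / (2 * pi) ^ DIM('a)) * fourier (%v. fourier f (- v)) x"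
  unfolding inv_fourier_eq[abs_def] by (rule fourier_cmult)
 also have "fourier (%v. fourier f (- v)) x = (LINT v|lborel. (%v. fexp (- (v \<bullet> x)) * fourier f v) (0 + (-1) *\<^sub>R v))"
  unfolding fourier_fexp[of "%v. fourier f (- v)"] by (intro LINT_cong) (auto simp: inner_commute)
 also have "\<dots> = cr ((2 * pi) ^ DIM('a)) * f x"
  by (subst integral_affine(1)) (use m fourier_inversion_aux[OF f, of x] in auto)
 finally show "fourier (inv_fourier f) x = f x" by simp
qed

section \<open>Fourier multipliers on Schwartz functions\<close>

text \<open>Functions with bounded derivatives of every order; they act on the Schwartz space by multiplication.\<close>

definition bmul :: "('a::euclidean_space => complex) => bool" where
 "bmul m \<longleftrightarrow> (\<forall>n. lev (%N x. 1) n (%_::unit. m) UNIV)"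

lemma bmul_lev: "bmul m ==> lev (%N x. 1) n (%_. m) J"
 using lev_reindex[of "%N x. 1" n "%_. m" UNIV "%_. ()" J] by (auto simp: bmul_def)

lemma bmul_mult: assumes "bmul m" "bmul m'" shows "bmul (%x. m x * m' x)"
proof -
 have ex: "\<exists>(N1::nat) (N2::nat) K. 0 <= K \<and> (\<forall>x::'a. (1::real) <= K * (1 * 1))"
  by (rule exI, rule exI, rule exI[of _ 1]) simp
 show ?thesis unfolding bmul_def
  by (intro allI lev_mult[where ?w1.0="%N x. 1" and ?w2.0="%N x. 1" and ?w3.0="%N x. 1", OF _ _ _ ex bmul_lev[OF assms(1)] bmul_lev[OF assms(2)]]) auto
qed

lemma bmul_sum: assumes "finite I" "\<And>i. i \<in> I ==> bmul (m i)" shows "bmul (%x. \<Sum>i\<in>I. m i x)"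
 unfolding bmul_def using lev_sum[where w="%N x. 1" and J=UNIV and F="%i _. m i", OF _ assms(1)] assms(2) by (auto simp: bmul_def)

lemma bmul_const: "bmul (%x. c)"
 unfolding bmul_def using lev_const[of UNIV "%_::unit. c" "norm c"] by auto

lemma bmul_diff: assumes "bmul m" "bmul m'" shows "bmul (%x. m x - m' x)"
proof -
 have "bmul (%x. -1 * m' x)" by (intro bmul_mult bmul_const assms)
 then have "lev (%N x. 1) n (%(_::unit) x. m x + (-1) * m' x) UNIV" for n
  using assms unfolding bmul_def by (intro lev_add) auto
 then show ?thesis by (simp add: bmul_def)
qed

lemma bmul_comp:
 fixes L :: "'b::euclidean_space => 'a::euclidean_space"
 assumes m: "bmul m" and L: "bounded_linear L" shows "bmul (%z. m (L z))"
proof -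
 have ex: "\<exists>(N1::nat) K. 0 <= K \<and> (\<forall>z::'b. (1::real) <= K * 1)"
  by (rule exI, rule exI[of _ 1]) simp
 show ?thesis unfolding bmul_def
  by (intro allI lev_comp[OF L, where ?w1.0="%N x. 1" and ?w2.0="%N x. 1", OF _ _ ex bmul_lev[OF m]]) auto
qed

lemma schwartz_bmul: assumes "schwartz m" shows "bmul m"
proof -
 have ex: "\<exists>(N1::nat) K. 0 <= K \<and> (\<forall>z::'a. (1::real) <= K * sw N1 z)"
  by (rule exI[of _ 0], rule exI[of _ 1]) simp
 show ?thesis unfolding bmul_def
  by (intro allI lev_comp[OF bounded_linear_ident, where ?w1.0=sw and ?w2.0="%N x. 1", OF _ _ ex schwartz_lev[OF assms]]) auto
qed

lemma bmul_schwartz_mult: "bmul m ==> schwartz f ==> schwartz (%x. m x * f x)"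
 unfolding schwartz_iff by (rule sbdd_mult[OF bmul_lev])

text \<open>The transposed action of a Fourier multiplier on test functions.\<close>

definition fmul :: "('a::euclidean_space => complex) => ('a => complex) => 'a => complex" where
 "fmul m f = fourier (%\<zeta>. m \<zeta> * inv_fourier f \<zeta>)"

lemma fourier_multiplier_fmul: "fourier_multiplier m T = (%f. T (fmul m f))"
 by (simp add: fourier_multiplier_def inv_fourier_distr_def mult_distr_def fourier_distr_def fmul_def)

lemma fmul_schwartz: "bmul m ==> schwartz f ==> schwartz (fmul m f)"
 unfolding fmul_def by (intro fourier_schwartz bmul_schwartz_mult inv_fourier_schwartz)

lemma inv_fourier_fmul: "bmul m ==> schwartz f ==> inv_fourier (fmul m f) = (%\<zeta>. m \<zeta> * inv_fourier f \<zeta>)"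
 unfolding fmul_def by (intro inv_fourier_fourier bmul_schwartz_mult inv_fourier_schwartz)

lemma fmul_fmul: "bmul m' ==> schwartz f ==> fmul m (fmul m' f) = fmul (%x. m x * m' x) f"
 unfolding fmul_def[of m] inv_fourier_fmul by (simp add: fmul_def mult.assoc)

lemma schwartz_cmult: "schwartz f ==> schwartz (%x. c * f x)"
 unfolding schwartz_iff by (rule sbdd_cmult[where M="norm c"]) auto

lemma schwartz_sum: "finite I ==> (\<And>i. i \<in> I ==> schwartz (f i)) ==> schwartz (%x. \<Sum>i\<in>I. f i x)"
 unfolding schwartz_iff by (rule sbdd_sum)

lemma schwartz_zero: "schwartz (%x. 0)"
 unfolding schwartz_iff sbdd_def by (simp add: lev_zero)

lemma fourier_sum:
 fixes f :: "'i => 'a::euclidean_space => complex"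
 assumes "finite I" "\<And>i. i \<in> I ==> schwartz (f i)" shows "fourier (%x. \<Sum>i\<in>I. f i x) = (%\<xi>. \<Sum>i\<in>I. fourier (f i) \<xi>)"
 using assms
proof (induction I)
 case empty then show ?case by (simp add: fourier_fexp)
next
 case (insert i I)
 have s: "schwartz (f i)" "schwartz (%x. \<Sum>i\<in>I. f i x)" by (auto intro: schwartz_sum insert)
 show ?case using insert(3,4) by (simp add: insert(1,2) fourier_add[OF s[THEN schwartz_integrable]] fun_eq_iff)
qed

lemma inv_fourier_add:
 fixes f g :: "'a::euclidean_space => complex"
 assumes "schwartz f" "schwartz g" shows "inv_fourier (%x. f x + g x) = (%x. inv_fourier f x + inv_fourier g x)"
 using fourier_add[OF schwartz_integrable[OF assms(1)] schwartz_integrable[OF assms(2)]]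
 by (simp add: inv_fourier_eq fun_eq_iff distrib_left)

lemma inv_fourier_cmult:
 fixes f :: "'a::euclidean_space => complex"
 shows "inv_fourier (%x. c * f x) = (%x. c * inv_fourier f x)"
 by (simp add: inv_fourier_eq fun_eq_iff fourier_cmult mult_ac)

lemma fmul_add:
 fixes f g :: "'a::euclidean_space => complex"
 assumes m: "bmul m" and f: "schwartz f" and g: "schwartz g"
 shows "fmul m (%x. f x + g x) = (%x. fmul m f x + fmul m g x)"
proof -
 have s: "schwartz (%\<zeta>. m \<zeta> * inv_fourier f \<zeta>)" "schwartz (%\<zeta>. m \<zeta> * inv_fourier g \<zeta>)"
  by (intro bmul_schwartz_mult inv_fourier_schwartz m f g)+
 show ?thesis unfolding fmul_def inv_fourier_add[OF f g] distrib_left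
  by (rule ext) (rule fourier_add[OF s[THEN schwartz_integrable]])
qed

lemma fmul_cmult: "fmul m (%x. c * f x) = (%x. c * fmul m f x)"
proof -
 have "(%\<zeta>. m \<zeta> * (c * inv_fourier f \<zeta>)) = (%\<zeta>. c * (m \<zeta> * inv_fourier f \<zeta>))" by (simp add: fun_eq_iff)
 then show ?thesis unfolding fmul_def inv_fourier_cmult by (simp only:) (rule ext, rule fourier_cmult)
qed

lemma tempered_add: "tempered T ==> schwartz f ==> schwartz g ==> T (%x. f x + g x) = T f + T g"
 by (auto simp: tempered_def)

lemma tempered_cmult: "tempered T ==> schwartz f ==> T (%x. c * f x) = c * T f"
 by (auto simp: tempered_def)

lemma tempered_zero: "tempered T ==> T (%x. 0) = 0"
 using tempered_cmult[of T "%x. 0" 0] schwartz_zero by auto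

lemma tempered_sum:
 assumes "tempered T" "finite I" "\<And>i. i \<in> I ==> schwartz (f i)" shows "T (%x. \<Sum>i\<in>I. f i x) = (\<Sum>i\<in>I. T (f i))"
 using assms(2,3)
proof (induction I)
 case empty then show ?case using tempered_zero[OF assms(1)] by simp
next
 case (insert i I)
 have s: "schwartz (f i)" "schwartz (%x. \<Sum>i\<in>I. f i x)" by (auto intro: schwartz_sum insert)
 show ?case using insert(3,4) by (simp add: insert(1,2) tempered_add[OF assms(1) s])
qed

text \<open>A multiplier that is the Fourier transform of an integrable function acts by convolution.\<close>

lemma fmul_conv:
 fixes k :: "'b::euclidean_space => complex" and L :: "'b => 'a::euclidean_space"
 assumes k: "integrable lborel k" and L: "bounded_linear L" and G: "schwartz G"
  and m: "\<And>\<zeta>. m \<zeta> = (LINT w|lborel. k w * fexp (- (\<zeta> \<bullet> L w)))"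
 shows "fmul m G z = (LINT w|lborel. k w * G (z - L w))"
proof -
 have [measurable]: "k \<in> bmeas" using k by auto
 have [measurable]: "L \<in> bmeas"
  by (intro borel_measurable_continuous_onI linear_continuous_on L)
 note I = inv_fourier_schwartz[OF G]
 have [measurable]: "inv_fourier G \<in> bmeas" using schwartz_measurable[OF I] .
 let ?P = "%\<zeta> w. fexp (z \<bullet> \<zeta>) * ((k w * fexp (- (\<zeta> \<bullet> L w))) * inv_fourier G \<zeta>)"
 have Pi: "integrable (lborel \<Otimes>\<^sub>M lborel) (%(\<zeta>, w). ?P \<zeta> w)"
  by (rule Bochner_Integration.integrable_bound[OF integrable_norm[OF integrable_prod_mult[OF schwartz_integrable[OF I] k]]])
    (auto simp: norm_mult fexp_simps mult.commute)
 have "fmul m G z = (LINT \<zeta>|lborel. fexp (z \<bullet> \<zeta>) * (m \<zeta> * inv_fourier G \<zeta>))"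
  by (simp add: fmul_def fourier_fexp)
 also have "\<dots> = (LINT \<zeta>|lborel. LINT w|lborel. ?P \<zeta> w)"
  unfolding m by (simp only: integral_mult_left_zero integral_mult_right_zero)
 also have "\<dots> = (LINT w|lborel. LINT \<zeta>|lborel. ?P \<zeta> w)"
  by (rule lborel_pair.Fubini_integral[symmetric, OF Pi])
 also have "\<dots> = (LINT w|lborel. k w * G (z - L w))"
 proof (intro LINT_cong refl)
  fix w
  have "(LINT \<zeta>|lborel. ?P \<zeta> w) = (LINT \<zeta>|lborel. k w * (fexp ((z - L w) \<bullet> \<zeta>) * inv_fourier G \<zeta>))"
  proof (intro LINT_cong refl)
   fix \<zeta>
   have "(z - L w) \<bullet> \<zeta> = z \<bullet> \<zeta> + - (\<zeta> \<bullet> L w)" by (simp add: inner_diff_left inner_commute[of "L w"])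
   then have "fexp ((z - L w) \<bullet> \<zeta>) = fexp (z \<bullet> \<zeta>) * fexp (- (\<zeta> \<bullet> L w))"
    by (simp only: fexp_simps(2)[symmetric])
   then show "?P \<zeta> w = k w * (fexp ((z - L w) \<bullet> \<zeta>) * inv_fourier G \<zeta>)" by simp
  qed
  also have "\<dots> = k w * fourier (inv_fourier G) (z - L w)"
   unfolding fourier_fexp by (rule integral_mult_right_zero)
  finally show "(LINT \<zeta>|lborel. ?P \<zeta> w) = k w * G (z - L w)" by (simp add: fourier_inv_fourier[OF G])
 qed
 finally show ?thesis .
qed

section \<open>Sheared tensor products\<close>

text \<open>The regularized test function \<open>\<theta> (x + r v)\<close>.\<close>

definition shten :: "real => real => ('a::euclidean_space => complex) => ('a => complex) => 'a \<times> 'a => complex" where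
 "shten r \<epsilon> \<theta> \<kappa> = (%(x, v). \<theta> (x + r *\<^sub>R v) * \<kappa> (\<epsilon> *\<^sub>R v))"

lemma shten_schwartz:
 assumes \<theta>: "schwartz \<theta>" and \<kappa>: "schwartz \<kappa>" and \<epsilon>: "\<epsilon> ~= 0"
 shows "schwartz (shten r \<epsilon> \<theta> \<kappa>)"
proof -
 have "sbdd (%(_::unit) z. \<theta> (stream r z) * \<kappa> (\<epsilon> *\<^sub>R snd z)) UNIV"
 proof (rule sbdd_pair[OF schwartz_sbdd[OF \<theta>] schwartz_sbdd[OF \<kappa>]])
  show "bounded_linear (%z::'a \<times> 'a. stream r z)" "bounded_linear (%z::'a \<times> 'a. \<epsilon> *\<^sub>R snd z)"
   by (intro bounded_linear_add bounded_linear_fst bounded_linear_snd bounded_linear_scaleR_right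
     bounded_linear_compose[OF bounded_linear_scaleR_right bounded_linear_snd])+
  fix z :: "'a \<times> 'a"
  let ?x = "fst z" let ?v = "snd z"
  have "norm z <= norm ?x + norm ?v" by (metis norm_Pair_le prod.collapse)
  also have "norm ?x <= norm (?x + r *\<^sub>R ?v) + \<bar>r\<bar> * norm ?v"
   using norm_triangle_ineq4[of "?x + r *\<^sub>R ?v" "r *\<^sub>R ?v"] by simp
  finally have a: "norm z <= norm (?x + r *\<^sub>R ?v) + (1 + \<bar>r\<bar>) * norm ?v" by (simp add: algebra_simps)
  have b: "(1 + \<bar>r\<bar>) * norm ?v = ((1 + \<bar>r\<bar>) / \<bar>\<epsilon>\<bar>) * norm (\<epsilon> *\<^sub>R ?v)" using \<epsilon> by simp
  from a have le: "norm z <= norm (?x + r *\<^sub>R ?v) + ((1 + \<bar>r\<bar>) / \<bar>\<epsilon>\<bar>) * norm (\<epsilon> *\<^sub>R ?v)" unfolding b .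
  have "A + c * B <= (1 + c) * (A + B)" if "0 <= c" "0 <= A" "0 <= B" for c A B :: real
   using that mult_nonneg_nonneg[OF that(1,2)] by (simp add: algebra_simps)
  from order_trans[OF le this] show "norm z <= (1 + (1 + \<bar>r\<bar>) / \<bar>\<epsilon>\<bar>) * (norm (?x + r *\<^sub>R ?v) + norm (\<epsilon> *\<^sub>R ?v))"
   by simp
 qed
 then show ?thesis unfolding schwartz_iff shten_def by (simp add: case_prod_beta')
qed

text \<open>For small \<epsilon> the transform concentrates on \<open>\<eta> = r \<xi>\<close>.\<close>

lemma fourier_shten:
 fixes \<theta> \<kappa> :: "'a::euclidean_space => complex"
 assumes \<theta>: "schwartz \<theta>" and \<kappa>: "schwartz \<kappa>" and \<epsilon>: "\<epsilon> ~= 0"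
 shows "fourier (shten r \<epsilon> \<theta> \<kappa>) (\<xi>, \<eta>) =
   fourier \<theta> \<xi> * ((1 / \<bar>\<epsilon>\<bar> ^ DIM('a)) *\<^sub>R fourier \<kappa> ((1 / \<epsilon>) *\<^sub>R (\<eta> - r *\<^sub>R \<xi>)))"
proof -
 have [measurable]: "\<theta> \<in> bmeas" "\<kappa> \<in> bmeas" using \<theta> \<kappa> schwartz_measurable by auto
 let ?P = "%x v. fexp ((\<xi>, \<eta>) \<bullet> (x, v)) * (\<theta> (x + r *\<^sub>R v) * \<kappa> (\<epsilon> *\<^sub>R v))"
 have "integrable (lborel \<Otimes>\<^sub>M lborel) (%z. fexp ((\<xi>, \<eta>) \<bullet> z) * shten r \<epsilon> \<theta> \<kappa> z)"
  unfolding lborel_prod by (intro integrable_fexp schwartz_integrable shten_schwartz assms)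
 then have i: "integrable (lborel \<Otimes>\<^sub>M lborel) (%(x, v). ?P x v)" by (simp add: shten_def case_prod_beta' inner_prod_def)
 have "fourier (shten r \<epsilon> \<theta> \<kappa>) (\<xi>, \<eta>) = integral\<^sup>L (lborel \<Otimes>\<^sub>M lborel) (%(x, v). ?P x v)"
  unfolding fourier_fexp lborel_prod by (intro LINT_cong refl) (simp add: shten_def case_prod_beta' inner_prod_def)
 also have "\<dots> = (LINT v|lborel. LINT x|lborel. ?P x v)" by (rule lborel_pair.integral_snd[symmetric, OF i])
 also have "\<dots> = (LINT v|lborel. fourier \<theta> \<xi> * (%w. fexp (((1 / \<epsilon>) *\<^sub>R (\<eta> - r *\<^sub>R \<xi>)) \<bullet> w) * \<kappa> w) (0 + \<epsilon> *\<^sub>R v))"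
 proof (intro LINT_cong refl)
  fix v
  have "(LINT x|lborel. ?P x v) = (LINT x|lborel. (fexp (((1 / \<epsilon>) *\<^sub>R (\<eta> - r *\<^sub>R \<xi>)) \<bullet> (\<epsilon> *\<^sub>R v)) * \<kappa> (\<epsilon> *\<^sub>R v)) * (fexp (\<xi> \<bullet> (x + r *\<^sub>R v)) * \<theta> (x + r *\<^sub>R v)))"
  proof (intro LINT_cong refl)
   fix x
   have "fexp ((\<xi>, \<eta>) \<bullet> (x, v)) = fexp (((1 / \<epsilon>) *\<^sub>R (\<eta> - r *\<^sub>R \<xi>)) \<bullet> (\<epsilon> *\<^sub>R v)) * fexp (\<xi> \<bullet> (x + r *\<^sub>R v))"
    using \<epsilon> by (simp add: fexp_simps(2)[symmetric] inner_diff_left inner_add_right add.commute)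
   then show "?P x v = (fexp (((1 / \<epsilon>) *\<^sub>R (\<eta> - r *\<^sub>R \<xi>)) \<bullet> (\<epsilon> *\<^sub>R v)) * \<kappa> (\<epsilon> *\<^sub>R v)) * (fexp (\<xi> \<bullet> (x + r *\<^sub>R v)) * \<theta> (x + r *\<^sub>R v))"
    by (simp add: mult_ac)
  qed
  also have "\<dots> = (fexp (((1 / \<epsilon>) *\<^sub>R (\<eta> - r *\<^sub>R \<xi>)) \<bullet> (\<epsilon> *\<^sub>R v)) * \<kappa> (\<epsilon> *\<^sub>R v)) * (LINT x|lborel. fexp (\<xi> \<bullet> (x + r *\<^sub>R v)) * \<theta> (x + r *\<^sub>R v))"
   by (rule integral_mult_right_zero)
  also have "(LINT x|lborel. fexp (\<xi> \<bullet> (x + r *\<^sub>R v)) * \<theta> (x + r *\<^sub>R v)) = fourier \<theta> \<xi>"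
   unfolding fourier_fexp by (rule integral_translation[of "%x. fexp (\<xi> \<bullet> x) * \<theta> x"]) simp
  finally show "(LINT x|lborel. ?P x v) = fourier \<theta> \<xi> * (%w. fexp (((1 / \<epsilon>) *\<^sub>R (\<eta> - r *\<^sub>R \<xi>)) \<bullet> w) * \<kappa> w) (0 + \<epsilon> *\<^sub>R v)"
   by (simp add: mult_ac)
 qed
 also have "\<dots> = fourier \<theta> \<xi> * (LINT v|lborel. (%w. fexp (((1 / \<epsilon>) *\<^sub>R (\<eta> - r *\<^sub>R \<xi>)) \<bullet> w) * \<kappa> w) (0 + \<epsilon> *\<^sub>R v))"
  by (rule integral_mult_right_zero)
 also have "\<dots> = fourier \<theta> \<xi> * ((1 / \<bar>\<epsilon>\<bar> ^ DIM('a)) *\<^sub>R fourier \<kappa> ((1 / \<epsilon>) *\<^sub>R (\<eta> - r *\<^sub>R \<xi>)))"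
  by (subst integral_affine(1)) (use \<epsilon> in \<open>auto simp: fourier_fexp\<close>)
 finally show ?thesis .
qed

lemma inv_fourier_shten:
 fixes \<theta> \<kappa> :: "'a::euclidean_space => complex"
 assumes "schwartz \<theta>" "schwartz \<kappa>" "\<epsilon> ~= 0"
 shows "inv_fourier (shten r \<epsilon> \<theta> \<kappa>) (\<xi>, \<eta>) =
   inv_fourier \<theta> \<xi> * ((1 / \<bar>\<epsilon>\<bar> ^ DIM('a)) *\<^sub>R inv_fourier \<kappa> ((1 / \<epsilon>) *\<^sub>R (\<eta> - r *\<^sub>R \<xi>)))"
proof -
 have e: "(1 / \<epsilon>) *\<^sub>R (- \<eta> - r *\<^sub>R (- \<xi>)) = - ((1 / \<epsilon>) *\<^sub>R (\<eta> - r *\<^sub>R \<xi>))"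
  by (simp add: scaleR_right_diff_distrib)
 show ?thesis unfolding inv_fourier_eq uminus_Pair fourier_shten[OF assms] e
  by (simp add: power_add scaleR_conv_of_real)
qed

section \<open>Test functions and Littlewood--Paley partitions\<close>

lemma iter_deriv_supp:
 fixes f :: "'a::euclidean_space => 'b::real_normed_vector"
 shows "x \<notin> closure {x. f x ~= 0} ==> iter_deriv es f x = 0"
proof (induction es arbitrary: x)
 case Nil
 then have "x \<notin> {x. f x ~= 0}" by (meson closure_subset subsetD)
 then show ?case by simp
next
 case (Cons e es)
 let ?U = "- closure {x. f x ~= 0}"
 have "((%x. 0) has_derivative (%h. 0)) (at x)" by simp
 moreover have "open ?U" "x \<in> ?U" using Cons.prems by auto
 ultimately have "(iter_deriv es f has_derivative (%h. 0)) (at x)"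
  by (rule has_derivative_transform_within_open) (use Cons.IH in auto)
 from frechet_derivative_at[OF this] show ?case by (simp add: fun_eq_iff)
qed

lemma iter_deriv_of_real:
 fixes f :: "'a::euclidean_space => real"
 assumes f: "smooth f" and es: "set es \<subseteq> Basis"
 shows "iter_deriv es (%x. cr (f x)) = (%x. cr (iter_deriv es f x))"
 using es
proof (induction es)
 case (Cons e es)
 then have "iter_deriv es f differentiable (at x)" for x using f by (auto simp: smooth_def)
 then have "((%x. cr (iter_deriv es f x)) has_derivative (%h. cr (frechet_derivative (iter_deriv es f) (at x) h))) (at x)" for x
  by (intro has_derivative_of_real) (simp add: frechet_derivative_works[symmetric])
 from fun_cong[OF frechet_derivative_at[OF this], of _ e]
 have d: "pd e (%x. cr (iter_deriv es f x)) x = cr (pd e (iter_deriv es f) x)" for x by simp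
 have ih: "iter_deriv es (%x. cr (f x)) = (%x. cr (iter_deriv es f x))" using Cons by simp
 show ?case unfolding iter_deriv.simps ih by (rule ext) (rule d)
qed simp

lemma test_function_schwartz:
 fixes f :: "'a::euclidean_space => real"
 assumes f: "test_function f" shows "schwartz (%x. cr (f x))"
proof -
 have s: "smooth f" and K: "compact (closure {x. f x ~= 0})" using f by (auto simp: test_function_def)
 let ?K = "closure {x. f x ~= 0}"
 have d: "iter_deriv es f differentiable (at x)" if "set es \<subseteq> Basis" for es x using s that by (auto simp: smooth_def)
 have sm: "smooth (%x. cr (f x))" unfolding smooth_def
 proof (intro allI impI)
  fix es :: "'a list" and x assume es: "set es \<subseteq> Basis"
  have "((%x. cr (iter_deriv es f x)) has_derivative (%h. cr (frechet_derivative (iter_deriv es f) (at x) h))) (at x)"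
   using d[OF es] by (intro has_derivative_of_real) (simp add: frechet_derivative_works[symmetric])
  then show "iter_deriv es (%x. cr (f x)) differentiable (at x)"
   unfolding iter_deriv_of_real[OF s es] by (rule differentiableI)
 qed
 have "\<exists>C. \<forall>x. sw N x * norm (iter_deriv es (%x. cr (f x)) x) <= C" if es: "set es \<subseteq> Basis" for es N
 proof -
  have "continuous_on ?K (iter_deriv es f)"
   by (intro continuous_at_imp_continuous_on ballI differentiable_imp_continuous_within d es)
  then have "continuous_on ?K (%x. sw N x * norm (iter_deriv es f x))" by (intro continuous_intros)
  from compact_imp_bounded[OF compact_continuous_image[OF this K]] obtain C where
   C: "\<And>x. x \<in> ?K ==> sw N x * norm (iter_deriv es f x) <= C" unfolding bounded_iff by force
  have "sw N x * norm (iter_deriv es (%x. cr (f x)) x) <= max C 0" for x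
   using C[of x] iter_deriv_supp[of x f es] by (cases "x \<in> ?K") (auto simp: iter_deriv_of_real[OF s es])
  then show ?thesis by blast
 qed
 with sm show ?thesis unfolding schwartz_iff sbdd_iter by auto
qed

context
 fixes \<psi> \<phi> :: "'a::euclidean_space => real"
 assumes lp: "littlewood_paley \<psi> \<phi>"
begin

lemma lp_supp: "\<phi> \<zeta> ~= 0 ==> 1 / 2 <= norm \<zeta> \<and> norm \<zeta> <= 2"
 using lp closure_subset[of "{\<xi>. \<phi> \<xi> ~= 0}"] unfolding littlewood_paley_def by blast

lemma lp_psi_supp: "\<psi> \<zeta> ~= 0 ==> norm \<zeta> <= 1"
 using lp closure_subset[of "{\<xi>. \<psi> \<xi> ~= 0}"] unfolding littlewood_paley_def by blast

lemma lp_phi_schwartz: "schwartz (%x. cr (\<phi> x))"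
 using lp test_function_schwartz by (auto simp: littlewood_paley_def)

lemma lp_psi_schwartz: "schwartz (%x. cr (\<psi> x))"
 using lp test_function_schwartz by (auto simp: littlewood_paley_def)

lemma lp_supp_powi:
 assumes "\<phi> ((1 / 2 powi j) *\<^sub>R \<xi>) ~= 0"
 shows "2 powi (j - 1) <= norm \<xi>" "norm \<xi> <= 2 powi (j + 1)"
proof -
 have p: "(0::real) < 2 powi j" by simp
 have "1 / 2 <= norm \<xi> / 2 powi j" "norm \<xi> / 2 powi j <= 2" using lp_supp[OF assms] by auto
 then show "2 powi (j - 1) <= norm \<xi>" "norm \<xi> <= 2 powi (j + 1)"
  using p by (auto simp: field_simps power_int_diff power_int_add)
qed

lemma powi_less_imp: "(2::real) powi i <= 2 powi j ==> i <= j"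
 by (metis not_le one_less_numeral_iff power_int_strict_increasing semiring_norm(76))

text \<open>Rescale by a power of two that moves \<xi> out of the support of \<psi>; then all terms outside the given range
vanish.\<close>

lemma lp_partition:
 assumes k: "2 powi (k1 - 5) <= norm \<xi>" "norm \<xi> <= 2 powi (k2 + 5)"
 shows "(\<Sum>j=k1-6..k2+6. \<phi> ((1 / 2 powi j) *\<^sub>R \<xi>)) = 1"
proof -
 define n :: nat where "n = nat (\<bar>k1\<bar> + 7)"
 have n: "int n \<ge> 7 - k1" by (simp add: n_def)
 let ?\<zeta> = "2 ^ n *\<^sub>R \<xi>"
 have "(1::real) < 2 powi (int n) * 2 powi (k1 - 5)" unfolding power_int_add[symmetric, of "2::real", simplified]
  using n power_int_strict_increasing[of 0 "int n + (k1 - 5)" "2::real"] by simp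
 also have "\<dots> <= norm ?\<zeta>" using k by (simp add: power_int_of_nat mult_left_mono)
 finally have "\<psi> ?\<zeta> = 0" using lp_psi_supp[of ?\<zeta>] by force
 then have s: "(%i. \<phi> ((1 / 2 ^ i) *\<^sub>R ?\<zeta>)) sums 1" using lp unfolding littlewood_paley_def by (metis diff_zero)
 have e: "(1 / 2 ^ i) *\<^sub>R ?\<zeta> = (1 / 2 powi (int i - int n)) *\<^sub>R \<xi>" for i
  by (simp add: power_int_diff)
 let ?I = "{nat (k1 - 6 + int n)..nat (k2 + 6 + int n)}"
 have z: "\<phi> ((1 / 2 ^ i) *\<^sub>R ?\<zeta>) = 0" if i: "i \<notin> ?I" for i
 proof (rule ccontr)
  assume "\<phi> ((1 / 2 ^ i) *\<^sub>R ?\<zeta>) ~= 0"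
  then have "2 powi (int i - int n - 1) <= norm \<xi>" "norm \<xi> <= 2 powi (int i - int n + 1)"
   unfolding e by (rule lp_supp_powi)+
  then have "int i - int n - 1 <= k2 + 5" "k1 - 5 <= int i - int n + 1"
   using k by (rule_tac powi_less_imp, linarith)+
  with i show False by auto
 qed
 have "1 = (\<Sum>i\<in>?I. \<phi> ((1 / 2 ^ i) *\<^sub>R ?\<zeta>))"
  by (rule sums_unique2[OF s sums_finite[OF finite_atLeastAtMost z]])
 also have "\<dots> = (\<Sum>j=k1-6..k2+6. \<phi> ((1 / 2 powi j) *\<^sub>R \<xi>))" unfolding e
  by (rule sum.reindex_bij_witness[where i="%j. nat (j + int n)" and j="%i. int i - int n"]) (use n in auto)
 finally show ?thesis by simp
qed

text \<open>The symbol of the block of frequency \<open>2^k\<close>.\<close>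

definition lpm :: "int => 'a => complex" where "lpm k \<xi> = cr (\<phi> ((1 / 2 powi k) *\<^sub>R \<xi>))"

end

section \<open>Lebesgue norms\<close>

lemma epowr_simps: "epowr x 1 = x" "epowr x 0 = 1" "a ~= 0 ==> epowr 0 a = 0" "a ~= 0 ==> epowr top a = top"
 by (auto simp: epowr_def less_top)

lemma epowr_ennreal: "a ~= 0 ==> 0 <= x ==> epowr (ennreal x) a = ennreal (x powr a)"
 by (simp add: epowr_def)

lemma epowr_measurable[measurable]: "f \<in> borel_measurable M ==> (%x. epowr (f x) a) \<in> borel_measurable M"
 unfolding epowr_def by (cases "a = 0") auto

lemma epowr_mono: assumes "x <= y" "0 < a" shows "epowr x a <= epowr y a"
proof (cases y)
 case (real y')
 with assms(1) obtain x' where x: "x = ennreal x'" "0 <= x'" by (cases x) (auto simp: top_unique)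
 then show ?thesis using assms real by (auto simp: epowr_ennreal intro!: ennreal_leI powr_mono2)
qed (use assms in \<open>auto simp: epowr_simps\<close>)

lemma epowr_epowr: "0 < a ==> epowr (epowr x (1 / a)) a = x" "0 < a ==> epowr (epowr x a) (1 / a) = x"
 by (cases x; auto simp: epowr_simps epowr_ennreal powr_powr)+

lemma epowr_le_cancel: "0 < a ==> epowr x a <= epowr y a ==> x <= y"
 using epowr_mono[of "epowr x a" "epowr y a" "1 / a"] by (simp add: epowr_epowr)

lemma epowr_cmult: assumes "0 < a" "0 < c" shows "epowr (ennreal c * x) a = ennreal (c powr a) * epowr x a"
proof (cases x)
 case (real r) then show ?thesis using assms by (simp add: ennreal_mult[symmetric] epowr_ennreal powr_mult)
qed (use assms in \<open>auto simp: ennreal_mult_top epowr_simps\<close>)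

lemma epowr_mult_inverse: "0 < a ==> x ~= 0 ==> x ~= top ==> epowr (y / x) a * epowr x a = epowr y a"
proof -
 assume a: "0 < a" "x ~= 0" "x ~= top"
 then obtain r where r: "x = ennreal r" "0 < r" by (cases x) (auto simp: less_le)
 have "y / x = ennreal (1 / r) * y" using r by (simp add: divide_ennreal_def inverse_ennreal mult.commute inverse_eq_divide)
 then have "epowr (y / x) a = ennreal ((1 / r) powr a) * epowr y a"
  using r a epowr_cmult[of a "1 / r" y] by simp
 moreover have "epowr x a = ennreal (r powr a)" using r a by (simp add: epowr_ennreal)
 ultimately have "epowr (y / x) a * epowr x a = (ennreal ((1 / r) powr a) * ennreal (r powr a)) * epowr y a"
  by (simp only: mult_ac)
 also have "ennreal ((1 / r) powr a) * ennreal (r powr a) = 1"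
  using r by (subst ennreal_mult[symmetric]) (auto simp: powr_mult[symmetric])
 finally show ?thesis by simp
qed

text \<open>Compare h with the threshold l; where h exceeds l, \<open>h \<le> l^(1-P) h^P\<close>.\<close>

lemma young_weak:
 assumes l: "0 < l" and P: "1 <= P"
 shows "h <= ennreal l + ennreal (l powr (1 - P)) * epowr h P"
proof (cases h)
 case (real r)
 show ?thesis
 proof (cases "r <= l")
  case True then show ?thesis using real l by (simp add: add_increasing2 ennreal_leI)
 next
  case False
  then have "r = r powr (1 - P) * r powr P" using l by (simp add: powr_add[symmetric])
  also have "\<dots> <= l powr (1 - P) * r powr P" using False l P by (intro mult_right_mono powr_mono2') auto
  finally show ?thesis using real l P by (simp add: epowr_ennreal ennreal_mult[symmetric] add_increasing ennreal_leI)
 qed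
qed (use assms in \<open>simp add: epowr_simps ennreal_mult_top\<close>)

text \<open>Integrate the threshold inequality and optimize the threshold. This avoids convexity and costs a factor
\<open>2^P\<close>.\<close>

lemma jensen_weak:
 assumes [measurable]: "h \<in> borel_measurable M" "k \<in> borel_measurable M"
  and A: "0 < A" "(\<integral>\<^sup>+x. k x \<partial>M) <= ennreal A" and P: "1 <= P"
 shows "epowr (\<integral>\<^sup>+x. h x * k x \<partial>M) P <= ennreal (2 powr P * A powr (P - 1)) * (\<integral>\<^sup>+x. epowr (h x) P * k x \<partial>M)"
proof -
 let ?J = "\<integral>\<^sup>+x. epowr (h x) P * k x \<partial>M"
 have le: "(\<integral>\<^sup>+x. h x * k x \<partial>M) <= ennreal (l * A) + ennreal (l powr (1 - P)) * ?J" if l: "0 < l" for l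
 proof -
  have "(\<integral>\<^sup>+x. h x * k x \<partial>M) <= (\<integral>\<^sup>+x. ennreal l * k x + ennreal (l powr (1 - P)) * (epowr (h x) P * k x) \<partial>M)"
   using mult_right_mono[OF young_weak[OF l P]] by (intro nn_integral_mono) (simp add: distrib_right mult.assoc)
  also have "\<dots> = ennreal l * (\<integral>\<^sup>+x. k x \<partial>M) + ennreal (l powr (1 - P)) * ?J"
   by (simp add: nn_integral_add nn_integral_cmult)
  also have "\<dots> <= ennreal l * ennreal A + ennreal (l powr (1 - P)) * ?J" by (intro add_mono mult_left_mono A) auto
  finally show ?thesis using l A by (simp add: ennreal_mult)
 qed
 show ?thesis
 proof (cases ?J)
  case top then show ?thesis using A by (simp add: ennreal_mult_top)
 next
  case (real j)
  show ?thesis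
  proof (cases "j = 0")
   case True
   have "(\<integral>\<^sup>+x. h x * k x \<partial>M) <= 0 + ennreal e" if "0 < e" and "(0::ennreal) < top" for e
    using le[of "e / A"] that A real True by simp
   then have "(\<integral>\<^sup>+x. h x * k x \<partial>M) <= 0" by (rule ennreal_le_epsilon)
   then show ?thesis using P by (simp add: epowr_simps)
  next
   case False
   with real have j: "0 < j" by simp
   let ?l = "(j / A) powr (1 / P)"
   have l: "0 < ?l" using j A by simp
   have e1: "?l * A = A powr (1 - 1 / P) * j powr (1 / P)"
    using A j by (simp add: powr_divide powr_diff)
   have "?l powr (1 - P) * j = (j / A) powr (1 / P - 1) * j" using P by (simp add: powr_powr field_simps)
   also have "\<dots> = (j / A) powr (1 / P) * A" using A j by (simp add: powr_diff)
   finally have e2: "?l powr (1 - P) * j = A powr (1 - 1 / P) * j powr (1 / P)" using e1 by simp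
   have "(\<integral>\<^sup>+x. h x * k x \<partial>M) <= ennreal (?l * A) + ennreal (?l powr (1 - P)) * ennreal j" using le[OF l] real by simp
   also have "\<dots> = ennreal (?l * A) + ennreal (?l powr (1 - P) * j)" using j by (simp add: ennreal_mult)
   also have "\<dots> = ennreal (2 * (A powr (1 - 1 / P) * j powr (1 / P)))" unfolding e1 e2
    by (subst ennreal_plus[symmetric]) auto
   finally have "epowr (\<integral>\<^sup>+x. h x * k x \<partial>M) P <= epowr (ennreal (2 * (A powr (1 - 1 / P) * j powr (1 / P)))) P"
    using P by (intro epowr_mono) auto
   also have "\<dots> = ennreal (2 powr P * A powr (P - 1) * j)"
    using P j A by (simp add: epowr_ennreal powr_mult powr_powr right_diff_distrib left_diff_distrib mult.assoc)
   also have "\<dots> = ennreal (2 powr P * A powr (P - 1)) * ?J" using real j by (simp add: ennreal_mult)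
   finally show ?thesis .
  qed
 qed
qed

lemma esssup_greater_iff:
 assumes [measurable]: "f \<in> borel_measurable M"
 shows "c < esssup M f \<longleftrightarrow> emeasure M {x \<in> space M. c < (f x :: ennreal)} ~= 0"
proof -
 have "esssup M f <= c \<longleftrightarrow> (AE x in M. f x <= c)"
  using esssup_AE[of f M] esssup_I[of f M c] by (auto elim!: eventually_mono)
 also have "\<dots> \<longleftrightarrow> emeasure M {x \<in> space M. c < f x} = 0"
  by (subst AE_iff_measurable[where N="{x \<in> space M. c < f x}"]) auto
 finally show ?thesis by (simp add: not_le[symmetric])
qed

lemma Lp_norm_pow:
 assumes "1 <= p" "p ~= top"
 shows "epowr (Lp_norm p M f) (enn2real p) = (\<integral>\<^sup>+x. epowr (f x) (enn2real p) \<partial>M)"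
proof -
 have "1 <= enn2real p" using assms by (metis enn2real_1 enn2real_mono less_top)
 then show ?thesis using assms by (simp add: Lp_norm_def epowr_epowr)
qed

lemma enn2real_ge_1: "1 <= p ==> p ~= top ==> 1 <= enn2real p"
 by (metis enn2real_1 enn2real_mono less_top)

lemma Lp_norm_1: "Lp_norm 1 M f = (\<integral>\<^sup>+x. f x \<partial>M)"
 by (simp add: Lp_norm_def epowr_simps)

lemma Lp_norm_leI:
 assumes "1 <= p" "p ~= top" "(\<integral>\<^sup>+x. epowr (f x) (enn2real p) \<partial>M) <= epowr c (enn2real p)"
 shows "Lp_norm p M f <= c"
 by (rule epowr_le_cancel[of "enn2real p"]) (use assms enn2real_ge_1[of p] in \<open>auto simp: Lp_norm_pow\<close>)

lemma Lp_norm_mono_AE: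
 assumes "f \<in> borel_measurable M" "AE x in M. f x <= g x" "1 <= p"
 shows "Lp_norm p M f <= Lp_norm p M g"
proof (cases "p = top")
 case True
 have "esssup M f <= esssup M g"
 proof (cases "g \<in> borel_measurable M")
  case True
  have "AE x in M. f x <= esssup M g" using esssup_AE[of g M] assms(2) by eventually_elim auto
  then show ?thesis using assms(1) by (intro esssup_I)
 qed (simp add: esssup_non_measurable)
 then show ?thesis using True by (simp add: Lp_norm_def)
next
 case False
 then show ?thesis using assms enn2real_ge_1[of p]
  by (intro Lp_norm_leI) (auto simp: Lp_norm_pow intro!: nn_integral_mono_AE epowr_mono elim!: eventually_mono)
qed

lemma Lp_norm_measurable:
 assumes "sigma_finite_measure M" and [measurable]: "case_prod V \<in> borel_measurable (M \<Otimes>\<^sub>M N)"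
 shows "(%y. Lp_norm p M (%x. V x y)) \<in> borel_measurable N"
proof -
 interpret sigma_finite_measure M by fact
 have V': "(%(y, x). V x y) \<in> borel_measurable (N \<Otimes>\<^sub>M M)"
  using measurable_pair_swap[of "case_prod V" M N borel] assms(2) by (simp add: case_prod_beta')
 show ?thesis
 proof (cases "p = top")
  case True
  have "{y \<in> space N. c < esssup M (%x. V x y)} \<in> sets N" for c
  proof -
   have "{y \<in> space N. c < esssup M (%x. V x y)} = {y \<in> space N. emeasure M {x \<in> space M. c < V x y} ~= 0}"
    by (intro Collect_cong conj_cong refl esssup_greater_iff) measurable
   also have "\<dots> \<in> sets N"
   proof -
    have Q: "{z \<in> space (N \<Otimes>\<^sub>M M). c < (%(y, x). V x y) z} \<in> sets (N \<Otimes>\<^sub>M M)" using V' by measurable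
    have "(%y. emeasure M (Pair y -` {z \<in> space (N \<Otimes>\<^sub>M M). c < (%(y, x). V x y) z})) \<in> borel_measurable N"
     by (rule measurable_emeasure_Pair[OF Q])
    moreover have "Pair y -` {z \<in> space (N \<Otimes>\<^sub>M M). c < (%(y, x). V x y) z} = {x \<in> space M. c < V x y}" if "y \<in> space N" for y
     using that by (auto simp: space_pair_measure)
    ultimately have "(%y. emeasure M {x \<in> space M. c < V x y}) \<in> borel_measurable N"
     by (subst measurable_cong[where g="%y. emeasure M (Pair y -` {z \<in> space (N \<Otimes>\<^sub>M M). c < (%(y, x). V x y) z})"]) auto
    then show ?thesis by measurable
   qed
   finally show ?thesis .
  qed
  then have "(%y. esssup M (%x. V x y)) \<in> borel_measurable N" by (rule borel_measurableI_greater)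
  then show ?thesis using True by (simp add: Lp_norm_def)
 next
  case False
  have "(%(y, x). epowr (V x y) (enn2real p)) \<in> borel_measurable (N \<Otimes>\<^sub>M M)" using V' by (simp add: case_prod_beta')
  from borel_measurable_nn_integral[OF this] show ?thesis
   using False by (simp add: Lp_norm_def epowr_measurable)
 qed
qed

text \<open>Jensen's inequality for the measure \<open>k x v dv\<close>, then Fubini. For \<open>p = 1\<close> the estimate is
Fubini's theorem and involves the column sums alone.\<close>

lemma schur_test:
 assumes M: "sigma_finite_measure M" and N: "sigma_finite_measure N"
  and k[measurable]: "case_prod k \<in> borel_measurable (M \<Otimes>\<^sub>M N)" and h[measurable]: "h \<in> borel_measurable N"
  and A: "0 < A" "p ~= 1 ==> (\<And>x. x \<in> space M ==> (\<integral>\<^sup>+v. k x v \<partial>N) <= ennreal A)"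
  and B: "0 < B" "\<And>v. v \<in> space N ==> (\<integral>\<^sup>+x. k x v \<partial>M) <= ennreal B" and p: "1 <= p"
 shows "Lp_norm p M (%x. \<integral>\<^sup>+v. h v * k x v \<partial>N)
   <= ennreal (2 * A powr (1 - enn2real (1 / p)) * B powr (enn2real (1 / p))) * Lp_norm p N h"
proof -
 interpret N: sigma_finite_measure N by fact
 interpret M: sigma_finite_measure M by fact
 interpret pair_sigma_finite M N ..
 have Um[measurable]: "(%x. \<integral>\<^sup>+v. h v * k x v \<partial>N) \<in> borel_measurable M" by measurable
 consider "p = top" | "p = 1" | "p ~= 1" "p ~= top" by blast
 then show ?thesis
 proof cases
  case 1
  have "(\<integral>\<^sup>+v. h v * k x v \<partial>N) <= ennreal (2 * A) * esssup N h" if x: "x \<in> space M" for x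
  proof -
   have [measurable]: "k x \<in> borel_measurable N" using x by measurable
   have "(\<integral>\<^sup>+v. h v * k x v \<partial>N) <= (\<integral>\<^sup>+v. esssup N h * k x v \<partial>N)"
    by (rule nn_integral_mono_AE, use esssup_AE[of h N] in eventually_elim, rule mult_right_mono) auto
   also have "\<dots> = esssup N h * (\<integral>\<^sup>+v. k x v \<partial>N)" by (rule nn_integral_cmult) simp
   also have "\<dots> <= esssup N h * ennreal (2 * A)"
    using A(2)[OF _ x] 1 A(1) by (intro mult_left_mono) (auto intro: order_trans ennreal_leI)
   finally show ?thesis by (simp add: mult.commute)
  qed
  then have "esssup M (%x. \<integral>\<^sup>+v. h v * k x v \<partial>N) <= ennreal (2 * A) * esssup N h"
   by (intro esssup_I AE_I2 Um)
  then show ?thesis using 1 A B by (simp add: Lp_norm_def divide_ennreal_def)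
 next
  case 2
  have "(\<integral>\<^sup>+x. \<integral>\<^sup>+v. h v * k x v \<partial>N \<partial>M) = (\<integral>\<^sup>+v. \<integral>\<^sup>+x. h v * k x v \<partial>M \<partial>N)"
   by (rule Fubini'[symmetric]) measurable
  also have "\<dots> = (\<integral>\<^sup>+v. h v * (\<integral>\<^sup>+x. k x v \<partial>M) \<partial>N)"
   by (intro nn_integral_cong nn_integral_cmult) measurable
  also have "\<dots> <= (\<integral>\<^sup>+v. h v * ennreal (2 * B) \<partial>N)"
  proof (intro nn_integral_mono mult_left_mono)
   fix v assume "v \<in> space N"
   from B(2)[OF this] show "(\<integral>\<^sup>+x. k x v \<partial>M) <= ennreal (2 * B)"
    using B(1) by (rule_tac order_trans[OF _ ennreal_leI[of B "2 * B"]]) auto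
  qed simp
  also have "\<dots> = ennreal (2 * B) * (\<integral>\<^sup>+v. h v \<partial>N)" by (simp add: nn_integral_multc mult.commute)
  finally show ?thesis using 2 A B by (simp add: Lp_norm_1 divide_ennreal_def)
 next
  case 3
  define P where "P = enn2real p"
  have P: "1 <= P" using enn2real_ge_1[OF p 3(2)] by (simp add: P_def)
  have pP: "p = ennreal P" using 3 by (simp add: P_def less_top)
  have inv: "enn2real (1 / p) = 1 / P" using P by (simp add: pP divide_ennreal_def inverse_ennreal inverse_eq_divide)
  have pt: "epowr (\<integral>\<^sup>+v. h v * k x v \<partial>N) P <= ennreal (2 powr P * A powr (P - 1)) * (\<integral>\<^sup>+v. epowr (h v) P * k x v \<partial>N)" if x: "x \<in> space M" for x
  proof -
   have [measurable]: "k x \<in> borel_measurable N" using x by measurable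
   show ?thesis by (rule jensen_weak) (use A(1) A(2)[OF 3(1) x] P in auto)
  qed
  have "(\<integral>\<^sup>+x. epowr (\<integral>\<^sup>+v. h v * k x v \<partial>N) P \<partial>M) <= (\<integral>\<^sup>+x. ennreal (2 powr P * A powr (P - 1)) * (\<integral>\<^sup>+v. epowr (h v) P * k x v \<partial>N) \<partial>M)"
   by (intro nn_integral_mono pt)
  also have "\<dots> = ennreal (2 powr P * A powr (P - 1)) * (\<integral>\<^sup>+x. \<integral>\<^sup>+v. epowr (h v) P * k x v \<partial>N \<partial>M)"
   by (rule nn_integral_cmult) measurable
  also have "(\<integral>\<^sup>+x. \<integral>\<^sup>+v. epowr (h v) P * k x v \<partial>N \<partial>M) = (\<integral>\<^sup>+v. \<integral>\<^sup>+x. epowr (h v) P * k x v \<partial>M \<partial>N)"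
   by (rule Fubini'[symmetric]) measurable
  also have "\<dots> = (\<integral>\<^sup>+v. epowr (h v) P * (\<integral>\<^sup>+x. k x v \<partial>M) \<partial>N)"
   by (intro nn_integral_cong nn_integral_cmult) measurable
  also have "\<dots> <= (\<integral>\<^sup>+v. epowr (h v) P * ennreal B \<partial>N)"
   using B by (intro nn_integral_mono mult_left_mono) auto
  also have "\<dots> = ennreal B * epowr (Lp_norm p N h) P"
   using Lp_norm_pow[OF p 3(2), of N h] by (subst nn_integral_multc) (auto simp: P_def mult.commute)
  finally have "(\<integral>\<^sup>+x. epowr (\<integral>\<^sup>+v. h v * k x v \<partial>N) P \<partial>M) <= ennreal (2 powr P * A powr (P - 1)) * (ennreal B * epowr (Lp_norm p N h) P)"
   by (simp add: mult_left_mono)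
  also have "\<dots> = ennreal (2 powr P * A powr (P - 1) * B) * epowr (Lp_norm p N h) P"
   using B by (simp add: ennreal_mult mult.assoc)
  also have "2 powr P * A powr (P - 1) * B = (2 * A powr (1 - 1 / P) * B powr (1 / P)) powr P"
   using A B P by (simp add: powr_mult powr_powr left_diff_distrib)
  also have "ennreal \<dots> * epowr (Lp_norm p N h) P = epowr (ennreal (2 * A powr (1 - 1 / P) * B powr (1 / P)) * Lp_norm p N h) P"
   using A B P by (subst epowr_cmult) auto
  finally show ?thesis unfolding inv by (intro Lp_norm_leI p 3) (simp add: P_def)
 qed
qed

text \<open>Jensen's inequality for the measure \<open>n y dy\<close>, where n is the norm of the slice at y.\<close>

lemma minkowski_weak:
 assumes M: "sigma_finite_measure M" and N: "sigma_finite_measure N"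
  and V[measurable]: "case_prod V \<in> borel_measurable (M \<Otimes>\<^sub>M N)" and p: "1 <= p"
 shows "Lp_norm p M (%x. \<integral>\<^sup>+y. V x y \<partial>N) <= 2 * (\<integral>\<^sup>+y. Lp_norm p M (%x. V x y) \<partial>N)"
proof -
 interpret N: sigma_finite_measure N by fact
 interpret M: sigma_finite_measure M by fact
 interpret pair_sigma_finite M N ..
 have Um[measurable]: "(%x. \<integral>\<^sup>+y. V x y \<partial>N) \<in> borel_measurable M" by measurable
 define n where "n y = Lp_norm p M (%x. V x y)" for y
 have n[measurable]: "n \<in> borel_measurable N" unfolding n_def[abs_def] by (rule Lp_norm_measurable[OF M V])
 have goal: ?thesis if "Lp_norm p M (%x. \<integral>\<^sup>+y. V x y \<partial>N) <= 2 * (\<integral>\<^sup>+y. n y \<partial>N)" using that by (simp add: n_def)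
 show ?thesis
 proof (rule goal, cases "p = top")
  case True
  have "AE y in N. AE x in M. V x y <= n y"
   unfolding n_def Lp_norm_def using True by (simp add: esssup_AE)
  then have "AE x in M. AE y in N. V x y <= n y" by (subst AE_commute) auto
  then have "AE x in M. (\<integral>\<^sup>+y. V x y \<partial>N) <= (\<integral>\<^sup>+y. n y \<partial>N)" by eventually_elim (rule nn_integral_mono_AE)
  then have "esssup M (%x. \<integral>\<^sup>+y. V x y \<partial>N) <= (\<integral>\<^sup>+y. n y \<partial>N)" by (intro esssup_I Um)
  also have "\<dots> <= 2 * (\<integral>\<^sup>+y. n y \<partial>N)" using mult_right_mono[of 1 "2::ennreal" "\<integral>\<^sup>+y. n y \<partial>N"] by simp
  finally show "Lp_norm p M (%x. \<integral>\<^sup>+y. V x y \<partial>N) <= 2 * (\<integral>\<^sup>+y. n y \<partial>N)" using True by (simp add: Lp_norm_def)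
 next
  case False
  define P where "P = enn2real p"
  have P: "1 <= P" using enn2real_ge_1[OF p False] by (simp add: P_def)
  have nP: "epowr (n y) P = (\<integral>\<^sup>+x. epowr (V x y) P \<partial>M)" for y
   unfolding n_def P_def by (rule Lp_norm_pow[OF p False])
  show "Lp_norm p M (%x. \<integral>\<^sup>+y. V x y \<partial>N) <= 2 * (\<integral>\<^sup>+y. n y \<partial>N)"
  proof (cases "(\<integral>\<^sup>+y. n y \<partial>N)")
   case top then show ?thesis by (simp add: ennreal_mult_top)
  next
   case (real A)
   have fin: "AE y in N. n y ~= top" using nn_integral_PInf_AE[OF n] real by simp
   have "AE y in N. AE x in M. n y = 0 --> V x y = 0"
   proof (rule AE_I2)
    fix y assume y: "y \<in> space N"
    then have [measurable]: "(%x. V x y) \<in> borel_measurable M" by measurable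
    show "AE x in M. n y = 0 --> V x y = 0"
    proof (cases "n y = 0")
     case True
     then have "(\<integral>\<^sup>+x. epowr (V x y) P \<partial>M) = 0" using nP[of y] P by (simp add: epowr_simps)
     then have "AE x in M. epowr (V x y) P = 0" by (subst (asm) nn_integral_0_iff_AE) auto
     then show ?thesis
     proof eventually_elim
      case (elim x)
      then show ?case using epowr_epowr(2)[of P "V x y"] P by (simp add: epowr_simps)
     qed
    qed simp
   qed
   then have z: "AE x in M. AE y in N. n y = 0 --> V x y = 0" by (subst AE_commute) auto
   show ?thesis
   proof (cases "A = 0")
    case True
    then have "(\<integral>\<^sup>+y. n y \<partial>N) = 0" using real by simp
    then have n0: "AE y in N. n y = 0" by (subst (asm) nn_integral_0_iff_AE) auto
    have "AE x in M. (\<integral>\<^sup>+y. V x y \<partial>N) = 0"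
     using z
    proof eventually_elim
     case (elim x)
     from AE_mp[OF n0 elim] have "AE y in N. V x y = 0" .
     then have "(\<integral>\<^sup>+y. V x y \<partial>N) = (\<integral>\<^sup>+y. 0 \<partial>N)" by (rule nn_integral_cong_AE)
     then show ?case by simp
    qed
    then have "(\<integral>\<^sup>+x. epowr (\<integral>\<^sup>+y. V x y \<partial>N) P \<partial>M) = 0"
     using P by (subst nn_integral_0_iff_AE) (auto elim!: eventually_mono simp: epowr_simps)
    then show ?thesis by (intro Lp_norm_leI p False) (simp add: P_def)
   next
    case A: False
    have AP: "0 < A" using A real by simp
    have a: "AE x in M. (\<integral>\<^sup>+y. V x y \<partial>N) <= (\<integral>\<^sup>+y. (V x y / n y) * n y \<partial>N)" using z
    proof eventually_elim
     case (elim x)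
     show ?case
     proof (rule nn_integral_mono_AE, use elim fin in eventually_elim)
      case (elim y)
      show ?case
      proof (cases "n y = 0")
       case False
       obtain r where r: "n y = ennreal r" "0 < r" using False elim by (cases "n y") (auto simp: less_le)
       then have "inverse (n y) * n y = 1" by (simp add: inverse_ennreal ennreal_mult[symmetric])
       then show ?thesis by (simp add: divide_ennreal_def mult.assoc)
      qed (use elim in simp)
     qed
    qed
    have b: "epowr (\<integral>\<^sup>+y. (V x y / n y) * n y \<partial>N) P <= ennreal (2 powr P * A powr (P - 1)) * (\<integral>\<^sup>+y. epowr (V x y / n y) P * n y \<partial>N)"
     if "x \<in> space M" for x
    proof -
     have [measurable]: "V x \<in> borel_measurable N" using that by measurable
     show ?thesis by (rule jensen_weak) (use AP real P in auto)
    qed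
    from a AE_space have "AE x in M. epowr (\<integral>\<^sup>+y. V x y \<partial>N) P <= ennreal (2 powr P * A powr (P - 1)) * (\<integral>\<^sup>+y. epowr (V x y / n y) P * n y \<partial>N)"
    proof eventually_elim
     case (elim x)
     show ?case by (rule order_trans[OF epowr_mono[OF elim(1)] b[OF elim(2)]]) (use P in simp)
    qed
    then have "(\<integral>\<^sup>+x. epowr (\<integral>\<^sup>+y. V x y \<partial>N) P \<partial>M) <= (\<integral>\<^sup>+x. ennreal (2 powr P * A powr (P - 1)) * (\<integral>\<^sup>+y. epowr (V x y / n y) P * n y \<partial>N) \<partial>M)"
     by (rule nn_integral_mono_AE)
    also have "\<dots> = ennreal (2 powr P * A powr (P - 1)) * (\<integral>\<^sup>+x. \<integral>\<^sup>+y. epowr (V x y / n y) P * n y \<partial>N \<partial>M)"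
     by (rule nn_integral_cmult) measurable
    also have "(\<integral>\<^sup>+x. \<integral>\<^sup>+y. epowr (V x y / n y) P * n y \<partial>N \<partial>M) = (\<integral>\<^sup>+y. \<integral>\<^sup>+x. epowr (V x y / n y) P * n y \<partial>M \<partial>N)"
     by (rule Fubini'[symmetric]) measurable
    also have "\<dots> <= (\<integral>\<^sup>+y. n y \<partial>N)"
    proof (rule nn_integral_mono_AE, use fin AE_space in eventually_elim)
     case (elim y)
     then have [measurable]: "(%x. V x y) \<in> borel_measurable M" by measurable
     have e: "(\<integral>\<^sup>+x. epowr (V x y / n y) P * n y \<partial>M) = (\<integral>\<^sup>+x. epowr (V x y / n y) P \<partial>M) * n y"
      by (rule nn_integral_multc) measurable
     show ?case
     proof (cases "n y = 0")
      case False
      have "(\<integral>\<^sup>+x. epowr (V x y / n y) P \<partial>M) * epowr (n y) P = (\<integral>\<^sup>+x. epowr (V x y / n y) P * epowr (n y) P \<partial>M)"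
       by (rule nn_integral_multc[symmetric]) measurable
      also have "\<dots> = epowr (n y) P" using epowr_mult_inverse[of P "n y"] False elim P by (simp add: nP)
      finally have eq: "(\<integral>\<^sup>+x. epowr (V x y / n y) P \<partial>M) * epowr (n y) P = 1 * epowr (n y) P" by simp
      obtain r where r: "n y = ennreal r" "0 < r" using False elim by (cases "n y") (auto simp: less_le)
      have "epowr (n y) P ~= 0" "epowr (n y) P ~= top" using r P by (auto simp: epowr_ennreal)
      with eq have "(\<integral>\<^sup>+x. epowr (V x y / n y) P \<partial>M) = 1" by (metis ennreal_mult_cancel_left mult.commute)
      then show ?thesis unfolding e by simp
     qed (simp add: e)
    qed
    finally have "(\<integral>\<^sup>+x. epowr (\<integral>\<^sup>+y. V x y \<partial>N) P \<partial>M) <= ennreal (2 powr P * A powr (P - 1)) * ennreal A"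
     using real by (simp add: mult_left_mono)
    also have "\<dots> = ennreal ((2 * A) powr P)" using AP by (simp add: ennreal_mult[symmetric] powr_mult powr_diff)
    also have "\<dots> = epowr (2 * (\<integral>\<^sup>+y. n y \<partial>N)) P"
     using real P AP epowr_ennreal[of P "2 * A"] by (simp add: ennreal_mult)
    finally show ?thesis by (intro Lp_norm_leI p False) (simp add: P_def)
   qed
  qed
 qed
qed

lemma Lp_norm_unit: "1 <= p ==> Lp_norm p (count_space (UNIV :: unit set)) f = f ()"
proof (cases "p = top")
 case True
 have "esssup (count_space (UNIV :: unit set)) f = f ()"
 proof (rule antisym)
  show "esssup (count_space (UNIV :: unit set)) f <= f ()" by (intro esssup_I) (auto simp: AE_count_space)
  show "f () <= esssup (count_space (UNIV :: unit set)) f"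
   using esssup_AE[of f "count_space UNIV"] by (auto simp: AE_count_space)
 qed
 then show ?thesis using True by (simp add: Lp_norm_def)
next
 assume p: "1 <= p"
 case False
 then have "0 < enn2real p" using enn2real_ge_1[OF p] by simp
 then show ?thesis using False
  by (simp add: Lp_norm_def nn_integral_count_space_finite UNIV_unit epowr_epowr)
qed

text \<open>The Schur test with a one-point target space.\<close>

lemma holder_weak:
 assumes M: "sigma_finite_measure M" and [measurable]: "h \<in> borel_measurable M" "w \<in> borel_measurable M"
  and A: "0 < A" "(\<integral>\<^sup>+v. w v \<partial>M) <= ennreal A" and B: "0 < B" "\<And>v. v \<in> space M ==> w v <= ennreal B" and p: "1 <= p"
 shows "(\<integral>\<^sup>+v. h v * w v \<partial>M) <= ennreal (2 * A powr (1 - enn2real (1 / p)) * B powr enn2real (1 / p)) * Lp_norm p M h"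
proof -
 have "Lp_norm p (count_space (UNIV::unit set)) (%x. \<integral>\<^sup>+v. h v * w v \<partial>M)
   <= ennreal (2 * A powr (1 - enn2real (1 / p)) * B powr enn2real (1 / p)) * Lp_norm p M h"
  by (rule schur_test[where k="%_. w"])
    (use A B p M in \<open>auto simp: nn_integral_count_space_finite UNIV_unit sigma_finite_measure_count_space\<close>)
 then show ?thesis by (simp add: Lp_norm_unit[OF p])
qed

text \<open>The norm of \<open>L^1\<^sub>x L^p\<^sub>v\<close>.\<close>

definition mix :: "ennreal => ('a::euclidean_space \<times> 'a => complex) => ennreal" where
 "mix p u = (NN x. Lp_norm p lborel (%v. ennreal (norm (u (x, v)))))"

lemma mixed_norm_mix: "mixed_norm_distr 1 p T = (INF u \<in> {u. represents u T}. mix p u)"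
 by (simp add: mixed_norm_distr_def mix_def Lp_norm_1)

lemma lborel_prod_measurable[measurable_dest]:
 "(u :: 'a::euclidean_space \<times> 'b::euclidean_space => 'c::topological_space) \<in> bmeas ==> u \<in> borel_measurable (lborel \<Otimes>\<^sub>M lborel)"
 by (simp add: lborel_prod)

lemma sigma_finite_lborel': "sigma_finite_measure lborel"
 by (rule lborel.sigma_finite_measure_axioms)

lemma mix_pair:
 fixes u :: "'a::euclidean_space \<times> 'a => complex" and w :: "'a \<times> 'a => ennreal"
 assumes u[measurable]: "u \<in> bmeas" and w[measurable]: "w \<in> bmeas"
  and A: "0 < A" "\<And>x. (NN v. w (x, v)) <= ennreal A" and B: "0 < B" "\<And>z. w z <= ennreal B" and p: "1 <= p"
 shows "(NN z. ennreal (norm (u z)) * w z) <= ennreal (2 * A powr (1 - enn2real (1 / p)) * B powr enn2real (1 / p)) * mix p u"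
proof -
 let ?C = "ennreal (2 * A powr (1 - enn2real (1 / p)) * B powr enn2real (1 / p))"
 have "(NN z. ennreal (norm (u z)) * w z) = (NN x. NN v. ennreal (norm (u (x, v))) * w (x, v))"
  unfolding lborel_prod[symmetric] by (rule lborel.nn_integral_fst[symmetric]) measurable
 also have "\<dots> <= (NN x. ?C * Lp_norm p lborel (%v. ennreal (norm (u (x, v)))))"
  by (intro nn_integral_mono holder_weak) (use A B p sigma_finite_lborel' in auto)
 also have "\<dots> = ?C * mix p u" unfolding mix_def
  by (intro nn_integral_cmult Lp_norm_measurable[where V="%v x. ennreal (norm (u (x, v)))"] sigma_finite_lborel') measurable
 finally show ?thesis .
qed

text \<open>If the infimum is positive, it is nearly attained. If it is zero, then T pairs to zero with every Schwartz function by
Hoelder's inequality, so the zero function represents it.\<close>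

lemma mixed_norm_attained:
 fixes T :: "('a::euclidean_space \<times> 'a) distr"
 assumes fin: "mixed_norm_distr 1 p T < top" and p: "1 <= p"
 shows "\<exists>u. represents u T \<and> mix p u <= 2 * mixed_norm_distr 1 p T"
proof (cases "mixed_norm_distr 1 p T = 0")
 case False
 let ?N = "mixed_norm_distr 1 p T"
 have "?N < 2 * ?N" using False fin by (cases ?N) (auto simp: ennreal_mult[symmetric] ennreal_less_iff less_le simp flip: ennreal_numeral)
 then obtain u where "represents u T" "mix p u < 2 * ?N" unfolding mixed_norm_mix INF_less_iff by auto
 then show ?thesis by (auto intro: less_imp_le)
next
 case True
 have "T \<eta> = 0" if \<eta>: "schwartz \<eta>" for \<eta>
 proof -
  let ?N = "swN TYPE('a)"
  obtain C where C: "0 <= C" "\<And>z. sw ?N z * norm (\<eta> z) <= C" using schwartz_bound[OF \<eta>] by blast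
  have pt: "norm (\<eta> (x, v)) <= C * (1 / (1 + norm v) ^ ?N)" for x v :: 'a
  proof -
   have "norm v <= norm (x, v)" by (rule norm_snd_le)
   then have "sw ?N v <= sw ?N (x, v)" by (intro power_mono) auto
   then have "sw ?N v * norm (\<eta> (x, v)) <= C" using C(2)[of "(x, v)"] by (meson mult_right_mono norm_ge_zero order_trans)
   then show ?thesis by (simp add: field_simps add_pos_nonneg)
  qed
  have pt2: "norm (\<eta> z) <= C" for z
  proof -
   have "1 * norm (\<eta> z) <= sw ?N z * norm (\<eta> z)" by (intro mult_right_mono one_le_power) auto
   with C(2)[of z] show ?thesis by simp
  qed
  define K where "K = 2 * (C * swc TYPE('a) + 1) powr (1 - enn2real (1 / p)) * (C + 1) powr enn2real (1 / p)"
  have K: "ennreal (norm (T \<eta>)) <= ennreal K * mix p u" if u: "represents u T" for u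
  proof -
   have [measurable]: "u \<in> bmeas" "\<eta> \<in> bmeas" using u schwartz_measurable[OF \<eta>] by (auto simp: represents_def)
   have i: "integrable lborel (%z. u z * \<eta> z)" "T \<eta> = (LINT z|lborel. u z * \<eta> z)" using u \<eta> by (auto simp: represents_def)
   have "ennreal (norm (T \<eta>)) <= (NN z. ennreal (norm (u z * \<eta> z)))"
    unfolding i(2) by (rule integral_norm_bound_ennreal[OF i(1)])
   also have "\<dots> = (NN z. ennreal (norm (u z)) * ennreal (norm (\<eta> z)))"
    by (simp add: norm_mult ennreal_mult)
   also have "\<dots> <= ennreal K * mix p u" unfolding K_def
   proof (rule mix_pair)
    show "0 < C * swc TYPE('a) + 1" using C(1) swc_nonneg[where 'a='a] by (simp add: add_nonneg_pos)
    fix x :: 'a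
    have "(NN v. ennreal (norm (\<eta> (x, v)))) <= (NN (v::'a). ennreal (C * (1 / (1 + norm v) ^ ?N)))"
     by (intro nn_integral_mono ennreal_leI pt)
    also have "\<dots> = ennreal (C * swc TYPE('a))" unfolding swc_def integral_mult_right_zero[symmetric]
     using C(1) by (intro nn_integral_eq_integral integrable_mult_right integrable_weight) auto
    also have "\<dots> <= ennreal (C * swc TYPE('a) + 1)" by (intro ennreal_leI) simp
    finally show "(NN v. ennreal (norm (\<eta> (x, v)))) <= ennreal (C * swc TYPE('a) + 1)" .
   next
    show "ennreal (norm (\<eta> z)) <= ennreal (C + 1)" for z using pt2[of z] by (intro ennreal_leI) simp
   qed (use C(1) p in auto)
   finally show ?thesis .
  qed
  have "ennreal (norm (T \<eta>)) <= 0 + ennreal e" if e: "0 < e" for e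
  proof -
   have K0: "0 <= K" by (simp add: K_def)
   have "mixed_norm_distr 1 p T < ennreal (e / (K + 1))" using True e K0 by (simp add: add_nonneg_pos)
   then obtain u where u: "represents u T" "mix p u < ennreal (e / (K + 1))" unfolding mixed_norm_mix INF_less_iff by auto
   have "ennreal (norm (T \<eta>)) <= ennreal K * ennreal (e / (K + 1))"
    using K[OF u(1)] u(2) by (meson less_imp_le mult_left_mono order_trans zero_le)
   also have "\<dots> = ennreal (K * (e / (K + 1)))" using K0 e by (subst ennreal_mult[symmetric]) auto
   also have "\<dots> <= ennreal e" using K0 e by (intro ennreal_leI) (simp add: field_simps)
   finally show ?thesis by simp
  qed
  then have "ennreal (norm (T \<eta>)) <= 0" by (rule ennreal_le_epsilon)
  then show "T \<eta> = 0" by simp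
 qed
 then have "represents (%z. 0) T" by (simp add: represents_def)
 moreover have "mix p (%z::'a \<times> 'a. 0) = 0"
  using Lp_norm_1[of "lborel :: 'a measure" "%_. 0"] mix_pair[of "%z. 0" "%z. 0" 1 1 p] p
 proof -
  have "Lp_norm p (lborel :: 'a measure) (%v. 0) = 0"
  proof (cases "p = top")
   case True
   have "esssup (lborel :: 'a measure) (%v. 0 :: ennreal) <= 0" by (intro esssup_I) auto
   then show ?thesis using True by (simp add: Lp_norm_def)
  next
   case False
   then have "Lp_norm p (lborel :: 'a measure) (%v. 0) <= 0"
    using enn2real_ge_1[OF p False] by (intro Lp_norm_leI p) (auto simp: epowr_simps)
   then show ?thesis by simp
  qed
  then show ?thesis by (simp add: mix_def)
 qed
 ultimately show ?thesis by auto
qed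

text \<open>Minkowski's inequality for the counting measure on I. The constant does not depend on the number of terms.\<close>

lemma Lp_norm_sum_weak:
 assumes M: "sigma_finite_measure M" and I: "finite I" and V: "\<And>i. i \<in> I ==> V i \<in> borel_measurable M" and p: "1 <= p"
 shows "Lp_norm p M (%x. \<Sum>i\<in>I. V i x) <= 2 * (\<Sum>i\<in>I. Lp_norm p M (V i))"
proof -
 interpret M: sigma_finite_measure M by fact
 have m: "(%(i, x). V i x) \<in> borel_measurable (count_space I \<Otimes>\<^sub>M M)"
  by (rule measurable_pair_measure_countable1) (use I V in \<open>auto intro: countable_finite\<close>)
 have "(%(x, i). V i x) \<in> borel_measurable (M \<Otimes>\<^sub>M count_space I)"
  using measurable_pair_swap[OF m] by (simp add: case_prod_beta')
 from minkowski_weak[OF M sigma_finite_measure_count_space_finite[OF I] this p] show ?thesis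
  using I by (simp add: nn_integral_count_space_finite)
qed

lemma Lp_norm_ge_point:
 assumes q: "1 <= q" shows "F i <= Lp_norm q (count_space (UNIV :: 'i set)) F"
proof (cases "q = top")
 case True
 have "F i <= esssup (count_space UNIV) F"
  using esssup_AE[of F "count_space UNIV"] by (auto simp: AE_count_space)
 then show ?thesis using True by (simp add: Lp_norm_def)
next
 case False
 have P: "0 < enn2real q" using enn2real_ge_1[OF q False] by simp
 have "epowr (F i) (enn2real q) <= (\<integral>\<^sup>+i. epowr (F i) (enn2real q) \<partial>count_space UNIV)" by (rule nn_integral_ge_point) simp
 then have "epowr (F i) (enn2real q) <= epowr (Lp_norm q (count_space UNIV) F) (enn2real q)"
  using Lp_norm_pow[OF q False, of "count_space UNIV" F] by simp
 then show ?thesis by (rule epowr_le_cancel[OF P])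
qed

lemma Lp_norm_count_finite:
 assumes "Lp_norm q (count_space (UNIV :: 'i set)) F < top" "1 <= q" shows "F i < top"
 using Lp_norm_ge_point[OF assms(2), of F i] assms(1) by (rule le_less_trans)

section \<open>Localized representatives\<close>

text \<open>Equals 1 on frequencies between \<open>2^(k1 - 5)\<close> and \<open>2^(k2 + 5)\<close>, by
\<open>lp_partition\<close>; the margin absorbs the perturbation by the cutoff.\<close>

definition lpsum :: "('a::euclidean_space => real) => int => int => 'a => complex" where
 "lpsum \<phi> k1 k2 \<xi> = (\<Sum>j=k1-6..k2+6. lpm \<phi> j \<xi>)"

definition PP :: "('a::euclidean_space => real) => int => int => int => 'a \<times> 'a => complex" where
 "PP \<phi> k l1 l2 z = lpsum \<phi> k k (fst z) * lpsum \<phi> l1 l2 (snd z)"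

definition near :: "int => int => int => (int \<times> int) set" where
 "near k l1 l2 = {k-6..k+6} \<times> {l1-6..l2+6}"

text \<open>\<open>H k l1 l2\<close> is a function representing the part of h with frequencies near \<open>2^k\<close> in x and
between \<open>2^l1\<close> and \<open>2^l2\<close> in v. The range of velocity frequencies is kept general, because
the transport equation is integrated over an interval of r, for which one representative is needed.\<close>

definition locrep :: "('a::euclidean_space => real) => ennreal => ('a \<times> 'a) distr => (int => int => int => 'a \<times> 'a => complex) => bool" where
 "locrep \<phi> p h H \<longleftrightarrow> (\<forall>k l1 l2. H k l1 l2 \<in> bmeas \<and> mix p (H k l1 l2) < top \<and>
   (\<forall>E. schwartz E --> integrable lborel (%z. H k l1 l2 z * E z) \<and>
    (LINT z|lborel. H k l1 l2 z * E z) = h (fmul (PP \<phi> k l1 l2) E)))"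

context
 fixes \<psi> \<phi> :: "'a::euclidean_space => real"
 assumes lp: "littlewood_paley \<psi> \<phi>"
begin

lemma lpm_schwartz: "schwartz (lpm \<phi> k)"
proof -
 have "sbdd (%_::unit. %z. cr (\<phi> ((1 / 2 powi k) *\<^sub>R z))) UNIV"
  by (rule sbdd_comp[OF schwartz_sbdd[OF lp_phi_schwartz[OF lp]], where K="2 powi k"]) (auto intro: bounded_linear_scaleR_right)
 then show ?thesis unfolding schwartz_iff lpm_def[OF lp, abs_def] .
qed

lemma lpm_bmul: "bmul (lpm \<phi> k)" by (rule schwartz_bmul[OF lpm_schwartz])

lemma lpsum_bmul: "bmul (lpsum \<phi> k1 k2)"
 unfolding lpsum_def[abs_def] by (intro bmul_sum lpm_bmul) auto

lemma lpsum_eq_1: "2 powi (k1 - 5) <= norm \<xi> ==> norm \<xi> <= 2 powi (k2 + 5) ==> lpsum \<phi> k1 k2 \<xi> = 1"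
 unfolding lpsum_def lpm_def[OF lp] using lp_partition[OF lp, of k1 \<xi> k2] by (simp add: of_real_sum[symmetric] del: of_real_sum)

lemma bmul_fst: "bmul m ==> bmul (%z::'a \<times> 'a. m (fst z))"
 by (rule bmul_comp[OF _ bounded_linear_fst])

lemma bmul_snd: "bmul m ==> bmul (%z::'a \<times> 'a. m (snd z))"
 by (rule bmul_comp[OF _ bounded_linear_snd])

lemma PP_bmul: "bmul (PP \<phi> k l1 l2)"
 unfolding PP_def[abs_def] by (intro bmul_mult bmul_fst bmul_snd lpsum_bmul)

lemma block_block:
 assumes "schwartz E"
 shows "block_x \<phi> (2 powi i) (block_v \<phi> (2 powi j) h) E = h (fmul (%z. lpm \<phi> i (fst z) * lpm \<phi> j (snd z)) E)"
proof -
 have "(%(\<xi>, \<zeta>::'a). cr (\<phi> ((1 / 2 powi i) *\<^sub>R \<xi>))) = (%z. lpm \<phi> i (fst z))"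
  "(%(\<xi>::'a, \<zeta>). cr (\<phi> ((1 / 2 powi j) *\<^sub>R \<zeta>))) = (%z. lpm \<phi> j (snd z))"
  by (auto simp: fun_eq_iff lpm_def[OF lp])
 then have "block_x \<phi> (2 powi i) (block_v \<phi> (2 powi j) h) E = h (fmul (%z. lpm \<phi> j (snd z)) (fmul (%z. lpm \<phi> i (fst z)) E))"
  unfolding block_x_def block_v_def fourier_multiplier_fmul by (simp only:)
 also have "fmul (%z. lpm \<phi> j (snd z)) (fmul (%z. lpm \<phi> i (fst z)) E) = fmul (%z. lpm \<phi> i (fst z) * lpm \<phi> j (snd z)) E"
  by (subst fmul_fmul[OF bmul_fst[OF lpm_bmul] assms]) (simp add: mult.commute)
 finally show ?thesis .
qed

lemma fmul_PP:
 assumes h: "tempered h" and E: "schwartz E"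
 shows "h (fmul (PP \<phi> k l1 l2) E) = (\<Sum>(i, j)\<in>near k l1 l2. block_x \<phi> (2 powi i) (block_v \<phi> (2 powi j) h) E)"
proof -
 let ?m = "%ij z. lpm \<phi> (fst ij) (fst z) * lpm \<phi> (snd ij) (snd z)"
 have fin: "finite (near k l1 l2)" by (simp add: near_def)
 have m: "bmul (?m ij)" for ij :: "int \<times> int"
  by (intro bmul_mult bmul_fst[of "lpm \<phi> (fst ij)"] bmul_snd[of "lpm \<phi> (snd ij)"] lpm_bmul)
 have s: "schwartz (%\<zeta>. ?m ij \<zeta> * inv_fourier E \<zeta>)" for ij :: "int \<times> int"
  by (rule bmul_schwartz_mult[OF m inv_fourier_schwartz[OF E]])
 have "PP \<phi> k l1 l2 z = (\<Sum>ij\<in>near k l1 l2. ?m ij z)" for z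
  unfolding PP_def lpsum_def near_def sum_product sum.cartesian_product by (simp add: case_prod_beta')
 then have "fmul (PP \<phi> k l1 l2) E = fourier (%\<zeta>. \<Sum>ij\<in>near k l1 l2. ?m ij \<zeta> * inv_fourier E \<zeta>)"
  by (simp add: fmul_def sum_distrib_right)
 also have "\<dots> = (%\<xi>. \<Sum>ij\<in>near k l1 l2. fmul (?m ij) E \<xi>)"
  by (subst fourier_sum[OF fin s]) (simp add: fmul_def)
 finally have "h (fmul (PP \<phi> k l1 l2) E) = (\<Sum>ij\<in>near k l1 l2. h (fmul (?m ij) E))"
  by (simp add: tempered_sum[OF h fin fmul_schwartz[OF m E]])
 then show ?thesis by (simp add: block_block[OF E] case_prod_beta')
qed

text \<open>Add up nearly optimal representatives of the finitely many blocks involved. One factor 2 comes from near-optimality,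
one from Minkowski's inequality.\<close>

lemma locrep_exists:
 assumes h: "tempered h" and fin: "\<And>i j. mixed_norm_distr 1 p (block_x \<phi> (2 powi i) (block_v \<phi> (2 powi j) h)) < top" and p: "1 <= p"
 shows "\<exists>H. locrep \<phi> p h H \<and> (\<forall>k l1 l2. mix p (H k l1 l2) <=
   4 * (\<Sum>(i, j)\<in>near k l1 l2. mixed_norm_distr 1 p (block_x \<phi> (2 powi i) (block_v \<phi> (2 powi j) h))))"
proof -
 let ?T = "%i j. block_x \<phi> (2 powi i) (block_v \<phi> (2 powi j) h)"
 have "\<forall>i j. \<exists>u. represents u (?T i j) \<and> mix p u <= 2 * mixed_norm_distr 1 p (?T i j)"
  using mixed_norm_attained[OF fin p] by blast
 then obtain u where u: "\<And>i j. represents (u i j) (?T i j)" "\<And>i j. mix p (u i j) <= 2 * mixed_norm_distr 1 p (?T i j)" by metis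
 have um[measurable]: "u i j \<in> bmeas" for i j using u(1) by (auto simp: represents_def)
 define H where "H k l1 l2 z = (\<Sum>(i, j)\<in>near k l1 l2. u i j z)" for k l1 l2 z
 have fn: "finite (near k l1 l2)" for k l1 l2 by (simp add: near_def)
 have Hm[measurable]: "H k l1 l2 \<in> bmeas" for k l1 l2
  unfolding H_def[abs_def] by (intro borel_measurable_sum) auto
 have mx: "mix p (H k l1 l2) <= 4 * (\<Sum>(i, j)\<in>near k l1 l2. mixed_norm_distr 1 p (?T i j))" for k l1 l2
 proof -
  have "mix p (H k l1 l2) <= (NN x. 2 * (\<Sum>(i, j)\<in>near k l1 l2. Lp_norm p lborel (%v. ennreal (norm (u i j (x, v))))))"
   unfolding mix_def
  proof (rule nn_integral_mono)
   fix x :: 'a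
   have "Lp_norm p lborel (%v. ennreal (norm (H k l1 l2 (x, v)))) <= Lp_norm p lborel (%v. \<Sum>ij\<in>near k l1 l2. ennreal (norm (u (fst ij) (snd ij) (x, v))))"
   proof (rule Lp_norm_mono_AE[OF _ _ p])
    show "AE v in lborel. ennreal (norm (H k l1 l2 (x, v))) <= (\<Sum>ij\<in>near k l1 l2. ennreal (norm (u (fst ij) (snd ij) (x, v))))"
     unfolding H_def by (intro AE_I2) (simp add: case_prod_beta' sum_ennreal ennreal_leI norm_sum)
   qed measurable
   also have "\<dots> <= 2 * (\<Sum>ij\<in>near k l1 l2. Lp_norm p lborel (%v. ennreal (norm (u (fst ij) (snd ij) (x, v)))))"
    by (rule Lp_norm_sum_weak[OF sigma_finite_lborel' fn _ p]) measurable
   finally show "Lp_norm p lborel (%v. ennreal (norm (H k l1 l2 (x, v)))) <= 2 * (\<Sum>(i, j)\<in>near k l1 l2. Lp_norm p lborel (%v. ennreal (norm (u i j (x, v)))))"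
    by (simp add: case_prod_beta')
  qed
  also have "\<dots> = 2 * (\<Sum>(i, j)\<in>near k l1 l2. mix p (u i j))"
  proof -
   have [measurable]: "(%x. Lp_norm p lborel (%v. ennreal (norm (u i j (x, v))))) \<in> borel_measurable lborel" for i j
    by (intro Lp_norm_measurable[where V="%v x. ennreal (norm (u i j (x, v)))"] sigma_finite_lborel') measurable
   show ?thesis unfolding mix_def case_prod_beta'
    by (subst nn_integral_cmult, measurable) (subst nn_integral_sum, measurable)
  qed
  also have "\<dots> <= 2 * (\<Sum>(i, j)\<in>near k l1 l2. 2 * mixed_norm_distr 1 p (?T i j))"
   using u(2) by (intro mult_left_mono sum_mono) auto
  also have "\<dots> = 4 * (\<Sum>(i, j)\<in>near k l1 l2. mixed_norm_distr 1 p (?T i j))"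
   by (simp add: case_prod_beta' sum_distrib_left[symmetric] mult.assoc[symmetric])
  finally show ?thesis .
 qed
 have "mix p (H k l1 l2) < top" for k l1 l2
  using mx[of k l1 l2] fin by (rule_tac le_less_trans) (auto simp: ennreal_mult_less_top fn case_prod_beta')
 moreover have "integrable lborel (%z. H k l1 l2 z * E z) \<and> (LINT z|lborel. H k l1 l2 z * E z) = h (fmul (PP \<phi> k l1 l2) E)"
  if E: "schwartz E" for k l1 l2 E
 proof -
  have i: "integrable lborel (%z. u i j z * E z)" "?T i j E = (LINT z|lborel. u i j z * E z)" for i j
   using u(1)[of i j] E by (auto simp: represents_def)
  have e: "H k l1 l2 z * E z = (\<Sum>ij\<in>near k l1 l2. u (fst ij) (snd ij) z * E z)" for z
   by (simp add: H_def case_prod_beta' sum_distrib_right)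
  show ?thesis unfolding e fmul_PP[OF h E] case_prod_beta' i(2)
   by (auto intro!: Bochner_Integration.integrable_sum Bochner_Integration.integral_sum i(1))
 qed
 ultimately have "locrep \<phi> p h H" unfolding locrep_def using Hm by blast
 with mx show ?thesis by blast
qed

text \<open>The multiplier \<open>PP\<close> is the identity on test functions whose spectrum lies in the region where it equals
1.\<close>

lemma locrep_spec:
 assumes H: "locrep \<phi> p h H" and E: "schwartz E"
  and sp: "\<And>\<xi> \<eta>. inv_fourier E (\<xi>, \<eta>) ~= 0 ==> 2 powi (k - 5) <= norm \<xi> \<and> norm \<xi> <= 2 powi (k + 5) \<and> 2 powi (l1 - 5) <= norm \<eta> \<and> norm \<eta> <= 2 powi (l2 + 5)"
 shows "integrable lborel (%z. H k l1 l2 z * E z)" "h E = (LINT z|lborel. H k l1 l2 z * E z)"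
proof -
 have "(%\<zeta>. PP \<phi> k l1 l2 \<zeta> * inv_fourier E \<zeta>) = inv_fourier E"
 proof
  fix \<zeta> :: "'a \<times> 'a"
  show "PP \<phi> k l1 l2 \<zeta> * inv_fourier E \<zeta> = inv_fourier E \<zeta>"
   using sp[of "fst \<zeta>" "snd \<zeta>"] by (cases "inv_fourier E \<zeta> = 0") (auto simp: PP_def lpsum_eq_1)
 qed
 then have "fmul (PP \<phi> k l1 l2) E = E" by (simp add: fmul_def fourier_inv_fourier[OF E])
 then show "integrable lborel (%z. H k l1 l2 z * E z)" "h E = (LINT z|lborel. H k l1 l2 z * E z)"
  using H E unfolding locrep_def by (metis, metis)
qed

text \<open>The convolution kernel of the block of frequency 1.\<close>

definition kk :: "'a => complex" where
 "kk w = cr (1 / (2 * pi) ^ DIM('a)) * fourier (%x. cr (\<phi> x)) w"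

lemma kk_schwartz: "schwartz kk"
 unfolding kk_def[abs_def] by (intro schwartz_cmult fourier_schwartz lp_phi_schwartz[OF lp])

lemma kk_phi: "cr (\<phi> y) = (LINT w|lborel. kk w * fexp (- (y \<bullet> w)))"
proof -
 have "cr (\<phi> y) = inv_fourier (fourier (%x. cr (\<phi> x))) y"
  by (simp add: inv_fourier_fourier[OF lp_phi_schwartz[OF lp]])
 also have "\<dots> = (LINT w|lborel. cr (1 / (2 * pi) ^ DIM('a)) * (fexp (- (y \<bullet> w)) * fourier (%x. cr (\<phi> x)) w))"
  unfolding inv_fourier_eq fourier_fexp[of "fourier _"] by simp
 also have "\<dots> = (LINT w|lborel. kk w * fexp (- (y \<bullet> w)))"
  by (intro LINT_cong refl) (simp add: kk_def mult_ac)
 finally show ?thesis .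
qed

lemma fmul_lpm:
 assumes "schwartz G"
 shows "fmul (lpm \<phi> k) G x = (LINT w|lborel. kk w * G (x - (1 / 2 powi k) *\<^sub>R w))"
proof (rule fmul_conv[OF schwartz_integrable[OF kk_schwartz] bounded_linear_scaleR_right assms])
 show "lpm \<phi> k \<zeta> = (LINT w|lborel. kk w * fexp (- (\<zeta> \<bullet> (1 / 2 powi k) *\<^sub>R w)))" for \<zeta>
  unfolding lpm_def[OF lp] kk_phi by simp
qed

lemma fmul_snd:
 fixes G :: "'a \<times> 'a => complex"
 assumes "schwartz G"
 shows "fmul (%z. cr (\<phi> ((1 / \<tau>) *\<^sub>R snd z))) G (x, v) = (LINT w|lborel. kk w * G (x, v - (1 / \<tau>) *\<^sub>R w))"
proof -
 have "fmul (%z. cr (\<phi> ((1 / \<tau>) *\<^sub>R snd z))) G (x, v) = (LINT w|lborel. kk w * G ((x, v) - (%w. (0, (1 / \<tau>) *\<^sub>R w)) w))"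
 proof (rule fmul_conv[OF schwartz_integrable[OF kk_schwartz] _ assms])
  show "bounded_linear (%w::'a. (0::'a, (1 / \<tau>) *\<^sub>R w))"
   by (intro bounded_linear_Pair bounded_linear_zero bounded_linear_scaleR_right)
  show "cr (\<phi> ((1 / \<tau>) *\<^sub>R snd \<zeta>)) = (LINT w|lborel. kk w * fexp (- (\<zeta> \<bullet> (0, (1 / \<tau>) *\<^sub>R w))))" for \<zeta> :: "'a \<times> 'a"
   unfolding kk_phi by (simp add: inner_prod_def)
 qed
 then show ?thesis by simp
qed

text \<open>A cutoff with \<open>kap 0 = 1\<close> and compactly supported spectrum: the normalized Fourier transform of \<phi>,
whose integral is not zero.\<close>

definition kap :: "'a => complex" where
 "kap w = fourier (%x. cr (\<phi> x)) w / fourier (%x. cr (\<phi> x)) 0"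

lemma fourier_phi_0: "fourier (%x. cr (\<phi> x)) 0 ~= 0"
proof
 assume "fourier (%x. cr (\<phi> x)) 0 = 0"
 then have "(LINT x|lborel. cr (\<phi> x)) = 0" by (simp add: fourier_fexp fexp_simps)
 then have z: "(LINT x|lborel. \<phi> x) = 0" by simp
 have c: "continuous_on UNIV \<phi>"
  using continuous_on_Re[OF schwartz_continuous[OF lp_phi_schwartz[OF lp]]] by simp
 have nn: "0 <= \<phi> x" for x using lp by (auto simp: littlewood_paley_def)
 have i: "integrable lborel \<phi>" using integrable_Re[OF schwartz_integrable[OF lp_phi_schwartz[OF lp]]] by simp
 have ae: "AE x in lborel. \<phi> x = 0" using z i nn by (subst (asm) integral_nonneg_eq_0_iff_AE) auto
 obtain e :: 'a where e: "norm e = 1" using vector_choose_size[of 1] by auto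
 have "(\<Sum>j=0-6..0+6. \<phi> ((1 / 2 powi j) *\<^sub>R e)) = 1" using e by (intro lp_partition[OF lp]) (auto simp: power_int_minus)
 then obtain y where y: "\<phi> y ~= 0" by (metis (no_types, lifting) sum.neutral zero_neq_one)
 have "open {x. \<phi> x ~= 0}" using c by (intro open_Collect_neq continuous_on_const) auto
 then have "\<not> negligible {x. \<phi> x ~= 0}" using y by (intro open_not_negligible) auto
 moreover have "{x. \<phi> x ~= 0} \<in> null_sets lborel"
 proof -
  have "{x. \<phi> x ~= 0} \<in> sets lborel" using \<open>open {x. \<phi> x ~= 0}\<close> by simp
  from AE_iff_null_sets[OF this] show ?thesis using ae by simp
 qed
 then have "negligible {x. \<phi> x ~= 0}" unfolding negligible_iff_null_sets by (rule null_sets_completionI)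
 ultimately show False by simp
qed

lemma kap_0: "kap 0 = 1" using fourier_phi_0 by (simp add: kap_def)

lemma kap_eq: "kap = (%w. (1 / fourier (%x. cr (\<phi> x)) 0) * fourier (%x. cr (\<phi> x)) w)"
 by (simp add: kap_def fun_eq_iff)

lemma kap_schwartz: "schwartz kap"
 unfolding kap_eq by (intro schwartz_cmult fourier_schwartz lp_phi_schwartz[OF lp])

lemma kap_supp: "inv_fourier kap \<zeta> ~= 0 ==> norm \<zeta> <= 2"
 unfolding kap_eq inv_fourier_cmult inv_fourier_fourier[OF lp_phi_schwartz[OF lp]] using lp_supp[OF lp, of \<zeta>] by auto

lemma pd_phi_supp: "pd b (%x. cr (\<phi> x)) \<zeta> ~= 0 ==> norm \<zeta> <= 2"
proof (rule ccontr)
 assume n: "pd b (%x. cr (\<phi> x)) \<zeta> ~= 0" "\<not> norm \<zeta> <= 2"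
 have "closure {x. cr (\<phi> x) ~= 0} \<subseteq> {\<xi>. 1 / 2 <= norm \<xi> \<and> norm \<xi> <= 2}"
  using lp by (simp add: littlewood_paley_def)
 with n have "\<zeta> \<notin> closure {x. cr (\<phi> x) ~= 0}" by auto
 from iter_deriv_supp[OF this, of "[b]"] n show False by simp
qed

text \<open>Multiplication by a coordinate differentiates the spectrum and preserves its support.\<close>

lemma kap_coord:
 assumes b: "b \<in> Basis"
 shows "schwartz (%w. c * (cr (w \<bullet> b) * kap w))"
  and "inv_fourier (%w. c * (cr (w \<bullet> b) * kap w)) \<zeta> ~= 0 ==> norm \<zeta> <= 2"
proof -
 let ?f = "%x. cr (\<phi> x)"
 note f = lp_phi_schwartz[OF lp]
 have pf: "schwartz (pd b ?f)" using sbdd_pd[OF schwartz_sbdd[OF f, of "UNIV :: unit set"] b] by (simp add: schwartz_iff)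
 have "(%w. c * (cr (w \<bullet> b) * kap w)) = (%w. (- \<i> * c / fourier ?f 0) * fourier (pd b ?f) w)"
 proof
  fix w
  have "fourier (pd b ?f) w = \<i> * cr (w \<bullet> b) * fourier ?f w"
   by (rule fourier_pd[OF schwartz_lev[OF f] b])
  then show "c * (cr (w \<bullet> b) * kap w) = (- \<i> * c / fourier ?f 0) * fourier (pd b ?f) w"
   by (simp add: kap_def mult.left_commute[of c \<i>] mult.assoc)
 qed
 note eq = this
 show "schwartz (%w. c * (cr (w \<bullet> b) * kap w))"
  unfolding eq by (intro schwartz_cmult fourier_schwartz pf)
 show "inv_fourier (%w. c * (cr (w \<bullet> b) * kap w)) \<zeta> ~= 0 ==> norm \<zeta> <= 2"
  unfolding eq inv_fourier_cmult inv_fourier_fourier[OF pf] using pd_phi_supp by auto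
qed

end

section \<open>Scaled families\<close>

lemma pd_vanish:
 fixes A :: "'a::euclidean_space => complex"
 assumes U: "open U" "\<And>z. z \<in> U ==> A z = 0" "z \<in> U" shows "frechet_derivative A (at z) e = 0"
proof -
 have "((%x. 0) has_derivative (%h. 0)) (at z)" by simp
 then have "(A has_derivative (%h. 0)) (at z)"
  by (rule has_derivative_transform_within_open[OF _ U(1,3)]) (use U(2) in auto)
 from fun_cong[OF frechet_derivative_at[OF this], of e] show ?thesis by simp
qed

lemma bmul_pd: "bmul m ==> e \<in> Basis ==> bmul (pd e m)"
 unfolding bmul_def using lev_pd[of "%N x. 1" _ "%_::unit. m" UNIV e] by blast

lemma bmul_has_derivative: "bmul m ==> (m has_derivative frechet_derivative m (at x)) (at x)"
 using lev_has_derivative[of "%N x. 1" 0 "%_::unit. m" UNIV "()" x] by (simp add: bmul_def)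

lemma schwartz_has_derivative: "schwartz m ==> (m has_derivative frechet_derivative m (at x)) (at x)"
 using bmul_has_derivative[OF schwartz_bmul] .

lemma schwartz_pd: "schwartz f ==> e \<in> Basis ==> schwartz (pd e f)"
 unfolding schwartz_iff by (rule sbdd_pd)

lemma bmul_bounded: "bmul m ==> \<exists>C\<ge>0. \<forall>x. norm (m x) <= C"
proof -
 assume "bmul m"
 then obtain C where "\<forall>x. norm (m x) <= C" using lev_bound[of "%N x. 1" 0 "%_::unit. m" UNIV] by (auto simp: bmul_def)
 then show ?thesis by (intro exI[of _ "\<bar>C\<bar>"]) (auto intro: order_trans[OF _ abs_ge_self])
qed

lemma frechet_scaleR:
 fixes A :: "'a::euclidean_space => complex"
 assumes "(A has_derivative frechet_derivative A (at x)) (at x)"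
 shows "frechet_derivative A (at x) (c *\<^sub>R h) = cr c * frechet_derivative A (at x) h"
 using linear_scale[OF has_derivative_linear[OF assms], of c h] by (simp add: scaleR_conv_of_real)

text \<open>On the support of \<open>A (\<mu> z)\<close> one has \<open>norm z \<ge> c / \<mu>\<close>, so the rapid decay of G
absorbs any power of \<open>1 / \<mu>\<close>. Each derivative falling on A gains a factor \<open>\<mu> \<le>
1\<close>.\<close>

lemma scaled_left:
 fixes G :: "'j => 'a::euclidean_space => complex"
 assumes G: "sbdd G J" and A: "bmul A" and c: "0 < c" "\<And>w. norm w < c ==> A w = 0"
 shows "sbdd (%(\<mu>, j) z. cr ((1 / \<mu>) ^ m) * (A (\<mu> *\<^sub>R z) * G j z)) ({0<..1} \<times> J)"
proof -
 have "lev sw n (%(\<mu>, j) z. cr ((1 / \<mu>) ^ m) * (A (\<mu> *\<^sub>R z) * G j z)) ({0<..1} \<times> J)" for n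
  using G A c(2)
 proof (induction n arbitrary: G A)
  case 0
  show ?case unfolding lev.simps
  proof
   fix N
   obtain CA where CA: "0 <= CA" "\<And>w. norm (A w) <= CA" using bmul_bounded[OF 0(2)] by blast
   obtain CG where CG: "\<forall>j\<in>J. \<forall>z. sw (N + m) z * norm (G j z) <= CG" using lev_bound[OF sbddD[OF 0(1)]] by metis
   have "sw N z * norm (cr ((1 / \<mu>) ^ m) * (A (\<mu> *\<^sub>R z) * G j z)) <= CA * \<bar>CG\<bar> / c ^ m"
    if \<mu>: "\<mu> \<in> {0<..1}" and j: "j \<in> J" for \<mu> j z
   proof (cases "A (\<mu> *\<^sub>R z) = 0")
    case True then show ?thesis using CA(1) c(1) by simp
   next
    case False
    then have "c <= norm (\<mu> *\<^sub>R z)" using 0(3)[of "\<mu> *\<^sub>R z"] by (meson not_le)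
    then have "1 / \<mu> <= (1 + norm z) / c" using \<mu> c(1) by (simp add: field_simps)
    then have "(1 / \<mu>) ^ m <= ((1 + norm z) / c) ^ m" using \<mu> by (intro power_mono) auto
    then have "(1 / \<mu>) ^ m <= sw m z / c ^ m" by (simp add: power_divide)
    then have "sw N z * ((1 / \<mu>) ^ m * (norm (A (\<mu> *\<^sub>R z)) * norm (G j z))) <= sw N z * (sw m z / c ^ m * (CA * norm (G j z)))"
     using CA c(1) \<mu> by (intro mult_left_mono mult_mono mult_right_mono) auto
    also have "\<dots> = CA * (sw (N + m) z * norm (G j z)) / c ^ m" by (simp add: power_add)
    also have "\<dots> <= CA * \<bar>CG\<bar> / c ^ m" using CG j CA(1) c(1)
     by (intro divide_right_mono mult_left_mono) (auto intro: order_trans[OF _ abs_ge_self])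
    finally show ?thesis using \<mu> by (simp add: norm_mult norm_divide norm_power)
   qed
   then show "\<exists>C. \<forall>j\<in>{0<..1} \<times> J. \<forall>x. sw N x * norm ((case j of (\<mu>, j) => %z. cr ((1 / \<mu>) ^ m) * (A (\<mu> *\<^sub>R z) * G j z)) x) <= C"
    by (intro exI[of _ "CA * \<bar>CG\<bar> / c ^ m"]) auto
  qed
 next
  case (Suc n)
  note Ad = bmul_has_derivative[OF Suc.prems(2)]
  have Gd: "(G j has_derivative frechet_derivative (G j) (at x)) (at x)" if "j \<in> J" for j x
   using lev_has_derivative[OF sbddD[OF Suc.prems(1)] that] .
  define D where "D = (%(\<mu>, j) z h. cr ((1 / \<mu>) ^ m) * (A (\<mu> *\<^sub>R z) * frechet_derivative (G j) (at z) h + frechet_derivative A (at (\<mu> *\<^sub>R z)) (\<mu> *\<^sub>R h) * G j z))"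
  show ?case
  proof (rule lev_SucI[where D=D])
   show "lev sw 0 (%(\<mu>, j) z. cr ((1 / \<mu>) ^ m) * (A (\<mu> *\<^sub>R z) * G j z)) ({0<..1} \<times> J)"
    using lev_0[OF Suc.IH[OF Suc.prems]] .
   fix \<mu>j x assume \<mu>j: "\<mu>j \<in> {0<..1::real} \<times> J"
   obtain \<mu> j where e: "\<mu>j = (\<mu>, j)" "j \<in> J" using \<mu>j by auto
   have "((%z. A (\<mu> *\<^sub>R z)) has_derivative (%h. frechet_derivative A (at (\<mu> *\<^sub>R x)) (\<mu> *\<^sub>R h))) (at x)"
    by (rule has_derivative_compose[OF _ Ad]) (auto intro!: derivative_eq_intros)
   from has_derivative_mult_right[OF has_derivative_mult[OF this Gd[OF e(2)]]]
   show "((case \<mu>j of (\<mu>, j) => %z. cr ((1 / \<mu>) ^ m) * (A (\<mu> *\<^sub>R z) * G j z)) has_derivative D \<mu>j x) (at x)"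
    by (simp add: e D_def)
  next
   fix e :: 'a assume e: "e \<in> Basis"
   have v: "norm w < c ==> pd e A w = 0" for w
    by (rule pd_vanish[of "ball 0 c"]) (use Suc.prems(3) in auto)
   have l1: "lev sw n (%(\<mu>, j) z. cr ((1 / \<mu>) ^ m) * (A (\<mu> *\<^sub>R z) * pd e (G j) z)) ({0<..1} \<times> J)"
    by (rule Suc.IH[OF sbdd_pd[OF Suc.prems(1) e] Suc.prems(2,3)])
   have l2: "lev sw n (%\<mu>j z. cr (fst \<mu>j) * (%(\<mu>, j) z. cr ((1 / \<mu>) ^ m) * (pd e A (\<mu> *\<^sub>R z) * G j z)) \<mu>j z) ({0<..1} \<times> J)"
    by (rule lev_cmult[OF sw_nonneg _ Suc.IH[OF Suc.prems(1) bmul_pd[OF Suc.prems(2) e] v], where M=1]) auto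
   show "lev sw n (%\<mu>j z. D \<mu>j z e) ({0<..1} \<times> J)"
    by (rule iffD1[OF lev_cong lev_add[OF sw_nonneg l1 l2]])
      (auto simp: D_def fun_eq_iff frechet_scaleR[OF Ad] algebra_simps)
  qed
 qed
 then show ?thesis by (simp add: sbdd_def)
qed

text \<open>Here the argument of B is at least \<open>c / \<epsilon>\<close> on the support of A, and the rapid decay of B absorbs
powers of \<open>1 / \<epsilon>\<close>.\<close>

lemma scaled_right:
 fixes A :: "'a::euclidean_space => complex" and B :: "'b::euclidean_space => complex"
 assumes A: "schwartz A" and B: "schwartz B" and L: "bounded_linear L" and c: "0 < c" "\<And>z. A z ~= 0 ==> c <= norm (L z)"
 shows "sbdd (%\<epsilon> z. cr ((1 / \<epsilon>) ^ m) * (A z * B ((1 / \<epsilon>) *\<^sub>R L z))) {0<..1}"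
proof -
 have "lev sw n (%\<epsilon> z. cr ((1 / \<epsilon>) ^ m) * (A z * B ((1 / \<epsilon>) *\<^sub>R L z))) {0<..1}" for n
  using A B c(2)
 proof (induction n arbitrary: A B m)
  case 0
  show ?case unfolding lev.simps
  proof
   fix N
   obtain CA where CA: "0 <= CA" "\<And>z. sw N z * norm (A z) <= CA" using schwartz_bound[OF 0(1)] by blast
   obtain CB where CB: "0 <= CB" "\<And>w. sw m w * norm (B w) <= CB" using schwartz_bound[OF 0(2)] by blast
   have "sw N z * norm (cr ((1 / \<epsilon>) ^ m) * (A z * B ((1 / \<epsilon>) *\<^sub>R L z))) <= CA * (CB / c ^ m)"
    if \<epsilon>: "\<epsilon> \<in> {0<..1}" for \<epsilon> z
   proof (cases "A z = 0")
    case True then show ?thesis using CA(1) CB(1) c(1) by simp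
   next
    case False
    let ?w = "(1 / \<epsilon>) *\<^sub>R L z"
    have "c <= norm (L z)" using 0(3)[OF False] .
    then have "c / \<epsilon> <= norm ?w" using \<epsilon> by (simp add: divide_right_mono)
    then have "(c / \<epsilon>) ^ m <= sw m ?w" using c \<epsilon> by (intro power_mono) auto
    then have "(c / \<epsilon>) ^ m * norm (B ?w) <= CB" using CB(2)[of ?w] by (meson mult_right_mono norm_ge_zero order_trans)
    then have "(1 / \<epsilon>) ^ m * norm (B ?w) <= CB / c ^ m" using c(1) \<epsilon> by (simp add: power_divide field_simps)
    then have "(sw N z * norm (A z)) * ((1 / \<epsilon>) ^ m * norm (B ?w)) <= CA * (CB / c ^ m)"
     using CA \<epsilon> by (intro mult_mono) auto
    then show ?thesis using \<epsilon> by (simp add: norm_mult norm_divide norm_power mult_ac)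
   qed
   then show "\<exists>C. \<forall>\<epsilon>\<in>{0<..1}. \<forall>z. sw N z * norm (cr ((1 / \<epsilon>) ^ m) * (A z * B ((1 / \<epsilon>) *\<^sub>R L z))) <= C"
    by blast
  qed
 next
  case (Suc n)
  note Ad = schwartz_has_derivative[OF Suc.prems(1)] note Bd = schwartz_has_derivative[OF Suc.prems(2)]
  note IH = Suc.IH
  let ?D = "%\<epsilon> z h. cr ((1 / \<epsilon>) ^ m) * (A z * frechet_derivative B (at ((1 / \<epsilon>) *\<^sub>R L z)) ((1 / \<epsilon>) *\<^sub>R L h) + frechet_derivative A (at z) h * B ((1 / \<epsilon>) *\<^sub>R L z))"
  show ?case
  proof (rule lev_SucI[where D="?D"])
   show "lev sw 0 (%\<epsilon> z. cr ((1 / \<epsilon>) ^ m) * (A z * B ((1 / \<epsilon>) *\<^sub>R L z))) {0<..1}"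
    using lev_0[OF IH[OF Suc.prems]] .
   fix \<epsilon> x assume "\<epsilon> \<in> {0<..1::real}"
   have "((%z. B ((1 / \<epsilon>) *\<^sub>R L z)) has_derivative (%h. frechet_derivative B (at ((1 / \<epsilon>) *\<^sub>R L x)) ((1 / \<epsilon>) *\<^sub>R L h))) (at x)"
    by (rule has_derivative_compose[OF bounded_linear_imp_has_derivative[OF bounded_linear_compose[OF bounded_linear_scaleR_right L]] Bd])
   from has_derivative_mult_right[OF has_derivative_mult[OF Ad this]]
   show "((%z. cr ((1 / \<epsilon>) ^ m) * (A z * B ((1 / \<epsilon>) *\<^sub>R L z))) has_derivative ?D \<epsilon> x) (at x)" .
  next
   fix e :: 'a assume e: "e \<in> Basis"
   have "open {z. norm (L z) < c}"
    by (intro open_Collect_less continuous_intros linear_continuous_on L)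
   then have vA: "norm (L z) < c ==> pd e A z = 0" for z
    by (rule pd_vanish) (use Suc.prems(3) in \<open>auto simp: not_le[symmetric]\<close>)
   then have vA': "pd e A z ~= 0 ==> c <= norm (L z)" for z by (meson not_le)
   have l1: "lev sw n (%\<epsilon> z. cr ((1 / \<epsilon>) ^ m) * (pd e A z * B ((1 / \<epsilon>) *\<^sub>R L z))) {0<..1}"
    by (rule IH[OF schwartz_pd[OF Suc.prems(1) e] Suc.prems(2) vA'])
   have l2: "lev sw n (%\<epsilon> z. \<Sum>b\<in>Basis. cr (L e \<bullet> b) * (cr ((1 / \<epsilon>) ^ Suc m) * (A z * pd b B ((1 / \<epsilon>) *\<^sub>R L z)))) {0<..1}"
   proof (rule lev_sum[OF sw_nonneg finite_Basis])
    fix b :: 'b assume b: "b \<in> Basis"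
    show "lev sw n (%\<epsilon> z. cr (L e \<bullet> b) * (cr ((1 / \<epsilon>) ^ Suc m) * (A z * pd b B ((1 / \<epsilon>) *\<^sub>R L z)))) {0<..1}"
     by (rule lev_cmult[OF sw_nonneg _ IH[OF Suc.prems(1) schwartz_pd[OF Suc.prems(2) b] Suc.prems(3)], where M="norm (L e)"])
       (use b in \<open>auto simp: Basis_le_norm\<close>)
   qed
   have eq: "?D \<epsilon> z e = cr ((1 / \<epsilon>) ^ m) * (pd e A z * B ((1 / \<epsilon>) *\<^sub>R L z)) +
     (\<Sum>b\<in>Basis. cr (L e \<bullet> b) * (cr ((1 / \<epsilon>) ^ Suc m) * (A z * pd b B ((1 / \<epsilon>) *\<^sub>R L z))))" for \<epsilon> z
   proof -
    have "frechet_derivative B (at ((1 / \<epsilon>) *\<^sub>R L z)) ((1 / \<epsilon>) *\<^sub>R L e) = cr (1 / \<epsilon>) * frechet_derivative B (at ((1 / \<epsilon>) *\<^sub>R L z)) (L e)"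
     by (rule frechet_scaleR[OF Bd])
    also have "frechet_derivative B (at ((1 / \<epsilon>) *\<^sub>R L z)) (L e) = (\<Sum>b\<in>Basis. cr (L e \<bullet> b) * pd b B ((1 / \<epsilon>) *\<^sub>R L z))"
     by (rule linear_sum_Basis[OF has_derivative_linear[OF Bd]])
    finally show ?thesis by (simp add: sum_distrib_left distrib_left mult_ac add.commute)
   qed
   show "lev sw n (%\<epsilon> z. ?D \<epsilon> z e) {0<..1}"
    unfolding eq by (rule lev_add[OF sw_nonneg l1 l2])
  qed
 qed
 then show ?thesis by (simp add: sbdd_def)
qed

section \<open>The transport equation for Schwartz functions\<close>

text \<open>The transport operator \<open>v \<cdot> \<nabla>\<^sub>x\<close>.\<close>

definition Vop :: "('a::euclidean_space \<times> 'a => complex) => 'a \<times> 'a => complex" where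
 "Vop \<zeta> z = frechet_derivative \<zeta> (at z) (snd z, 0)"

lemma Vop_sum:
 assumes "(\<zeta> has_derivative frechet_derivative \<zeta> (at z)) (at z)"
 shows "Vop \<zeta> z = (\<Sum>b\<in>Basis. cr (z \<bullet> (0, b)) * pd (b, 0) \<zeta> z)"
proof -
 note lin = has_derivative_linear[OF assms]
 have "(snd z, 0) = (\<Sum>b\<in>Basis. (z \<bullet> (0, b)) *\<^sub>R (b, 0::'a))"
 proof -
  have "(\<Sum>b\<in>Basis. (z \<bullet> (0, b)) *\<^sub>R (b, 0::'a)) = (\<Sum>b\<in>Basis. (z \<bullet> (0, b)) *\<^sub>R b, 0)"
   by (simp add: prod_eq_iff fst_sum snd_sum)
  also have "(\<Sum>b\<in>Basis. (z \<bullet> (0, b)) *\<^sub>R b) = snd z" by (simp add: inner_prod_def euclidean_representation)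
  finally show ?thesis by simp
 qed
 then show ?thesis unfolding Vop_def
  by (simp only: linear_sum[OF lin] linear_scale[OF lin] scaleR_conv_of_real)
qed

lemma Vop_sbdd: assumes F: "sbdd F J" shows "sbdd (%j. Vop (F j)) J"
proof -
 have "sbdd (%j z. \<Sum>b\<in>Basis. cr (z \<bullet> (0, b)) * pd (b, 0) (F j) z) J"
  by (intro sbdd_sum finite_Basis sbdd_coord sbdd_pd F) (auto simp: Basis_prod_def)
 moreover have "Vop (F j) = (%z. \<Sum>b\<in>Basis. cr (z \<bullet> (0, b)) * pd (b, 0) (F j) z)" if "j \<in> J" for j
  using Vop_sum[OF schwartz_has_derivative[OF sbdd_schwartz[OF F that]]] by (simp add: fun_eq_iff)
 ultimately show ?thesis unfolding sbdd_def by (subst lev_cong) auto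
qed

lemma Vop_schwartz: "schwartz \<zeta> ==> schwartz (Vop \<zeta>)"
 using Vop_sbdd[OF schwartz_sbdd, of \<zeta> "UNIV :: unit set"] by (simp add: schwartz_iff)

lemma Vop_add_cmult:
 assumes "schwartz f" "schwartz g" shows "Vop (%z. f z + c * g z) = (%z. Vop f z + c * Vop g z)"
proof
 fix z
 from has_derivative_add[OF schwartz_has_derivative[OF assms(1), of z] has_derivative_mult_right[OF schwartz_has_derivative[OF assms(2), of z], of c]]
 have "((%z. f z + c * g z) has_derivative (%h. frechet_derivative f (at z) h + c * frechet_derivative g (at z) h)) (at z)" .
 from fun_cong[OF frechet_derivative_at[OF this]] show "Vop (%z. f z + c * g z) z = Vop f z + c * Vop g z"
  by (simp add: Vop_def)
qed

text \<open>The equation is assumed for test functions only. It extends by continuity: cut off by \<open>\<psi> (x / n) \<psi> (v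
/ n)\<close>, which produces errors of order \<open>1 / n\<close> in every seminorm.\<close>

lemma transport_schwartz:
 fixes \<psi> \<phi> :: "'a::euclidean_space => real" and f g :: "('a \<times> 'a) distr" and \<zeta> :: "'a \<times> 'a => complex"
 assumes lp: "littlewood_paley \<psi> \<phi>" and tr: "transport_eq f g" and f: "tempered f" and g: "tempered g" and \<zeta>: "schwartz \<zeta>"
 shows "- f (Vop \<zeta>) = g \<zeta>"
proof -
 define \<Theta> where "\<Theta> z = cr (\<psi> (fst z)) * cr (\<psi> (snd z))" for z :: "'a \<times> 'a"
 have "sbdd (%(_::unit) z. cr (\<psi> (fst z)) * cr (\<psi> (snd z))) UNIV"
  by (rule sbdd_pair[OF schwartz_sbdd[OF lp_psi_schwartz[OF lp]] schwartz_sbdd[OF lp_psi_schwartz[OF lp]] bounded_linear_fst bounded_linear_snd, where K=1])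
    (metis mult_1 norm_Pair_le prod.collapse)
 then have \<Theta>: "schwartz \<Theta>" unfolding schwartz_iff \<Theta>_def[abs_def] .
 have \<psi>1: "\<psi> x = 1" if "norm x < 1 / 2" for x
 proof -
  have z: "\<phi> ((1 / 2 ^ k) *\<^sub>R x) = 0" for k
  proof (rule ccontr)
   assume "\<phi> ((1 / 2 ^ k) *\<^sub>R x) ~= 0"
   then have "1 / 2 <= norm ((1 / 2 ^ k) *\<^sub>R x)" using lp_supp[OF lp] by blast
   also have "\<dots> <= norm x" using mult_left_mono[OF one_le_power[of "2::real" k], of "norm x"] by (simp add: divide_le_eq)
   finally show False using that by simp
  qed
  have "(%k::nat. \<phi> ((1 / 2 ^ k) *\<^sub>R x)) sums (1 - \<psi> x)" using lp unfolding littlewood_paley_def by blast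
  then have "(%k::nat. 0) sums (1 - \<psi> x)" by (simp only: z)
  then show ?thesis using sums_unique2[OF _ sums_zero] by fastforce
 qed
 have \<Theta>1: "\<Theta> z = 1" if "norm z < 1 / 2" for z
  using \<psi>1[of "fst z"] \<psi>1[of "snd z"] that norm_fst_le[of "fst z" "snd z"] norm_snd_le[of "snd z" "fst z"] by (simp add: \<Theta>_def)
 let ?A = "%z. 1 - \<Theta> z"
 have A: "bmul ?A" by (intro bmul_diff bmul_const schwartz_bmul \<Theta>)
 have A0: "norm w < 1 / 2 ==> ?A w = 0" for w using \<Theta>1 by simp
 \<comment> \<open>The error of the cutoff, times \<open>n + 1\<close>; still bounded, by \<open>scaled_left\<close> with \<open>\<mu> = 1 / (n + 1)\<close>.\<close>
 define fam where "fam n z = cr (real (Suc n)) * (?A ((1 / real (Suc n)) *\<^sub>R z) * \<zeta> z)" for n z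
 have "sbdd (%(\<mu>, j::unit) z. cr ((1 / \<mu>) ^ 1) * (?A (\<mu> *\<^sub>R z) * \<zeta> z)) ({0<..1} \<times> UNIV)"
  by (rule scaled_left[OF schwartz_sbdd[OF \<zeta>] A, where c="1/2"]) (use A0 in auto)
 from sbdd_reindex[OF this, where h="%n::nat. (1 / real (Suc n), ())" and K=UNIV]
 have fam: "sbdd fam UNIV"
  by (simp add: image_subset_iff fam_def[abs_def] mult_ac)
 define \<zeta>n where "\<zeta>n n z = \<Theta> ((1 / real (Suc n)) *\<^sub>R z) * \<zeta> z" for n z
 have \<zeta>ns: "schwartz (\<zeta>n n)" for n
  unfolding \<zeta>n_def[abs_def] by (intro bmul_schwartz_mult \<zeta> bmul_comp[OF schwartz_bmul[OF \<Theta>]] bounded_linear_scaleR_right)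
 have fams: "schwartz (fam n)" for n using sbdd_schwartz[OF fam] by simp
 have dec: "\<zeta> = (%z. \<zeta>n n z + cr (1 / real (Suc n)) * fam n z)" for n
 proof
  fix z
  have "cr (1 / real (Suc n)) * fam n z = ?A ((1 / real (Suc n)) *\<^sub>R z) * \<zeta> z"
   unfolding fam_def mult.assoc[symmetric] of_real_mult[symmetric] by simp
  then show "\<zeta> z = \<zeta>n n z + cr (1 / real (Suc n)) * fam n z" by (simp add: \<zeta>n_def algebra_simps)
 qed
 have test: "test_function (\<zeta>n n)" for n
 proof -
  have "{z. \<zeta>n n z ~= 0} \<subseteq> cball 0 (2 * real (Suc n))"
  proof
   fix z assume "z \<in> {z. \<zeta>n n z ~= 0}"
   then have "\<psi> (fst ((1 / real (Suc n)) *\<^sub>R z)) ~= 0" "\<psi> (snd ((1 / real (Suc n)) *\<^sub>R z)) ~= 0" by (auto simp: \<zeta>n_def \<Theta>_def)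
   from this[THEN lp_psi_supp[OF lp]] have "norm (fst z) <= real (Suc n)" "norm (snd z) <= real (Suc n)"
    by (auto simp: divide_le_eq)
   moreover have "norm z <= norm (fst z) + norm (snd z)" by (metis norm_Pair_le prod.collapse)
   ultimately show "z \<in> cball 0 (2 * real (Suc n))" by simp
  qed
  then have "bounded {z. \<zeta>n n z ~= 0}" using bounded_cball bounded_subset by blast
  then show ?thesis using \<zeta>ns[of n] by (simp add: test_function_def schwartz_def compact_closure)
 qed
 have eqn: "- f (Vop (\<zeta>n n)) = g (\<zeta>n n)" for n
 proof -
  have "(%(x, v). frechet_derivative (\<zeta>n n) (at (x, v)) (v, 0)) = Vop (\<zeta>n n)" by (auto simp: Vop_def fun_eq_iff)
  then show ?thesis using tr[unfolded transport_eq_def, rule_format, OF test[of n]] by (simp only:)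
 qed
 obtain Cg where Cg: "\<And>n. norm (g (fam n)) <= Cg" using tempered_bounded[OF g fam] by auto
 obtain Cf where Cf: "\<And>n. norm (f (Vop (fam n))) <= Cf" using tempered_bounded[OF f Vop_sbdd[OF fam]] by auto
 have le: "norm (g \<zeta> + f (Vop \<zeta>)) <= (Cg + Cf) / real (Suc n)" for n
 proof -
  let ?c = "cr (1 / real (Suc n))"
  have a: "g \<zeta> = g (\<zeta>n n) + ?c * g (fam n)"
   by (subst dec[of n]) (simp only: tempered_add[OF g \<zeta>ns schwartz_cmult[OF fams]] tempered_cmult[OF g fams])
  have b: "f (Vop \<zeta>) = f (Vop (\<zeta>n n)) + ?c * f (Vop (fam n))"
   by (subst dec[of n]) (simp only: Vop_add_cmult[OF \<zeta>ns fams] tempered_add[OF f Vop_schwartz[OF \<zeta>ns] schwartz_cmult[OF Vop_schwartz[OF fams]]] tempered_cmult[OF f Vop_schwartz[OF fams]])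
  have z: "g (\<zeta>n n) + f (Vop (\<zeta>n n)) = 0" unfolding eqn[symmetric] by simp
  have "g \<zeta> + f (Vop \<zeta>) = (g (\<zeta>n n) + f (Vop (\<zeta>n n))) + ?c * (g (fam n) + f (Vop (fam n)))"
   unfolding a b by (simp only: distrib_left add_ac)
  then have "g \<zeta> + f (Vop \<zeta>) = ?c * (g (fam n) + f (Vop (fam n)))" unfolding z by simp
  then have "norm (g \<zeta> + f (Vop \<zeta>)) = (1 / real (Suc n)) * norm (g (fam n) + f (Vop (fam n)))" by (simp only: norm_mult norm_of_real) simp
  also have "\<dots> <= (1 / real (Suc n)) * (Cg + Cf)"
   by (intro mult_left_mono order_trans[OF norm_triangle_ineq] add_mono Cg Cf) auto
  finally show ?thesis by simp
 qed
 have "(%n. (Cg + Cf) / real (Suc n)) \<longlonglongrightarrow> 0"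
  using tendsto_mult[OF tendsto_const[of "Cg + Cf"] LIMSEQ_inverse_real_of_nat] by (simp add: divide_inverse)
 then have "norm (g \<zeta> + f (Vop \<zeta>)) <= 0" by (rule LIMSEQ_le_const) (use le in auto)
 then show ?thesis by (simp add: add_eq_0_iff2)
qed

section \<open>Frequencies along the line of slope r\<close>

text \<open>The integer l with \<open>2^l \<le> s 2^k < 2^(l + 1)\<close>, by \<open>ll_bounds\<close>.\<close>

definition ll :: "int => real => int" where "ll k s = \<lfloor>log 2 s\<rfloor> + k"

lemma ll_bounds:
 assumes "0 < s" shows "2 powi (ll k s) <= s * 2 powi k" "s * 2 powi k < 2 powi (ll k s + 1)"
proof -
 have s: "s = 2 powr (log 2 s)" using assms by simp
 have p: "(2::real) powi n = 2 powr (real_of_int n)" for n by (simp add: powr_real_of_int')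
 have "2 powr (real_of_int \<lfloor>log 2 s\<rfloor>) <= 2 powr (log 2 s)" by (intro powr_mono) auto
 then show "2 powi (ll k s) <= s * 2 powi k" using s by (simp add: ll_def p powr_add mult_right_mono)
 have "2 powr (log 2 s) < 2 powr (real_of_int \<lfloor>log 2 s\<rfloor> + 1)" by (intro powr_less_mono) linarith+
 then have "s * 2 powr (real_of_int k) < 2 powr (real_of_int \<lfloor>log 2 s\<rfloor> + 1) * 2 powr (real_of_int k)"
  using s by (intro mult_strict_right_mono) auto
 then show "s * 2 powi k < 2 powi (ll k s + 1)" by (simp add: ll_def p powr_add mult_ac)
qed

lemma ll_measurable[measurable]: "ll k \<in> borel \<rightarrow>\<^sub>M count_space UNIV"
 unfolding ll_def[abs_def] by measurable

lemma ll_compose_measurable: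
 assumes "\<And>l. \<Phi> l \<in> bmeas" shows "(%r. \<Phi> (ll k r) r) \<in> bmeas"
 by (rule measurable_compose_countable[OF assms ll_measurable])

text \<open>Schwartz functions with spectrum in the annulus of the k-th block.\<close>

definition spec1 :: "int => ('a::euclidean_space => complex) => bool" where
 "spec1 k \<theta> \<longleftrightarrow> schwartz \<theta> \<and> (\<forall>\<xi>. inv_fourier \<theta> \<xi> ~= 0 --> 2 powi (k - 1) <= norm \<xi> \<and> norm \<xi> <= 2 powi (k + 1))"

lemma spec1_pd:
 fixes \<theta> :: "'a::euclidean_space => complex"
 assumes \<theta>: "spec1 k \<theta>" and b: "b \<in> Basis" shows "spec1 k (pd b \<theta>)"
proof -
 have s: "schwartz \<theta>" using \<theta> by (simp add: spec1_def)
 have "inv_fourier (pd b \<theta>) \<xi> = - \<i> * cr (\<xi> \<bullet> b) * inv_fourier \<theta> \<xi>" for \<xi>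
  unfolding inv_fourier_eq fourier_pd[OF schwartz_lev[OF s] b] by simp
 then show ?thesis using \<theta> schwartz_pd[OF s b] by (auto simp: spec1_def)
qed

text \<open>By \<open>inv_fourier_shten\<close>, \<open>norm \<xi>\<close> is comparable to \<open>2^k\<close> and \<eta> differs
from \<open>r \<xi>\<close> by at most \<open>2 \<epsilon>\<close>.\<close>

lemma shten_spec:
 fixes \<theta> \<kappa> :: "'a::euclidean_space => complex"
 assumes \<theta>: "spec1 k \<theta>" and \<kappa>: "schwartz \<kappa>" "\<And>\<zeta>. inv_fourier \<kappa> \<zeta> ~= 0 ==> norm \<zeta> <= 2"
  and \<epsilon>: "0 < \<epsilon>" "8 * \<epsilon> <= r * 2 powi k" and r: "0 < r"
  and l: "2 powi l1 <= r * 2 powi k" "r * 2 powi k <= 2 powi (l2 + 1)"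
  and nz: "inv_fourier (shten r \<epsilon> \<theta> \<kappa>) (\<xi>, \<eta>) ~= 0"
 shows "2 powi (k - 5) <= norm \<xi> \<and> norm \<xi> <= 2 powi (k + 5) \<and> 2 powi (l1 - 5) <= norm \<eta> \<and> norm \<eta> <= 2 powi (l2 + 5)"
proof -
 have \<theta>s: "schwartz \<theta>" using \<theta> by (simp add: spec1_def)
 have "inv_fourier \<theta> \<xi> ~= 0" "inv_fourier \<kappa> ((1 / \<epsilon>) *\<^sub>R (\<eta> - r *\<^sub>R \<xi>)) ~= 0"
  using nz unfolding inv_fourier_shten[OF \<theta>s \<kappa>(1), of \<epsilon>] using \<epsilon> by (auto simp: inv_fourier_shten[OF \<theta>s \<kappa>(1)])
 then have x: "2 powi (k - 1) <= norm \<xi>" "norm \<xi> <= 2 powi (k + 1)" and y: "norm ((1 / \<epsilon>) *\<^sub>R (\<eta> - r *\<^sub>R \<xi>)) <= 2"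
  using \<theta> \<kappa>(2) unfolding spec1_def by blast+
 have "norm (\<eta> - r *\<^sub>R \<xi>) / \<epsilon> <= 2" using y \<epsilon> unfolding norm_scaleR by simp
 then have y: "norm (\<eta> - r *\<^sub>R \<xi>) <= 2 * \<epsilon>" using \<epsilon> by (simp add: pos_divide_le_eq)
 let ?\<rho> = "r * 2 powi k"
 have rx: "?\<rho> / 2 <= norm (r *\<^sub>R \<xi>)" "norm (r *\<^sub>R \<xi>) <= 2 * ?\<rho>"
  using mult_left_mono[OF x(1), of r] mult_left_mono[OF x(2), of r] r by (auto simp: power_int_add power_int_diff)
 have t: "norm (r *\<^sub>R \<xi>) <= norm \<eta> + norm (\<eta> - r *\<^sub>R \<xi>)" "norm \<eta> <= norm (r *\<^sub>R \<xi>) + norm (\<eta> - r *\<^sub>R \<xi>)"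
  using norm_triangle_ineq4[of \<eta> "\<eta> - r *\<^sub>R \<xi>"] norm_triangle_ineq[of "r *\<^sub>R \<xi>" "\<eta> - r *\<^sub>R \<xi>"] by auto
 have e: "?\<rho> / 4 <= norm \<eta>" "norm \<eta> <= 4 * ?\<rho>" using t rx y \<epsilon> by linarith+
 have "(2::real) powi (l1 - 5) <= 2 powi l1 / 4" "4 * 2 powi (l2 + 1) <= (2::real) powi (l2 + 5)"
  "(2::real) powi (k - 5) <= 2 powi (k - 1)" "(2::real) powi (k + 1) <= 2 powi (k + 5)"
  by (simp_all add: power_int_add power_int_diff)
 then show ?thesis using e x l by linarith
qed

text \<open>The dispersion exponent d.\<close>

definition dd :: "ennreal => 'a::euclidean_space itself => real" where
 "dd p _ = real DIM('a) * (1 - enn2real (1 / p))"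

section \<open>The dispersive pairing estimate\<close>

text \<open>The dispersive estimate in dual form: for fixed x, \<open>w (x + r v)\<close> as a function of v is bounded by B and
has integral at most \<open>A / r^D\<close>; interpolate by Hoelder's inequality.\<close>

lemma shear_pair:
 fixes u :: "'a::euclidean_space \<times> 'a => complex" and w :: "'a => real"
 assumes u[measurable]: "u \<in> bmeas" and w[measurable]: "w \<in> bmeas"
  and A: "0 < A" "(NN x. ennreal (w x)) <= ennreal A" and B: "0 < B" "\<And>x. w x <= B" and p: "1 <= p" and r: "0 < r"
 shows "(NN z. ennreal (norm (u z)) * ennreal (w (stream r z)))
  <= ennreal (2 * A powr (1 - enn2real (1 / p)) * B powr enn2real (1 / p)) * ennreal (r powr - dd p TYPE('a)) * mix p u"
proof -
 let ?A = "A / r ^ DIM('a)"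
 have "(NN z. ennreal (norm (u z)) * ennreal (w (stream r z)))
  <= ennreal (2 * ?A powr (1 - enn2real (1 / p)) * B powr enn2real (1 / p)) * mix p u"
 proof (rule mix_pair)
  show "(%z. ennreal (w (stream r z))) \<in> bmeas"
  proof -
   have "(%z::'a\<times>'a. stream r z) \<in> bmeas"
    by (intro borel_measurable_continuous_onI continuous_intros)
   from measurable_compose[OF this w] show ?thesis by measurable
  qed
  fix x :: 'a
  have "(NN v. ennreal (w (fst (x, v) + r *\<^sub>R snd (x, v)))) = (NN v. (%y. ennreal (w y)) (x + r *\<^sub>R v))" by simp
  also have "\<dots> = ennreal (1 / r ^ DIM('a)) * (NN x. ennreal (w x))"
   by (subst nn_integral_affine) (use r in auto)
  also have "\<dots> <= ennreal (1 / r ^ DIM('a)) * ennreal A" by (intro mult_left_mono A) auto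
  also have "\<dots> = ennreal ?A" using r A(1) by (subst ennreal_mult[symmetric]) auto
  finally show "(NN v. ennreal (w (fst (x, v) + r *\<^sub>R snd (x, v)))) <= ennreal ?A" .
 qed (use assms in \<open>auto intro: ennreal_leI\<close>)
 also have "?A powr (1 - enn2real (1 / p)) = A powr (1 - enn2real (1 / p)) * r powr - dd p TYPE('a)"
 proof -
  have "?A powr (1 - enn2real (1 / p)) = A powr (1 - enn2real (1 / p)) / (r powr real DIM('a)) powr (1 - enn2real (1 / p))"
   using A(1) r by (simp add: powr_divide powr_realpow)
  then show ?thesis by (simp add: powr_powr dd_def powr_minus_divide)
 qed
 also have "2 * (A powr (1 - enn2real (1 / p)) * r powr - dd p TYPE('a)) * B powr enn2real (1 / p)
   = (2 * A powr (1 - enn2real (1 / p)) * B powr enn2real (1 / p)) * r powr - dd p TYPE('a)" by simp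
 also have "ennreal \<dots> = ennreal (2 * A powr (1 - enn2real (1 / p)) * B powr enn2real (1 / p)) * ennreal (r powr - dd p TYPE('a))"
  by (rule ennreal_mult) auto
 finally show ?thesis .
qed

text \<open>The pairing of \<open>\<integral> h (x - r v, v) dv\<close> with \<theta>, restricted to the blocks of h that matter
when \<theta> has frequency \<open>2^k\<close>.\<close>

definition Av :: "(int => int => int => 'a::euclidean_space \<times> 'a => complex) => int => real => ('a => complex) => complex" where
 "Av H k r \<theta> = (LINT z|lborel. H k (ll k r) (ll k r) z * \<theta> (stream r z))"

lemma shear_measurable: "(%z::'a::euclidean_space\<times>'a. stream r z) \<in> bmeas"
 by (intro borel_measurable_continuous_onI continuous_intros)

text \<open>Increased by one to be positive, as the pairing estimates require.\<close>

definition l1n :: "('a::euclidean_space => complex) => real" where "l1n \<theta> = (LINT x|lborel. norm (\<theta> x)) + 1"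

lemma l1n: "integrable lborel \<theta> ==> 0 < l1n \<theta>" "integrable lborel \<theta> ==> (NN x. ennreal (norm (\<theta> x))) <= ennreal (l1n \<theta>)"
proof -
 show "0 < l1n \<theta>" unfolding l1n_def by (intro add_nonneg_pos integral_nonneg_AE) auto
 assume i: "integrable lborel \<theta>"
 have "(NN x. ennreal (norm (\<theta> x))) = ennreal (LINT x|lborel. norm (\<theta> x))"
  using i by (intro nn_integral_eq_integral) auto
 also have "\<dots> <= ennreal (l1n \<theta>)" by (intro ennreal_leI) (simp add: l1n_def)
 finally show "(NN x. ennreal (norm (\<theta> x))) <= ennreal (l1n \<theta>)" .
qed

text \<open>The constant in the pairing estimates.\<close>

definition hc :: "ennreal => real => real => real" where
 "hc p A B = 2 * A powr (1 - enn2real (1 / p)) * B powr enn2real (1 / p)"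

lemma hc_nonneg: "0 <= hc p A B" by (simp add: hc_def)

lemma shear_integrable:
 fixes u :: "'a::euclidean_space \<times> 'a => complex"
 assumes u[measurable]: "u \<in> bmeas" and m: "mix p u < top" and w[measurable]: "w \<in> bmeas"
  and A: "0 < A" "(NN x. ennreal (w x)) <= ennreal A" and B: "0 < B" "\<And>x. w x <= B" "\<And>x. 0 <= w x" and p: "1 <= p" and r: "0 < r"
 shows "integrable lborel (%z. norm (u z) * w (stream r z))"
  and "(LINT z|lborel. norm (u z) * w (stream r z)) <= hc p A B * r powr - dd p TYPE('a) * enn2real (mix p u)"
proof -
 have [measurable]: "(%z::'a\<times>'a. w (stream r z)) \<in> bmeas"
  by (rule measurable_compose[OF shear_measurable w])
 have le: "(NN z. ennreal (norm (u z) * w (stream r z))) <= ennreal (hc p A B * r powr - dd p TYPE('a) * enn2real (mix p u))"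
 proof -
  have "(NN z. ennreal (norm (u z) * w (stream r z))) = (NN z. ennreal (norm (u z)) * ennreal (w (stream r z)))"
   using B(3) by (simp add: ennreal_mult)
  also have "\<dots> <= ennreal (hc p A B) * ennreal (r powr - dd p TYPE('a)) * mix p u"
   unfolding hc_def by (rule shear_pair[OF u w A B(1,2) p r])
  also have "\<dots> = ennreal (hc p A B * r powr - dd p TYPE('a) * enn2real (mix p u))"
   using m by (simp add: ennreal_mult hc_nonneg)
  finally show ?thesis .
 qed
 show i: "integrable lborel (%z. norm (u z) * w (stream r z))"
  by (rule integrableI_nonneg) (use le B(3) in \<open>auto intro: le_less_trans\<close>)
 have "ennreal (LINT z|lborel. norm (u z) * w (stream r z)) = (NN z. ennreal (norm (u z) * w (stream r z)))"
  by (rule nn_integral_eq_integral[symmetric, OF i]) (use B(3) in auto)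
 with le have "ennreal (LINT z|lborel. norm (u z) * w (stream r z)) <= ennreal (hc p A B * r powr - dd p TYPE('a) * enn2real (mix p u))"
  by simp
 moreover have "0 <= hc p A B * r powr - dd p TYPE('a) * enn2real (mix p u)" by (intro mult_nonneg_nonneg hc_nonneg) auto
 ultimately show "(LINT z|lborel. norm (u z) * w (stream r z)) <= hc p A B * r powr - dd p TYPE('a) * enn2real (mix p u)"
  by (simp only: ennreal_le_iff)
qed

lemma dominated_convergence_at_right_AE:
 fixes s :: "real => 'a => 'b::{banach, second_countable_topology}"
 assumes "f \<in> borel_measurable M" "\<And>\<epsilon>. \<epsilon> > 0 ==> s \<epsilon> \<in> borel_measurable M" "integrable M w"
  and lim: "AE x in M. ((%\<epsilon>. s \<epsilon> x) \<longlongrightarrow> f x) (at_right 0)"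
  and bound: "\<And>\<epsilon>. \<epsilon> > 0 ==> AE x in M. norm (s \<epsilon> x) <= w x"
 shows "((%\<epsilon>. integral\<^sup>L M (s \<epsilon>)) \<longlongrightarrow> integral\<^sup>L M f) (at_right 0)"
 unfolding tendsto_at_iff_sequentially
proof (intro allI impI)
 fix X :: "nat => real" assume X: "\<forall>i. X i \<in> {0<..} - {0}" "X \<longlonglongrightarrow> 0"
 show "((%\<epsilon>. integral\<^sup>L M (s \<epsilon>)) \<circ> X) \<longlonglongrightarrow> integral\<^sup>L M f" unfolding o_def
 proof (rule integral_dominated_convergence[where w=w])
  show "AE x in M. (%i. s (X i) x) \<longlonglongrightarrow> f x"
   using lim
  proof eventually_elim
   case (elim x)
   then show ?case using X unfolding tendsto_at_iff_sequentially o_def by blast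
  qed
  show "AE x in M. norm (s (X i) x) <= w x" for i using bound X by auto
 qed (use assms X in auto)
qed

lemma conj_exp_le_1: "1 <= p ==> enn2real (1 / p) <= 1"
proof -
 assume p: "1 <= p"
 then have "0 < p" by (rule less_le_trans[rotated]) simp
 then have "1 / p <= 1" using p by (intro divide_le_posI_ennreal) auto
 then show ?thesis by (metis enn2real_1 enn2real_mono ennreal_one_less_top)
qed

lemma dd_nonneg: "1 <= p ==> 0 <= dd p TYPE('a::euclidean_space)"
 using conj_exp_le_1[of p] by (simp add: dd_def)

section \<open>Weighted sequence estimates\<close>

abbreviation "wt2 k s \<equiv> ennreal (2 powr (of_int k * s))"
abbreviation "lq q \<equiv> Lp_norm q (count_space UNIV)"

text \<open>With rows and columns bounded by the same S the constant does not depend on q.\<close>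

lemma schur_count:
 fixes k :: "int => int \<times> int => ennreal"
 assumes S: "0 < S" "q ~= 1 ==> (\<And>x. (\<integral>\<^sup>+v. k x v \<partial>count_space UNIV) <= ennreal S)"
  "\<And>v. (\<integral>\<^sup>+x. k x v \<partial>count_space UNIV) <= ennreal S" and q: "1 <= q"
  and le: "\<And>x. f x <= (\<integral>\<^sup>+v. h v * k x v \<partial>count_space UNIV)"
 shows "lq q f <= ennreal (2 * S) * lq q h"
proof -
 have "lq q f <= lq q (%x. \<integral>\<^sup>+v. h v * k x v \<partial>count_space UNIV)"
  by (rule Lp_norm_mono_AE[OF _ _ q]) (use le in auto)
 also have "\<dots> <= ennreal (2 * S powr (1 - enn2real (1 / q)) * S powr (enn2real (1 / q))) * lq q h"
  by (rule schur_test) (use S q in \<open>auto simp: sigma_finite_measure_count_space pair_measure_countable\<close>)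
 also have "2 * S powr (1 - enn2real (1 / q)) * S powr (enn2real (1 / q)) = 2 * S"
  using S(1) by (simp add: powr_add[symmetric] mult.assoc)
 finally show ?thesis .
qed

lemma near_sum: "(\<Sum>z\<in>near k l1 l2. h z) = (\<integral>\<^sup>+z. h z * indicator (near k l1 l2) z \<partial>count_space UNIV)"
proof -
 have f: "finite (near k l1 l2)" by (simp add: near_def)
 have "(\<Sum>z\<in>near k l1 l2. h z) = (\<integral>\<^sup>+z. h z \<partial>count_space (near k l1 l2))" by (rule nn_integral_count_space_finite[OF f, symmetric])
 then show ?thesis by (simp add: nn_integral_count_space_indicator)
qed

lemma count_interval: "(\<integral>\<^sup>+(k::int). ennreal c * indicator {i - 6..i + 6} k \<partial>count_space UNIV) = 13 * ennreal c"
 by (subst nn_integral_cmult) (simp_all add: mult.commute)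

lemma ll_powr: "ll k (2 powr x) = \<lfloor>x\<rfloor> + k" by (simp add: ll_def)

text \<open>With \<open>t k 2^k = 2^(L + m k)\<close> the weights cancel up to the factor \<open>2^(-(\<alpha> + d) L)\<close>,
and the matrix is banded: i is within 6 of k, and j within 6 of the integer part of \<open>L + m k\<close>, so there
are \<open>13 * 13 = 169\<close> entries per row.\<close>

lemma lq_first:
 fixes N :: "int \<times> int => ennreal" and a \<alpha> d m s L :: real
 assumes q: "1 <= q" and s: "s + d - a = m * (\<alpha> + d)"
  and T: "\<And>k. t k = 2 powr (L + m * of_int k - of_int k)"
 shows "lq q (%k. wt2 k s * (ennreal (t k powr - d) * (\<Sum>z\<in>near k (ll k (t k)) (ll k (t k)). N z)))
  <= ennreal (338 * 2 powr (6 * \<bar>a\<bar> + 7 * \<bar>\<alpha>\<bar> - (\<alpha> + d) * L))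
    * lq q (%(k, l). wt2 k a * wt2 l \<alpha> * N (k, l))"
proof -
 let ?c = "2 powr (6 * \<bar>a\<bar> + 7 * \<bar>\<alpha>\<bar> - (\<alpha> + d) * L)"
 let ?h = "%(k, l). wt2 k a * wt2 l \<alpha> * N (k, l)"
 let ?l = "%k. ll k (t k)"
 let ?K = "%k z. ennreal ?c * indicator (near k (?l k) (?l k)) z"
 have coef: "2 powr (of_int k * s) * t k powr - d <= 2 powr (of_int i * a) * 2 powr (of_int j * \<alpha>) * ?c"
  if z: "(i, j) \<in> near k (?l k) (?l k)" for i j k
 proof -
  define x where "x = L + m * real_of_int k"
  have "?l k = \<lfloor>x\<rfloor>" unfolding T ll_powr x_def by linarith
  then have j: "\<bar>real_of_int j - x\<bar> <= 7" "\<bar>real_of_int i - real_of_int k\<bar> <= 6" using z by (auto simp: near_def abs_le_iff) linarith+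
  have "- ((real_of_int i - real_of_int k) * a) <= 6 * \<bar>a\<bar>"
   using mult_right_mono[OF j(2), of "\<bar>a\<bar>"] abs_ge_minus_self[of "(real_of_int i - real_of_int k) * a"] by (simp add: abs_mult)
  moreover have "- ((real_of_int j - x) * \<alpha>) <= 7 * \<bar>\<alpha>\<bar>"
   using mult_right_mono[OF j(1), of "\<bar>\<alpha>\<bar>"] abs_ge_minus_self[of "(real_of_int j - x) * \<alpha>"] by (simp add: abs_mult)
  moreover have "of_int k * s + (x - of_int k) * (- d) = of_int k * a + x * \<alpha> - (\<alpha> + d) * L"
  proof -
   have "of_int k * (s + d - a) = of_int k * (m * (\<alpha> + d))" using s by simp
   then show ?thesis by (simp add: x_def algebra_simps)
  qed
  ultimately have "of_int k * s + (x - of_int k) * (- d) <= of_int i * a + of_int j * \<alpha> + (6 * \<bar>a\<bar> + 7 * \<bar>\<alpha>\<bar> - (\<alpha> + d) * L)"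
   by (simp add: algebra_simps)
  then have "2 powr (of_int k * s + (x - of_int k) * (- d)) <= 2 powr (of_int i * a + of_int j * \<alpha> + (6 * \<bar>a\<bar> + 7 * \<bar>\<alpha>\<bar> - (\<alpha> + d) * L))"
   by (intro powr_mono) auto
  then show ?thesis by (simp add: T x_def powr_powr powr_add[symmetric])
 qed
 have "lq q (%k. wt2 k s * (ennreal (t k powr - d) * (\<Sum>z\<in>near k (?l k) (?l k). N z)))
  <= ennreal (2 * (169 * ?c)) * lq q ?h"
 proof (rule schur_count[where k="?K"])
  show "(\<integral>\<^sup>+v. ?K x v \<partial>count_space UNIV) <= ennreal (169 * ?c)" for x
  proof -
   have "(\<integral>\<^sup>+v. ?K x v \<partial>count_space UNIV) = (\<Sum>z\<in>near x (?l x) (?l x). ennreal ?c)" unfolding near_sum ..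
   also have "\<dots> = ennreal (169 * ?c)" by (simp add: near_def ennreal_mult)
   finally show ?thesis by simp
  qed
  show "(\<integral>\<^sup>+x. ?K x v \<partial>count_space UNIV) <= ennreal (169 * ?c)" for v
  proof -
   have "(\<integral>\<^sup>+x. ?K x v \<partial>count_space UNIV) <= (\<integral>\<^sup>+x. ennreal ?c * indicator {fst v - 6..fst v + 6} x \<partial>count_space UNIV)"
    by (intro nn_integral_mono mult_left_mono) (auto simp: near_def indicator_def)
   also have "\<dots> = ennreal (13 * ?c)" unfolding count_interval by (simp add: ennreal_mult)
   also have "\<dots> <= ennreal (169 * ?c)" by (intro ennreal_leI) simp
   finally show ?thesis .
  qed
  fix k
  have "wt2 k s * (ennreal (t k powr - d) * (\<Sum>z\<in>near k (?l k) (?l k). N z))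
   = (\<integral>\<^sup>+z. wt2 k s * (ennreal (t k powr - d) * (N z * indicator (near k (?l k) (?l k)) z)) \<partial>count_space UNIV)"
   unfolding near_sum by (simp add: nn_integral_cmult)
  also have "\<dots> <= (\<integral>\<^sup>+z. ?h z * ?K k z \<partial>count_space UNIV)"
  proof (intro nn_integral_mono)
   fix z :: "int \<times> int"
   obtain i j where z: "z = (i, j)" by (cases z)
   show "wt2 k s * (ennreal (t k powr - d) * (N z * indicator (near k (?l k) (?l k)) z)) <= ?h z * ?K k z"
   proof (cases "z \<in> near k (?l k) (?l k)")
    case True
    have "ennreal (2 powr (of_int k * s) * t k powr - d) * N z <= ennreal (2 powr (of_int i * a) * 2 powr (of_int j * \<alpha>) * ?c) * N z"
     using coef[of i j k] True z by (intro mult_right_mono ennreal_leI) auto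
    then show ?thesis using True z by (simp add: ennreal_mult mult_ac)
   qed simp
  qed
  finally show "wt2 k s * (ennreal (t k powr - d) * (\<Sum>z\<in>near k (?l k) (?l k). N z)) <= (\<integral>\<^sup>+z. ?h z * ?K k z \<partial>count_space UNIV)" .
 qed (use q in auto)
 then show ?thesis by simp
qed

text \<open>The sum of the geometric series of ratio \<open>2^(-\<delta>)\<close>; 1 for \<open>\<delta> = 0\<close>, where only
column sums are used.\<close>

definition geo :: "real => real" where "geo \<delta> = (if 0 < \<delta> then 1 / (1 - 2 powr - \<delta>) else 1)"

lemma powr_neg_less_1: "0 < \<delta> ==> 2 powr - \<delta> < (1::real)"
 using powr_less_mono[of "- \<delta>" 0 2] by simp

lemma geo_ge_1: "1 <= geo \<delta>" using powr_neg_less_1[of \<delta>] by (auto simp: geo_def le_divide_eq)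

lemma geometric_half_line:
 fixes x \<delta> :: real
 assumes "0 < \<delta>"
 shows "(\<integral>\<^sup>+j. ennreal (2 powr ((of_int j - x) * \<delta>)) * indicator {j. of_int j - 6 <= x} (j::int) \<partial>count_space UNIV) <= ennreal (2 powr (6 * \<delta>) * geo \<delta>)"
proof -
 let ?N = "\<lfloor>x\<rfloor> + 6"
 have eq: "{j::int. of_int j - 6 <= x} = {..?N}" by (auto simp: le_floor_iff)
   (metis (no_types) add.commute diff_le_eq le_floor_iff of_int_diff of_int_numeral)+
 have bij: "bij_betw (%n. ?N - int n) UNIV {..?N}"
  by (rule bij_betwI[where g="%j. nat (?N - j)"]) auto
 have "(\<integral>\<^sup>+j. ennreal (2 powr ((of_int j - x) * \<delta>)) * indicator {j. of_int j - 6 <= x} (j::int) \<partial>count_space UNIV)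
   = (\<integral>\<^sup>+j. ennreal (2 powr ((of_int j - x) * \<delta>)) \<partial>count_space {..?N})"
  unfolding eq by (simp add: nn_integral_count_space_indicator)
 also have "\<dots> = (\<integral>\<^sup>+n. ennreal (2 powr ((of_int (?N - int n) - x) * \<delta>)) \<partial>count_space UNIV)"
  by (rule nn_integral_bij_count_space[OF bij, symmetric])
 also have "\<dots> <= (\<integral>\<^sup>+n. ennreal (2 powr (6 * \<delta>) * (2 powr - \<delta>) ^ n) \<partial>count_space UNIV)"
 proof (intro nn_integral_mono ennreal_leI)
  fix n
  have "(of_int (?N - int n) - x) * \<delta> <= (6 - real n) * \<delta>" using assms by (intro mult_right_mono) auto
  then have "2 powr ((of_int (?N - int n) - x) * \<delta>) <= 2 powr ((6 - real n) * \<delta>)" by (intro powr_mono) auto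
  also have "\<dots> = 2 powr (6 * \<delta>) * (2 powr - \<delta>) ^ n"
   by (simp add: powr_realpow[symmetric] powr_powr powr_add[symmetric] algebra_simps)
  finally show "2 powr ((of_int (?N - int n) - x) * \<delta>) <= 2 powr (6 * \<delta>) * (2 powr - \<delta>) ^ n" .
 qed
 also have "\<dots> = (\<Sum>n. ennreal (2 powr (6 * \<delta>) * (2 powr - \<delta>) ^ n))" by (rule nn_integral_count_space_nat)
 also have "\<dots> = ennreal (2 powr (6 * \<delta>) * geo \<delta>)"
 proof (rule suminf_ennreal_eq)
  have "(%n. (2 powr - \<delta>) ^ n) sums (1 / (1 - 2 powr - \<delta>))" using powr_neg_less_1[OF assms] by (intro geometric_sums) simp
  from sums_mult[OF this, of "2 powr (6 * \<delta>)"]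
  show "(%n. 2 powr (6 * \<delta>) * (2 powr - \<delta>) ^ n) sums (2 powr (6 * \<delta>) * geo \<delta>)"
   using assms by (simp add: geo_def)
 qed simp
 finally show ?thesis .
qed

text \<open>The block (i, j) of g enters for r between \<open>2^(j - k - 6)\<close> and \<open>2^(j - k + 7)\<close>, provided
this meets the interval of integration, which forces \<open>j - 6 \<le> L + m k\<close>. The integral of
\<open>r^(-d)\<close> over that range is of order \<open>2^((j - k) (1 - d))\<close>. After cancellation of the
weights there remains \<open>2^(\<delta> (j - L - m k))\<close>, which is summable over j if \<open>\<delta> >
0\<close>, and bounded if \<open>\<delta> = 0\<close>.\<close>

lemma lq_second:
 fixes N :: "int \<times> int => ennreal" and b \<beta> d m s L :: real
 assumes q: "1 <= q" and s: "s - b - 1 + d + m * \<delta> = 0" and \<delta>: "\<delta> = 1 - d - \<beta>" "0 <= \<delta>" "q ~= 1 ==> 0 < \<delta>"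
  and T: "\<And>k. t k = 2 powr (L + m * of_int k - of_int k)"
 shows "lq q (%k. wt2 k s *
    (NN r. indicator {0<..<t k} r * (ennreal (r powr - d) * (\<Sum>z\<in>near k (ll k r) (ll k r). N z))))
  <= ennreal (26 * geo \<delta> * 2 powr (7 * \<bar>d\<bar> + 7 + 6 * \<bar>b\<bar> + 6 * \<delta> + \<delta> * L))
    * lq q (%(k, l). wt2 k b * wt2 l \<beta> * N (k, l))"
proof -
 define x where "x k = L + m * real_of_int k" for k
 let ?c = "2 powr (7 * \<bar>d\<bar> + 7 + 6 * \<bar>b\<bar> + \<delta> * L)"
 let ?h = "%(k, l). wt2 k b * wt2 l \<beta> * N (k, l)"
 let ?K = "%k (i, j). ennreal ?c * (indicator {k - 6..k + 6} i * (ennreal (2 powr ((of_int j - x k) * \<delta>)) * indicator {j. of_int j - 6 <= x k} j))"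
 let ?S = "13 * ?c * (2 powr (6 * \<delta>) * geo \<delta>)"
 let ?J = "%k z r. indicator {0<..<t k} r * (ennreal (r powr - d) * indicator (near k (ll k r) (ll k r)) z)"
 have Jm: "(%r. ?J k z r) \<in> borel_measurable lborel" for k z
 proof -
  have "(%r. indicator (near k (ll k r) (ll k r)) z :: ennreal) \<in> bmeas"
   by (rule ll_compose_measurable[of "%l r. indicator (near k l l) z"]) simp
  then show ?thesis by simp
 qed
 have J: "(NN r. ?J k (i, j) r) <= ennreal (2 powr ((of_int j - of_int k) * (1 - d) + 7 * \<bar>d\<bar> + 7)) * (indicator {k - 6..k + 6} i * indicator {j. of_int j - 6 <= x k} j)" for k i j
 proof -
  let ?e = "real_of_int j - real_of_int k"
  have pt: "?J k (i, j) r <= ennreal (2 powr (- d * ?e + 7 * \<bar>d\<bar>)) * (indicator {k - 6..k + 6} i * indicator {j. of_int j - 6 <= x k} j) * indicator {0..2 powr (?e + 7)} r" for r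
  proof (cases "0 < r \<and> r < t k \<and> (i, j) \<in> near k (ll k r) (ll k r)")
   case True
   define y where "y = log 2 r"
   have r: "r = 2 powr y" using True by (simp add: y_def)
   have l: "ll k r = \<lfloor>y\<rfloor> + k" by (simp add: ll_def y_def)
   have i: "i \<in> {k - 6..k + 6}" using True by (simp add: near_def)
   have "\<lfloor>y\<rfloor> + k - 6 <= j" "j <= \<lfloor>y\<rfloor> + k + 6" using True by (simp_all add: near_def l)
   then have j: "?e - 6 <= y" "y <= ?e + 7" by linarith+
   have "y < x k - of_int k"
   proof -
    have "2 powr y < 2 powr (x k - of_int k)" using True T[of k] r by (simp add: x_def)
    then show ?thesis by simp
   qed
   then have jx: "of_int j - 6 <= x k" using j by linarith
   have "- ((y - ?e) * d) <= 7 * \<bar>d\<bar>"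
   proof -
    have "\<bar>y - ?e\<bar> <= 7" using j by linarith
    from mult_right_mono[OF this, of "\<bar>d\<bar>"] abs_ge_minus_self[of "(y - ?e) * d"] show ?thesis by (simp add: abs_mult)
   qed
   then have "y * (- d) <= - d * ?e + 7 * \<bar>d\<bar>" by (simp add: algebra_simps)
   then have "r powr - d <= 2 powr (- d * ?e + 7 * \<bar>d\<bar>)" unfolding r powr_powr by (intro powr_mono) auto
   then have "ennreal (r powr - d) <= ennreal (2 powr (- d * ?e + 7 * \<bar>d\<bar>))" by (rule ennreal_leI)
   moreover have "r \<in> {0..2 powr (?e + 7)}" using r j(2) by (simp add: powr_mono)
   ultimately show ?thesis using True i jx by simp
  next
   case False
   then have z: "?J k (i, j) r = 0" by (auto simp: indicator_def)
   show ?thesis unfolding z by (rule zero_le)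
  qed
  have "(NN r. ?J k (i, j) r) <= (NN r. ennreal (2 powr (- d * ?e + 7 * \<bar>d\<bar>)) * (indicator {k - 6..k + 6} i * indicator {j. of_int j - 6 <= x k} j) * indicator {0..2 powr (?e + 7)} r)"
   by (intro nn_integral_mono pt)
  also have "\<dots> = ennreal (2 powr (- d * ?e + 7 * \<bar>d\<bar>)) * (indicator {k - 6..k + 6} i * indicator {j. of_int j - 6 <= x k} j) * ennreal (2 powr (?e + 7))"
   by (subst nn_integral_cmult) (auto simp: emeasure_lborel_Icc_eq)
  also have "\<dots> = ennreal (2 powr (- d * ?e + 7 * \<bar>d\<bar>) * 2 powr (?e + 7)) * (indicator {k - 6..k + 6} i * indicator {j. of_int j - 6 <= x k} j)"
   by (simp add: ennreal_mult mult_ac)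
  also have "2 powr (- d * ?e + 7 * \<bar>d\<bar>) * 2 powr (?e + 7) = 2 powr (?e * (1 - d) + 7 * \<bar>d\<bar> + 7)"
   by (simp add: powr_add[symmetric] algebra_simps)
  finally show ?thesis .
 qed
 have coef: "2 powr (of_int k * s) * 2 powr ((of_int j - of_int k) * (1 - d) + 7 * \<bar>d\<bar> + 7)
   <= 2 powr (of_int i * b) * 2 powr (of_int j * \<beta>) * (?c * 2 powr ((of_int j - x k) * \<delta>))" if i: "i \<in> {k - 6..k + 6}" for i j k
 proof -
  have "\<bar>real_of_int i - real_of_int k\<bar> <= 6" using i by (auto simp: abs_le_iff)
  from mult_right_mono[OF this, of "\<bar>b\<bar>"] abs_ge_minus_self[of "(real_of_int i - real_of_int k) * b"]
  have "- ((real_of_int i - real_of_int k) * b) <= 6 * \<bar>b\<bar>" by (simp add: abs_mult)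
  moreover have "of_int k * s + (of_int j - of_int k) * (1 - d) = of_int k * b + of_int j * \<beta> + (\<delta> * L + (of_int j - x k) * \<delta>)"
  proof -
   have "of_int k * (s - b - 1 + d + m * \<delta>) = 0" unfolding s by simp
   moreover have "of_int j * (1 - d) = of_int j * \<beta> + of_int j * \<delta>" by (simp add: \<delta>(1) algebra_simps)
   ultimately show ?thesis unfolding x_def by (simp add: algebra_simps)
  qed
  ultimately have "of_int k * s + ((of_int j - of_int k) * (1 - d) + 7 * \<bar>d\<bar> + 7)
   <= of_int i * b + of_int j * \<beta> + ((7 * \<bar>d\<bar> + 7 + 6 * \<bar>b\<bar> + \<delta> * L) + (of_int j - x k) * \<delta>)"
   by (simp add: algebra_simps)
  then have "2 powr (of_int k * s + ((of_int j - of_int k) * (1 - d) + 7 * \<bar>d\<bar> + 7))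
   <= 2 powr (of_int i * b + of_int j * \<beta> + ((7 * \<bar>d\<bar> + 7 + 6 * \<bar>b\<bar> + \<delta> * L) + (of_int j - x k) * \<delta>))" by (intro powr_mono) auto
  then show ?thesis by (simp only: powr_add)
 qed
 have "lq q (%k. wt2 k s *
    (NN r. indicator {0<..<t k} r * (ennreal (r powr - d) * (\<Sum>z\<in>near k (ll k r) (ll k r). N z))))
   <= ennreal (2 * ?S) * lq q ?h"
 proof (rule schur_count[where k="?K"])
  show "0 < ?S" using geo_ge_1[of \<delta>] by simp
  show "(\<integral>\<^sup>+v. ?K k v \<partial>count_space UNIV) <= ennreal ?S" if "q ~= 1" for k
  proof -
   let ?g = "\<integral>\<^sup>+j. ennreal (2 powr ((of_int j - x k) * \<delta>)) * indicator {j. of_int j - 6 <= x k} (j::int) \<partial>count_space UNIV"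
   have "(\<integral>\<^sup>+v. ?K k v \<partial>count_space UNIV) = (\<integral>\<^sup>+i. \<integral>\<^sup>+j. ?K k (i, j) \<partial>count_space UNIV \<partial>count_space UNIV)"
    by (rule nn_integral_fst_count_space[symmetric])
   also have "\<dots> = (\<integral>\<^sup>+i. ennreal ?c * indicator {k - 6..k + 6} i * ?g \<partial>count_space UNIV)"
    by (intro nn_integral_cong) (simp add: nn_integral_cmult mult.assoc)
   also have "\<dots> = (\<integral>\<^sup>+i. ennreal ?c * indicator {k - 6..k + 6} i \<partial>count_space UNIV) * ?g"
    by (rule nn_integral_multc) simp
   also have "\<dots> = 13 * ennreal ?c * ?g" unfolding count_interval ..
   also have "\<dots> <= 13 * ennreal ?c * ennreal (2 powr (6 * \<delta>) * geo \<delta>)"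
    using \<delta>(3)[OF that] by (intro mult_left_mono geometric_half_line) auto
   also have "\<dots> = ennreal ?S" using geo_ge_1[of \<delta>] by (simp add: ennreal_mult)
   finally show ?thesis .
  qed
  show "(\<integral>\<^sup>+k. ?K k v \<partial>count_space UNIV) <= ennreal ?S" for v
  proof -
   obtain i j where v: "v = (i, j)" by (cases v)
   have "(\<integral>\<^sup>+k. ?K k v \<partial>count_space UNIV) <= (\<integral>\<^sup>+k. ennreal (?c * 2 powr (6 * \<delta>)) * indicator {i - 6..i + 6} k \<partial>count_space UNIV)"
   proof (intro nn_integral_mono)
    fix k :: int
    show "?K k v <= ennreal (?c * 2 powr (6 * \<delta>)) * indicator {i - 6..i + 6} k"
    proof (cases "i \<in> {k - 6..k + 6} \<and> of_int j - 6 <= x k")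
     case True
     have "(of_int j - x k) * \<delta> <= 6 * \<delta>" using True \<delta>(2) by (intro mult_right_mono) auto
     then have "2 powr ((of_int j - x k) * \<delta>) <= 2 powr (6 * \<delta>)" by (intro powr_mono) auto
     then have "ennreal (?c * 2 powr ((of_int j - x k) * \<delta>)) <= ennreal (?c * 2 powr (6 * \<delta>))"
      by (intro ennreal_leI mult_left_mono) auto
     then show ?thesis using True by (simp add: v ennreal_mult indicator_def)
    next
     case False then show ?thesis by (auto simp: v indicator_def)
    qed
   qed
   also have "\<dots> = 13 * ennreal (?c * 2 powr (6 * \<delta>))" by (rule count_interval)
   also have "\<dots> = ennreal (13 * ?c * 2 powr (6 * \<delta>) * 1)" by (simp add: ennreal_mult mult.assoc)
   also have "\<dots> <= ennreal ?S" using geo_ge_1[of \<delta>] unfolding mult.assoc by (intro ennreal_leI mult_left_mono) auto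
   finally show ?thesis .
  qed
  fix k
  have "(NN r. indicator {0<..<t k} r * (ennreal (r powr - d) * (\<Sum>z\<in>near k (ll k r) (ll k r). N z)))
   = (NN r. \<integral>\<^sup>+z. N z * ?J k z r \<partial>count_space UNIV)"
   unfolding near_sum
   by (intro nn_integral_cong) (simp add: nn_integral_cmult[symmetric] mult_ac)
  also have "\<dots> = (\<integral>\<^sup>+z. (NN r. N z * ?J k z r) \<partial>count_space UNIV)"
   by (rule nn_integral_count_space_nn_integral) (use Jm in auto)
  also have "\<dots> = (\<integral>\<^sup>+z. N z * (NN r. ?J k z r) \<partial>count_space UNIV)"
   by (intro nn_integral_cong nn_integral_cmult Jm)
  finally have "wt2 k s * (NN r. indicator {0<..<t k} r * (ennreal (r powr - d) * (\<Sum>z\<in>near k (ll k r) (ll k r). N z)))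
   = (\<integral>\<^sup>+z. wt2 k s * (N z * (NN r. ?J k z r)) \<partial>count_space UNIV)"
   by (simp add: nn_integral_cmult)
  also have "\<dots> <= (\<integral>\<^sup>+z. ?h z * ?K k z \<partial>count_space UNIV)"
  proof (intro nn_integral_mono)
   fix z :: "int \<times> int"
   obtain i j where z: "z = (i, j)" by (cases z)
   let ?I = "indicator {k - 6..k + 6} i * indicator {j. of_int j - 6 <= x k} j :: ennreal"
   have "wt2 k s * (N z * (NN r. ?J k z r))
    <= wt2 k s * (N z * (ennreal (2 powr ((of_int j - of_int k) * (1 - d) + 7 * \<bar>d\<bar> + 7)) * ?I))"
    unfolding z by (intro mult_left_mono J) auto
   also have "\<dots> = ennreal (2 powr (of_int k * s) * 2 powr ((of_int j - of_int k) * (1 - d) + 7 * \<bar>d\<bar> + 7)) * (N z * ?I)"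
    by (simp add: ennreal_mult mult_ac)
   also have "\<dots> <= ennreal (2 powr (of_int i * b) * 2 powr (of_int j * \<beta>) * (?c * 2 powr ((of_int j - x k) * \<delta>))) * (N z * ?I)"
   proof (cases "i \<in> {k - 6..k + 6}")
    case True then show ?thesis by (intro mult_right_mono ennreal_leI coef) auto
   qed simp
   also have "\<dots> = ?h z * ?K k z" unfolding z by (simp add: ennreal_mult mult_ac)
   finally show "wt2 k s * (N z * (NN r. ?J k z r)) <= ?h z * ?K k z" .
  qed
  finally show "wt2 k s * (NN r. indicator {0<..<t k} r * (ennreal (r powr - d) * (\<Sum>z\<in>near k (ll k r) (ll k r). N z)))
   <= (\<integral>\<^sup>+z. ?h z * ?K k z \<partial>count_space UNIV)" .
 qed (rule q)
 also have "2 * ?S = 26 * geo \<delta> * 2 powr (7 * \<bar>d\<bar> + 7 + 6 * \<bar>b\<bar> + 6 * \<delta> + \<delta> * L)"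
  by (simp add: powr_add)
 finally show ?thesis .
qed

lemma powr_linear_limits:
 fixes c :: real
 assumes c: "0 < c"
 shows "((%L. 2 powr (- (c * L))) \<longlongrightarrow> 0) at_top" "((%L. 2 powr (c * L)) \<longlongrightarrow> 0) at_bot"
proof -
 have b: "LIM L at_bot. (c * ln 2) * L :> at_bot"
  by (rule filterlim_tendsto_pos_mult_at_bot[OF tendsto_const _ filterlim_ident]) (use c in simp)
 have "((%L. exp ((c * ln 2) * L)) \<longlongrightarrow> 0) at_bot" by (rule filterlim_compose[OF exp_at_bot b])
 then show 1: "((%L. 2 powr (c * L)) \<longlongrightarrow> 0) at_bot" by (simp add: powr_def mult_ac)
 from filterlim_compose[OF 1 filterlim_uminus_at_bot_at_top]
 show "((%L. 2 powr (- (c * L))) \<longlongrightarrow> 0) at_top" by simp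
qed

text \<open>If x and y are positive, take the L for which both terms agree. If one of them vanishes, or if \<open>\<delta> =
0\<close>, let L tend to infinity in the direction that kills the other term.\<close>

lemma interpolate:
 fixes x y C e \<delta> :: real and E :: ennreal
 assumes x: "0 <= x" and y: "0 <= y" and C: "0 <= C" and e: "0 < e" and \<delta>: "0 <= \<delta>"
  and le: "\<And>L. E <= ennreal (C * (2 powr (- (e * L)) * x + 2 powr (\<delta> * L) * y))"
 shows "E <= ennreal (2 * C) * epowr (ennreal x) (\<delta> / (e + \<delta>)) * epowr (ennreal y) (e / (e + \<delta>))"
proof -
 have ed: "0 < e + \<delta>" "e / (e + \<delta>) ~= 0" using e \<delta> by auto
 have top: "((%L. 2 powr (- (e * L))) \<longlongrightarrow> 0) at_top" by (rule powr_linear_limits(1)[OF e])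
 consider "y = 0" | "y ~= 0" "\<delta> = 0" | "y ~= 0" "0 < \<delta>" "x = 0" | "y ~= 0" "0 < \<delta>" "x ~= 0" using \<delta> by fastforce
 then show ?thesis
 proof cases
  case 1
  have "((%L. ennreal (C * (2 powr (- (e * L)) * x + 2 powr (\<delta> * L) * y))) \<longlongrightarrow> ennreal (C * (0 * x + 0))) at_top"
   using 1 by (intro tendsto_ennrealI tendsto_mult tendsto_add tendsto_const top) simp
  then have "E <= ennreal (C * (0 * x + 0))" by (rule tendsto_lowerbound) (use le in auto)
  then show ?thesis by simp
 next
  case 2
  have "((%L. ennreal (C * (2 powr (- (e * L)) * x + 2 powr (\<delta> * L) * y))) \<longlongrightarrow> ennreal (C * (0 * x + y))) at_top"
   using 2 by (intro tendsto_ennrealI tendsto_mult tendsto_add tendsto_const top) simp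
  then have "E <= ennreal (C * (0 * x + y))" by (rule tendsto_lowerbound) (use le in auto)
  also have "\<dots> <= ennreal (2 * C * y)" using C y by (intro ennreal_leI) simp
  finally show ?thesis using 2 e C y by (simp add: epowr_simps ennreal_mult)
 next
  case 3
  have "((%L. 2 powr (\<delta> * L)) \<longlongrightarrow> 0) at_bot" by (rule powr_linear_limits(2)[OF 3(2)])
  then have "((%L. ennreal (C * (2 powr (- (e * L)) * x + 2 powr (\<delta> * L) * y))) \<longlongrightarrow> ennreal (C * (0 + 0 * y))) at_bot"
   using 3 by (intro tendsto_ennrealI tendsto_mult tendsto_add tendsto_const) simp_all
  then have "E <= ennreal (C * (0 + 0 * y))" by (rule tendsto_lowerbound) (use le in auto)
  then show ?thesis by simp
 next
  case 4
  define u v where "u = log 2 x" and "v = log 2 y"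
  have xy: "x = 2 powr u" "y = 2 powr v" using x y 4 by (auto simp: u_def v_def)
  \<comment> \<open>The point where \<open>- e L + u = \<delta> L + v\<close>.\<close>
  define L where "L = (u - v) / (e + \<delta>)"
  have z: "- (e * L) + u = (\<delta> * u + e * v) / (e + \<delta>)" "\<delta> * L + v = (\<delta> * u + e * v) / (e + \<delta>)"
   using ed(1) by (simp_all add: L_def field_simps)
  have P: "2 powr (- (e * L)) * x = 2 powr ((\<delta> * u + e * v) / (e + \<delta>))" "2 powr (\<delta> * L) * y = 2 powr ((\<delta> * u + e * v) / (e + \<delta>))"
   unfolding xy powr_add[symmetric] z by simp_all
  have "E <= ennreal (2 * C * 2 powr ((\<delta> * u + e * v) / (e + \<delta>)))" using le[of L] unfolding P by (simp add: mult_ac)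
  also have "2 powr ((\<delta> * u + e * v) / (e + \<delta>)) = x powr (\<delta> / (e + \<delta>)) * y powr (e / (e + \<delta>))"
   unfolding xy powr_powr powr_add[symmetric] by (simp add: add_divide_distrib mult_ac)
  finally show ?thesis using 4 ed C x y by (simp add: epowr_ennreal ennreal_mult mult.assoc)
 qed
qed

section \<open>Schwartz functions vanishing to high order at the origin\<close>

text \<open>Iterated partial derivative, innermost derivative first.\<close>

primrec dw :: "'a list => ('a::euclidean_space => complex) => 'a => complex" where
 "dw [] f = f" | "dw (b # bs) f = dw bs (pd b f)"

lemma pd_add:
 fixes f g :: "'a::euclidean_space => complex"
 assumes "schwartz f" "schwartz g" shows "pd b (%x. f x + g x) = (%x. pd b f x + pd b g x)"
 using frechet_derivative_at[OF has_derivative_add[OF schwartz_has_derivative[OF assms(1)] schwartz_has_derivative[OF assms(2)]]]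
 by (metis (no_types, lifting))

lemma pd_cmult:
 fixes f :: "'a::euclidean_space => complex"
 assumes "schwartz f" shows "pd b (%x. c * f x) = (%x. c * pd b f x)"
 using frechet_derivative_at[OF has_derivative_mult_right[OF schwartz_has_derivative[OF assms(1)], of c]]
 by (metis (no_types, lifting))

lemma dw_sbdd: "sbdd F J ==> set bs \<subseteq> Basis ==> sbdd (%j. dw bs (F j)) J"
 by (induction bs arbitrary: F) (auto intro: sbdd_pd)

lemma dw_add: "schwartz f ==> schwartz g ==> set bs \<subseteq> Basis ==> dw bs (%x. f x + g x) = (%x. dw bs f x + dw bs g x)"
 by (induction bs arbitrary: f g) (simp_all add: pd_add schwartz_pd)

lemma dw_cmult: "schwartz f ==> set bs \<subseteq> Basis ==> dw bs (%x. c * f x) = (%x. c * dw bs f x)"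
 by (induction bs arbitrary: f) (simp_all add: pd_cmult schwartz_pd)

text \<open>Vanishing near the origin.\<close>

definition nz0 :: "('a::euclidean_space => complex) => bool" where
 "nz0 g \<longleftrightarrow> (\<exists>c>0. \<forall>z. norm z < c --> g z = 0)"

lemma nz0_pd: assumes "nz0 g" shows "nz0 (pd b g)"
proof -
 obtain c where c: "0 < c" "\<And>z. norm z < c ==> g z = 0" using assms by (auto simp: nz0_def)
 have "frechet_derivative g (at z) b = 0" if "norm z < c" for z
  by (rule pd_vanish[of "ball 0 c"]) (use c that in auto)
 then show ?thesis using c(1) unfolding nz0_def by blast
qed

lemma dw_nz0: "nz0 g ==> dw bs g 0 = 0"
proof (induction bs arbitrary: g)
 case Nil then show ?case by (auto simp: nz0_def)
next
 case (Cons b bs) then show ?case using nz0_pd[OF Cons.prems, of b] by simp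
qed

text \<open>A projection of finite corank whose range is killed by the given derivatives at 0. The functionals are treated one at
a time: subtract from P a multiple of \<open>P \<theta>\<close>, for a \<theta> on which the new functional does not
vanish. Functions vanishing near 0 are killed by all the functionals, hence fixed.\<close>

lemma moment_projection:
 assumes "finite E" "\<And>bs. bs \<in> E ==> set bs \<subseteq> (Basis :: 'a::euclidean_space set)"
 shows "\<exists>P :: ('a => complex) => 'a => complex.
  (\<forall>f g. schwartz f --> schwartz g --> P (%x. f x + g x) = (%x. P f x + P g x)) \<and>
  (\<forall>c f. schwartz f --> P (%x. c * f x) = (%x. c * P f x)) \<and>
  (\<forall>F :: nat => 'a => complex. sbdd F UNIV --> sbdd (%j. P (F j)) UNIV) \<and>
  (\<forall>bs\<in>E. \<forall>g. schwartz g --> dw bs (P g) 0 = 0) \<and>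
  (\<forall>g. schwartz g --> nz0 g --> P g = g)"
 using assms
proof (induction E)
 case empty
 show ?case by (intro exI[of _ "%g. g"]) auto
next
 case (insert bs E)
 have bs: "set bs \<subseteq> Basis" and E: "\<And>cs. cs \<in> E ==> set cs \<subseteq> Basis" using insert.prems by auto
 obtain P :: "('a => complex) => 'a => complex" where
  add: "\<And>f g. schwartz f ==> schwartz g ==> P (%x. f x + g x) = (%x. P f x + P g x)"
  and sc: "\<And>c f. schwartz f ==> P (%x. c * f x) = (%x. c * P f x)"
  and bd: "\<And>F :: nat => 'a => complex. sbdd F UNIV ==> sbdd (%j. P (F j)) UNIV"
  and van: "\<And>bs g. bs \<in> E ==> schwartz g ==> dw bs (P g) 0 = 0"
  and id: "\<And>g. schwartz g ==> nz0 g ==> P g = g"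
  using insert.IH[OF E] by blast
 have Ps: "schwartz (P g)" if "schwartz g" for g
  using sbdd_schwartz[OF bd[OF schwartz_sbdd[OF that]], of 0] by simp
 show ?case
 proof (cases "\<forall>g. schwartz g --> dw bs (P g) 0 = 0")
  case True
  then show ?thesis using add sc bd van id by (intro exI[of _ P]) blast
 next
  case False
  then obtain \<theta> where \<theta>: "schwartz \<theta>" "dw bs (P \<theta>) 0 ~= 0" by blast
  define c where "c g = - (dw bs (P g) 0 / dw bs (P \<theta>) 0)" for g
  define Q where "Q g = (%x. P g x + c g * P \<theta> x)" for g
  have dQ: "dw cs (Q g) 0 = dw cs (P g) 0 + c g * dw cs (P \<theta>) 0" if "set cs \<subseteq> Basis" "schwartz g" for cs g
   unfolding Q_def using that \<theta>(1) by (simp add: dw_add dw_cmult Ps schwartz_cmult)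
  have c_add: "c (%x. f x + g x) = c f + c g" if "schwartz f" "schwartz g" for f g
   using that bs by (simp add: c_def add dw_add Ps add_divide_distrib)
  have c_sc: "c (%x. a * f x) = a * c f" if "schwartz f" for f a
   using that bs by (simp add: c_def sc dw_cmult Ps)
  have "Q (%x. f x + g x) = (%x. Q f x + Q g x)" if "schwartz f" "schwartz g" for f g
   using that by (simp add: Q_def c_add add fun_eq_iff algebra_simps)
  moreover have "Q (%x. a * f x) = (%x. a * Q f x)" if "schwartz f" for f a
   using that by (simp add: Q_def c_sc sc fun_eq_iff algebra_simps)
  moreover have "sbdd (%j. Q (F j)) UNIV" if F: "sbdd F UNIV" for F :: "nat => 'a => complex"
  proof -
   obtain C where C: "\<forall>j\<in>UNIV. \<forall>x. sw 0 x * norm (dw bs (P (F j)) x) <= C"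
    using lev_bound[OF sbddD[OF dw_sbdd[OF bd[OF F] bs]]] by blast
   have "norm (dw bs (P (F j)) 0) <= C" for j using C by simp
   then have "norm (c (F j)) <= C / norm (dw bs (P \<theta>) 0)" for j
    by (simp add: c_def norm_divide divide_right_mono)
   then show ?thesis unfolding Q_def
    by (intro sbdd_add bd F sbdd_cmult[where M="C / norm (dw bs (P \<theta>) 0)"] schwartz_sbdd Ps \<theta>(1))
  qed
  moreover have "dw cs (Q g) 0 = 0" if "cs \<in> insert bs E" "schwartz g" for cs g
  proof (cases "cs = bs")
   case True then show ?thesis using dQ[OF bs that(2)] \<theta>(2) by (simp add: c_def)
  next
   case False
   then have "cs \<in> E" using that by simp
   then show ?thesis using dQ[OF E that(2)] van that(2) \<theta>(1) by simp
  qed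
  moreover have "Q g = g" if "schwartz g" "nz0 g" for g
   using id[OF that] dw_nz0[OF that(2)] by (simp add: Q_def c_def)
  ultimately show ?thesis by (intro exI[of _ Q]) blast
 qed
qed

text \<open>All derivatives of order less than n vanish at the origin.\<close>

definition van :: "nat => ('a::euclidean_space => complex) => bool" where
 "van n r \<longleftrightarrow> (\<forall>bs. set bs \<subseteq> Basis \<and> length bs < n --> dw bs r 0 = 0)"

lemma van_Suc: assumes "van (Suc n) r" shows "r 0 = 0" "b \<in> Basis ==> van n (pd b r)"
proof -
 show "r 0 = 0" using assms[unfolded van_def, rule_format, of "[]"] by simp
 assume b: "b \<in> Basis"
 show "van n (pd b r)" unfolding van_def
 proof (intro allI impI)
  fix bs :: "'a list" assume "set bs \<subseteq> Basis \<and> length bs < n"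
  then show "dw bs (pd b r) 0 = 0" using assms[unfolded van_def, rule_format, of "b # bs"] b by simp
 qed
qed

text \<open>Apply the mean value theorem to the induction hypothesis for the partial derivatives.\<close>

lemma taylor_vanishing:
 fixes F :: "'j => 'a::euclidean_space => complex"
 assumes "sbdd F J" "\<And>j. j \<in> J ==> van n (F j)"
 shows "\<exists>C\<ge>0. \<forall>j\<in>J. \<forall>z. norm (F j z) <= C * norm z ^ n"
 using assms
proof (induction n arbitrary: F)
 case 0
 obtain C where C: "\<forall>j\<in>J. \<forall>x. sw 0 x * norm (F j x) <= C" using lev_bound[OF sbddD[OF 0(1)]] by blast
 then show ?case by (intro exI[of _ "\<bar>C\<bar>"]) (auto intro: order_trans[OF _ abs_ge_self])
next
 case (Suc n)
 have "\<forall>b\<in>Basis. \<exists>C\<ge>0. \<forall>j\<in>J. \<forall>z. norm (pd b (F j) z) <= C * norm z ^ n"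
  using Suc.IH[OF sbdd_pd[OF Suc.prems(1)]] van_Suc(2)[OF Suc.prems(2)] by blast
 then obtain C where C: "\<And>b. b \<in> Basis ==> 0 <= C b" "\<And>b j z. b \<in> Basis ==> j \<in> J ==> norm (pd b (F j) z) <= C b * norm z ^ n" by metis
 have "norm (F j z) <= (\<Sum>b\<in>Basis. C b) * norm z ^ Suc n" if j: "j \<in> J" for j z
 proof -
  have sF: "schwartz (F j)" by (rule sbdd_schwartz[OF Suc.prems(1) j])
  note d = schwartz_has_derivative[OF sF]
  have "norm (F j z - F j 0) <= ((\<Sum>b\<in>Basis. C b) * norm z ^ n) * norm (z - 0)"
  proof (rule differentiable_bound[where S="cball 0 (norm z)" and f'="%x. frechet_derivative (F j) (at x)"])
   fix x :: 'a assume x: "x \<in> cball 0 (norm z)"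
   show "(F j has_derivative frechet_derivative (F j) (at x)) (at x within cball 0 (norm z))" using d by (rule has_derivative_at_withinI)
   show "onorm (frechet_derivative (F j) (at x)) <= (\<Sum>b\<in>Basis. C b) * norm z ^ n"
   proof (rule onorm_bound)
    show "0 <= (\<Sum>b\<in>Basis. C b) * norm z ^ n" using C(1) by (simp add: sum_nonneg)
    fix h :: 'a
    have "norm (frechet_derivative (F j) (at x) h) <= (\<Sum>b\<in>Basis. norm (cr (h \<bullet> b) * pd b (F j) x))"
     unfolding linear_sum_Basis[OF has_derivative_linear[OF d], of x h] by (rule norm_sum)
    also have "\<dots> <= (\<Sum>b\<in>Basis. norm h * (C b * norm z ^ n))"
    proof (rule sum_mono)
     fix b :: 'a assume b: "b \<in> Basis"
     have "norm x ^ n <= norm z ^ n" using x by (intro power_mono) auto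
     then have "norm (pd b (F j) x) <= C b * norm z ^ n"
      using C(2)[OF b j, of x] mult_left_mono[OF _ C(1)[OF b]] by (meson order_trans)
     then show "norm (cr (h \<bullet> b) * pd b (F j) x) <= norm h * (C b * norm z ^ n)"
      unfolding norm_mult using Basis_le_norm[OF b, of h] by (intro mult_mono) auto
    qed
    also have "\<dots> = (\<Sum>b\<in>Basis. C b) * norm z ^ n * norm h" by (simp add: sum_distrib_left sum_distrib_right mult_ac)
    finally show "norm (frechet_derivative (F j) (at x) h) <= (\<Sum>b\<in>Basis. C b) * norm z ^ n * norm h" .
   qed
  qed auto
  then show ?thesis using van_Suc(1)[OF Suc.prems(2)[OF j]] by (simp add: mult_ac)
 qed
 then show ?case using C(1) by (intro exI[of _ "\<Sum>b\<in>Basis. C b"]) (simp add: sum_nonneg)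
qed

text \<open>On the support of \<open>A (\<mu> z)\<close> one has \<open>norm z \<le> 2 / \<mu>\<close>, so vanishing of order m
absorbs \<open>\<mu>^m\<close>. A derivative falling on A costs a factor \<mu> and one falling on G an order of
vanishing; hence n derivatives require order \<open>m + n\<close>.\<close>

lemma scaled_low:
 fixes G :: "'j => 'a::euclidean_space => complex"
 assumes "sbdd G J" "bmul A" "\<And>w. 2 < norm w ==> A w = 0" "\<And>j. j \<in> J ==> van (m + n) (G j)"
 shows "lev sw n (%(\<mu>, j) z. cr (\<mu> ^ m) * (A (\<mu> *\<^sub>R z) * G j z)) ({1..} \<times> J)"
 using assms
proof (induction n arbitrary: G A m)
 case 0
 show ?case unfolding lev.simps
 proof
  fix N
  obtain CA where CA: "0 <= CA" "\<And>w. norm (A w) <= CA" using bmul_bounded[OF 0(2)] by blast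
  obtain CG where CG: "0 <= CG" "\<forall>j\<in>J. \<forall>z. norm (G j z) <= CG * norm z ^ m"
   using taylor_vanishing[OF 0(1), of m] 0(4) by auto
  have "sw N z * norm (cr (\<mu> ^ m) * (A (\<mu> *\<^sub>R z) * G j z)) <= 3 ^ N * (CA * (CG * 2 ^ m))"
   if \<mu>: "\<mu> \<in> {1..}" and j: "j \<in> J" for \<mu> j z
  proof (cases "A (\<mu> *\<^sub>R z) = 0")
   case True then show ?thesis using CA(1) CG(1) by simp
  next
   case False
   then have "norm (\<mu> *\<^sub>R z) <= 2" using 0(3)[of "\<mu> *\<^sub>R z"] by (meson not_le)
   then have \<mu>z: "\<mu> * norm z <= 2" using \<mu> by simp
   have "1 * norm z <= \<mu> * norm z" using \<mu> by (intro mult_right_mono) auto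
   with \<mu>z have "1 + norm z <= 3" by simp
   then have s: "sw N z <= 3 ^ N" by (intro power_mono) auto
   have "\<mu> ^ m * norm (G j z) <= \<mu> ^ m * (CG * norm z ^ m)" using CG j \<mu> by (intro mult_left_mono) auto
   also have "\<dots> = CG * (\<mu> * norm z) ^ m" by (simp add: power_mult_distrib)
   also have "\<dots> <= CG * 2 ^ m" using \<mu>z \<mu> CG(1) by (intro mult_left_mono power_mono) auto
   finally have "norm (A (\<mu> *\<^sub>R z)) * (\<mu> ^ m * norm (G j z)) <= CA * (CG * 2 ^ m)"
    by (rule mult_mono[OF CA(2) _ CA(1)]) (use \<mu> in auto)
   then have "sw N z * (norm (A (\<mu> *\<^sub>R z)) * (\<mu> ^ m * norm (G j z))) <= 3 ^ N * (CA * (CG * 2 ^ m))"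
    by (rule mult_mono[OF s]) (use \<mu> in auto)
   then show ?thesis using \<mu> by (simp add: norm_mult norm_power mult_ac)
  qed
  then show "\<exists>C. \<forall>j\<in>{1..} \<times> J. \<forall>x. sw N x * norm ((case j of (\<mu>, j) => %z. cr (\<mu> ^ m) * (A (\<mu> *\<^sub>R z) * G j z)) x) <= C"
   by (intro exI[of _ "3 ^ N * (CA * (CG * 2 ^ m))"]) auto
 qed
next
 case (Suc n)
 note Ad = bmul_has_derivative[OF Suc.prems(2)]
 have Gd: "(G j has_derivative frechet_derivative (G j) (at x)) (at x)" if "j \<in> J" for j x
  using lev_has_derivative[OF sbddD[OF Suc.prems(1)] that] .
 have v1: "van (Suc m + n) (G j)" if "j \<in> J" for j using Suc.prems(4)[OF that] by simp
 define D where "D = (%(\<mu>, j) z h. cr (\<mu> ^ m) * (A (\<mu> *\<^sub>R z) * frechet_derivative (G j) (at z) h + frechet_derivative A (at (\<mu> *\<^sub>R z)) (\<mu> *\<^sub>R h) * G j z))"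
 show ?case
 proof (rule lev_SucI[where D=D])
  have "van (m + n) (G j)" if "j \<in> J" for j using v1[OF that] by (auto simp: van_def)
  from lev_0[OF Suc.IH[OF Suc.prems(1-3) this]]
  show "lev sw 0 (%(\<mu>, j) z. cr (\<mu> ^ m) * (A (\<mu> *\<^sub>R z) * G j z)) ({1..} \<times> J)" .
  fix \<mu>j x assume \<mu>j: "\<mu>j \<in> ({1..} :: real set) \<times> J"
  obtain \<mu> j where e: "\<mu>j = (\<mu>, j)" "j \<in> J" using \<mu>j by auto
  have "((%z. A (\<mu> *\<^sub>R z)) has_derivative (%h. frechet_derivative A (at (\<mu> *\<^sub>R x)) (\<mu> *\<^sub>R h))) (at x)"
   by (rule has_derivative_compose[OF _ Ad]) (auto intro!: derivative_eq_intros)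
  from has_derivative_mult_right[OF has_derivative_mult[OF this Gd[OF e(2)]]]
  show "((case \<mu>j of (\<mu>, j) => %z. cr (\<mu> ^ m) * (A (\<mu> *\<^sub>R z) * G j z)) has_derivative D \<mu>j x) (at x)"
   by (simp add: e D_def)
 next
  fix e :: 'a assume e: "e \<in> Basis"
  have v: "pd e A w = 0" if "2 < norm w" for w
   by (rule pd_vanish[of "- cball 0 2"]) (use Suc.prems(3) that in auto)
  have v2: "van (m + n) (pd e (G j))" if "j \<in> J" for j
   using van_Suc(2)[OF _ e] Suc.prems(4)[OF that] by simp
  have l1: "lev sw n (%(\<mu>, j) z. cr (\<mu> ^ m) * (A (\<mu> *\<^sub>R z) * pd e (G j) z)) ({1..} \<times> J)"
   by (rule Suc.IH[OF sbdd_pd[OF Suc.prems(1) e] Suc.prems(2,3) v2])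
  have l2: "lev sw n (%(\<mu>, j) z. cr (\<mu> ^ Suc m) * (pd e A (\<mu> *\<^sub>R z) * G j z)) ({1..} \<times> J)"
   by (rule Suc.IH[OF Suc.prems(1) bmul_pd[OF Suc.prems(2) e] v v1])
  show "lev sw n (%\<mu>j z. D \<mu>j z e) ({1..} \<times> J)"
   by (rule iffD1[OF lev_cong lev_add[OF sw_nonneg l1 l2]])
     (auto simp: D_def fun_eq_iff frechet_scaleR[OF Ad] algebra_simps)
 qed
qed

section \<open>Distributions with prescribed blocks\<close>

text \<open>A series of functionals that converges geometrically, uniformly on bounded families.\<close>

lemma series_tempered:
 fixes T :: "nat => 'a::euclidean_space distr"
 assumes add: "\<And>n f g. schwartz f ==> schwartz g ==> T n (%x. f x + g x) = T n f + T n g"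
  and scale: "\<And>n c f. schwartz f ==> T n (%x. c * f x) = c * T n f"
  and bdd: "\<And>F :: nat => 'a => complex. sbdd F UNIV ==> \<exists>C. \<forall>n j. norm (T n (F j)) <= C * (1 / 2) ^ n"
 shows "tempered (%\<eta>. \<Sum>n. T n \<eta>)"
proof -
 have g: "summable (%n. C * (1 / 2) ^ n)" for C :: real by (intro summable_mult summable_geometric) simp
 have s: "summable (%n. T n \<eta>)" if \<eta>: "schwartz \<eta>" for \<eta>
 proof -
  obtain C where "\<forall>n j. norm (T n \<eta>) <= C * (1 / 2) ^ n" using bdd[OF schwartz_sbdd[OF \<eta>]] by blast
  then show ?thesis by (intro summable_comparison_test'[OF g, of 0 _ C]) auto
 qed
 show ?thesis
 proof (rule temperedI)
  show "(\<Sum>n. T n (%x. f x + g x)) = (\<Sum>n. T n f) + (\<Sum>n. T n g)" if "schwartz f" "schwartz g" for f g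
   using that by (simp add: add suminf_add[OF s s])
  show "(\<Sum>n. T n (%x. c * f x)) = c * (\<Sum>n. T n f)" if "schwartz f" for f c
   using that by (simp add: scale suminf_mult[OF s])
  fix F :: "nat => 'a => complex" assume F: "sbdd F UNIV"
  obtain C where C: "\<forall>n j. norm (T n (F j)) <= C * (1 / 2) ^ n" using bdd[OF F] by blast
  have "norm (\<Sum>n. T n (F j)) <= (\<Sum>n. C * (1 / 2) ^ n)" for j
   by (rule norm_suminf_le) (use C g in auto)
  then show "\<exists>C. \<forall>j. norm (\<Sum>n. T n (F j)) <= C" by blast
 qed
qed

context
 fixes \<psi> \<phi> :: "'a::euclidean_space => real"
 assumes lp: "littlewood_paley \<psi> \<phi>"
begin

text \<open>Given functionals \<open>\<Theta> k\<close> growing at most exponentially in \<open>|k|\<close>, the distribution is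
the sum of \<open>\<Theta> k\<close> applied to the blocks of \<eta>, where for \<open>k < 0\<close> the spectrum of
\<eta> is first replaced by its projection. The blocks of \<eta> decay like any power of \<open>2^(-|k|)\<close>, by
\<open>scaled_left\<close> for \<open>k \<ge> 0\<close> and by \<open>scaled_low\<close> for \<open>k < 0\<close>.\<close>

lemma realize:
 fixes \<Theta> :: "int => ('a => complex) => complex"
 assumes add: "\<And>k f g. schwartz f ==> schwartz g ==> \<Theta> k (%x. f x + g x) = \<Theta> k f + \<Theta> k g"
  and sc: "\<And>k c f. schwartz f ==> \<Theta> k (%x. c * f x) = c * \<Theta> k f"
  and bd: "\<And>C. \<exists>B. \<forall>k \<theta>. schwartz \<theta> --> (\<forall>x. sw (swN TYPE('a)) x * norm (\<theta> x) <= C) --> norm (\<Theta> k \<theta>) <= B * 2 ^ (\<sigma> * nat \<bar>k\<bar>)"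
 shows "\<exists>\<rho>. tempered \<rho> \<and> (\<forall>k \<eta>. schwartz \<eta> -->
   \<rho> (fmul (lpm \<phi> k) \<eta>) = (\<Sum>j=k-6..k+6. \<Theta> j (fmul (lpm \<phi> j) (fmul (lpm \<phi> k) \<eta>))))"
proof -
 let ?N = "swN TYPE('a)"
 \<comment> \<open>One power of \<open>2^|k|\<close> more than the growth of \<open>\<Theta>\<close>, to make the series geometric.\<close>
 define M where "M = Suc \<sigma>"
 note lb = lpm_bmul[OF lp]
 have scal: "norm (\<Theta> k \<theta>) <= \<bar>B\<bar> * (1 / 2) ^ n"
  if \<theta>: "schwartz \<theta>" and b: "norm (\<Theta> k (%x. cr ((2 ^ n) ^ M) * \<theta> x)) <= B * 2 ^ (\<sigma> * n)" for k \<theta> B and n :: nat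
 proof -
  have "(2 ^ n) ^ M * norm (\<Theta> k \<theta>) <= \<bar>B\<bar> * 2 ^ (\<sigma> * n)"
  proof -
   have "(2 ^ n) ^ M * norm (\<Theta> k \<theta>) <= B * 2 ^ (\<sigma> * n)" using b unfolding sc[OF \<theta>] norm_mult norm_of_real by simp
   also have "\<dots> <= \<bar>B\<bar> * 2 ^ (\<sigma> * n)" by (intro mult_right_mono) auto
   finally show ?thesis .
  qed
  then have "2 ^ (\<sigma> * n) * (2 ^ n * norm (\<Theta> k \<theta>)) <= 2 ^ (\<sigma> * n) * \<bar>B\<bar>"
   by (simp add: M_def power_mult[symmetric] power_add mult_ac)
  then have "2 ^ n * norm (\<Theta> k \<theta>) <= \<bar>B\<bar>" by (rule mult_left_le_imp_le) simp
  then show ?thesis by (simp add: power_one_over field_simps)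
 qed
 \<comment> \<open>Decay of order \<open>swN\<close> of a Fourier transform takes \<open>swN + 1\<close> derivatives, which \<open>scaled_low\<close> pays for by as many orders of vanishing.\<close>
 define E :: "'a list set" where "E = {bs. set bs \<subseteq> Basis \<and> length bs <= M + Suc ?N}"
 have fE: "finite E" unfolding E_def by (rule finite_lists_length_le) simp
 have bE: "set bs \<subseteq> Basis" if "bs \<in> E" for bs using that by (simp add: E_def)
 obtain P :: "('a => complex) => 'a => complex" where
  P_add: "\<And>f g. schwartz f ==> schwartz g ==> P (%x. f x + g x) = (%x. P f x + P g x)"
  and P_sc: "\<And>c f. schwartz f ==> P (%x. c * f x) = (%x. c * P f x)"
  and P_bd: "\<And>F :: nat => 'a => complex. sbdd F UNIV ==> sbdd (%j. P (F j)) UNIV"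
  and P_van: "\<And>bs g. bs \<in> E ==> schwartz g ==> dw bs (P g) 0 = 0"
  and P_id: "\<And>g. schwartz g ==> nz0 g ==> P g = g"
  using moment_projection[OF fE bE] by blast
 have Ps: "schwartz (P g)" if "schwartz g" for g
  using sbdd_schwartz[OF P_bd[OF schwartz_sbdd[OF that]], of 0] by simp
 define S where "S \<eta> = fourier (P (inv_fourier \<eta>))" for \<eta>
 have Ss: "schwartz (S \<eta>)" if "schwartz \<eta>" for \<eta> unfolding S_def by (intro fourier_schwartz Ps inv_fourier_schwartz that)
 have S_add: "S (%x. f x + g x) = (%x. S f x + S g x)" if "schwartz f" "schwartz g" for f g
  unfolding S_def inv_fourier_add[OF that] P_add[OF inv_fourier_schwartz[OF that(1)] inv_fourier_schwartz[OF that(2)]]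
  by (rule ext, rule fourier_add) (intro schwartz_integrable Ps inv_fourier_schwartz that)+
 have S_sc: "S (%x. c * f x) = (%x. c * S f x)" if "schwartz f" for f c
  unfolding S_def inv_fourier_cmult P_sc[OF inv_fourier_schwartz[OF that]] by (rule ext, rule fourier_cmult)
 define T1 where "T1 n \<eta> = \<Theta> (int n) (fmul (lpm \<phi> (int n)) \<eta>)" for n \<eta>
 define T2 where "T2 n \<eta> = \<Theta> (- int n - 1) (fmul (lpm \<phi> (- int n - 1)) (S \<eta>))" for n \<eta>
 note fs = fmul_schwartz[OF lb]
 have t1: "tempered (%\<eta>. \<Sum>n. T1 n \<eta>)"
 proof (rule series_tempered)
  show "T1 n (%x. f x + g x) = T1 n f + T1 n g" if "schwartz f" "schwartz g" for n f g
   unfolding T1_def fmul_add[OF lb that] by (intro add fs that)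
  show "T1 n (%x. c * f x) = c * T1 n f" if "schwartz f" for n c f
   unfolding T1_def fmul_cmult by (intro sc fs that)
  fix F :: "nat => 'a => complex" assume F: "sbdd F UNIV"
  let ?H = "%(\<mu>, j) z. cr ((1 / \<mu>) ^ M) * (cr (\<phi> (\<mu> *\<^sub>R z)) * inv_fourier (F j) z)"
  have v: "cr (\<phi> w) = 0" if "norm w < 1 / 2" for w using lp_supp[OF lp, of w] that by auto
  have "sbdd ?H ({0<..1} \<times> UNIV)"
   by (rule scaled_left[OF inv_fourier_sbdd[OF F] schwartz_bmul[OF lp_phi_schwartz[OF lp]], of "1/2"]) (use v in auto)
  from lev_bound[OF sbddD[OF fourier_sbdd[OF this]]]
  obtain C where C: "\<forall>\<mu>j\<in>{0<..1} \<times> UNIV. \<forall>x. sw ?N x * norm (fourier (?H \<mu>j) x) <= C" by blast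
  obtain B where B: "\<And>k \<theta>. schwartz \<theta> ==> (\<And>x. sw ?N x * norm (\<theta> x) <= C) ==> norm (\<Theta> k \<theta>) <= B * 2 ^ (\<sigma> * nat \<bar>k\<bar>)"
   using bd[of C] by blast
  have "norm (T1 n (F j)) <= \<bar>B\<bar> * (1 / 2) ^ n" for n j
   unfolding T1_def
  proof (rule scal)
   have Fj: "schwartz (F j)" using sbdd_schwartz[OF F] by simp
   then show "schwartz (fmul (lpm \<phi> (int n)) (F j))" by (rule fs)
   have e: "fourier (?H (1 / 2 ^ n, j)) = (%x. cr ((2 ^ n) ^ M) * fmul (lpm \<phi> (int n)) (F j) x)"
    by (rule ext) (simp add: fourier_cmult fmul_def lpm_def[OF lp])
   have "norm (\<Theta> (int n) (fourier (?H (1 / 2 ^ n, j)))) <= B * 2 ^ (\<sigma> * nat \<bar>int n\<bar>)"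
   proof (rule B)
    show "schwartz (fourier (?H (1 / 2 ^ n, j)))" unfolding e by (intro schwartz_cmult fs Fj)
    show "sw ?N x * norm (fourier (?H (1 / 2 ^ n, j)) x) <= C" for x
     using C[rule_format, of "(1 / 2 ^ n, j)" x] by (simp add: le_divide_eq)
   qed
   then show "norm (\<Theta> (int n) (%x. cr ((2 ^ n) ^ M) * fmul (lpm \<phi> (int n)) (F j) x)) <= B * 2 ^ (\<sigma> * n)"
    unfolding e by simp
  qed
  then show "\<exists>C. \<forall>n j. norm (T1 n (F j)) <= C * (1 / 2) ^ n" by blast
 qed
 have t2: "tempered (%\<eta>. \<Sum>n. T2 n \<eta>)"
 proof (rule series_tempered)
  show "T2 n (%x. f x + g x) = T2 n f + T2 n g" if "schwartz f" "schwartz g" for n f g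
   unfolding T2_def S_add[OF that] fmul_add[OF lb Ss[OF that(1)] Ss[OF that(2)]] by (intro add fs Ss that)
  show "T2 n (%x. c * f x) = c * T2 n f" if "schwartz f" for n c f
   unfolding T2_def S_sc[OF that] fmul_cmult by (intro sc fs Ss that)
  fix F :: "nat => 'a => complex" assume F: "sbdd F UNIV"
  let ?G = "%j. P (inv_fourier (F j))"
  let ?H = "%(\<mu>, j) z. cr (\<mu> ^ M) * (cr (\<phi> (\<mu> *\<^sub>R z)) * ?G j z)"
  have v: "cr (\<phi> w) = 0" if "2 < norm w" for w using lp_supp[OF lp, of w] that by auto
  have Fj: "schwartz (F j)" for j using sbdd_schwartz[OF F] by simp
  have van: "van (M + Suc ?N) (?G j)" for j
   unfolding van_def using P_van[OF _ inv_fourier_schwartz[OF Fj]] by (auto simp: E_def)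
  have "lev sw (Suc ?N) ?H ({1..} \<times> UNIV)"
   by (rule scaled_low[OF P_bd[OF inv_fourier_sbdd[OF F]] schwartz_bmul[OF lp_phi_schwartz[OF lp]] v van])
  from fourier_decay[OF this]
  obtain C where C: "\<forall>\<mu>j\<in>{1..} \<times> UNIV. \<forall>x. sw ?N x * norm (fourier (?H \<mu>j) x) <= C" by blast
  obtain B where B: "\<And>k \<theta>. schwartz \<theta> ==> (\<And>x. sw ?N x * norm (\<theta> x) <= C) ==> norm (\<Theta> k \<theta>) <= B * 2 ^ (\<sigma> * nat \<bar>k\<bar>)"
   using bd[of C] by blast
  have "norm (T2 n (F j)) <= \<bar>B\<bar> * (1 / 2) ^ n" for n j
  proof -
   let ?k = "- int n - 1"
   have "norm (T2 n (F j)) <= \<bar>B\<bar> * (1 / 2) ^ Suc n"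
    unfolding T2_def
   proof (rule scal)
    show s: "schwartz (fmul (lpm \<phi> ?k) (S (F j)))" by (intro fs Ss Fj)
    have pw: "1 / 2 powi ?k = (2::real) ^ Suc n"
     by (simp add: power_int_diff power_int_minus field_simps)
    have e: "fourier (?H (2 ^ Suc n, j)) = (%x. cr ((2 ^ Suc n) ^ M) * fmul (lpm \<phi> ?k) (S (F j)) x)"
    proof
     fix x
     have "fourier (?H (2 ^ Suc n, j)) x = cr ((2 ^ Suc n) ^ M) * fourier (%z. cr (\<phi> ((2 ^ Suc n) *\<^sub>R z)) * ?G j z) x"
      by (simp only: prod.case fourier_cmult)
     also have "fourier (%z. cr (\<phi> ((2 ^ Suc n) *\<^sub>R z)) * ?G j z) x = fmul (lpm \<phi> ?k) (S (F j)) x"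
      unfolding fmul_def S_def inv_fourier_fourier[OF Ps[OF inv_fourier_schwartz[OF Fj]]] lpm_def[OF lp] pw ..
     finally show "fourier (?H (2 ^ Suc n, j)) x = cr ((2 ^ Suc n) ^ M) * fmul (lpm \<phi> ?k) (S (F j)) x" .
    qed
    have "norm (\<Theta> ?k (fourier (?H (2 ^ Suc n, j)))) <= B * 2 ^ (\<sigma> * nat \<bar>?k\<bar>)"
    proof (rule B)
     show "schwartz (fourier (?H (2 ^ Suc n, j)))" unfolding e by (intro schwartz_cmult s)
     have "(2 ^ Suc n, j) \<in> ({1..} :: real set) \<times> UNIV" by (simp del: power_Suc)
     then show "sw ?N x * norm (fourier (?H (2 ^ Suc n, j)) x) <= C" for x using C by blast
    qed
    moreover have "nat \<bar>?k\<bar> = Suc n" by simp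
    ultimately show "norm (\<Theta> ?k (%x. cr ((2 ^ Suc n) ^ M) * fmul (lpm \<phi> ?k) (S (F j)) x)) <= B * 2 ^ (\<sigma> * Suc n)"
     unfolding e by simp
   qed
   also have "\<dots> <= \<bar>B\<bar> * (1 / 2) ^ n" by (intro mult_left_mono) auto
   finally show ?thesis .
  qed
  then show "\<exists>C. \<forall>n j. norm (T2 n (F j)) <= C * (1 / 2) ^ n" by blast
 qed
 define \<rho> where "\<rho> \<eta> = (\<Sum>n. T1 n \<eta>) + (\<Sum>n. T2 n \<eta>)" for \<eta>
 have "tempered \<rho>"
 proof (rule temperedI)
  show "\<rho> (%x. f x + g x) = \<rho> f + \<rho> g" if "schwartz f" "schwartz g" for f g
   unfolding \<rho>_def using tempered_add[OF t1 that] tempered_add[OF t2 that] by (simp add: add_ac)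
  show "\<rho> (%x. c * f x) = c * \<rho> f" if "schwartz f" for f c
   unfolding \<rho>_def using tempered_cmult[OF t1 that] tempered_cmult[OF t2 that] by (simp add: distrib_left)
  fix F :: "nat => 'a => complex" assume F: "sbdd F UNIV"
  obtain C1 C2 where "\<forall>j\<in>UNIV. norm (\<Sum>n. T1 n (F j)) <= C1" "\<forall>j\<in>UNIV. norm (\<Sum>n. T2 n (F j)) <= C2"
   using tempered_bounded[OF t1 F] tempered_bounded[OF t2 F] by blast
  then have "norm (\<rho> (F j)) <= C1 + C2" for j unfolding \<rho>_def by (intro order_trans[OF norm_triangle_ineq] add_mono) auto
  then show "\<exists>C. \<forall>j. norm (\<rho> (F j)) <= C" by blast
 qed
 moreover have "\<rho> (fmul (lpm \<phi> k) \<eta>) = (\<Sum>j=k-6..k+6. \<Theta> j (fmul (lpm \<phi> j) (fmul (lpm \<phi> k) \<eta>)))" if \<eta>: "schwartz \<eta>" for k \<eta>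
 proof -
  let ?\<eta> = "fmul (lpm \<phi> k) \<eta>"
  define h where "h j = \<Theta> j (fmul (lpm \<phi> j) ?\<eta>)" for j
  have \<eta>s: "schwartz ?\<eta>" by (rule fs[OF \<eta>])
  have i: "inv_fourier ?\<eta> = (%\<zeta>. lpm \<phi> k \<zeta> * inv_fourier \<eta> \<zeta>)" by (rule inv_fourier_fmul[OF lb \<eta>])
  have "nz0 (inv_fourier ?\<eta>)" unfolding nz0_def
  proof (intro exI conjI allI impI)
   show "0 < (2::real) powi (k - 1)" by simp
   fix z :: 'a assume "norm z < 2 powi (k - 1)"
   then have "\<phi> ((1 / 2 powi k) *\<^sub>R z) = 0" using lp_supp_powi(1)[OF lp, of k z] by (meson not_le)
   then show "inv_fourier ?\<eta> z = 0" by (simp add: i lpm_def[OF lp])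
  qed
  then have S: "S ?\<eta> = ?\<eta>" unfolding S_def using P_id[OF inv_fourier_schwartz[OF \<eta>s]] fourier_inv_fourier[OF \<eta>s] by simp
  have T0: "\<Theta> j (%x. 0) = 0" for j using sc[OF schwartz_zero, of j 0] by simp
  have h0: "h j = 0" if j: "j \<notin> {k-6..k+6}" for j
  proof -
   have z: "lpm \<phi> j \<zeta> * lpm \<phi> k \<zeta> = 0" for \<zeta>
   proof (rule ccontr)
    assume "lpm \<phi> j \<zeta> * lpm \<phi> k \<zeta> ~= 0"
    then have "\<phi> ((1 / 2 powi j) *\<^sub>R \<zeta>) ~= 0" "\<phi> ((1 / 2 powi k) *\<^sub>R \<zeta>) ~= 0" by (auto simp: lpm_def[OF lp])
    from lp_supp_powi[OF lp this(1)] lp_supp_powi[OF lp this(2)]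
    have "(2::real) powi (j - 1) <= 2 powi (k + 1)" "(2::real) powi (k - 1) <= 2 powi (j + 1)" by linarith+
    from powi_less_imp[OF lp this(1)] powi_less_imp[OF lp this(2)] have "j - 1 <= k + 1" "k - 1 <= j + 1" by auto
    then show False using j by auto
   qed
   have "fmul (lpm \<phi> j) ?\<eta> = (%x. 0)" unfolding fmul_def[of "lpm \<phi> j"] i mult.assoc[symmetric] z
    by (simp add: fourier_fexp fun_eq_iff)
   then show ?thesis by (simp add: h_def T0)
  qed
  have s1: "(\<Sum>n. h (int n)) = (\<Sum>j\<in>{k-6..k+6} \<inter> {0..}. h j)"
  proof -
   let ?A = "nat ` ({k-6..k+6} \<inter> {0..})"
   have "(\<Sum>n. h (int n)) = (\<Sum>n\<in>?A. h (int n))"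
   proof (rule suminf_finite)
    fix n assume "n \<notin> ?A"
    then have "int n \<notin> {k-6..k+6}" by (metis IntI atLeast_iff imageI nat_int of_nat_0_le_iff)
    then show "h (int n) = 0" by (rule h0)
   qed simp
   also have "\<dots> = (\<Sum>j\<in>{k-6..k+6} \<inter> {0..}. h j)"
    by (subst sum.reindex) (auto simp: inj_on_def)
   finally show ?thesis .
  qed
  have s2: "(\<Sum>n. h (- int n - 1)) = (\<Sum>j\<in>{k-6..k+6} - {0..}. h j)"
  proof -
   let ?A = "(%j. nat (- j - 1)) ` ({k-6..k+6} - {0..})"
   have "(\<Sum>n. h (- int n - 1)) = (\<Sum>n\<in>?A. h (- int n - 1))"
   proof (rule suminf_finite)
    fix n assume n: "n \<notin> ?A"
    have "- int n - 1 \<notin> {k-6..k+6}"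
    proof
     assume "- int n - 1 \<in> {k-6..k+6}"
     then have "- int n - 1 \<in> {k-6..k+6} - {0..}" by simp
     then have "nat (- (- int n - 1) - 1) \<in> ?A" by (rule imageI)
     then show False using n by simp
    qed
    then show "h (- int n - 1) = 0" by (rule h0)
   qed simp
   also have "\<dots> = (\<Sum>j\<in>{k-6..k+6} - {0..}. h j)"
    by (subst sum.reindex) (auto simp: inj_on_def intro!: sum.cong)
   finally show ?thesis .
  qed
  have "\<rho> ?\<eta> = (\<Sum>n. h (int n)) + (\<Sum>n. h (- int n - 1))" by (simp add: \<rho>_def T1_def T2_def S h_def)
  also have "\<dots> = (\<Sum>j=k-6..k+6. h j)" unfolding s1 s2 by (rule sum.Int_Diff[symmetric]) simp
  finally show ?thesis by (simp add: h_def)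
 qed
 ultimately show ?thesis by blast
qed

end

section \<open>Finiteness of block norms\<close>

text \<open>Majorize c by a sum of ones; homogeneity up to a constant is enough.\<close>

lemma Lp_norm_cmult:
 assumes M: "sigma_finite_measure M" and h: "h \<in> borel_measurable M" and p: "1 <= p" and c: "0 <= c"
 shows "Lp_norm p M (%x. ennreal c * h x) <= ennreal (2 * (c + 1)) * Lp_norm p M h"
proof -
 define n where "n = nat \<lceil>c\<rceil>"
 have n: "c <= real n" "real n <= c + 1" using c by (auto simp: n_def)
 have "Lp_norm p M (%x. ennreal c * h x) <= Lp_norm p M (%x. \<Sum>i\<in>{..<n}. h x)"
 proof (rule Lp_norm_mono_AE[OF _ _ p])
  show "(%x. ennreal c * h x) \<in> borel_measurable M" using h by measurable
  have "ennreal c * h x <= ennreal (real n) * h x" for x using n(1) by (intro mult_right_mono ennreal_leI) auto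
  then show "AE x in M. ennreal c * h x <= (\<Sum>i\<in>{..<n}. h x)" by (simp add: ennreal_of_nat_eq_real_of_nat)
 qed
 also have "\<dots> <= 2 * (\<Sum>i\<in>{..<n}. Lp_norm p M h)" by (rule Lp_norm_sum_weak[OF M _ h p]) simp
 also have "\<dots> = ennreal (2 * real n) * Lp_norm p M h" by (simp add: ennreal_of_nat_eq_real_of_nat ennreal_mult mult.assoc)
 also have "\<dots> <= ennreal (2 * (c + 1)) * Lp_norm p M h" using n(2) by (intro mult_right_mono ennreal_leI) auto
 finally show ?thesis .
qed

lemma sigma_finite_count_int: "sigma_finite_measure (count_space (UNIV :: int set))"
 by (simp add: sigma_finite_measure_count_space)

text \<open>The majorant of the k-th block norm of the average, up to a constant.\<close>

definition BB :: "ennreal => (int => int => int => 'a::euclidean_space \<times> 'a => complex) => (int => int => int => 'a \<times> 'a => complex) => int => real => ennreal" where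
 "BB p F G k t = ennreal (t powr - dd p TYPE('a)) * mix p (F k (ll k t) (ll k t))
   + (NN r. indicator {0<..<t} r * (ennreal (r powr - dd p TYPE('a)) * mix p (G k (ll k r) (ll k r))))"

lemma besov_xv_mixed_finite:
 assumes "h \<in> besov_xv \<phi> a s 1 p q" and q: "1 <= q"
 shows "mixed_norm_distr 1 p (block_x \<phi> (2 powi i) (block_v \<phi> (2 powi j) h)) < top"
proof -
 have "besov_xv_norm \<phi> a s 1 p q h < top" using assms by (simp add: besov_xv_def)
 from Lp_norm_count_finite[OF this[unfolded besov_xv_norm_def] q, of "(i, j)"]
 show ?thesis by (auto simp: ennreal_mult_less_top)
qed

section \<open>Averages of functions integrable in velocity\<close>

lemma v_integrable_pairing:
 fixes u :: "'a::euclidean_space \<times> 'a => complex"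
 assumes N: "integrable lborel (%(x, v). u (x, v) / cr ((1 + norm x) ^ N))" and u[measurable]: "u \<in> bmeas"
  and \<eta>: "schwartz \<eta>" and C: "\<And>x. sw N x * norm (\<eta> x) <= C"
 shows "integrable lborel (%z. u z * \<eta> (fst z))"
  "norm (LINT z|lborel. u z * \<eta> (fst z)) <= C * (LINT z|lborel. norm (u z / cr ((1 + norm (fst z)) ^ N)))"
proof -
 let ?w = "%z::'a\<times>'a. C * norm (u z / cr ((1 + norm (fst z)) ^ N))"
 have nrm: "norm (u z / cr ((1 + norm (fst z)) ^ N)) = norm (u z) * (1 / sw N (fst z))" for z :: "'a \<times> 'a"
  by (simp add: norm_divide norm_power del: of_real_power of_real_add)
 have w: "integrable lborel ?w"
  using integrable_norm[OF N] by (intro integrable_mult_right) (simp add: case_prod_beta')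
 have "(%z::'a\<times>'a. fst z) \<in> bmeas" by (intro borel_measurable_continuous_onI continuous_intros)
 then have [measurable]: "(%z::'a\<times>'a. \<eta> (fst z)) \<in> bmeas"
  by (rule measurable_compose) (rule schwartz_measurable[OF \<eta>])
 have m: "(%z. u z * \<eta> (fst z)) \<in> borel_measurable lborel" by measurable
 have le: "norm (u z * \<eta> (fst z)) <= ?w z" for z
 proof -
  have "norm (\<eta> (fst z)) <= C * (1 / sw N (fst z))" using C[of "fst z"] by (simp add: field_simps add_pos_nonneg)
  from mult_left_mono[OF this, of "norm (u z)"] show ?thesis unfolding nrm by (simp add: norm_mult mult_ac)
 qed
 show "integrable lborel (%z. u z * \<eta> (fst z))" by (rule norm_integral_le(1)[OF m w le])
 show "norm (LINT z|lborel. u z * \<eta> (fst z)) <= C * (LINT z|lborel. norm (u z / cr ((1 + norm (fst z)) ^ N)))"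
  using norm_integral_le(2)[OF m w le] by simp
qed

lemma v_integral_pairing:
 fixes u :: "'a::euclidean_space \<times> 'a => complex"
 assumes u: "v_integrable u f" and \<eta>: "schwartz \<eta>"
 shows "integrable lborel (%x. (LINT v|lborel. u (x, v)) * \<eta> x)"
  "(LINT x|lborel. (LINT v|lborel. u (x, v)) * \<eta> x) = (LINT z|lborel. u z * \<eta> (fst z))"
proof -
 obtain N :: nat where N: "integrable lborel (%(x, v). u (x, v) / cr ((1 + norm x) ^ N))" and ru: "represents u f"
  using u unfolding v_integrable_def by blast
 obtain C where C: "\<And>x. sw N x * norm (\<eta> x) <= C" using schwartz_bound[OF \<eta>] by blast
 have um: "u \<in> bmeas" using ru by (simp add: represents_def)
 have i: "integrable (lborel \<Otimes>\<^sub>M lborel) (%z. u z * \<eta> (fst z))"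
  unfolding lborel_prod by (rule v_integrable_pairing(1)[OF N um \<eta> C])
 have e: "(LINT v|lborel. u (x, v)) * \<eta> x = (LINT v|lborel. u (x, v) * \<eta> (fst (x, v)))" for x by simp
 show "integrable lborel (%x. (LINT v|lborel. u (x, v)) * \<eta> x)" unfolding e by (rule lborel_pair.integrable_fst'[OF i])
 show "(LINT x|lborel. (LINT v|lborel. u (x, v)) * \<eta> x) = (LINT z|lborel. u z * \<eta> (fst z))"
  unfolding e lborel_pair.integral_fst'[OF i] lborel_prod ..
qed

lemma v_integrable_average:
 fixes u :: "'a::euclidean_space \<times> 'a => complex"
 assumes u: "v_integrable u f"
 shows "\<exists>\<rho>. tempered \<rho> \<and> represents (%x. LINT v|lborel. u (x, v)) \<rho>"
proof -
 obtain N :: nat where N: "integrable lborel (%(x, v). u (x, v) / cr ((1 + norm x) ^ N))" and ru: "represents u f"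
  using u unfolding v_integrable_def by blast
 have um: "u \<in> bmeas" using ru by (simp add: represents_def)
 define \<rho> where "\<rho> \<eta> = (LINT z|lborel. u z * \<eta> (fst z))" for \<eta>
 have i: "integrable lborel (%z. u z * \<eta> (fst z))" if \<eta>: "schwartz \<eta>" for \<eta>
 proof -
  obtain C where C: "\<And>x. sw N x * norm (\<eta> x) <= C" using schwartz_bound[OF \<eta>] by blast
  show ?thesis by (rule v_integrable_pairing(1)[OF N um \<eta> C])
 qed
 have "tempered \<rho>"
 proof (rule temperedI)
  show "\<rho> (%x. f x + g x) = \<rho> f + \<rho> g" if "schwartz f" "schwartz g" for f g
   unfolding \<rho>_def distrib_left by (rule Bochner_Integration.integral_add[OF i[OF that(1)] i[OF that(2)]])
  show "\<rho> (%x. c * f x) = c * \<rho> f" if "schwartz f" for f c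
   unfolding \<rho>_def integral_mult_right_zero[symmetric] by (simp only: mult.left_commute)
  fix F :: "nat => 'a => complex" assume F: "sbdd F UNIV"
  obtain C where C: "\<forall>j\<in>UNIV. \<forall>x. sw N x * norm (F j x) <= C" using lev_bound[OF sbddD[OF F]] by blast
  have "norm (\<rho> (F j)) <= C * (LINT z|lborel. norm (u z / cr ((1 + norm (fst z)) ^ N)))" for j
   unfolding \<rho>_def by (rule v_integrable_pairing(2)[OF N um]) (use C sbdd_schwartz[OF F] in auto)
  then show "\<exists>C. \<forall>j. norm (\<rho> (F j)) <= C" by blast
 qed
 moreover have "represents (%x. LINT v|lborel. u (x, v)) \<rho>"
  unfolding represents_def
 proof (intro conjI allI impI)
  have "(%x. LINT v|lborel. u (x, v)) \<in> borel_measurable lborel"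
   by (rule lborel.borel_measurable_lebesgue_integral) (use um in \<open>simp add: lborel_prod_measurable\<close>)
  then show "(%x. LINT v|lborel. u (x, v)) \<in> bmeas" by simp
  fix \<eta> :: "'a => complex" assume \<eta>: "schwartz \<eta>"
  show "integrable lborel (%x. (LINT v|lborel. u (x, v)) * \<eta> x)" by (rule v_integral_pairing(1)[OF u \<eta>])
  show "\<rho> \<eta> = (LINT x|lborel. (LINT v|lborel. u (x, v)) * \<eta> x)" unfolding \<rho>_def by (rule v_integral_pairing(2)[OF u \<eta>, symmetric])
 qed
 ultimately show ?thesis by blast
qed

lemma powr_le_power_nat:
 assumes "\<bar>c\<bar> <= real \<sigma>" shows "2 powr (c * real_of_int k) <= 2 ^ (\<sigma> * nat \<bar>k\<bar>)"
proof -
 have "c * real_of_int k <= \<bar>c\<bar> * real_of_int \<bar>k\<bar>" using abs_ge_self[of "c * real_of_int k"] by (simp add: abs_mult)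
 also have "\<dots> <= real \<sigma> * real_of_int \<bar>k\<bar>" using assms by (intro mult_right_mono) auto
 also have "\<dots> = real (\<sigma> * nat \<bar>k\<bar>)" by simp
 finally have "2 powr (c * real_of_int k) <= 2 powr real (\<sigma> * nat \<bar>k\<bar>)" by (intro powr_mono) auto
 then show ?thesis by (simp only: powr_realpow zero_less_numeral)
qed

context
 fixes \<psi> \<phi> :: "'a::euclidean_space => real" and p :: ennreal
 assumes lp: "littlewood_paley \<psi> \<phi>" and p: "1 <= p"
begin

abbreviation "LP k == fmul (lpm \<phi> k)"

abbreviation "KK == kap \<phi>"

lemma K_bound: "\<exists>B>0. \<forall>w. norm (KK w) <= B"
 by (rule schwartz_sup[OF kap_schwartz[OF lp]])

lemma shten_measurable:
 fixes \<theta> \<kappa> :: "'a => complex"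
 assumes "\<theta> \<in> bmeas" "\<kappa> \<in> bmeas"
 shows "shten r \<epsilon> \<theta> \<kappa> \<in> bmeas"
proof -
 have [measurable]: "(%z::'a\<times>'a. \<theta> (stream r z)) \<in> bmeas"
  by (rule measurable_compose[OF shear_measurable assms(1)])
 have "(%z::'a\<times>'a. \<epsilon> *\<^sub>R snd z) \<in> bmeas" by (intro borel_measurable_continuous_onI continuous_intros)
 then have [measurable]: "(%z::'a\<times>'a. \<kappa> (\<epsilon> *\<^sub>R snd z)) \<in> bmeas"
  by (rule measurable_compose[OF _ assms(2)])
 show ?thesis unfolding shten_def case_prod_beta' by measurable
qed

text \<open>The test function has its spectrum where \<open>shten_spec\<close> puts it, so \<open>H k l1 l2\<close> represents h
on it.\<close>

lemma locrep_shten: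
 assumes H: "locrep \<phi> p h H" and \<theta>: "spec1 k \<theta>" and \<kappa>: "schwartz \<kappa>" "\<And>\<zeta>. inv_fourier \<kappa> \<zeta> ~= 0 ==> norm \<zeta> <= 2"
  and \<epsilon>: "0 < \<epsilon>" "8 * \<epsilon> <= r * 2 powi k" and r: "0 < r"
  and l: "2 powi l1 <= r * 2 powi k" "r * 2 powi k <= 2 powi (l2 + 1)"
 shows "integrable lborel (%z. H k l1 l2 z * shten r \<epsilon> \<theta> \<kappa> z)" "h (shten r \<epsilon> \<theta> \<kappa>) = (LINT z|lborel. H k l1 l2 z * shten r \<epsilon> \<theta> \<kappa> z)"
proof -
 have \<theta>s: "schwartz \<theta>" using \<theta> by (simp add: spec1_def)
 note E = shten_schwartz[OF \<theta>s \<kappa>(1), of \<epsilon> r]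
 show "integrable lborel (%z. H k l1 l2 z * shten r \<epsilon> \<theta> \<kappa> z)" "h (shten r \<epsilon> \<theta> \<kappa>) = (LINT z|lborel. H k l1 l2 z * shten r \<epsilon> \<theta> \<kappa> z)"
  using \<epsilon> by (intro locrep_spec[OF lp H E shten_spec[OF \<theta> \<kappa> \<epsilon> r l]]; simp)+
qed

lemma locrepD: assumes "locrep \<phi> p h H" shows "H k l1 l2 \<in> bmeas" "mix p (H k l1 l2) < top"
 using assms by (auto simp: locrep_def)

section \<open>Regularized velocity averages and their limits\<close>

text \<open>The regularization of \<open>Av\<close> by the cutoff. For small \<epsilon> it is the pairing of h itself
(\<open>gm_eq\<close>).\<close>

definition gm where "gm H k \<theta> \<epsilon> r = (LINT z|lborel. H k (ll k r) (ll k r) z * shten r \<epsilon> \<theta> KK z)"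

lemma gm_eq:
 assumes H: "locrep \<phi> p h H" and \<theta>: "spec1 k \<theta>" and \<epsilon>: "0 < \<epsilon>" "8 * \<epsilon> <= r * 2 powi k"
 shows "h (shten r \<epsilon> \<theta> KK) = gm H k \<theta> \<epsilon> r"
proof -
 have "0 < r * 2 powi k" using \<epsilon> by linarith
 then have r: "0 < r" by (rule zero_less_mult_pos2) simp
 show ?thesis unfolding gm_def
  by (rule locrep_shten(2)[OF H \<theta> kap_schwartz[OF lp] kap_supp[OF lp] \<epsilon> r]) (use ll_bounds[OF r, of k] in auto)
qed

lemma Av_limit:
 assumes H: "locrep \<phi> p h H" and \<theta>: "schwartz \<theta>" and r: "0 < r"
 shows "((%\<epsilon>. gm H k \<theta> \<epsilon> r) \<longlongrightarrow> Av H k r \<theta>) (at_right 0)"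
proof -
 have [measurable]: "H k l1 l2 \<in> bmeas" for k l1 l2 using locrepD[OF H] by simp
 have [measurable]: "\<theta> \<in> bmeas" "KK \<in> bmeas" using schwartz_measurable \<theta> kap_schwartz[OF lp] by auto
 have [measurable]: "(%z::'a\<times>'a. \<theta> (stream r z)) \<in> bmeas"
  by (rule measurable_compose[OF shear_measurable]) measurable
 have [measurable]: "shten r \<epsilon> \<theta> KK \<in> bmeas" for \<epsilon> by (rule shten_measurable) measurable
 obtain B where B: "0 < B" "\<And>w. norm (KK w) <= B" using K_bound by blast
 obtain C where C: "0 <= C" "\<And>w. sw 0 w * norm (\<theta> w) <= C" using schwartz_bound[OF \<theta>, of 0] by blast
 have i: "integrable lborel (%z. norm (H k (ll k r) (ll k r) z) * norm (\<theta> (stream r z)))"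
  by (rule shear_integrable(1)[where w="%x. norm (\<theta> x)" and A="l1n \<theta>" and B="C + 1" and p=p])
    (use locrepD[OF H] l1n[OF schwartz_integrable[OF \<theta>]] C p r in \<open>auto intro: add_increasing2\<close>)
 show ?thesis unfolding gm_def Av_def
 proof (rule dominated_convergence_at_right[where w="%z. B * (norm (H k (ll k r) (ll k r) z) * norm (\<theta> (stream r z)))"])
  show "integrable lborel (%z. B * (norm (H k (ll k r) (ll k r) z) * norm (\<theta> (stream r z))))"
   by (intro integrable_mult_right i)
  fix z :: "'a \<times> 'a"
  have "((%\<epsilon>::real. \<epsilon> *\<^sub>R snd z) \<longlongrightarrow> 0) (at_right 0)" by (auto intro!: tendsto_eq_intros)
  moreover have "isCont KK 0" using schwartz_continuous[OF kap_schwartz[OF lp]] continuous_on_eq_continuous_at by blast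
  ultimately have "((%\<epsilon>. KK (\<epsilon> *\<^sub>R snd z)) \<longlongrightarrow> KK 0) (at_right 0)" by (rule isCont_tendsto_compose[rotated])
  then have "((%\<epsilon>. H k (ll k r) (ll k r) z * (\<theta> (stream r z) * KK (\<epsilon> *\<^sub>R snd z))) \<longlongrightarrow> H k (ll k r) (ll k r) z * (\<theta> (stream r z) * 1)) (at_right 0)"
   using kap_0[OF lp] by (intro tendsto_mult tendsto_const) simp
  then show "((%\<epsilon>. H k (ll k r) (ll k r) z * shten r \<epsilon> \<theta> KK z) \<longlongrightarrow> H k (ll k r) (ll k r) z * \<theta> (stream r z)) (at_right 0)"
   by (simp add: shten_def case_prod_beta')
  fix \<epsilon> :: real
  show "norm (H k (ll k r) (ll k r) z * shten r \<epsilon> \<theta> KK z) <= B * (norm (H k (ll k r) (ll k r) z) * norm (\<theta> (stream r z)))"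
   using mult_left_mono[OF B(2)[of "\<epsilon> *\<^sub>R snd z"], of "norm (H k (ll k r) (ll k r) z) * norm (\<theta> (stream r z))"]
   by (simp add: shten_def case_prod_beta' norm_mult mult_ac)
 qed measurable
qed

lemma gm_bound:
 assumes H: "locrep \<phi> p h H" and \<theta>: "schwartz \<theta>" and r: "0 < r" and B: "0 < B" "\<And>w. norm (KK w) <= B"
  and C: "0 < C" "\<And>w. norm (\<theta> w) <= C"
 shows "norm (gm H k \<theta> \<epsilon> r) <= B * (hc p (l1n \<theta>) C * (r powr - dd p TYPE('a) * enn2real (mix p (H k (ll k r) (ll k r)))))"
  and "norm (Av H k r \<theta>) <= hc p (l1n \<theta>) C * (r powr - dd p TYPE('a) * enn2real (mix p (H k (ll k r) (ll k r))))"
  and "integrable lborel (%z. H k (ll k r) (ll k r) z * \<theta> (stream r z))"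
proof -
 have [measurable]: "H k l1 l2 \<in> bmeas" for k l1 l2 using locrepD[OF H] by simp
 have [measurable]: "\<theta> \<in> bmeas" "KK \<in> bmeas" using schwartz_measurable \<theta> kap_schwartz[OF lp] by auto
 have [measurable]: "(%z::'a\<times>'a. \<theta> (stream r z)) \<in> bmeas"
  by (rule measurable_compose[OF shear_measurable]) measurable
 have [measurable]: "shten r \<epsilon> \<theta> KK \<in> bmeas" for \<epsilon> by (rule shten_measurable) measurable
 note S = shear_integrable[where w="%x. norm (\<theta> x)" and A="l1n \<theta>" and B=C and p=p and u="H k (ll k r) (ll k r)" and r=r]
 have i: "integrable lborel (%z. norm (H k (ll k r) (ll k r) z) * norm (\<theta> (stream r z)))"
  and le: "(LINT z|lborel. norm (H k (ll k r) (ll k r) z) * norm (\<theta> (stream r z))) <= hc p (l1n \<theta>) C * r powr - dd p TYPE('a) * enn2real (mix p (H k (ll k r) (ll k r)))"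
  by (rule S; use locrepD[OF H] l1n[OF schwartz_integrable[OF \<theta>]] C p r in auto)+
 have "norm (gm H k \<theta> \<epsilon> r) <= (LINT z|lborel. B * (norm (H k (ll k r) (ll k r) z) * norm (\<theta> (stream r z))))"
  unfolding gm_def
 proof (rule norm_integral_le(2)[OF _ integrable_mult_right[OF i]])
  fix z :: "'a \<times> 'a"
  show "norm (H k (ll k r) (ll k r) z * shten r \<epsilon> \<theta> KK z) <= B * (norm (H k (ll k r) (ll k r) z) * norm (\<theta> (stream r z)))"
   using mult_left_mono[OF B(2)[of "\<epsilon> *\<^sub>R snd z"], of "norm (H k (ll k r) (ll k r) z) * norm (\<theta> (stream r z))"]
   by (simp add: shten_def case_prod_beta' norm_mult mult_ac)
 qed measurable
 also have "\<dots> = B * (LINT z|lborel. norm (H k (ll k r) (ll k r) z) * norm (\<theta> (stream r z)))" by simp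
 also have "\<dots> <= B * (hc p (l1n \<theta>) C * r powr - dd p TYPE('a) * enn2real (mix p (H k (ll k r) (ll k r))))"
  using B(1) le by (intro mult_left_mono) auto
 finally show "norm (gm H k \<theta> \<epsilon> r) <= B * (hc p (l1n \<theta>) C * (r powr - dd p TYPE('a) * enn2real (mix p (H k (ll k r) (ll k r)))))"
  by (simp only: mult.assoc)
 show "integrable lborel (%z. H k (ll k r) (ll k r) z * \<theta> (stream r z))"
  by (rule norm_integral_le(1)[OF _ i]) (auto simp: norm_mult)
 have "norm (Av H k r \<theta>) <= (LINT z|lborel. norm (H k (ll k r) (ll k r) z) * norm (\<theta> (stream r z)))"
  unfolding Av_def by (rule norm_integral_le(2)[OF _ i]) (auto simp: norm_mult)
 with le show "norm (Av H k r \<theta>) <= hc p (l1n \<theta>) C * (r powr - dd p TYPE('a) * enn2real (mix p (H k (ll k r) (ll k r))))"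
  by (simp only: mult.assoc)
qed

lemma gm_measurable:
 assumes H: "locrep \<phi> p h H" and \<theta>: "schwartz \<theta>"
 shows "gm H k \<theta> \<epsilon> \<in> bmeas" "(%r. Av H k r \<theta>) \<in> bmeas"
  "(%r. enn2real (mix p (H k (ll k r) (ll k r)))) \<in> bmeas"
proof -
 have [measurable]: "H k l1 l2 \<in> borel_measurable (lborel :: ('a \<times> 'a) measure)" for k l1 l2 using locrepD[OF H] by simp
 have [measurable]: "\<theta> \<in> bmeas" "KK \<in> bmeas" using schwartz_measurable \<theta> kap_schwartz[OF lp] by auto
 have m1: "(%(r::real, z::'a\<times>'a). stream r z) \<in> borel_measurable (borel \<Otimes>\<^sub>M borel)"
  unfolding borel_prod by (intro borel_measurable_continuous_onI) (auto simp: case_prod_beta' intro!: continuous_intros)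
 have "(%(r::real, z::'a\<times>'a). \<theta> (stream r z)) \<in> borel_measurable (borel \<Otimes>\<^sub>M borel)"
  using measurable_compose[OF m1, of \<theta> borel] by (simp add: case_prod_beta')
 then have [measurable]: "(%(r::real, z::'a\<times>'a). \<theta> (stream r z)) \<in> borel_measurable (borel \<Otimes>\<^sub>M lborel)"
  by (simp add: measurable_lborel1 cong: measurable_cong_sets)
 have "(%z::'a\<times>'a. \<epsilon> *\<^sub>R snd z) \<in> bmeas" by (intro borel_measurable_continuous_onI continuous_intros)
 then have [measurable]: "(%z::'a\<times>'a. KK (\<epsilon> *\<^sub>R snd z)) \<in> borel_measurable lborel"
  using measurable_compose[of "%z::'a\<times>'a. \<epsilon> *\<^sub>R snd z" borel borel KK borel] by simp
 have sh: "shten r \<epsilon> \<theta> KK z = (%(r, z). \<theta> (stream r z)) (r, z) * KK (\<epsilon> *\<^sub>R snd z)" for r z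
  by (simp add: shten_def case_prod_beta')
 show "gm H k \<theta> \<epsilon> \<in> bmeas" unfolding gm_def[abs_def]
 proof (rule ll_compose_measurable)
  fix l
  show "(%r. LINT z|lborel. H k l l z * shten r \<epsilon> \<theta> KK z) \<in> bmeas"
   unfolding sh by (rule lborel.borel_measurable_lebesgue_integral) measurable
 qed
 define Q where "Q = (%(r::real, z::'a\<times>'a). \<theta> (stream r z))"
 have [measurable]: "Q \<in> borel_measurable (borel \<Otimes>\<^sub>M lborel)" unfolding Q_def by measurable
 have sh2: "\<theta> (stream r z) = Q (r, z)" for r z by (simp add: Q_def)
 show "(%r. Av H k r \<theta>) \<in> bmeas" unfolding Av_def
 proof (rule ll_compose_measurable)
  fix l
  show "(%r. LINT z|lborel. H k l l z * \<theta> (stream r z)) \<in> bmeas"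
   unfolding sh2 by (rule lborel.borel_measurable_lebesgue_integral) measurable
 qed
 show "(%r. enn2real (mix p (H k (ll k r) (ll k r)))) \<in> bmeas"
  by (rule ll_compose_measurable) simp
qed

section \<open>Velocity averages of velocity blocks\<close>

text \<open>Split the test function, localized to velocity frequency \<open>t 2^k\<close>, by the multiplier \<open>PP\<close>. On
the first part h is represented by \<open>H\<close>, and dominated convergence applies. On the support of the second
part \<open>\<eta> - t \<xi>\<close> is bounded away from 0, so by \<open>scaled_right\<close> it tends to 0 in the
Schwartz space as \<open>\<epsilon> \<rightarrow> 0\<close>, for every cutoff.\<close>

lemma has_v_integral_Av:
 assumes h: "tempered h" and H: "locrep \<phi> p h H" and t: "0 < t"
 shows "has_v_integral (shear t (block_v \<phi> (t * 2 powi k) h)) (%\<eta>. Av H k t (LP k \<eta>))"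
 unfolding has_v_integral_def
proof (intro allI impI)
 fix \<kappa> \<eta> :: "'a => complex" assume \<kappa>: "schwartz \<kappa>" and \<kappa>0: "\<kappa> 0 = 1" and \<eta>: "schwartz \<eta>"
 let ?\<tau> = "t * 2 powi k" let ?l = "ll k t"
 have \<tau>: "0 < ?\<tau>" using t by simp
 define mv where "mv z = cr (\<phi> ((1 / ?\<tau>) *\<^sub>R snd z))" for z :: "'a \<times> 'a"
 have mvb: "bmul mv" unfolding mv_def[abs_def]
  by (rule bmul_comp[OF schwartz_bmul[OF lp_phi_schwartz[OF lp]] bounded_linear_compose[OF bounded_linear_scaleR_right bounded_linear_snd]])
 define S where "S \<epsilon> = shten t \<epsilon> \<eta> \<kappa>" for \<epsilon>
 have S: "schwartz (S \<epsilon>)" if "0 < \<epsilon>" for \<epsilon> unfolding S_def using that by (intro shten_schwartz \<eta> \<kappa>) auto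
 define \<Theta> where "\<Theta> \<epsilon> = fmul mv (S \<epsilon>)" for \<epsilon>
 have \<Theta>s: "schwartz (\<Theta> \<epsilon>)" if "0 < \<epsilon>" for \<epsilon> unfolding \<Theta>_def using that by (intro fmul_schwartz mvb S)
 let ?P = "PP \<phi> k ?l ?l"
 note Pb = PP_bmul[OF lp, of k ?l ?l]
 have T: "shear t (block_v \<phi> ?\<tau> h) (%(x, v). \<eta> x * \<kappa> (\<epsilon> *\<^sub>R v)) = h (\<Theta> \<epsilon>)" for \<epsilon>
 proof -
  have "(%(\<xi>::'a, \<zeta>). cr (\<phi> ((1 / ?\<tau>) *\<^sub>R \<zeta>))) = mv" by (auto simp: mv_def fun_eq_iff)
  then show ?thesis unfolding shear_def block_v_def fourier_multiplier_fmul \<Theta>_def S_def shten_def by simp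
 qed
 have mv_nz: "mv z ~= 0 ==> ?\<tau> / 2 <= norm (snd z) \<and> norm (snd z) <= 2 * ?\<tau>" for z
 proof -
  assume "mv z ~= 0"
  then have "1 / 2 <= norm (snd z) / ?\<tau>" "norm (snd z) / ?\<tau> <= 2" using lp_supp[OF lp, of "(1 / ?\<tau>) *\<^sub>R snd z"] t by (auto simp: mv_def)
  then show ?thesis using pos_le_divide_eq[OF \<tau>] pos_divide_le_eq[OF \<tau>] by simp
 qed
 have P1: "mv z ~= 0 ==> 2 powi (k - 5) <= norm (fst z) ==> norm (fst z) <= 2 powi (k + 5) ==> ?P z = 1" for z
 proof -
  assume a: "mv z ~= 0" "2 powi (k - 5) <= norm (fst z)" "norm (fst z) <= 2 powi (k + 5)"
  have "(2::real) powi (?l - 5) <= 2 powi ?l / 2" "2 * 2 powi (?l + 1) <= (2::real) powi (?l + 5)"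
   by (simp_all add: power_int_add power_int_diff)
  then have "2 powi (?l - 5) <= norm (snd z)" "norm (snd z) <= 2 powi (?l + 5)"
   using mv_nz[OF a(1)] ll_bounds[OF t, of k] by linarith+
  then show "?P z = 1" using a by (simp add: PP_def lpsum_eq_1[OF lp])
 qed
 \<comment> \<open>The spectrum of this part keeps away from the plane (velocity frequency t times spatial frequency) at which the spectrum of \<open>S \<epsilon>\<close> concentrates.\<close>
 define A where "A z = (1 - ?P z) * (mv z * inv_fourier \<eta> (fst z))" for z :: "'a \<times> 'a"
 have As: "schwartz A"
 proof -
  have "sbdd (%(_::unit) z. cr (\<phi> ((1 / ?\<tau>) *\<^sub>R snd z)) * inv_fourier \<eta> (fst z)) (UNIV :: unit set)"
  proof (rule sbdd_pair[OF schwartz_sbdd[OF lp_phi_schwartz[OF lp]] schwartz_sbdd[OF inv_fourier_schwartz[OF \<eta>]]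
     bounded_linear_compose[OF bounded_linear_scaleR_right bounded_linear_snd] bounded_linear_fst, where K="1 + ?\<tau>"])
   fix z :: "'a \<times> 'a"
   have n: "norm z <= norm (fst z) + norm (snd z)" by (metis norm_Pair_le prod.collapse)
   have "norm (snd z) = ?\<tau> * norm ((1 / ?\<tau>) *\<^sub>R snd z)" using t by simp
   moreover have "a + T * b <= (1 + T) * (b + a)" if "0 <= T" "0 <= a" "0 <= b" for a b T :: real
    using that mult_nonneg_nonneg[OF that(1,2)] by (simp add: algebra_simps)
   from this[of ?\<tau> "norm (fst z)" "norm ((1 / ?\<tau>) *\<^sub>R snd z)"] \<tau>
   have "norm (fst z) + ?\<tau> * norm ((1 / ?\<tau>) *\<^sub>R snd z) <= (1 + ?\<tau>) * (norm ((1 / ?\<tau>) *\<^sub>R snd z) + norm (fst z))" by simp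
   ultimately show "norm z <= (1 + ?\<tau>) * (norm ((1 / ?\<tau>) *\<^sub>R snd z) + norm (fst z))" using n by linarith
  qed
  then have "schwartz (%z. mv z * inv_fourier \<eta> (fst z))" unfolding schwartz_iff mv_def .
  then show ?thesis unfolding A_def[abs_def] by (rule bmul_schwartz_mult[OF bmul_diff[OF bmul_const Pb]])
 qed
 define L where "L z = snd z - t *\<^sub>R fst z" for z :: "'a \<times> 'a"
 have L: "bounded_linear L" unfolding L_def[abs_def]
  by (intro bounded_linear_sub bounded_linear_snd bounded_linear_compose[OF bounded_linear_scaleR_right bounded_linear_fst])
 have AL: "?\<tau> / 8 <= norm (L z)" if nz: "A z ~= 0" for z
 proof -
  have mz: "mv z ~= 0" and pz: "?P z ~= 1" using nz by (auto simp: A_def)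
  have "\<not> (2 powi (k - 5) <= norm (fst z) \<and> norm (fst z) <= 2 powi (k + 5))" using P1[OF mz] pz by blast
  then consider "norm (fst z) < 2 powi (k - 5)" | "2 powi (k + 5) < norm (fst z)" by linarith
  then show ?thesis
  proof cases
   case 1
   then have "norm (t *\<^sub>R fst z) <= t * 2 powi (k - 5)" using t by (simp add: mult_left_mono)
   also have "\<dots> = ?\<tau> / 32" by (simp add: power_int_diff)
   finally have "norm (t *\<^sub>R fst z) <= ?\<tau> / 32" .
   then show ?thesis using mv_nz[OF mz] norm_triangle_ineq2[of "snd z" "t *\<^sub>R fst z"] \<tau> unfolding L_def by linarith
  next
   case 2
   then have "t * 2 powi (k + 5) <= norm (t *\<^sub>R fst z)" using t by (simp add: mult_left_mono)
   moreover have "t * 2 powi (k + 5) = 32 * ?\<tau>" by (simp add: power_int_add)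
   ultimately have "32 * ?\<tau> <= norm (t *\<^sub>R fst z)" by simp
   then show ?thesis using mv_nz[OF mz] norm_triangle_ineq2[of "t *\<^sub>R fst z" "snd z"] \<tau> norm_minus_commute[of "snd z" "t *\<^sub>R fst z"] unfolding L_def by linarith
  qed
 qed
 define fam where "fam \<epsilon> z = cr ((1 / \<epsilon>) ^ Suc DIM('a)) * (A z * inv_fourier \<kappa> ((1 / \<epsilon>) *\<^sub>R L z))" for \<epsilon> z
 have fam: "sbdd fam {0<..1}" unfolding fam_def[abs_def]
  by (rule scaled_right[OF As inv_fourier_schwartz[OF \<kappa>] L _ AL]) (use \<tau> in auto)
 have off: "fmul (%z. 1 - ?P z) (\<Theta> \<epsilon>) = (%z. cr \<epsilon> * fourier (fam \<epsilon>) z)" if \<epsilon>: "0 < \<epsilon>" for \<epsilon>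
 proof -
  have "inv_fourier (\<Theta> \<epsilon>) z = mv z * (inv_fourier \<eta> (fst z) * ((1 / \<bar>\<epsilon>\<bar> ^ DIM('a)) *\<^sub>R inv_fourier \<kappa> ((1 / \<epsilon>) *\<^sub>R L z)))" for z
   unfolding \<Theta>_def inv_fourier_fmul[OF mvb S[OF \<epsilon>]] unfolding S_def using inv_fourier_shten[OF \<eta> \<kappa>, of \<epsilon> t "fst z" "snd z"] \<epsilon> by (simp add: L_def)
  then have "(1 - ?P z) * inv_fourier (\<Theta> \<epsilon>) z = cr \<epsilon> * fam \<epsilon> z" for z
   using \<epsilon> by (simp add: fam_def A_def scaleR_conv_of_real power_divide field_simps)
  then show ?thesis unfolding fmul_def by (simp add: fun_eq_iff fourier_cmult)
 qed
 obtain Ch where Ch: "\<And>\<epsilon>. \<epsilon> \<in> {0<..1} ==> norm (h (fourier (fam \<epsilon>))) <= Ch"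
  using tempered_bounded[OF h fourier_sbdd[OF fam]] by blast
 have lim2: "((%\<epsilon>. h (fmul (%z. 1 - ?P z) (\<Theta> \<epsilon>))) \<longlongrightarrow> 0) (at_right 0)"
 proof (rule Lim_null_comparison)
  show "((%\<epsilon>. \<epsilon> * Ch) \<longlongrightarrow> 0) (at_right 0)" by (auto intro!: tendsto_eq_intros)
  have "norm (h (fmul (%z. 1 - ?P z) (\<Theta> \<epsilon>))) <= \<epsilon> * Ch" if "0 < \<epsilon>" "\<epsilon> < 1" for \<epsilon>
  proof -
   have "schwartz (fourier (fam \<epsilon>))" using sbdd_schwartz[OF fourier_sbdd[OF fam]] that by auto
   then have "h (fmul (%z. 1 - ?P z) (\<Theta> \<epsilon>)) = cr \<epsilon> * h (fourier (fam \<epsilon>))"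
    unfolding off[OF that(1)] by (rule tempered_cmult[OF h])
   then show ?thesis using Ch[of \<epsilon>] that by (simp add: norm_mult)
  qed
  then show "\<forall>\<^sub>F \<epsilon> in at_right 0. norm (h (fmul (%z. 1 - ?P z) (\<Theta> \<epsilon>))) <= \<epsilon> * Ch"
   unfolding eventually_at_right_field by (intro exI[of _ 1]) auto
 qed
 have [measurable]: "H k l1 l2 \<in> bmeas" for k l1 l2 using locrepD[OF H] by simp
 note ks = kk_schwartz[OF lp]
 have [measurable]: "\<eta> \<in> bmeas" "kk \<phi> \<in> bmeas" using schwartz_measurable \<eta> ks by auto
 obtain B where B: "0 <= B" "\<And>w. sw 0 w * norm (\<kappa> w) <= B" using schwartz_bound[OF \<kappa>, of 0] by blast
 obtain C where C: "0 <= C" "\<And>w. sw 0 w * norm (\<eta> w) <= C" using schwartz_bound[OF \<eta>, of 0] by blast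
 let ?K1 = "LINT w|lborel. norm (kk \<phi> w)"
 have ki: "integrable lborel (%w. norm (kk \<phi> w))" by (intro integrable_norm schwartz_integrable ks)
 define \<Omega> where "\<Omega> x = (LINT w|lborel. norm (kk \<phi> w) * norm (\<eta> (x - (1 / 2 powi k) *\<^sub>R w)))" for x
 have m2: "(%(x::'a, w::'a). \<eta> (x - (1 / 2 powi k) *\<^sub>R w)) \<in> borel_measurable (borel \<Otimes>\<^sub>M borel)"
 proof -
  have "(%(x::'a, w::'a). x - (1 / 2 powi k) *\<^sub>R w) \<in> borel_measurable (borel \<Otimes>\<^sub>M borel)"
   unfolding borel_prod by (intro borel_measurable_continuous_onI) (auto simp: case_prod_beta' intro!: continuous_intros)
  from measurable_compose[OF this, of \<eta> borel] show ?thesis by (simp add: case_prod_beta')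
 qed
 have m3[measurable]: "(%(x::'a, w::'a). norm (kk \<phi> w) * norm (\<eta> (x - (1 / 2 powi k) *\<^sub>R w))) \<in> borel_measurable (borel \<Otimes>\<^sub>M lborel)"
 proof -
  have "(%(x::'a, w::'a). norm (kk \<phi> w) * norm (\<eta> (x - (1 / 2 powi k) *\<^sub>R w))) \<in> borel_measurable (borel \<Otimes>\<^sub>M borel)"
   using m2 by (simp add: case_prod_beta')
  then show ?thesis by (simp cong: measurable_cong_sets)
 qed
 have \<Omega>m[measurable]: "\<Omega> \<in> bmeas" unfolding \<Omega>_def[abs_def]
  by (rule lborel.borel_measurable_lebesgue_integral[OF m3])
 have \<Omega>i: "integrable lborel (%w. norm (kk \<phi> w) * norm (\<eta> (x - (1 / 2 powi k) *\<^sub>R w)))" for x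
 proof (rule norm_integral_le(1)[OF _ integrable_mult_left[OF ki, of C]])
  show "(%w. norm (kk \<phi> w) * norm (\<eta> (x - (1 / 2 powi k) *\<^sub>R w))) \<in> borel_measurable lborel" by measurable
 qed (use C in \<open>auto intro: mult_left_mono\<close>)
 have \<Omega>0: "0 <= \<Omega> x" for x unfolding \<Omega>_def by (intro integral_nonneg_AE) auto
 have \<Omega>C: "\<Omega> x <= ?K1 * C" for x unfolding \<Omega>_def integral_mult_left_zero[symmetric]
  by (intro integral_mono \<Omega>i integrable_mult_left ki mult_left_mono) (use C in auto)
 have \<Omega>1: "(NN x. ennreal (\<Omega> x)) <= ennreal (?K1 * l1n \<eta>)"
 proof -
  have "(NN x. ennreal (\<Omega> x)) = (NN x. NN w. ennreal (norm (kk \<phi> w) * norm (\<eta> (x - (1 / 2 powi k) *\<^sub>R w))))"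
   unfolding \<Omega>_def by (intro nn_integral_cong nn_integral_eq_integral[symmetric] \<Omega>i) auto
  also have "\<dots> = (NN w. NN x. ennreal (norm (kk \<phi> w) * norm (\<eta> (x - (1 / 2 powi k) *\<^sub>R w))))"
   using m3 by (intro lborel_pair.Fubini'[symmetric]) (simp cong: measurable_cong_sets)
  also have "\<dots> = (NN w. ennreal (norm (kk \<phi> w)) * (NN x. ennreal (norm (\<eta> x))))"
  proof (intro nn_integral_cong)
   fix w
   have "(NN x. ennreal (norm (kk \<phi> w) * norm (\<eta> (x - (1 / 2 powi k) *\<^sub>R w)))) = ennreal (norm (kk \<phi> w)) * (NN x. ennreal (norm (\<eta> (x - (1 / 2 powi k) *\<^sub>R w))))"
    by (subst nn_integral_cmult[symmetric]) (auto simp: ennreal_mult)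
   also have "(NN x. ennreal (norm (\<eta> (x - (1 / 2 powi k) *\<^sub>R w)))) = (NN x. ennreal (norm (\<eta> x)))"
    using nn_integral_affine[of 1 "%x. ennreal (norm (\<eta> x))" "- ((1 / 2 powi k) *\<^sub>R w)"] by simp
   finally show "(NN x. ennreal (norm (kk \<phi> w) * norm (\<eta> (x - (1 / 2 powi k) *\<^sub>R w)))) = ennreal (norm (kk \<phi> w)) * (NN x. ennreal (norm (\<eta> x)))" .
  qed
  also have "\<dots> = (NN w. ennreal (norm (kk \<phi> w))) * (NN x. ennreal (norm (\<eta> x)))"
   by (rule nn_integral_multc) measurable
  also have "\<dots> <= ennreal ?K1 * ennreal (l1n \<eta>)"
   using l1n(2)[OF schwartz_integrable[OF \<eta>]] nn_integral_eq_integral[OF ki] by (intro mult_mono) auto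
  also have "\<dots> = ennreal (?K1 * l1n \<eta>)"
   using l1n(1)[OF schwartz_integrable[OF \<eta>]] by (subst ennreal_mult) (auto intro!: integral_nonneg_AE)
  finally show ?thesis .
 qed
 have K10: "0 <= ?K1" by (intro integral_nonneg_AE) auto
 have i: "integrable lborel (%z. norm (H k ?l ?l z) * \<Omega> (stream t z))"
 proof (rule shear_integrable(1)[where A="?K1 * l1n \<eta> + 1" and B="?K1 * C + 1" and p=p])
  show "(NN x. ennreal (\<Omega> x)) <= ennreal (?K1 * l1n \<eta> + 1)"
   using \<Omega>1 by (rule order_trans) (intro ennreal_leI, simp)
  show "0 < ?K1 * l1n \<eta> + 1" using K10 l1n(1)[OF schwartz_integrable[OF \<eta>]] by (intro add_nonneg_pos) auto
  show "0 < ?K1 * C + 1" using K10 C by (intro add_nonneg_pos) auto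
  show "\<Omega> x <= ?K1 * C + 1" for x using \<Omega>C[of x] by simp
 qed (use locrepD[OF H] p t \<Omega>0 in auto)
 have \<Theta>f: "\<Theta> \<epsilon> z = (LINT w|lborel. kk \<phi> w * (\<eta> (stream t z - (1 / 2 powi k) *\<^sub>R w) * \<kappa> (\<epsilon> *\<^sub>R (snd z - (1 / ?\<tau>) *\<^sub>R w))))" if \<epsilon>: "0 < \<epsilon>" for \<epsilon> z
 proof -
  have "\<Theta> \<epsilon> (fst z, snd z) = (LINT w|lborel. kk \<phi> w * S \<epsilon> (fst z, snd z - (1 / ?\<tau>) *\<^sub>R w))"
   unfolding \<Theta>_def mv_def[abs_def] by (rule fmul_snd[OF lp S[OF \<epsilon>]])
  moreover have "fst z + t *\<^sub>R (snd z - (1 / ?\<tau>) *\<^sub>R w) = stream t z - (1 / 2 powi k) *\<^sub>R w" for w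
   using t by (simp add: scaleR_right_diff_distrib)
  ultimately show ?thesis by (simp add: S_def shten_def)
 qed
 have pt\<Theta>: "((%\<epsilon>. \<Theta> \<epsilon> z) \<longlongrightarrow> LP k \<eta> (stream t z)) (at_right 0)" for z
 proof -
  let ?y = "stream t z"
  let ?s = "%\<epsilon> w. kk \<phi> w * (\<eta> (?y - (1 / 2 powi k) *\<^sub>R w) * \<kappa> (\<epsilon> *\<^sub>R (snd z - (1 / ?\<tau>) *\<^sub>R w)))"
  have [measurable]: "\<kappa> \<in> bmeas" using schwartz_measurable[OF \<kappa>] .
  have "((%\<epsilon>. LINT w|lborel. ?s \<epsilon> w) \<longlongrightarrow> (LINT w|lborel. kk \<phi> w * \<eta> (?y - (1 / 2 powi k) *\<^sub>R w))) (at_right 0)"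
  proof (rule dominated_convergence_at_right[where w="%w. B * (norm (kk \<phi> w) * norm (\<eta> (?y - (1 / 2 powi k) *\<^sub>R w)))"])
   show "integrable lborel (%w. B * (norm (kk \<phi> w) * norm (\<eta> (?y - (1 / 2 powi k) *\<^sub>R w))))" by (intro integrable_mult_right \<Omega>i)
   fix w :: 'a
   have "((%\<epsilon>::real. \<epsilon> *\<^sub>R (snd z - (1 / ?\<tau>) *\<^sub>R w)) \<longlongrightarrow> 0) (at_right 0)" by (auto intro!: tendsto_eq_intros)
   moreover have "isCont \<kappa> 0" using schwartz_continuous[OF \<kappa>] continuous_on_eq_continuous_at by blast
   ultimately have "((%\<epsilon>. \<kappa> (\<epsilon> *\<^sub>R (snd z - (1 / ?\<tau>) *\<^sub>R w))) \<longlongrightarrow> \<kappa> 0) (at_right 0)" by (rule isCont_tendsto_compose[rotated])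
   then have "((%\<epsilon>. ?s \<epsilon> w) \<longlongrightarrow> kk \<phi> w * (\<eta> (?y - (1 / 2 powi k) *\<^sub>R w) * 1)) (at_right 0)"
    using \<kappa>0 by (intro tendsto_mult tendsto_const) simp
   then show "((%\<epsilon>. ?s \<epsilon> w) \<longlongrightarrow> kk \<phi> w * \<eta> (?y - (1 / 2 powi k) *\<^sub>R w)) (at_right 0)" by simp
   fix \<epsilon> :: real
   show "norm (?s \<epsilon> w) <= B * (norm (kk \<phi> w) * norm (\<eta> (?y - (1 / 2 powi k) *\<^sub>R w)))"
    using mult_left_mono[OF B(2)[of "\<epsilon> *\<^sub>R (snd z - (1 / ?\<tau>) *\<^sub>R w)"], of "norm (kk \<phi> w) * norm (\<eta> (?y - (1 / 2 powi k) *\<^sub>R w))"]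
    by (simp add: norm_mult mult_ac)
  qed measurable
  then have "((%\<epsilon>. LINT w|lborel. ?s \<epsilon> w) \<longlongrightarrow> LP k \<eta> ?y) (at_right 0)"
   by (simp add: fmul_lpm[OF lp \<eta>])
  moreover have "\<forall>\<^sub>F \<epsilon> in at_right 0. (LINT w|lborel. ?s \<epsilon> w) = \<Theta> \<epsilon> z"
   unfolding eventually_at_right_field using \<Theta>f by (intro exI[of _ 1]) auto
  ultimately show ?thesis by (rule Lim_transform_eventually)
 qed
 have \<Theta>b: "norm (\<Theta> \<epsilon> z) <= B * \<Omega> (stream t z)" if \<epsilon>: "0 < \<epsilon>" for \<epsilon> z
 proof -
  have [measurable]: "\<kappa> \<in> bmeas" using schwartz_measurable[OF \<kappa>] .
  show ?thesis unfolding \<Theta>f[OF \<epsilon>] \<Omega>_def integral_mult_right_zero[symmetric]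
  proof (rule norm_integral_le(2)[OF _ integrable_mult_right[OF \<Omega>i]])
   fix w :: 'a
   show "norm (kk \<phi> w * (\<eta> (stream t z - (1 / 2 powi k) *\<^sub>R w) * \<kappa> (\<epsilon> *\<^sub>R (snd z - (1 / ?\<tau>) *\<^sub>R w)))) <= B * (norm (kk \<phi> w) * norm (\<eta> (stream t z - (1 / 2 powi k) *\<^sub>R w)))"
    using mult_left_mono[OF B(2)[of "\<epsilon> *\<^sub>R (snd z - (1 / ?\<tau>) *\<^sub>R w)"], of "norm (kk \<phi> w) * norm (\<eta> (stream t z - (1 / 2 powi k) *\<^sub>R w))"]
    by (simp add: norm_mult mult_ac)
  qed measurable
 qed
 have lim1: "((%\<epsilon>. LINT z|lborel. H k ?l ?l z * \<Theta> \<epsilon> z) \<longlongrightarrow> Av H k t (LP k \<eta>)) (at_right 0)"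
  unfolding Av_def
 proof (rule dominated_convergence_at_right[where w="%z. B * (norm (H k ?l ?l z) * \<Omega> (stream t z))"])
  have "(%z::'a\<times>'a. LP k \<eta> (stream t z)) \<in> bmeas"
   by (rule measurable_compose[OF shear_measurable schwartz_measurable[OF fmul_schwartz[OF lpm_bmul[OF lp] \<eta>]]])
  then show "(%z. H k ?l ?l z * LP k \<eta> (stream t z)) \<in> borel_measurable lborel" by measurable
  show "(%z. H k ?l ?l z * \<Theta> \<epsilon> z) \<in> borel_measurable lborel" if "0 < \<epsilon>" for \<epsilon>
  proof -
   have [measurable]: "\<Theta> \<epsilon> \<in> bmeas" by (rule schwartz_measurable[OF \<Theta>s[OF that]])
   show ?thesis by measurable
  qed
  show "integrable lborel (%z. B * (norm (H k ?l ?l z) * \<Omega> (stream t z)))" by (intro integrable_mult_right i)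
  fix z :: "'a \<times> 'a"
  show "((%\<epsilon>. H k ?l ?l z * \<Theta> \<epsilon> z) \<longlongrightarrow> H k ?l ?l z * LP k \<eta> (stream t z)) (at_right 0)"
   by (intro tendsto_mult tendsto_const pt\<Theta>)
  fix \<epsilon> :: real assume "0 < \<epsilon>"
  from mult_left_mono[OF \<Theta>b[OF this, of z], of "norm (H k ?l ?l z)"]
  show "norm (H k ?l ?l z * \<Theta> \<epsilon> z) <= B * (norm (H k ?l ?l z) * \<Omega> (stream t z))"
   by (simp add: norm_mult mult_ac)
 qed
 have "((%\<epsilon>. (LINT z|lborel. H k ?l ?l z * \<Theta> \<epsilon> z) + h (fmul (%z. 1 - ?P z) (\<Theta> \<epsilon>))) \<longlongrightarrow> Av H k t (LP k \<eta>) + 0) (at_right 0)"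
  by (rule tendsto_add[OF lim1 lim2])
 moreover have "\<forall>\<^sub>F \<epsilon> in at_right 0. (LINT z|lborel. H k ?l ?l z * \<Theta> \<epsilon> z) + h (fmul (%z. 1 - ?P z) (\<Theta> \<epsilon>)) = h (\<Theta> \<epsilon>)"
 proof -
  have "(LINT z|lborel. H k ?l ?l z * \<Theta> \<epsilon> z) + h (fmul (%z. 1 - ?P z) (\<Theta> \<epsilon>)) = h (\<Theta> \<epsilon>)" if \<epsilon>: "0 < \<epsilon>" for \<epsilon>
  proof -
   note Ts = \<Theta>s[OF \<epsilon>]
   have Q: "bmul (%z. 1 - ?P z)" by (intro bmul_diff bmul_const Pb)
   have s: "schwartz (%\<zeta>. ?P \<zeta> * inv_fourier (\<Theta> \<epsilon>) \<zeta>)" "schwartz (%\<zeta>. (1 - ?P \<zeta>) * inv_fourier (\<Theta> \<epsilon>) \<zeta>)"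
    by (intro bmul_schwartz_mult inv_fourier_schwartz Ts Pb Q)+
   have "(%z. fmul ?P (\<Theta> \<epsilon>) z + fmul (%z. 1 - ?P z) (\<Theta> \<epsilon>) z) = fourier (%\<zeta>. ?P \<zeta> * inv_fourier (\<Theta> \<epsilon>) \<zeta> + (1 - ?P \<zeta>) * inv_fourier (\<Theta> \<epsilon>) \<zeta>)"
    unfolding fmul_def by (rule ext) (rule fourier_add[OF s[THEN schwartz_integrable], symmetric])
   also have "\<dots> = \<Theta> \<epsilon>" by (simp add: distrib_right[symmetric] fourier_inv_fourier[OF Ts])
   finally have "\<Theta> \<epsilon> = (%z. fmul ?P (\<Theta> \<epsilon>) z + fmul (%z. 1 - ?P z) (\<Theta> \<epsilon>) z)" by simp
   then have "h (\<Theta> \<epsilon>) = h (%z. fmul ?P (\<Theta> \<epsilon>) z + fmul (%z. 1 - ?P z) (\<Theta> \<epsilon>) z)" by (rule arg_cong)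
   also have "\<dots> = h (fmul ?P (\<Theta> \<epsilon>)) + h (fmul (%z. 1 - ?P z) (\<Theta> \<epsilon>))"
    by (rule tempered_add[OF h fmul_schwartz[OF Pb Ts] fmul_schwartz[OF Q Ts]])
   also have "h (fmul ?P (\<Theta> \<epsilon>)) = (LINT z|lborel. H k ?l ?l z * \<Theta> \<epsilon> z)" using H Ts by (auto simp: locrep_def)
   finally show ?thesis by simp
  qed
  then show ?thesis unfolding eventually_at_right_field by (intro exI[of _ 1]) auto
 qed
 ultimately have "((%\<epsilon>. h (\<Theta> \<epsilon>)) \<longlongrightarrow> Av H k t (LP k \<eta>)) (at_right 0)"
  by (simp add: Lim_transform_eventually)
 then show "((%\<epsilon>. shear t (block_v \<phi> ?\<tau> h) (%(x, v). \<eta> x * \<kappa> (\<epsilon> *\<^sub>R v))) \<longlongrightarrow> Av H k t (LP k \<eta>)) (at_right 0)"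
  by (simp add: T)
qed

section \<open>The transport equation along the line of slope r\<close>

lemma shten_joint_measurable:
 fixes \<theta> \<kappa> :: "'a => complex"
 assumes \<theta>: "\<theta> \<in> bmeas" and \<kappa>: "\<kappa> \<in> bmeas"
 shows "(%(r, z). shten r \<epsilon> \<theta> \<kappa> z) \<in> borel_measurable (lborel \<Otimes>\<^sub>M lborel)"
proof -
 have "(%q::real \<times> 'a \<times> 'a. fst (snd q) + fst q *\<^sub>R snd (snd q)) \<in> bmeas"
  by (intro borel_measurable_continuous_onI continuous_intros)
 from measurable_compose[OF this \<theta>]
 have [measurable]: "(%q::real \<times> 'a \<times> 'a. \<theta> (fst (snd q) + fst q *\<^sub>R snd (snd q))) \<in> bmeas" .
 have "(%q::real \<times> 'a \<times> 'a. \<epsilon> *\<^sub>R snd (snd q)) \<in> bmeas"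
  by (intro borel_measurable_continuous_onI continuous_intros)
 from measurable_compose[OF this \<kappa>]
 have [measurable]: "(%q::real \<times> 'a \<times> 'a. \<kappa> (\<epsilon> *\<^sub>R snd (snd q))) \<in> bmeas" .
 have "(%q::real \<times> 'a \<times> 'a. \<theta> (fst (snd q) + fst q *\<^sub>R snd (snd q)) * \<kappa> (\<epsilon> *\<^sub>R snd (snd q))) \<in> bmeas"
  by measurable
 then show ?thesis unfolding lborel_prod by (simp add: shten_def case_prod_beta')
qed

lemma line_derivative:
 fixes \<theta> :: "'a => complex"
 assumes \<theta>: "schwartz \<theta>"
 shows "frechet_derivative \<theta> (at y) v = (\<Sum>b\<in>Basis. cr (v \<bullet> b) * pd b \<theta> y)"
 by (rule linear_sum_Basis[OF has_derivative_linear[OF schwartz_has_derivative[OF \<theta>]]])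

text \<open>The r-derivative of the regularized test function is \<open>v \<cdot> \<nabla>\<^sub>x\<close> of it, as the cutoff
depends on v only. One representative of f, covering the frequencies of the whole interval, turns this into an
identity between integrals.\<close>

lemma transport_gm:
 assumes tr: "transport_eq f g" and f: "tempered f" and g: "tempered g"
  and F: "locrep \<phi> p f F" and G: "locrep \<phi> p g G" and \<theta>: "spec1 k \<theta>"
  and s: "0 < s" "s <= t" and \<epsilon>: "0 < \<epsilon>" "8 * \<epsilon> <= s * 2 powi k"
 shows "f (shten t \<epsilon> \<theta> KK) - f (shten s \<epsilon> \<theta> KK) = - (LINT r|lborel. indicator {s..t} r *\<^sub>R gm G k \<theta> \<epsilon> r)"
proof -
 have \<theta>s: "schwartz \<theta>" using \<theta> by (simp add: spec1_def)
 note Ks = kap_schwartz[OF lp]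
 define FF where "FF = F k (ll k s) (ll k t)"
 have [measurable]: "FF \<in> bmeas" and mF: "mix p FF < top" using locrepD[OF F] by (auto simp: FF_def)
 have r\<epsilon>: "8 * \<epsilon> <= r * 2 powi k" if "s <= r" for r
 proof -
  have "s * 2 powi k <= r * 2 powi k" using that by (rule mult_right_mono) simp
  with \<epsilon>(2) show ?thesis by linarith
 qed
 have lr: "2 powi (ll k s) <= r * 2 powi k" "r * 2 powi k <= 2 powi (ll k t + 1)" if "s <= r" "r <= t" for r
 proof -
  have t: "0 < t" using s by simp
  have "s * 2 powi k <= r * 2 powi k" "r * 2 powi k <= t * 2 powi k" using that by (auto intro: mult_right_mono)
  then show "2 powi (ll k s) <= r * 2 powi k" "r * 2 powi k <= 2 powi (ll k t + 1)"
   using ll_bounds[OF s(1), of k] ll_bounds[OF t, of k] by linarith+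
 qed
 define \<kappa> where "\<kappa> b = (%w. cr (1 / \<epsilon>) * (cr (w \<bullet> b) * KK w))" for b :: 'a
 have \<kappa>: "schwartz (\<kappa> b)" "inv_fourier (\<kappa> b) \<zeta> ~= 0 ==> norm \<zeta> <= 2" if "b \<in> Basis" for b \<zeta>
  unfolding \<kappa>_def using kap_coord[OF lp that] by blast+
 define Dr where "Dr r z = (\<Sum>b\<in>Basis. shten r \<epsilon> (pd b \<theta>) (\<kappa> b) z)" for r z
 have Dr: "Dr r z = frechet_derivative \<theta> (at (stream r z)) (snd z) * KK (\<epsilon> *\<^sub>R snd z)" for r z
 proof -
  let ?y = "stream r z" and ?X = "KK (\<epsilon> *\<^sub>R snd z)"
  have "Dr r z = (\<Sum>b\<in>Basis. (cr (snd z \<bullet> b) * pd b \<theta> ?y) * ?X)"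
   unfolding Dr_def
  proof (intro sum.cong refl)
   fix b :: 'a
   have "shten r \<epsilon> (pd b \<theta>) (\<kappa> b) z = pd b \<theta> ?y * (cr (1 / \<epsilon>) * (cr ((\<epsilon> *\<^sub>R snd z) \<bullet> b) * ?X))"
    unfolding shten_def case_prod_beta' \<kappa>_def ..
   also have "cr (1 / \<epsilon>) * (cr ((\<epsilon> *\<^sub>R snd z) \<bullet> b) * ?X) = cr (1 / \<epsilon> * ((\<epsilon> *\<^sub>R snd z) \<bullet> b)) * ?X"
    by (simp only: of_real_mult mult.assoc)
   also have "1 / \<epsilon> * ((\<epsilon> *\<^sub>R snd z) \<bullet> b) = snd z \<bullet> b" using \<epsilon> by simp
   finally show "shten r \<epsilon> (pd b \<theta>) (\<kappa> b) z = (cr (snd z \<bullet> b) * pd b \<theta> ?y) * ?X"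
    by (simp only: mult_ac)
  qed
  also have "\<dots> = (\<Sum>b\<in>Basis. cr (snd z \<bullet> b) * pd b \<theta> ?y) * ?X"
   by (rule sum_distrib_right[symmetric])
  also have "(\<Sum>b\<in>Basis. cr (snd z \<bullet> b) * pd b \<theta> ?y) = frechet_derivative \<theta> (at ?y) (snd z)"
   by (rule line_derivative[OF \<theta>s, symmetric])
  finally show ?thesis .
 qed
 have V: "Vop (shten r \<epsilon> \<theta> KK) = Dr r" for r
 proof
  fix z :: "'a \<times> 'a"
  note d1 = has_derivative_compose[OF bounded_linear_imp_has_derivative[OF bounded_linear_add[OF bounded_linear_fst bounded_linear_compose[OF bounded_linear_scaleR_right bounded_linear_snd]]] schwartz_has_derivative[OF \<theta>s]]
  have d1: "((%z. \<theta> (stream r z)) has_derivative (%h. frechet_derivative \<theta> (at (stream r z)) (fst h + r *\<^sub>R snd h))) (at z)"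
   by (rule d1)
  have d2: "((%z::'a\<times>'a. KK (\<epsilon> *\<^sub>R snd z)) has_derivative (%h. frechet_derivative KK (at (\<epsilon> *\<^sub>R snd z)) (\<epsilon> *\<^sub>R snd h))) (at z)"
   by (rule has_derivative_compose[OF bounded_linear_imp_has_derivative[OF bounded_linear_compose[OF bounded_linear_scaleR_right bounded_linear_snd]] schwartz_has_derivative[OF Ks]])
  have z: "frechet_derivative KK (at (\<epsilon> *\<^sub>R snd z)) 0 = 0"
   using linear_0[OF has_derivative_linear[OF schwartz_has_derivative[OF Ks]]] .
  from fun_cong[OF frechet_derivative_at[OF has_derivative_mult[OF d1 d2]], of "(snd z, 0)"]
  show "Vop (shten r \<epsilon> \<theta> KK) z = Dr r z"
   by (simp add: Vop_def shten_def case_prod_beta' Dr z)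
 qed
 have fV: "integrable lborel (%z. FF z * Dr r z)" "f (Dr r) = (LINT z|lborel. FF z * Dr r z)" if r: "s <= r" "r <= t" for r
 proof -
  have r0: "0 < r" using s r by simp
  have i: "integrable lborel (%z. FF z * shten r \<epsilon> (pd b \<theta>) (\<kappa> b) z)" if "b \<in> Basis" for b
   unfolding FF_def by (rule locrep_shten(1)[OF F spec1_pd[OF \<theta> that] \<kappa>(1)[OF that] \<kappa>(2)[OF that] \<epsilon>(1) r\<epsilon>[OF r(1)] r0 lr[OF r]])
  have e: "f (shten r \<epsilon> (pd b \<theta>) (\<kappa> b)) = (LINT z|lborel. FF z * shten r \<epsilon> (pd b \<theta>) (\<kappa> b) z)" if "b \<in> Basis" for b
   unfolding FF_def by (rule locrep_shten(2)[OF F spec1_pd[OF \<theta> that] \<kappa>(1)[OF that] \<kappa>(2)[OF that] \<epsilon>(1) r\<epsilon>[OF r(1)] r0 lr[OF r]])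
  have ss: "schwartz (shten r \<epsilon> (pd b \<theta>) (\<kappa> b))" if "b \<in> Basis" for b
   using \<epsilon> by (intro shten_schwartz schwartz_pd \<theta>s that \<kappa>) auto
  show "integrable lborel (%z. FF z * Dr r z)" unfolding Dr_def sum_distrib_left
   by (intro Bochner_Integration.integrable_sum i)
  have "f (Dr r) = (\<Sum>b\<in>Basis. f (shten r \<epsilon> (pd b \<theta>) (\<kappa> b)))"
   unfolding Dr_def[abs_def] by (rule tempered_sum[OF f finite_Basis ss])
  also have "\<dots> = (\<Sum>b\<in>Basis. LINT z|lborel. FF z * shten r \<epsilon> (pd b \<theta>) (\<kappa> b) z)" using e by simp
  also have "\<dots> = (LINT z|lborel. FF z * Dr r z)" unfolding Dr_def sum_distrib_left
   by (rule Bochner_Integration.integral_sum[symmetric]) (rule i)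
  finally show "f (Dr r) = (LINT z|lborel. FF z * Dr r z)" .
 qed
 have gV: "gm G k \<theta> \<epsilon> r = - (LINT z|lborel. FF z * Dr r z)" if r: "s <= r" "r <= t" for r
 proof -
  have "schwartz (shten r \<epsilon> \<theta> KK)" using \<epsilon> by (intro shten_schwartz \<theta>s Ks) auto
  from transport_schwartz[OF lp tr f g this] have "g (shten r \<epsilon> \<theta> KK) = - f (Dr r)" by (simp add: V)
  then show ?thesis using gm_eq[OF G \<theta> \<epsilon>(1) r\<epsilon>[OF r(1)]] fV(2)[OF r] by simp
 qed
 have "\<exists>B>0. \<forall>w. norm (\<kappa> b w) <= B" if "b \<in> Basis" for b
 proof -
  note b = that
  obtain C where "0 <= C" "\<And>w. sw 0 w * norm (\<kappa> b w) <= C" using schwartz_bound[OF \<kappa>(1)[OF b], of 0] by blast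
  then have "0 < C + 1" "\<And>w. norm (\<kappa> b w) <= C + 1" by (auto intro: add_increasing2)
  then show ?thesis by blast
 qed
 then obtain Bb where Bb: "\<And>b. b \<in> Basis ==> 0 < Bb b" "\<And>b w. b \<in> Basis ==> norm (\<kappa> b w) <= Bb b" by metis
 define w where "w x = (\<Sum>b\<in>Basis. Bb b * norm (pd b \<theta> x))" for x
 have pdm: "pd b \<theta> \<in> bmeas" if "b \<in> Basis" for b by (rule schwartz_measurable[OF schwartz_pd[OF \<theta>s that]])
 have wi: "integrable lborel w" unfolding w_def[abs_def]
  by (intro Bochner_Integration.integrable_sum integrable_mult_right integrable_norm schwartz_integrable schwartz_pd \<theta>s)
 have wm[measurable]: "w \<in> bmeas" using wi by auto
 have w0: "0 <= w x" for x unfolding w_def using Bb(1) by (intro sum_nonneg mult_nonneg_nonneg) (auto intro: less_imp_le)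
 have "\<exists>C. \<forall>x. w x <= C"
 proof -
  have "\<forall>b. \<exists>C. b \<in> Basis --> (\<forall>x. norm (pd b \<theta> x) <= C)"
   using schwartz_bound[OF schwartz_pd[OF \<theta>s], of _ 0] by (metis mult_1 power_0)
  then obtain C where C: "\<And>b x. b \<in> Basis ==> norm (pd b \<theta> x) <= C b" by metis
  have "w x <= (\<Sum>b\<in>Basis. Bb b * C b)" for x unfolding w_def
   using Bb(1) C by (intro sum_mono mult_left_mono) (auto intro: less_imp_le)
  then show ?thesis by blast
 qed
 then obtain Cw where Cw: "\<And>x. w x <= Cw" by blast
 have Cw0: "0 < Cw + 1" using Cw[of 0] w0[of 0] by linarith
 define A where "A = (LINT x|lborel. w x) + 1"
 have A: "0 < A" "(NN x. ennreal (w x)) <= ennreal A"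
 proof -
  show "0 < A" unfolding A_def by (intro add_nonneg_pos integral_nonneg_AE) (use w0 in auto)
  have "(NN x. ennreal (w x)) = ennreal (LINT x|lborel. w x)" by (intro nn_integral_eq_integral wi) (use w0 in auto)
  also have "\<dots> <= ennreal A" by (intro ennreal_leI) (simp add: A_def)
  finally show "(NN x. ennreal (w x)) <= ennreal A" .
 qed
 have Dw: "norm (Dr r z) <= w (stream r z)" for r z
 proof -
  have "norm (Dr r z) <= (\<Sum>b\<in>Basis. norm (shten r \<epsilon> (pd b \<theta>) (\<kappa> b) z))" unfolding Dr_def by (rule norm_sum)
  also have "\<dots> <= w (stream r z)" unfolding w_def
  proof (rule sum_mono)
   fix b :: 'a assume b: "b \<in> Basis"
   show "norm (shten r \<epsilon> (pd b \<theta>) (\<kappa> b) z) <= Bb b * norm (pd b \<theta> (stream r z))"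
    using mult_right_mono[OF Bb(2)[OF b, of "\<epsilon> *\<^sub>R snd z"], of "norm (pd b \<theta> (stream r z))"]
    by (simp add: shten_def case_prod_beta' norm_mult mult.commute)
  qed
  finally show ?thesis .
 qed
 define Q where "Q = (%(r, z). Dr r z)"
 have Qm[measurable]: "Q \<in> borel_measurable (lborel \<Otimes>\<^sub>M lborel)"
 proof -
  have "(%q. \<Sum>b\<in>Basis. (%(r, z). shten r \<epsilon> (pd b \<theta>) (\<kappa> b) z) q) \<in> borel_measurable (lborel \<Otimes>\<^sub>M lborel)"
   by (intro borel_measurable_sum shten_joint_measurable pdm schwartz_measurable[OF \<kappa>(1)])
  then show ?thesis by (simp add: Q_def Dr_def[abs_def] case_prod_beta')
 qed
 let ?P = "%r z. indicator {s..t} r *\<^sub>R (FF z * Q (r, z))"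
 let ?M = "hc p A (Cw + 1) * s powr - dd p TYPE('a) * enn2real (mix p FF)"
 have nb: "(LINT z|lborel. norm (FF z * Dr r z)) <= ?M" if r: "s <= r" "r <= t" for r
 proof -
  have r0: "0 < r" using s r by simp
  have S: "integrable lborel (%z. norm (FF z) * w (stream r z))"
   "(LINT z|lborel. norm (FF z) * w (stream r z)) <= hc p A (Cw + 1) * r powr - dd p TYPE('a) * enn2real (mix p FF)"
   by (rule shear_integrable[where A=A and B="Cw+1" and p=p]; use mF A Cw Cw0 w0 p r0 in \<open>auto intro: add_increasing2\<close>)+
  have "(LINT z|lborel. norm (FF z * Dr r z)) <= (LINT z|lborel. norm (FF z) * w (stream r z))"
   by (intro integral_mono integrable_norm fV(1) r S(1)) (auto simp: norm_mult intro: mult_left_mono Dw)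
  also note S(2)
  also have "hc p A (Cw + 1) * r powr - dd p TYPE('a) * enn2real (mix p FF) <= ?M"
  proof (intro mult_right_mono mult_left_mono hc_nonneg)
   have "0 <= dd p TYPE('a)" by (rule dd_nonneg[OF p])
   then show "r powr - dd p TYPE('a) <= s powr - dd p TYPE('a)" using s r by (intro powr_mono2') auto
  qed auto
  finally show ?thesis .
 qed
 have QD: "Q (r, z) = Dr r z" for r z by (simp add: Q_def)
 have Pi: "integrable (lborel \<Otimes>\<^sub>M lborel) (%(r, z). ?P r z)"
 proof (rule lborel_pair.Fubini_integrable)
  show Pm: "(%(r, z). ?P r z) \<in> borel_measurable (lborel \<Otimes>\<^sub>M lborel)" by measurable
  have m: "(%r. LINT z|lborel. norm (case (r, z) of (r, z) => ?P r z)) \<in> borel_measurable lborel"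
   by (rule lborel.borel_measurable_lebesgue_integral) measurable
  have I: "integrable lborel (%r. indicator {s..t} r *\<^sub>R ?M)"
   by (rule integrable_scaleR_left, rule integrable_real_indicator) (auto simp: emeasure_lborel_Icc[OF s(2)])
  show "integrable lborel (%r. LINT z|lborel. norm (case (r, z) of (r, z) => ?P r z))"
  proof (rule norm_integral_le(1)[OF m I])
   fix r
   show "norm (LINT z|lborel. norm (case (r, z) of (r, z) => ?P r z)) <= indicator {s..t} r *\<^sub>R ?M"
    using nb[of r] by (auto simp: indicator_def QD)
  qed
  show "AE r in lborel. integrable lborel (%z. case (r, z) of (r, z) => ?P r z)"
   by (intro AE_I2) (use fV(1) in \<open>auto simp: indicator_def QD\<close>)
 qed
 have t0: "0 < t" using s by simp
 have E: "integrable lborel (%z. FF z * shten r \<epsilon> \<theta> KK z)" "f (shten r \<epsilon> \<theta> KK) = (LINT z|lborel. FF z * shten r \<epsilon> \<theta> KK z)"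
  if r: "s <= r" "r <= t" for r
  unfolding FF_def by (rule locrep_shten[OF F \<theta> Ks kap_supp[OF lp] \<epsilon>(1) r\<epsilon>[OF r(1)] _ lr[OF r]], assumption, use s r in simp)+
 have ftc: "shten t \<epsilon> \<theta> KK z - shten s \<epsilon> \<theta> KK z = (LINT r|lborel. indicator {s..t} r *\<^sub>R Dr r z)" for z
 proof (rule integral_FTC_Icc[OF s(2), symmetric])
  fix r assume "s <= r" "r <= t"
  have "((%r. stream r z) has_derivative (%h. h *\<^sub>R snd z)) (at r within {s..t})" by (auto intro!: derivative_eq_intros)
  from has_derivative_mult_left[OF has_derivative_compose[OF this schwartz_has_derivative[OF \<theta>s]], of "KK (\<epsilon> *\<^sub>R snd z)"]
  have "((%r. \<theta> (stream r z) * KK (\<epsilon> *\<^sub>R snd z)) has_derivative (%h. frechet_derivative \<theta> (at (stream r z)) (h *\<^sub>R snd z) * KK (\<epsilon> *\<^sub>R snd z))) (at r within {s..t})" .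
  moreover have "frechet_derivative \<theta> (at (stream r z)) (h *\<^sub>R snd z) * KK (\<epsilon> *\<^sub>R snd z) = h *\<^sub>R Dr r z" for h
   by (simp add: frechet_scaleR[OF schwartz_has_derivative[OF \<theta>s]] Dr scaleR_conv_of_real)
  ultimately show "((%r. shten r \<epsilon> \<theta> KK z) has_vector_derivative Dr r z) (at r within {s..t})"
   by (simp add: has_vector_derivative_def shten_def case_prod_beta')
 next
  have "continuous_on {s..t} (%r. pd b \<theta> (stream r z))" if "b \<in> Basis" for b
   by (rule continuous_on_compose2[OF schwartz_continuous[OF schwartz_pd[OF \<theta>s that]]]) (auto intro!: continuous_intros)
  then show "continuous_on {s..t} (%r. Dr r z)" unfolding Dr_def shten_def case_prod_beta'
   by (intro continuous_on_sum continuous_on_mult continuous_on_const) auto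
 qed
 have "f (shten t \<epsilon> \<theta> KK) - f (shten s \<epsilon> \<theta> KK) = (LINT z|lborel. FF z * (shten t \<epsilon> \<theta> KK z - shten s \<epsilon> \<theta> KK z))"
  using E[of s] E[of t] s by (simp add: right_diff_distrib)
 also have "\<dots> = (LINT z|lborel. LINT r|lborel. ?P r z)"
 proof (intro LINT_cong refl)
  fix z
  have "FF z * (shten t \<epsilon> \<theta> KK z - shten s \<epsilon> \<theta> KK z) = (LINT r|lborel. FF z * (indicator {s..t} r *\<^sub>R Dr r z))"
   unfolding ftc by (rule integral_mult_right_zero[symmetric])
  then show "FF z * (shten t \<epsilon> \<theta> KK z - shten s \<epsilon> \<theta> KK z) = (LINT r|lborel. ?P r z)" by (simp add: QD)
 qed
 also have "\<dots> = (LINT r|lborel. LINT z|lborel. ?P r z)" by (rule lborel_pair.Fubini_integral[OF Pi])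
 also have "\<dots> = (LINT r|lborel. - (indicator {s..t} r *\<^sub>R gm G k \<theta> \<epsilon> r))"
  by (intro LINT_cong refl) (auto simp: indicator_def gV QD)
 finally show ?thesis by simp
qed

text \<open>Up to a constant, the bound for \<open>Av G k r\<close> on a normalized test function.\<close>

definition \<gamma> where "\<gamma> G k r = r powr - dd p TYPE('a) * enn2real (mix p (G k (ll k r) (ll k r)))" for G :: "int => int => int => 'a \<times> 'a => complex"

lemma \<gamma>_nonneg: "0 <= \<gamma> G k r" by (simp add: \<gamma>_def)

lemma gm_integral_limit:
 assumes G: "locrep \<phi> p g G" and \<theta>: "schwartz \<theta>" and i: "set_integrable lborel {0<..<t} (\<gamma> G k)"
  and \<sigma>: "\<And>\<epsilon>. 0 < \<epsilon> ==> 0 < \<sigma> \<epsilon>" "(\<sigma> \<longlongrightarrow> s0) (at_right 0)" and s0: "0 <= s0"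
 shows "((%\<epsilon>. LINT r|lborel. indicator {\<sigma> \<epsilon>..t} r *\<^sub>R gm G k \<theta> \<epsilon> r) \<longlongrightarrow> (LINT r|lborel. indicator {s0<..<t} r *\<^sub>R Av G k r \<theta>)) (at_right 0)"
proof -
 obtain B where B: "0 < B" "\<And>w. norm (KK w) <= B" using K_bound by blast
 obtain C where C: "0 < C" "\<And>w. norm (\<theta> w) <= C" using schwartz_sup[OF \<theta>] by blast
 note gb = gm_bound(1)[OF G \<theta> _ B C, folded \<gamma>_def]
 note [measurable] = gm_measurable[OF G \<theta>]
 show ?thesis
 proof (rule dominated_convergence_at_right_AE[where w="%r. B * (hc p (l1n \<theta>) C * (indicator {0<..<t} r *\<^sub>R \<gamma> G k r))"])
  show "integrable lborel (%r. B * (hc p (l1n \<theta>) C * (indicator {0<..<t} r *\<^sub>R \<gamma> G k r)))"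
   using i by (intro integrable_mult_right) (simp add: set_integrable_def)
  show "AE r in lborel. ((%\<epsilon>. indicator {\<sigma> \<epsilon>..t} r *\<^sub>R gm G k \<theta> \<epsilon> r) \<longlongrightarrow> indicator {s0<..<t} r *\<^sub>R Av G k r \<theta>) (at_right 0)"
   using AE_lborel_singleton[of s0] AE_lborel_singleton[of t]
  proof eventually_elim
   case (elim r)
   consider "r < s0" | "s0 < r" "r < t" | "t < r" using elim by linarith
   then show ?case
   proof cases
    case 1
    then have ev: "\<forall>\<^sub>F \<epsilon> in at_right 0. r < \<sigma> \<epsilon>" using \<sigma>(2) by (rule order_tendstoD(1)[rotated])
    have "\<forall>\<^sub>F \<epsilon> in at_right 0. indicator {\<sigma> \<epsilon>..t} r *\<^sub>R gm G k \<theta> \<epsilon> r = 0"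
     using ev by eventually_elim (auto simp: indicator_def)
    then have "((%\<epsilon>. indicator {\<sigma> \<epsilon>..t} r *\<^sub>R gm G k \<theta> \<epsilon> r) \<longlongrightarrow> 0) (at_right 0)" by (rule tendsto_eventually)
    then show ?thesis using 1 by (simp add: indicator_def)
   next
    case 2
    then have ev: "\<forall>\<^sub>F \<epsilon> in at_right 0. \<sigma> \<epsilon> < r" using \<sigma>(2) by (intro order_tendstoD(2))
    have "\<forall>\<^sub>F \<epsilon> in at_right 0. gm G k \<theta> \<epsilon> r = indicator {\<sigma> \<epsilon>..t} r *\<^sub>R gm G k \<theta> \<epsilon> r"
     using ev by eventually_elim (use 2 in \<open>auto simp: indicator_def\<close>)
    moreover have "((%\<epsilon>. gm G k \<theta> \<epsilon> r) \<longlongrightarrow> Av G k r \<theta>) (at_right 0)"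
     by (rule Av_limit[OF G \<theta>]) (use 2 s0 in simp)
    ultimately have "((%\<epsilon>. indicator {\<sigma> \<epsilon>..t} r *\<^sub>R gm G k \<theta> \<epsilon> r) \<longlongrightarrow> Av G k r \<theta>) (at_right 0)"
     by (rule Lim_transform_eventually[rotated])
    then show ?thesis using 2 by (simp add: indicator_def)
   next
    case 3 then show ?thesis by (simp add: indicator_def)
   qed
  qed
  fix \<epsilon> :: real assume \<epsilon>: "0 < \<epsilon>"
  show "AE r in lborel. norm (indicator {\<sigma> \<epsilon>..t} r *\<^sub>R gm G k \<theta> \<epsilon> r) <= B * (hc p (l1n \<theta>) C * (indicator {0<..<t} r *\<^sub>R \<gamma> G k r))"
   using AE_lborel_singleton[of t]
  proof eventually_elim
   case (elim r)
   show ?case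
   proof (cases "r \<in> {\<sigma> \<epsilon>..t}")
    case True
    then have "0 < r" "r < t" using \<sigma>(1)[OF \<epsilon>] elim by auto
    then show ?thesis using gb[of r k \<epsilon>] True by (simp add: indicator_def)
   next
    case False
    then have "indicator {\<sigma> \<epsilon>..t} r = (0::real)" by simp
    moreover have "0 <= B * (hc p (l1n \<theta>) C * (indicator {0<..<t} r *\<^sub>R \<gamma> G k r))"
     using B(1) \<gamma>_nonneg[of G k r] by (intro mult_nonneg_nonneg hc_nonneg) (auto simp: indicator_def)
    ultimately show ?thesis by simp
   qed
  qed
 qed measurable
qed

text \<open>The right-hand side of the formula for the k-th block of the average.\<close>

definition RR where "RR F G k t \<theta> = Av F k t \<theta> + (LINT r|lborel. indicator {0<..<t} r *\<^sub>R Av G k r \<theta>)"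
 for F G :: "int => int => int => 'a \<times> 'a => complex"

lemma Av_set_integrable:
 assumes G: "locrep \<phi> p g G" and \<theta>: "schwartz \<theta>" and i: "set_integrable lborel {0<..<t} (\<gamma> G k)"
  and C: "0 < C" "\<And>w. norm (\<theta> w) <= C"
 shows "integrable lborel (%r. indicator {0<..<t} r *\<^sub>R Av G k r \<theta>)"
  "norm (LINT r|lborel. indicator {0<..<t} r *\<^sub>R Av G k r \<theta>) <= hc p (l1n \<theta>) C * (LINT r:{0<..<t}|lborel. \<gamma> G k r)"
proof -
 obtain B where B: "0 < B" "\<And>w. norm (KK w) <= B" using K_bound by blast
 note gb = gm_bound(2)[OF G \<theta> _ B C, folded \<gamma>_def]
 note [measurable] = gm_measurable[OF G \<theta>]
 have I: "integrable lborel (%r. hc p (l1n \<theta>) C * (indicator {0<..<t} r *\<^sub>R \<gamma> G k r))"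
  using i by (intro integrable_mult_right) (simp add: set_integrable_def)
 have le: "norm (indicator {0<..<t} r *\<^sub>R Av G k r \<theta>) <= hc p (l1n \<theta>) C * (indicator {0<..<t} r *\<^sub>R \<gamma> G k r)" for r
  using gb[of r k] by (auto simp: indicator_def)
 have m: "(%r. indicator {0<..<t} r *\<^sub>R Av G k r \<theta>) \<in> borel_measurable lborel" by measurable
 show "integrable lborel (%r. indicator {0<..<t} r *\<^sub>R Av G k r \<theta>)" by (rule norm_integral_le(1)[OF m I le])
 have "norm (LINT r|lborel. indicator {0<..<t} r *\<^sub>R Av G k r \<theta>) <= (LINT r|lborel. hc p (l1n \<theta>) C * (indicator {0<..<t} r *\<^sub>R \<gamma> G k r))"
  by (rule norm_integral_le(2)[OF m I le])
 also have "\<dots> = hc p (l1n \<theta>) C * (LINT r:{0<..<t}|lborel. \<gamma> G k r)"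
  by (simp add: set_lebesgue_integral_def)
 finally show "norm (LINT r|lborel. indicator {0<..<t} r *\<^sub>R Av G k r \<theta>) <= hc p (l1n \<theta>) C * (LINT r:{0<..<t}|lborel. \<gamma> G k r)" .
qed

text \<open>Let \<open>\<epsilon> \<rightarrow> 0\<close> in \<open>transport_gm\<close>, for fixed positive s.\<close>

lemma RR_indep_aux:
 assumes tr: "transport_eq f g" and f: "tempered f" and g: "tempered g"
  and F: "locrep \<phi> p f F" and G: "locrep \<phi> p g G" and \<theta>: "spec1 k \<theta>"
  and s: "0 < s" "s <= t" and i: "set_integrable lborel {0<..<t} (\<gamma> G k)"
 shows "RR F G k t \<theta> = RR F G k s \<theta>"
proof -
 have \<theta>s: "schwartz \<theta>" using \<theta> by (simp add: spec1_def)
 obtain C where C: "0 < C" "\<And>w. norm (\<theta> w) <= C" using schwartz_sup[OF \<theta>s] by blast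
 have t: "0 < t" using s by simp
 have ev: "\<forall>\<^sub>F \<epsilon> in at_right 0. 0 < \<epsilon> \<and> 8 * \<epsilon> <= s * 2 powi k"
  unfolding eventually_at_right_field using s by (intro exI[of _ "s * 2 powi k / 8"]) auto
 have "((%\<epsilon>. gm F k \<theta> \<epsilon> t - gm F k \<theta> \<epsilon> s) \<longlongrightarrow> Av F k t \<theta> - Av F k s \<theta>) (at_right 0)"
  by (intro tendsto_diff Av_limit[OF F \<theta>s] s t)
 moreover have "\<forall>\<^sub>F \<epsilon> in at_right 0. gm F k \<theta> \<epsilon> t - gm F k \<theta> \<epsilon> s = - (LINT r|lborel. indicator {s..t} r *\<^sub>R gm G k \<theta> \<epsilon> r)"
  using ev
 proof eventually_elim
  case (elim \<epsilon>)
  have "s * 2 powi k <= t * 2 powi k" using s(2) by (rule mult_right_mono) simp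
  with elim have e: "0 < \<epsilon>" "8 * \<epsilon> <= s * 2 powi k" "8 * \<epsilon> <= t * 2 powi k" by linarith+
  show ?case using transport_gm[OF tr f g F G \<theta> s e(1,2)] gm_eq[OF F \<theta> e(1,2)] gm_eq[OF F \<theta> e(1,3)] by simp
 qed
 ultimately have "((%\<epsilon>. - (LINT r|lborel. indicator {s..t} r *\<^sub>R gm G k \<theta> \<epsilon> r)) \<longlongrightarrow> Av F k t \<theta> - Av F k s \<theta>) (at_right 0)"
  by (rule Lim_transform_eventually)
 moreover have "((%\<epsilon>. - (LINT r|lborel. indicator {s..t} r *\<^sub>R gm G k \<theta> \<epsilon> r)) \<longlongrightarrow> - (LINT r|lborel. indicator {s<..<t} r *\<^sub>R Av G k r \<theta>)) (at_right 0)"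
  by (intro tendsto_minus gm_integral_limit[OF G \<theta>s i]) (use s in auto)
 ultimately have eq: "Av F k t \<theta> - Av F k s \<theta> = - (LINT r|lborel. indicator {s<..<t} r *\<^sub>R Av G k r \<theta>)"
  by (rule tendsto_unique[rotated]) simp
 note It = Av_set_integrable(1)[OF G \<theta>s i C]
 have Is: "integrable lborel (%r. indicator {0<..<s} r *\<^sub>R Av G k r \<theta>)" "integrable lborel (%r. indicator {s<..<t} r *\<^sub>R Av G k r \<theta>)"
 proof -
  have "set_integrable lborel {0<..<t} (%r. Av G k r \<theta>)" using It by (simp add: set_integrable_def)
  then have "set_integrable lborel {0<..<s} (%r. Av G k r \<theta>)" "set_integrable lborel {s<..<t} (%r. Av G k r \<theta>)"
   by (rule set_integrable_subset; use s in auto)+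
  then show "integrable lborel (%r. indicator {0<..<s} r *\<^sub>R Av G k r \<theta>)" "integrable lborel (%r. indicator {s<..<t} r *\<^sub>R Av G k r \<theta>)"
   by (auto simp: set_integrable_def)
 qed
 have "(LINT r|lborel. indicator {0<..<t} r *\<^sub>R Av G k r \<theta>) = (LINT r|lborel. indicator {0<..<s} r *\<^sub>R Av G k r \<theta> + indicator {s<..<t} r *\<^sub>R Av G k r \<theta>)"
 proof (rule integral_cong_AE)
  show "AE r in lborel. indicator {0<..<t} r *\<^sub>R Av G k r \<theta> = indicator {0<..<s} r *\<^sub>R Av G k r \<theta> + indicator {s<..<t} r *\<^sub>R Av G k r \<theta>"
   using AE_lborel_singleton[of s] by eventually_elim (use s in \<open>auto simp: indicator_def\<close>)
 qed (use It Is in auto)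
 also have "\<dots> = (LINT r|lborel. indicator {0<..<s} r *\<^sub>R Av G k r \<theta>) + (LINT r|lborel. indicator {s<..<t} r *\<^sub>R Av G k r \<theta>)"
  by (rule Bochner_Integration.integral_add[OF Is])
 finally show ?thesis using eq by (simp add: RR_def algebra_simps)
qed

lemma RR_indep:
 assumes "transport_eq f g" "tempered f" "tempered g" "locrep \<phi> p f F" "locrep \<phi> p g G" "spec1 k \<theta>"
  and i: "\<And>t. 0 < t ==> set_integrable lborel {0<..<t} (\<gamma> G k)" and "0 < s" "0 < t"
 shows "RR F G k t \<theta> = RR F G k s \<theta>"
proof (cases "s <= t")
 case True then show ?thesis using RR_indep_aux[OF assms(1-6) assms(8) True i[OF assms(9)]] by simp
next
 case False then show ?thesis using RR_indep_aux[OF assms(1-6) assms(9) _ i[OF assms(8)]] by simp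
qed

text \<open>Take the lower endpoint proportional to \<epsilon>. It stays in the range of validity of \<open>transport_gm\<close>,
and the test function at that endpoint, \<open>\<theta> (x + c \<epsilon> v) \<kappa> (\<epsilon> v)\<close>,
converges to \<open>\<theta> x\<close> boundedly with respect to the weight in x.\<close>

lemma v_integrable_RR:
 assumes tr: "transport_eq f g" and f: "tempered f" and g: "tempered g"
  and F: "locrep \<phi> p f F" and G: "locrep \<phi> p g G" and \<theta>: "spec1 k \<theta>"
  and t: "0 < t" and i: "set_integrable lborel {0<..<t} (\<gamma> G k)"
  and u: "v_integrable u f"
 shows "(LINT z|lborel. u z * \<theta> (fst z)) = RR F G k t \<theta>"
proof -
 have \<theta>s: "schwartz \<theta>" using \<theta> by (simp add: spec1_def)
 note Ks = kap_schwartz[OF lp]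
 \<comment> \<open>With \<open>s = c \<epsilon>\<close> the condition \<open>8 \<epsilon> \<le> s 2^k\<close> of \<open>transport_gm\<close> is an equality.\<close>
 define c :: real where "c = 8 / 2 powi k"
 have c: "0 < c" by (simp add: c_def)
 obtain N :: nat where N: "integrable lborel (%(x, v). u (x, v) / cr ((1 + norm x) ^ N))" and ru: "represents u f"
  using u unfolding v_integrable_def by blast
 have [measurable]: "u \<in> bmeas" using ru by (simp add: represents_def)
 have [measurable]: "\<theta> \<in> bmeas" "KK \<in> bmeas" using schwartz_measurable \<theta>s Ks by auto
 obtain C where C: "0 <= C" "\<And>x. sw N x * norm (\<theta> x) <= C" using schwartz_bound[OF \<theta>s] by blast
 obtain B where B: "0 <= B" "\<And>x. sw N x * norm (KK x) <= B" using schwartz_bound[OF Ks] by blast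
 have peetre: "norm (\<theta> (x + (c * \<epsilon>) *\<^sub>R v) * KK (\<epsilon> *\<^sub>R v)) <= (1 + c) ^ N * (C * B) * (1 / sw N x)" if \<epsilon>: "0 < \<epsilon>" for x v \<epsilon>
 proof -
  let ?y = "x + (c * \<epsilon>) *\<^sub>R v" let ?w = "\<epsilon> *\<^sub>R v"
  have "norm x <= norm ?y + norm ((c * \<epsilon>) *\<^sub>R v)" using norm_triangle_ineq4[of ?y "(c * \<epsilon>) *\<^sub>R v"] by simp
  also have "norm ((c * \<epsilon>) *\<^sub>R v) = c * norm ?w" using c by (simp add: abs_mult)
  finally have "1 + norm x <= (1 + c) * ((1 + norm ?y) * (1 + norm ?w))"
  proof -
   assume a: "norm x <= norm ?y + c * norm ?w"
   have gen: "1 + (a + c * b) <= (1 + c) * ((1 + a) * (1 + b))" if "0 <= a" "0 <= b" for a b :: real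
   proof -
    have "0 <= a * b" "0 <= c * a" "0 <= c * (a * b)" using that c by auto
    then show ?thesis using that c by (simp add: algebra_simps)
   qed
   show ?thesis using a gen[OF norm_ge_zero norm_ge_zero, of ?y ?w] by linarith
  qed
  from power_mono[OF this, of N] have "sw N x <= (1 + c) ^ N * (sw N ?y * sw N ?w)" by (simp add: power_mult_distrib)
  then have "sw N x * (norm (\<theta> ?y) * norm (KK ?w)) <= (1 + c) ^ N * (sw N ?y * sw N ?w) * (norm (\<theta> ?y) * norm (KK ?w))"
   by (intro mult_right_mono) auto
  also have "\<dots> = (1 + c) ^ N * ((sw N ?y * norm (\<theta> ?y)) * (sw N ?w * norm (KK ?w)))" by simp
  also have "\<dots> <= (1 + c) ^ N * (C * B)"
  proof (rule mult_left_mono)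
   show "(sw N ?y * norm (\<theta> ?y)) * (sw N ?w * norm (KK ?w)) <= C * B"
    by (rule mult_mono[OF C(2) B(2) C(1)]) (rule mult_nonneg_nonneg, auto)
  qed (use c in auto)
  finally show ?thesis by (simp add: norm_mult field_simps add_pos_nonneg)
 qed
 have dom: "integrable lborel (%z::'a\<times>'a. (1 + c) ^ N * (C * B) * norm (u z / cr ((1 + norm (fst z)) ^ N)))"
  using integrable_norm[OF N] by (intro integrable_mult_right) (simp add: case_prod_beta')
 have nrm: "norm (u z / cr ((1 + norm (fst z)) ^ N)) = norm (u z) * (1 / sw N (fst z))" for z :: "'a \<times> 'a"
  by (simp add: norm_divide norm_power del: of_real_power of_real_add)
 have "((%\<epsilon>. LINT z|lborel. u z * shten (c * \<epsilon>) \<epsilon> \<theta> KK z) \<longlongrightarrow> (LINT z|lborel. u z * \<theta> (fst z))) (at_right 0)"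
 proof (rule dominated_convergence_at_right[OF _ _ dom])
  show "(%z. u z * \<theta> (fst z)) \<in> borel_measurable lborel"
  proof -
   have "(%z::'a\<times>'a. fst z) \<in> bmeas" by (intro borel_measurable_continuous_onI continuous_intros)
   then have [measurable]: "(%z::'a\<times>'a. \<theta> (fst z)) \<in> bmeas" by (rule measurable_compose) measurable
   show ?thesis by measurable
  qed
  have [measurable]: "shten r \<epsilon> \<theta> KK \<in> bmeas" for r \<epsilon> by (rule shten_measurable) measurable
  show "(%z. u z * shten (c * \<epsilon>) \<epsilon> \<theta> KK z) \<in> borel_measurable lborel" for \<epsilon> by measurable
  fix z :: "'a \<times> 'a"
  have "((%\<epsilon>::real. \<epsilon> *\<^sub>R snd z) \<longlongrightarrow> 0) (at_right 0)" by (auto intro!: tendsto_eq_intros)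
  moreover have "isCont KK 0" using schwartz_continuous[OF Ks] continuous_on_eq_continuous_at by blast
  ultimately have k: "((%\<epsilon>. KK (\<epsilon> *\<^sub>R snd z)) \<longlongrightarrow> KK 0) (at_right 0)" by (rule isCont_tendsto_compose[rotated])
  have "((%\<epsilon>::real. fst z + (c * \<epsilon>) *\<^sub>R snd z) \<longlongrightarrow> fst z) (at_right 0)" by (auto intro!: tendsto_eq_intros)
  moreover have "isCont \<theta> (fst z)" using schwartz_continuous[OF \<theta>s] continuous_on_eq_continuous_at by blast
  ultimately have "((%\<epsilon>. \<theta> (fst z + (c * \<epsilon>) *\<^sub>R snd z)) \<longlongrightarrow> \<theta> (fst z)) (at_right 0)" by (rule isCont_tendsto_compose[rotated])
  from tendsto_mult[OF tendsto_const[of "u z"] tendsto_mult[OF this k]]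
  show "((%\<epsilon>. u z * shten (c * \<epsilon>) \<epsilon> \<theta> KK z) \<longlongrightarrow> u z * \<theta> (fst z)) (at_right 0)"
   by (simp add: shten_def case_prod_beta' kap_0[OF lp])
  fix \<epsilon> :: real assume "0 < \<epsilon>"
  from mult_left_mono[OF peetre[OF this, of "fst z" "snd z"], of "norm (u z)"]
  show "norm (u z * shten (c * \<epsilon>) \<epsilon> \<theta> KK z) <= (1 + c) ^ N * (C * B) * norm (u z / cr ((1 + norm (fst z)) ^ N))"
   unfolding nrm by (simp add: shten_def case_prod_beta' norm_mult mult_ac)
 qed
 moreover have "f (shten (c * \<epsilon>) \<epsilon> \<theta> KK) = (LINT z|lborel. u z * shten (c * \<epsilon>) \<epsilon> \<theta> KK z)" if "0 < \<epsilon>" for \<epsilon>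
  using ru shten_schwartz[OF \<theta>s Ks, of \<epsilon> "c * \<epsilon>"] that by (simp add: represents_def)
 ultimately have l1: "((%\<epsilon>. f (shten (c * \<epsilon>) \<epsilon> \<theta> KK)) \<longlongrightarrow> (LINT z|lborel. u z * \<theta> (fst z))) (at_right 0)"
  by (elim Lim_transform_eventually) (auto simp: eventually_at_right_field intro: exI[of _ 1])
 have ev: "\<forall>\<^sub>F \<epsilon> in at_right 0. 0 < \<epsilon> \<and> c * \<epsilon> <= t"
  unfolding eventually_at_right_field using t c by (intro exI[of _ "t / c"]) (auto simp: field_simps)
 have "((%\<epsilon>. gm F k \<theta> \<epsilon> t + (LINT r|lborel. indicator {c * \<epsilon>..t} r *\<^sub>R gm G k \<theta> \<epsilon> r)) \<longlongrightarrow> Av F k t \<theta> + (LINT r|lborel. indicator {0<..<t} r *\<^sub>R Av G k r \<theta>)) (at_right 0)"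
  by (intro tendsto_add Av_limit[OF F \<theta>s] t gm_integral_limit[OF G \<theta>s i]) (use c in \<open>auto intro!: tendsto_eq_intros\<close>)
 moreover have "\<forall>\<^sub>F \<epsilon> in at_right 0. gm F k \<theta> \<epsilon> t + (LINT r|lborel. indicator {c * \<epsilon>..t} r *\<^sub>R gm G k \<theta> \<epsilon> r) = f (shten (c * \<epsilon>) \<epsilon> \<theta> KK)"
  using ev
 proof eventually_elim
  case (elim \<epsilon>)
  have e: "0 < c * \<epsilon>" "8 * \<epsilon> <= c * \<epsilon> * 2 powi k" using elim c by (auto simp: c_def)
  have "c * \<epsilon> * 2 powi k <= t * 2 powi k" by (rule mult_right_mono) (use elim in auto)
  with e have e3: "8 * \<epsilon> <= t * 2 powi k" by linarith
  have \<epsilon>: "0 < \<epsilon>" "c * \<epsilon> <= t" using elim by auto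
  have "f (shten t \<epsilon> \<theta> KK) - f (shten (c * \<epsilon>) \<epsilon> \<theta> KK) = - (LINT r|lborel. indicator {c * \<epsilon>..t} r *\<^sub>R gm G k \<theta> \<epsilon> r)"
   by (rule transport_gm[OF tr f g F G \<theta> e(1) \<epsilon>(2) \<epsilon>(1) e(2)])
  moreover have "f (shten t \<epsilon> \<theta> KK) = gm F k \<theta> \<epsilon> t" by (rule gm_eq[OF F \<theta> \<epsilon>(1) e3])
  ultimately show ?case by (simp add: diff_eq_eq)
 qed
 ultimately have "((%\<epsilon>. f (shten (c * \<epsilon>) \<epsilon> \<theta> KK)) \<longlongrightarrow> RR F G k t \<theta>) (at_right 0)"
  unfolding RR_def by (rule Lim_transform_eventually)
 with l1 show "(LINT z|lborel. u z * \<theta> (fst z)) = RR F G k t \<theta>" by (rule tendsto_unique[rotated]) simp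
qed

section \<open>Norms of the blocks of the average\<close>

text \<open>The kernel of the k-th block, as a function of the point x for a unit mass at y.\<close>

definition cK :: "int => 'a => 'a => complex" where
 "cK k y x = cr ((2 powi k) ^ DIM('a)) * kk \<phi> ((2 powi k) *\<^sub>R (y - x))"

lemma cK_measurable:
 assumes Y: "Y \<in> borel_measurable Q"
 shows "(%(x, q). cK k (Y q) x) \<in> borel_measurable (lborel \<Otimes>\<^sub>M Q)"
proof -
 have [measurable]: "kk \<phi> \<in> bmeas" by (rule schwartz_measurable[OF kk_schwartz[OF lp]])
 note [measurable] = Y
 show ?thesis unfolding cK_def by measurable
qed

lemma cK_fmul:
 fixes \<eta> :: "'a => complex"
 assumes \<eta>: "schwartz \<eta>"
 shows "(LINT x|lborel. cK k y x * \<eta> x) = LP k \<eta> y"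
proof -
 have [measurable]: "kk \<phi> \<in> bmeas" "\<eta> \<in> bmeas"
  using schwartz_measurable kk_schwartz[OF lp] \<eta> by auto
 let ?f = "%x. cK k y x * \<eta> x" and ?c = "- (1 / 2 powi k) :: real"
 have c: "?c ~= 0" by simp
 have m: "?f \<in> bmeas" unfolding cK_def by measurable
 have e: "(2 powi k) *\<^sub>R (y - (y - (1 / 2 powi k) *\<^sub>R w)) = w" for w :: 'a by simp
 have "(LINT w|lborel. ?f (y + ?c *\<^sub>R w)) = (1 / \<bar>?c\<bar> ^ DIM('a)) *\<^sub>R (LINT x|lborel. ?f x)"
  by (rule integral_affine(1)[OF c m])
 moreover have "(LINT w|lborel. ?f (y + ?c *\<^sub>R w)) = (LINT w|lborel. cr ((2 powi k) ^ DIM('a)) * (kk \<phi> w * \<eta> (y - (1 / 2 powi k) *\<^sub>R w)))"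
  by (intro LINT_cong refl) (simp only: scaleR_minus_left add_uminus_conv_diff cK_def e mult.assoc)
 moreover have "1 / \<bar>?c\<bar> ^ DIM('a) = (2 powi k) ^ DIM('a)" by (simp add: power_divide)
 ultimately have "(2 powi k) ^ DIM('a) *\<^sub>R (LINT x|lborel. ?f x) = (2 powi k) ^ DIM('a) *\<^sub>R (LINT w|lborel. kk \<phi> w * \<eta> (y - (1 / 2 powi k) *\<^sub>R w))"
  by (simp only: integral_mult_right_zero scaleR_conv_of_real)
 then show ?thesis by (simp add: fmul_lpm[OF lp \<eta>])
qed

lemma cK_integrals:
 assumes r: "0 < r"
 shows "(NN x. ennreal (norm (cK k y x))) <= ennreal (l1n (kk \<phi>))"
  "(NN v. ennreal (norm (cK k (y + r *\<^sub>R v) x))) <= ennreal (l1n (kk \<phi>) / r ^ DIM('a))"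
proof -
 have [measurable]: "kk \<phi> \<in> bmeas" by (rule schwartz_measurable[OF kk_schwartz[OF lp]])
 note L = l1n[OF schwartz_integrable[OF kk_schwartz[OF lp]]]
 let ?g = "%w. ennreal ((2 powi k) ^ DIM('a) * norm (kk \<phi> w))"
 have nk: "norm (cK k y x) = (2 powi k) ^ DIM('a) * norm (kk \<phi> ((2 powi k) *\<^sub>R (y - x)))" for x y
  by (simp add: cK_def norm_mult del: of_real_power of_real_power_int)
 have gi: "(NN w. ?g w) <= ennreal ((2 powi k) ^ DIM('a) * l1n (kk \<phi>))"
 proof -
  have "(NN w. ?g w) = ennreal ((2 powi k) ^ DIM('a)) * (NN w. ennreal (norm (kk \<phi> w)))"
   by (subst nn_integral_cmult[symmetric]) (auto simp: ennreal_mult)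
  also have "\<dots> <= ennreal ((2 powi k) ^ DIM('a)) * ennreal (l1n (kk \<phi>))" by (intro mult_left_mono L(2)) simp
  also have "\<dots> = ennreal ((2 powi k) ^ DIM('a) * l1n (kk \<phi>))" using L(1) by (subst ennreal_mult) auto
  finally show ?thesis .
 qed
 have "(NN x. ennreal (norm (cK k y x))) = (NN x. ?g ((2 powi k) *\<^sub>R y + (- (2 powi k)) *\<^sub>R x))"
  by (simp add: nk scaleR_right_diff_distrib)
 also have "\<dots> = ennreal (1 / \<bar>- (2 powi k)\<bar> ^ DIM('a)) * (NN w. ?g w)"
  by (rule nn_integral_affine) (simp, measurable)
 also have "\<dots> <= ennreal (1 / \<bar>- (2 powi k)\<bar> ^ DIM('a)) * ennreal ((2 powi k) ^ DIM('a) * l1n (kk \<phi>))"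
  by (intro mult_left_mono gi) simp
 also have "\<dots> = ennreal (l1n (kk \<phi>))" using L(1) by (subst ennreal_mult[symmetric]) auto
 finally show "(NN x. ennreal (norm (cK k y x))) <= ennreal (l1n (kk \<phi>))" .
 have "(NN v. ennreal (norm (cK k (y + r *\<^sub>R v) x))) = (NN v. ?g ((2 powi k) *\<^sub>R (y - x) + (2 powi k * r) *\<^sub>R v))"
  by (simp add: nk scaleR_right_diff_distrib scaleR_right_distrib algebra_simps)
 also have "\<dots> = ennreal (1 / \<bar>2 powi k * r\<bar> ^ DIM('a)) * (NN w. ?g w)"
  by (rule nn_integral_affine) (use r in simp, measurable)
 also have "\<dots> <= ennreal (1 / \<bar>2 powi k * r\<bar> ^ DIM('a)) * ennreal ((2 powi k) ^ DIM('a) * l1n (kk \<phi>))"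
  by (intro mult_left_mono gi) simp
 also have "\<dots> = ennreal (l1n (kk \<phi>) / r ^ DIM('a))" using L(1) r
  by (subst ennreal_mult[symmetric]) (auto simp: power_mult_distrib)
 finally show "(NN v. ennreal (norm (cK k (y + r *\<^sub>R v) x))) <= ennreal (l1n (kk \<phi>) / r ^ DIM('a))" .
qed

text \<open>A superposition of point masses at \<open>Y q\<close> with weights \<open>Hq q\<close>, smoothed by the kernel of the
block, is a function as soon as the superposition of the absolute values has finite norm.\<close>

lemma smoothed:
 fixes Hq :: "'q => complex" and Y :: "'q => 'a"
 assumes Q: "sigma_finite_measure Q" and H[measurable]: "Hq \<in> borel_measurable Q" and Y: "Y \<in> borel_measurable Q"
  and V: "V = (%x. \<integral>\<^sup>+q. ennreal (norm (Hq q)) * ennreal (norm (cK k (Y q) x)) \<partial>Q)"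
  and fin: "Lp_norm p lborel V < top"
  and U: "U = (%x. LINT q|Q. Hq q * cK k (Y q) x)"
 shows "U \<in> bmeas" "V \<in> bmeas" "ennreal (norm (U x)) <= V x"
  "schwartz \<eta> ==> integrable lborel (%x. U x * \<eta> x)"
  "schwartz \<eta> ==> integrable Q (%q. Hq q * LP k \<eta> (Y q))"
  "schwartz \<eta> ==> (LINT x|lborel. U x * \<eta> x) = (LINT q|Q. Hq q * LP k \<eta> (Y q))"
proof -
 interpret Q: sigma_finite_measure Q by fact
 interpret P: pair_sigma_finite "lborel :: 'a measure" Q by unfold_locales
 define W where "W = (%(x, q). cK k (Y q) x)"
 have [measurable]: "W \<in> borel_measurable (lborel \<Otimes>\<^sub>M Q)" unfolding W_def by (rule cK_measurable[OF Y])
 have W: "cK k (Y q) x = W (x, q)" for x q by (simp add: W_def)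
 show Um: "U \<in> bmeas"
 proof -
  have "U \<in> borel_measurable (lborel :: 'a measure)" unfolding U W by (rule Q.borel_measurable_lebesgue_integral) measurable
  then show ?thesis by simp
 qed
 show Vm: "V \<in> bmeas"
 proof -
  have "V \<in> borel_measurable (lborel :: 'a measure)" unfolding V W by measurable
  then show ?thesis by simp
 qed
 show "ennreal (norm (U x)) <= V x"
 proof (cases "integrable Q (%q. Hq q * cK k (Y q) x)")
  case True
  from integral_norm_bound_ennreal[OF this] show ?thesis by (simp add: U V norm_mult ennreal_mult)
 next
  case False then show ?thesis by (simp add: U not_integrable_integral_eq)
 qed
 assume \<eta>: "schwartz \<eta>"
 have [measurable]: "\<eta> \<in> bmeas" by (rule schwartz_measurable[OF \<eta>])
 obtain C where C: "0 <= C" "\<And>w. sw 0 w * norm (\<eta> w) <= C" using schwartz_bound[OF \<eta>, of 0] by blast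
 have "(NN x. V x * ennreal (norm (\<eta> x)))
  <= ennreal (2 * l1n \<eta> powr (1 - enn2real (1 / p)) * (C + 1) powr enn2real (1 / p)) * Lp_norm p lborel V"
  by (rule holder_weak[OF sigma_finite_lborel'])
    (use Vm l1n[OF schwartz_integrable[OF \<eta>]] C p in \<open>auto intro!: ennreal_leI intro: add_increasing2\<close>)
 also have "\<dots> < top" using fin by (simp add: ennreal_mult_less_top)
 finally have fin2: "(NN x. V x * ennreal (norm (\<eta> x))) < top" .
 let ?g = "%z. Hq (snd z) * W z * \<eta> (fst z)"
 have I: "integrable (lborel \<Otimes>\<^sub>M Q) ?g"
 proof (rule integrableI_bounded)
  show "?g \<in> borel_measurable (lborel \<Otimes>\<^sub>M Q)" by measurable
  have "(\<integral>\<^sup>+z. ennreal (norm (?g z)) \<partial>(lborel \<Otimes>\<^sub>M Q)) = (NN x. \<integral>\<^sup>+q. ennreal (norm (?g (x, q))) \<partial>Q)"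
   by (rule Q.nn_integral_fst[symmetric]) measurable
  also have "\<dots> = (NN x. V x * ennreal (norm (\<eta> x)))"
  proof (intro nn_integral_cong)
   fix x
   have "(\<integral>\<^sup>+q. ennreal (norm (?g (x, q))) \<partial>Q) = (\<integral>\<^sup>+q. ennreal (norm (Hq q)) * ennreal (norm (cK k (Y q) x)) * ennreal (norm (\<eta> x)) \<partial>Q)"
    by (simp add: W norm_mult ennreal_mult)
   also have "\<dots> = V x * ennreal (norm (\<eta> x))" unfolding V W by (rule nn_integral_multc) measurable
   finally show "(\<integral>\<^sup>+q. ennreal (norm (?g (x, q))) \<partial>Q) = V x * ennreal (norm (\<eta> x))" .
  qed
  finally show "(\<integral>\<^sup>+z. ennreal (norm (?g z)) \<partial>(lborel \<Otimes>\<^sub>M Q)) < \<infinity>" using fin2 by simp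
 qed
 have I': "integrable (lborel \<Otimes>\<^sub>M Q) (%(x, q). Hq q * W (x, q) * \<eta> x)" using I by (simp add: case_prod_beta')
 have e1: "U x * \<eta> x = (LINT q|Q. Hq q * W (x, q) * \<eta> x)" for x unfolding U W by simp
 have e2: "Hq q * LP k \<eta> (Y q) = (LINT x|lborel. Hq q * W (x, q) * \<eta> x)" for q
  unfolding cK_fmul[OF \<eta>, symmetric] W integral_mult_right_zero[symmetric] by (simp only: mult.assoc)
 show "integrable lborel (%x. U x * \<eta> x)" unfolding e1 using P.integrable_fst'[OF I] by simp
 show "integrable Q (%q. Hq q * LP k \<eta> (Y q))" unfolding e2 using P.integrable_snd[OF I'] by simp
 show "(LINT x|lborel. U x * \<eta> x) = (LINT q|Q. Hq q * LP k \<eta> (Y q))"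
  unfolding e1 e2 by (rule P.Fubini_integral[OF I', symmetric])
qed

definition DC :: real where "DC = l1n (kk \<phi>)"

text \<open>Minkowski's inequality in y and the Schur test in v: the kernel has integral of order \<open>r^(-D)\<close> in v and
of order 1 in x.\<close>

lemma dispersive:
 fixes u :: "'a \<times> 'a => complex"
 assumes u[measurable]: "u \<in> bmeas" and r: "0 < r"
 shows "Lp_norm p lborel (%x. NN z. ennreal (norm (u z)) * ennreal (norm (cK k (stream r z) x)))
  <= ennreal (4 * DC) * (ennreal (r powr - dd p TYPE('a)) * mix p u)"
proof -
 have L: "0 < DC" unfolding DC_def by (rule l1n(1)[OF schwartz_integrable[OF kk_schwartz[OF lp]]])
 define W where "W = (%(x, z). cK k (stream r z) x)"
 have "W \<in> borel_measurable (lborel \<Otimes>\<^sub>M (lborel :: ('a \<times> 'a) measure))" unfolding W_def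
  by (rule cK_measurable) (simp add: shear_measurable)
 then have Wm[measurable]: "W \<in> borel_measurable (lborel \<Otimes>\<^sub>M (lborel \<Otimes>\<^sub>M lborel))" by (subst lborel_prod)
 have W: "cK k (y + r *\<^sub>R v) x = W (x, y, v)" for x y v by (simp add: W_def)
 have [measurable]: "u \<in> borel_measurable (lborel \<Otimes>\<^sub>M lborel)" by (simp add: lborel_prod)
 let ?V = "%x y. NN v. ennreal (norm (u (y, v))) * ennreal (norm (W (x, y, v)))"
 have "(%x. NN z. ennreal (norm (u z)) * ennreal (norm (cK k (stream r z) x))) = (%x. NN y. ?V x y)"
 proof
  fix x
  have "(\<integral>\<^sup>+z. ennreal (norm (u z)) * ennreal (norm (W (x, z))) \<partial>(lborel \<Otimes>\<^sub>M lborel)) = (NN y. ?V x y)"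
   by (rule lborel.nn_integral_fst[symmetric]) measurable
  then show "(NN z. ennreal (norm (u z)) * ennreal (norm (cK k (stream r z) x))) = (NN y. ?V x y)"
   by (simp add: lborel_prod W_def)
 qed
 then have "Lp_norm p lborel (%x. NN z. ennreal (norm (u z)) * ennreal (norm (cK k (stream r z) x)))
   = Lp_norm p lborel (%x. NN y. ?V x y)" by simp
 also have "\<dots> <= 2 * (NN y. Lp_norm p lborel (%x. ?V x y))"
  by (rule minkowski_weak[OF sigma_finite_lborel' sigma_finite_lborel' _ p]) measurable
 also have "\<dots> <= 2 * (NN y. ennreal (2 * DC * r powr - dd p TYPE('a)) * Lp_norm p lborel (%v. ennreal (norm (u (y, v)))))"
 proof (intro mult_left_mono nn_integral_mono)
  fix y
  have "Lp_norm p lborel (%x. ?V x y)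
   <= ennreal (2 * (DC / r ^ DIM('a)) powr (1 - enn2real (1 / p)) * DC powr enn2real (1 / p)) * Lp_norm p lborel (%v. ennreal (norm (u (y, v))))"
  proof (rule schur_test[OF sigma_finite_lborel' sigma_finite_lborel'])
   show "(NN v. ennreal (norm (W (x, y, v)))) <= ennreal (DC / r ^ DIM('a))" for x
    using cK_integrals(2)[OF r, of k y x] by (simp add: W DC_def)
   show "(NN x. ennreal (norm (W (x, y, v)))) <= ennreal DC" for v
    using cK_integrals(1)[OF r, of k "y + r *\<^sub>R v"] by (simp add: W DC_def)
  qed (use L r p in \<open>simp_all, measurable\<close>)
  also have "2 * (DC / r ^ DIM('a)) powr (1 - enn2real (1 / p)) * DC powr enn2real (1 / p) = 2 * DC * r powr - dd p TYPE('a)"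
  proof -
   have "(DC / r ^ DIM('a)) powr (1 - enn2real (1 / p)) = DC powr (1 - enn2real (1 / p)) / (r powr real DIM('a)) powr (1 - enn2real (1 / p))"
    using L r by (simp add: powr_divide powr_realpow)
   moreover have "DC powr (1 - enn2real (1 / p)) * DC powr enn2real (1 / p) = DC" using L by (simp add: powr_add[symmetric])
   ultimately show ?thesis by (simp add: powr_powr dd_def powr_minus_divide)
  qed
  finally show "Lp_norm p lborel (%x. ?V x y) <= ennreal (2 * DC * r powr - dd p TYPE('a)) * Lp_norm p lborel (%v. ennreal (norm (u (y, v))))" .
 qed simp
 also have "(NN y. ennreal (2 * DC * r powr - dd p TYPE('a)) * Lp_norm p lborel (%v. ennreal (norm (u (y, v)))))
   = ennreal (2 * DC * r powr - dd p TYPE('a)) * mix p u" unfolding mix_def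
  by (intro nn_integral_cmult Lp_norm_measurable[where V="%v x. ennreal (norm (u (x, v)))"] sigma_finite_lborel') measurable
 also have "2 * (ennreal (2 * DC * r powr - dd p TYPE('a)) * mix p u) = ennreal (4 * DC) * (ennreal (r powr - dd p TYPE('a)) * mix p u)"
 proof -
  have "2 * ennreal (2 * DC * r powr - dd p TYPE('a)) = ennreal 2 * ennreal (2 * DC * r powr - dd p TYPE('a))" by simp
  also have "\<dots> = ennreal (4 * DC) * ennreal (r powr - dd p TYPE('a))" using L
   by (subst (1 2) ennreal_mult[symmetric]) auto
  finally show ?thesis by (simp only: mult.assoc[symmetric])
 qed
 finally show ?thesis .
qed

text \<open>The functional is a superposition of point masses, at \<open>x + t v\<close> for f and at \<open>x + r v\<close>,
\<open>0 < r < t\<close>, for g.\<close>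

lemma block_bound:
 assumes F: "locrep \<phi> p f F" and G: "locrep \<phi> p g G" and t: "0 < t"
  and R: "\<And>\<eta>. schwartz \<eta> ==> R \<eta> = RR F G k t (LP k \<eta>)"
 shows "Lp_norm_distr p R <= ennreal (16 * DC) *
  (ennreal (t powr - dd p TYPE('a)) * mix p (F k (ll k t) (ll k t))
   + (NN r. indicator {0<..<t} r * (ennreal (r powr - dd p TYPE('a)) * mix p (G k (ll k r) (ll k r)))))"
  (is "_ <= _ * (?mf + ?mg)")
proof (cases "?mg = top")
 case True
 have "0 < DC" unfolding DC_def by (rule l1n(1)[OF schwartz_integrable[OF kk_schwartz[OF lp]]])
 then show ?thesis using True by (simp add: ennreal_mult_top)
next
 case False
 have L: "0 < DC" unfolding DC_def by (rule l1n(1)[OF schwartz_integrable[OF kk_schwartz[OF lp]]])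
 have [measurable]: "F k l1 l2 \<in> bmeas" "G k l1 l2 \<in> bmeas" for k l1 l2
  using locrepD[OF F] locrepD[OF G] by auto
 have [measurable]: "G k l1 l2 \<in> borel_measurable lborel" for l1 l2 by simp
 let ?F = "F k (ll k t) (ll k t)"
 define V1 where "V1 = (%x. NN z. ennreal (norm (?F z)) * ennreal (norm (cK k (stream t z) x)))"
 define U1 where "U1 = (%x. LINT z|lborel. ?F z * cK k (stream t z) x)"
 have n1: "Lp_norm p lborel V1 <= ennreal (4 * DC) * ?mf" unfolding V1_def by (rule dispersive[OF _ t]) measurable
 also have "\<dots> < top" using locrepD(2)[OF F] by (simp add: ennreal_mult_less_top)
 finally have f1: "Lp_norm p lborel V1 < top" .
 have sm: "(%z::'a\<times>'a. stream t z) \<in> borel_measurable lborel" by (simp add: shear_measurable)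
 note S1 = smoothed[OF sigma_finite_lborel' _ sm V1_def f1 U1_def]
 let ?Q = "lborel \<Otimes>\<^sub>M lborel :: (real \<times> 'a \<times> 'a) measure"
 define Hq where "Hq = (%q::real \<times> 'a \<times> 'a. indicator {0<..<t} (fst q) *\<^sub>R G k (ll k (fst q)) (ll k (fst q)) (snd q))"
 define Y where "Y = (%q::real \<times> 'a \<times> 'a. fst (snd q) + fst q *\<^sub>R snd (snd q))"
 have Ym: "Y \<in> borel_measurable ?Q"
 proof -
  have "Y \<in> bmeas" unfolding Y_def by (intro borel_measurable_continuous_onI continuous_intros)
  then show ?thesis by (simp add: lborel_prod)
 qed
 have Hm[measurable]: "Hq \<in> borel_measurable ?Q"
 proof -
  have "(%q::real \<times> 'a \<times> 'a. (%l q. G k l l (snd q)) (ll k (fst q)) q) \<in> borel_measurable ?Q"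
   by (rule measurable_compose_countable) measurable
  then show ?thesis unfolding Hq_def by measurable
 qed
 have sfQ: "sigma_finite_measure ?Q" unfolding lborel_prod by (rule sigma_finite_lborel')
 define V2 where "V2 = (%x. \<integral>\<^sup>+q. ennreal (norm (Hq q)) * ennreal (norm (cK k (Y q) x)) \<partial>?Q)"
 define U2 where "U2 = (%x. LINT q|?Q. Hq q * cK k (Y q) x)"
 define W where "W = (%(x, q). cK k (Y q) x)"
 have Wm[measurable]: "W \<in> borel_measurable (lborel \<Otimes>\<^sub>M ?Q)" unfolding W_def by (rule cK_measurable[OF Ym])
 let ?V = "%x r. NN z. ennreal (norm (Hq (r, z))) * ennreal (norm (W (x, r, z)))"
 have V2e: "V2 = (%x. NN r. ?V x r)"
 proof
  fix x
  have "(\<integral>\<^sup>+q. ennreal (norm (Hq q)) * ennreal (norm (W (x, q))) \<partial>?Q) = (NN r. ?V x r)"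
   by (rule lborel.nn_integral_fst[symmetric]) measurable
  then show "V2 x = (NN r. ?V x r)" by (simp add: V2_def W_def)
 qed
 have mm: "(%r. mix p (G k (ll k r) (ll k r))) \<in> borel_measurable lborel"
  using ll_compose_measurable[of "%l r. mix p (G k l l)" k] by simp
 have "Lp_norm p lborel V2 <= 2 * (NN r. Lp_norm p lborel (%x. ?V x r))"
  unfolding V2e by (rule minkowski_weak[OF sigma_finite_lborel' sigma_finite_lborel' _ p]) measurable
 also have "\<dots> <= 2 * (NN r. ennreal (4 * DC) * (indicator {0<..<t} r * (ennreal (r powr - dd p TYPE('a)) * mix p (G k (ll k r) (ll k r)))))"
 proof (intro mult_left_mono nn_integral_mono)
  fix r :: real
  show "Lp_norm p lborel (%x. ?V x r) <= ennreal (4 * DC) * (indicator {0<..<t} r * (ennreal (r powr - dd p TYPE('a)) * mix p (G k (ll k r) (ll k r))))"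
  proof (cases "r \<in> {0<..<t}")
   case True
   then have "?V x r = (NN z. ennreal (norm (G k (ll k r) (ll k r) z)) * ennreal (norm (cK k (stream r z) x)))" for x
    by (simp add: Hq_def W_def Y_def)
   then show ?thesis using True dispersive[of "G k (ll k r) (ll k r)" r k] by simp
  next
   case False
   then have "?V x r = 0" for x by (simp add: Hq_def)
   moreover have "Lp_norm p lborel (%x::'a. 0) <= 0"
    using Lp_norm_sum_weak[OF sigma_finite_lborel' finite.emptyI _ p, of "%i x::'a. 0"] by simp
   ultimately show ?thesis by simp
  qed
 qed simp
 also have "(NN r. ennreal (4 * DC) * (indicator {0<..<t} r * (ennreal (r powr - dd p TYPE('a)) * mix p (G k (ll k r) (ll k r))))) = ennreal (4 * DC) * ?mg"
  using mm by (intro nn_integral_cmult) measurable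
 finally have n2: "Lp_norm p lborel V2 <= 2 * (ennreal (4 * DC) * ?mg)" .
 also have "\<dots> < top" using False by (simp add: ennreal_mult_less_top less_top)
 finally have f2: "Lp_norm p lborel V2 < top" .
 note S2 = smoothed[OF sfQ Hm Ym V2_def f2 U2_def]
 have rep: "represents (%x. U1 x + U2 x) R"
  unfolding represents_def
 proof (intro conjI allI impI)
  show "(%x. U1 x + U2 x) \<in> bmeas" using S1(1) S2(1) by simp
  fix \<eta> :: "'a => complex" assume \<eta>: "schwartz \<eta>"
  have i: "integrable lborel (%x. U1 x * \<eta> x)" "integrable lborel (%x. U2 x * \<eta> x)" using S1(4) S2(4) \<eta> by auto
  then show "integrable lborel (%x. (U1 x + U2 x) * \<eta> x)" by (simp add: distrib_right)
  have "(LINT x|lborel. (U1 x + U2 x) * \<eta> x) = (LINT x|lborel. U1 x * \<eta> x) + (LINT x|lborel. U2 x * \<eta> x)"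
   using i by (simp add: distrib_right)
  also have "(LINT x|lborel. U1 x * \<eta> x) = Av F k t (LP k \<eta>)" using S1(6) \<eta> by (simp add: Av_def)
  also have "(LINT x|lborel. U2 x * \<eta> x) = (LINT q|?Q. Hq q * LP k \<eta> (Y q))" using S2(6) \<eta> by simp
  also have "\<dots> = (LINT r|lborel. LINT z|lborel. Hq (r, z) * LP k \<eta> (Y (r, z)))"
   by (rule lborel_pair.integral_fst'[symmetric, where f="%q. Hq q * LP k \<eta> (Y q)"]) (use S2(5) \<eta> in auto)
  also have "\<dots> = (LINT r|lborel. indicator {0<..<t} r *\<^sub>R Av G k r (LP k \<eta>))"
   by (simp add: Hq_def Y_def Av_def)
  finally show "R \<eta> = (LINT x|lborel. (U1 x + U2 x) * \<eta> x)" using R[OF \<eta>] by (simp add: RR_def)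
 qed
 have "Lp_norm_distr p R <= Lp_norm p lborel (%x. ennreal (norm (U1 x + U2 x)))"
  unfolding Lp_norm_distr_def using rep by (intro INF_lower) simp
 also have "\<dots> <= Lp_norm p lborel (%x. \<Sum>i\<in>{True, False}. (if i then V1 else V2) x)"
 proof (rule Lp_norm_mono_AE[OF _ _ p])
  show "(%x. ennreal (norm (U1 x + U2 x))) \<in> borel_measurable lborel" using S1(1) S2(1) by simp
  show "AE x in lborel. ennreal (norm (U1 x + U2 x)) <= (\<Sum>i\<in>{True, False}. (if i then V1 else V2) x)"
  proof (intro AE_I2)
   fix x
   have "ennreal (norm (U1 x + U2 x)) <= ennreal (norm (U1 x)) + ennreal (norm (U2 x))"
    unfolding ennreal_plus[OF norm_ge_zero norm_ge_zero, symmetric] by (intro ennreal_leI norm_triangle_ineq)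
   also have "\<dots> <= V1 x + V2 x" using S1(3) S2(3) by (intro add_mono) auto
   finally show "ennreal (norm (U1 x + U2 x)) <= (\<Sum>i\<in>{True, False}. (if i then V1 else V2) x)" by simp
  qed
 qed
 also have "\<dots> <= 2 * (\<Sum>i\<in>{True, False}. Lp_norm p lborel (if i then V1 else V2))"
  by (rule Lp_norm_sum_weak[OF sigma_finite_lborel' _ _ p]) (use S1(2) S2(2) in auto)
 also have "\<dots> = 2 * (Lp_norm p lborel V1 + Lp_norm p lborel V2)" by simp
 also have "\<dots> <= 2 * (ennreal (4 * DC) * ?mf + 2 * (ennreal (4 * DC) * ?mg))" by (intro mult_left_mono add_mono n1 n2) simp
 also have "\<dots> <= 2 * (2 * (ennreal (4 * DC) * ?mf) + 2 * (ennreal (4 * DC) * ?mg))"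
  by (intro mult_left_mono add_mono order_refl) (auto simp: mult_2 intro: add_increasing2)
 also have "\<dots> = (4 * ennreal (4 * DC)) * (?mf + ?mg)" by (simp add: algebra_simps)
 also have "4 * ennreal (4 * DC) = ennreal (16 * DC)"
 proof -
  have "4 * ennreal (4 * DC) = ennreal 4 * ennreal (4 * DC)" by simp
  also have "\<dots> = ennreal (16 * DC)" using L by (subst ennreal_mult[symmetric]) auto
  finally show ?thesis .
 qed
 finally show ?thesis .
qed

section \<open>The averaging estimate\<close>

text \<open>Insert the bound of \<open>locrep_exists\<close> for the representatives and apply the two sequence estimates.\<close>

lemma weighted_bound:
 fixes a b \<alpha> \<beta> s m \<delta> :: real
 defines "d == dd p TYPE('a)"
 assumes q: "1 <= q" and \<delta>: "\<delta> = 1 - d - \<beta>" "0 <= \<delta>" "q ~= 1 ==> 0 < \<delta>"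
  and s: "s + d - a = m * (\<alpha> + d)" "s - b - 1 + d + m * \<delta> = 0"
 shows "\<exists>C\<ge>0. \<forall>f g. f \<in> besov_xv \<phi> a \<alpha> 1 p q --> g \<in> besov_xv \<phi> b \<beta> 1 p q -->
  (\<exists>F G. locrep \<phi> p f F \<and> locrep \<phi> p g G \<and>
   (\<forall>L. lq q (%k. wt2 k s * BB p F G k (2 powr (L + m * of_int k - of_int k)))
    <= ennreal (C * (2 powr (- ((\<alpha> + d) * L)) * enn2real (besov_xv_norm \<phi> a \<alpha> 1 p q f)
       + 2 powr (\<delta> * L) * enn2real (besov_xv_norm \<phi> b \<beta> 1 p q g)))))"
proof -
 define C1 where "C1 = 338 * 2 powr (6 * \<bar>a\<bar> + 7 * \<bar>\<alpha>\<bar>)"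
 define C2 where "C2 = 26 * geo \<delta> * 2 powr (7 * \<bar>d\<bar> + 7 + 6 * \<bar>b\<bar> + 6 * \<delta>)"
 have C0: "0 <= C1" "0 <= C2" using geo_ge_1[of \<delta>] by (auto simp: C1_def C2_def)
 show ?thesis
 proof (intro exI[of _ "20 * (C1 + C2)"] conjI allI impI)
  show "0 <= 20 * (C1 + C2)" using C0 by simp
  fix f g assume f: "f \<in> besov_xv \<phi> a \<alpha> 1 p q" and g: "g \<in> besov_xv \<phi> b \<beta> 1 p q"
  have tf: "tempered f" "tempered g" using f g by (auto simp: besov_xv_def)
  define X Y where "X = enn2real (besov_xv_norm \<phi> a \<alpha> 1 p q f)" and "Y = enn2real (besov_xv_norm \<phi> b \<beta> 1 p q g)"
  have X: "besov_xv_norm \<phi> a \<alpha> 1 p q f = ennreal X" "besov_xv_norm \<phi> b \<beta> 1 p q g = ennreal Y" "0 <= X" "0 <= Y"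
   using f g by (auto simp: X_def Y_def besov_xv_def)
  define Nf where "Nf = (%(i, j). mixed_norm_distr 1 p (block_x \<phi> (2 powi i) (block_v \<phi> (2 powi j) f)))"
  define Ng where "Ng = (%(i, j). mixed_norm_distr 1 p (block_x \<phi> (2 powi i) (block_v \<phi> (2 powi j) g)))"
  obtain F where F: "locrep \<phi> p f F" "\<And>k l1 l2. mix p (F k l1 l2) <= 4 * (\<Sum>z\<in>near k l1 l2. Nf z)"
   using locrep_exists[OF lp tf(1) besov_xv_mixed_finite[OF f q] p] unfolding Nf_def by blast
  obtain G where G: "locrep \<phi> p g G" "\<And>k l1 l2. mix p (G k l1 l2) <= 4 * (\<Sum>z\<in>near k l1 l2. Ng z)"
   using locrep_exists[OF lp tf(2) besov_xv_mixed_finite[OF g q] p] unfolding Ng_def by blast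
  have "lq q (%k. wt2 k s * BB p F G k (2 powr (L + m * of_int k - of_int k)))
    <= ennreal (20 * (C1 + C2) * (2 powr (- ((\<alpha> + d) * L)) * X + 2 powr (\<delta> * L) * Y))" for L
  proof -
   define t where "t k = 2 powr (L + m * of_int k - of_int k)" for k :: int
   let ?Sf = "%k. \<Sum>z\<in>near k (ll k (t k)) (ll k (t k)). Nf z" and ?Sg = "%k r. \<Sum>z\<in>near k (ll k r) (ll k r). Ng z"
   let ?V1 = "%k. wt2 k s * (ennreal (t k powr - d) * ?Sf k)"
   let ?V2 = "%k. wt2 k s * (NN r. indicator {0<..<t k} r * (ennreal (r powr - d) * ?Sg k r))"
   let ?M = "count_space (UNIV :: int set)"
   have Sm: "(%r. ?Sg k r) \<in> borel_measurable lborel" for k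
    using ll_compose_measurable[of "%l r. \<Sum>z\<in>near k l l. Ng z" k] by simp
   have le: "wt2 k s * BB p F G k (t k) <= ennreal 4 * (\<Sum>i\<in>{True, False}. (if i then ?V1 else ?V2) k)" for k
   proof -
    have "BB p F G k (t k) <= ennreal (t k powr - d) * (4 * ?Sf k)
     + (NN r. 4 * (indicator {0<..<t k} r * (ennreal (r powr - d) * ?Sg k r)))"
     unfolding BB_def d_def[symmetric]
    proof (intro add_mono mult_left_mono F(2) nn_integral_mono)
     fix r
     have "indicator {0<..<t k} r * (ennreal (r powr - d) * mix p (G k (ll k r) (ll k r))) <= indicator {0<..<t k} r * (ennreal (r powr - d) * (4 * ?Sg k r))"
      by (intro mult_left_mono G(2)) auto
     then show "indicator {0<..<t k} r * (ennreal (r powr - d) * mix p (G k (ll k r) (ll k r))) <= 4 * (indicator {0<..<t k} r * (ennreal (r powr - d) * ?Sg k r))"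
      by (simp only: mult.left_commute[of 4])
    qed simp
    also have "(NN r. 4 * (indicator {0<..<t k} r * (ennreal (r powr - d) * ?Sg k r)))
     = 4 * (NN r. indicator {0<..<t k} r * (ennreal (r powr - d) * ?Sg k r))"
     using Sm by (intro nn_integral_cmult) measurable
    finally have "wt2 k s * BB p F G k (t k) <= wt2 k s * (ennreal (t k powr - d) * (4 * ?Sf k)
     + 4 * (NN r. indicator {0<..<t k} r * (ennreal (r powr - d) * ?Sg k r)))"
     by (intro mult_left_mono) auto
    also have "\<dots> = ennreal 4 * (?V1 k + ?V2 k)" by (simp add: distrib_left mult.left_commute)
    finally show ?thesis by simp
   qed
   have v1: "Lp_norm q ?M ?V1 <= ennreal (C1 * 2 powr (- ((\<alpha> + d) * L))) * ennreal X"
   proof -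
    have "Lp_norm q ?M ?V1 <= ennreal (338 * 2 powr (6 * \<bar>a\<bar> + 7 * \<bar>\<alpha>\<bar> - (\<alpha> + d) * L)) *
     lq q (%(k, l). wt2 k a * wt2 l \<alpha> * Nf (k, l))"
     by (rule lq_first[OF q s(1)]) (rule t_def)
    also have "lq q (%(k, l). wt2 k a * wt2 l \<alpha> * Nf (k, l)) = ennreal X"
     unfolding X(1)[symmetric] besov_xv_norm_def Nf_def by simp
    also have "338 * 2 powr (6 * \<bar>a\<bar> + 7 * \<bar>\<alpha>\<bar> - (\<alpha> + d) * L) = C1 * 2 powr (- ((\<alpha> + d) * L))"
     by (simp add: C1_def powr_diff powr_minus divide_inverse)
    finally show ?thesis .
   qed
   have v2: "Lp_norm q ?M ?V2 <= ennreal (C2 * 2 powr (\<delta> * L)) * ennreal Y"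
   proof -
    have "Lp_norm q ?M ?V2 <= ennreal (26 * geo \<delta> * 2 powr (7 * \<bar>d\<bar> + 7 + 6 * \<bar>b\<bar> + 6 * \<delta> + \<delta> * L)) *
     lq q (%(k, l). wt2 k b * wt2 l \<beta> * Ng (k, l))"
     by (rule lq_second[OF q s(2) \<delta>]) (assumption, rule t_def)
    also have "lq q (%(k, l). wt2 k b * wt2 l \<beta> * Ng (k, l)) = ennreal Y"
     unfolding X(2)[symmetric] besov_xv_norm_def Ng_def by simp
    also have "26 * geo \<delta> * 2 powr (7 * \<bar>d\<bar> + 7 + 6 * \<bar>b\<bar> + 6 * \<delta> + \<delta> * L) = C2 * 2 powr (\<delta> * L)"
     by (simp add: C2_def powr_add)
    finally show ?thesis .
   qed
   have "Lp_norm q ?M (%k. wt2 k s * BB p F G k (t k))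
    <= Lp_norm q ?M (%k. ennreal 4 * (\<Sum>i\<in>{True, False}. (if i then ?V1 else ?V2) k))"
    by (rule Lp_norm_mono_AE[OF _ _ q]) (use le in auto)
   also have "\<dots> <= ennreal (2 * (4 + 1)) * Lp_norm q ?M (%k. \<Sum>i\<in>{True, False}. (if i then ?V1 else ?V2) k)"
    by (rule Lp_norm_cmult[OF sigma_finite_count_int _ q]) auto
   also have "\<dots> <= ennreal (2 * (4 + 1)) * (2 * (\<Sum>i\<in>{True, False}. Lp_norm q ?M (if i then ?V1 else ?V2)))"
    by (intro mult_left_mono Lp_norm_sum_weak[OF sigma_finite_count_int _ _ q]) auto
   also have "\<dots> = ennreal (2 * (4 + 1)) * (2 * (Lp_norm q ?M ?V1 + Lp_norm q ?M ?V2))" by simp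
   also have "\<dots> <= ennreal (2 * (4 + 1)) * (2 * (ennreal (C1 * 2 powr (- ((\<alpha> + d) * L))) * ennreal X + ennreal (C2 * 2 powr (\<delta> * L)) * ennreal Y))"
    by (intro mult_left_mono add_mono v1 v2) auto
   also have "\<dots> = ennreal (20 * (C1 * 2 powr (- ((\<alpha> + d) * L)) * X + C2 * 2 powr (\<delta> * L) * Y))"
   proof -
    have "2 * (ennreal (C1 * 2 powr (- ((\<alpha> + d) * L))) * ennreal X + ennreal (C2 * 2 powr (\<delta> * L)) * ennreal Y)
     = ennreal 2 * ennreal (C1 * 2 powr (- ((\<alpha> + d) * L)) * X + C2 * 2 powr (\<delta> * L) * Y)"
     using C0 X(3,4) by (subst ennreal_plus) (auto simp: ennreal_mult)
    also have "ennreal 2 * ennreal (C1 * 2 powr (- ((\<alpha> + d) * L)) * X + C2 * 2 powr (\<delta> * L) * Y)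
     = ennreal (2 * (C1 * 2 powr (- ((\<alpha> + d) * L)) * X + C2 * 2 powr (\<delta> * L) * Y))" by (rule ennreal_mult'[symmetric]) simp
    also have "ennreal (2 * (4 + 1)) * \<dots> = ennreal (2 * (4 + 1) * (2 * (C1 * 2 powr (- ((\<alpha> + d) * L)) * X + C2 * 2 powr (\<delta> * L) * Y)))"
     by (rule ennreal_mult'[symmetric]) simp
    also have "2 * (4 + 1) * (2 * (C1 * 2 powr (- ((\<alpha> + d) * L)) * X + C2 * 2 powr (\<delta> * L) * Y)) = 20 * (C1 * 2 powr (- ((\<alpha> + d) * L)) * X + C2 * 2 powr (\<delta> * L) * Y)"
     by simp
    finally show ?thesis .
   qed
   also have "\<dots> <= ennreal (20 * (C1 + C2) * (2 powr (- ((\<alpha> + d) * L)) * X + 2 powr (\<delta> * L) * Y))"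
   proof (rule ennreal_leI)
    have "0 <= C2 * (2 powr (- ((\<alpha> + d) * L)) * X)" "0 <= C1 * (2 powr (\<delta> * L) * Y)" using C0 X(3,4) by auto
    then show "20 * (C1 * 2 powr (- ((\<alpha> + d) * L)) * X + C2 * 2 powr (\<delta> * L) * Y) <= 20 * (C1 + C2) * (2 powr (- ((\<alpha> + d) * L)) * X + 2 powr (\<delta> * L) * Y)"
     by (simp add: algebra_simps)
   qed
   finally show ?thesis unfolding t_def .
  qed
  then show "\<exists>F G. locrep \<phi> p f F \<and> locrep \<phi> p g G \<and>
   (\<forall>L. lq q (%k. wt2 k s * BB p F G k (2 powr (L + m * of_int k - of_int k)))
    <= ennreal (20 * (C1 + C2) * (2 powr (- ((\<alpha> + d) * L)) * enn2real (besov_xv_norm \<phi> a \<alpha> 1 p q f)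
       + 2 powr (\<delta> * L) * enn2real (besov_xv_norm \<phi> b \<beta> 1 p q g))))"
   using F(1) G(1) unfolding X_def Y_def by blast
 qed
qed

lemma BB_finite:
 fixes F G :: "int => int => int => 'a \<times> 'a => complex"
 assumes G: "locrep \<phi> p g G" and fin: "BB p F G k t < top"
 shows "set_integrable lborel {0<..<t} (\<gamma> G k)"
  and "enn2real (BB p F G k t) = t powr - dd p TYPE('a) * enn2real (mix p (F k (ll k t) (ll k t))) + (LINT r:{0<..<t}|lborel. \<gamma> G k r)"
proof -
 have mf: "mix p (G k l l) < top" for l using locrepD(2)[OF G] .
 have e: "(NN r. indicator {0<..<t} r * (ennreal (r powr - dd p TYPE('a)) * mix p (G k (ll k r) (ll k r)))) = (NN r. ennreal (indicator {0<..<t} r *\<^sub>R \<gamma> G k r))"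
  by (intro nn_integral_cong) (auto simp: indicator_def \<gamma>_def ennreal_mult mf)
 have g: "(NN r. ennreal (indicator {0<..<t} r *\<^sub>R \<gamma> G k r)) < top"
  using fin unfolding BB_def e by simp
 note [measurable] = gm_measurable(3)[OF G schwartz_zero]
 have n: "0 <= indicator {0<..<t} r *\<^sub>R \<gamma> G k r" for r
  using \<gamma>_nonneg[ of G k r] by (simp add: indicator_def)
 have i: "integrable lborel (%r. indicator {0<..<t} r *\<^sub>R \<gamma> G k r)"
 proof (rule integrableI_nonneg)
  show "(%r. indicator {0<..<t} r *\<^sub>R \<gamma> G k r) \<in> borel_measurable lborel" unfolding \<gamma>_def by measurable
 qed (use g n in auto)
 then show "set_integrable lborel {0<..<t} (\<gamma> G k)" by (simp add: set_integrable_def)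
 have "(NN r. ennreal (indicator {0<..<t} r *\<^sub>R \<gamma> G k r)) = ennreal (LINT r:{0<..<t}|lborel. \<gamma> G k r)"
  unfolding set_lebesgue_integral_def by (rule nn_integral_eq_integral[OF i]) (use n in auto)
 moreover have "0 <= (LINT r:{0<..<t}|lborel. \<gamma> G k r)" unfolding set_lebesgue_integral_def
  by (intro integral_nonneg_AE AE_I2) (use n in auto)
 moreover have "ennreal (t powr - dd p TYPE('a)) * mix p (F k (ll k t) (ll k t)) < top" using fin unfolding BB_def by simp
 ultimately show "enn2real (BB p F G k t) = t powr - dd p TYPE('a) * enn2real (mix p (F k (ll k t) (ll k t))) + (LINT r:{0<..<t}|lborel. \<gamma> G k r)"
  unfolding BB_def e by (simp add: enn2real_plus enn2real_mult)
qed

lemma spec1_block: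
 fixes \<eta> :: "'a => complex"
 assumes \<eta>: "schwartz \<eta>" shows "spec1 k (LP k \<eta>)"
proof -
 have "2 powi (k - 1) <= norm \<xi> \<and> norm \<xi> <= 2 powi (k + 1)" if "lpm \<phi> k \<xi> ~= 0" for \<xi>
  using lp_supp_powi[OF lp, of k \<xi>] that by (auto simp: lpm_def[OF lp])
 then show ?thesis unfolding spec1_def inv_fourier_fmul[OF lpm_bmul[OF lp] \<eta>]
  by (auto intro: fmul_schwartz[OF lpm_bmul[OF lp] \<eta>])
qed

lemma spec1_fmul: "spec1 k \<theta> ==> bmul m ==> spec1 k (fmul m \<theta>)" for \<theta> :: "'a => complex"
 unfolding spec1_def by (auto simp: inv_fourier_fmul intro: fmul_schwartz)

lemma block_lpm: "block \<phi> (2 powi k) T \<eta> = T (LP k \<eta>)"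
proof -
 have "(%\<xi>. cr (\<phi> ((1 / 2 powi k) *\<^sub>R \<xi>))) = lpm \<phi> k" by (simp add: fun_eq_iff lpm_def[OF lp])
 then show ?thesis unfolding block_def fourier_multiplier_fmul by simp
qed

text \<open>Both sides are the limit of the pairing of h with the regularized test function.\<close>

lemma Av_spec_indep:
 fixes \<theta> :: "'a => complex"
 assumes H: "locrep \<phi> p h H" and \<theta>: "spec1 j \<theta>" "spec1 k \<theta>" and r: "0 < r"
 shows "Av H j r \<theta> = Av H k r \<theta>"
proof -
 have \<theta>s: "schwartz \<theta>" using \<theta> by (simp add: spec1_def)
 have l: "((%\<epsilon>. h (shten r \<epsilon> \<theta> (kap \<phi>))) \<longlongrightarrow> Av H k r \<theta>) (at_right 0)" if \<theta>: "spec1 k \<theta>" for k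
 proof (rule Lim_transform_eventually[OF Av_limit[OF H \<theta>s r]])
  show "\<forall>\<^sub>F \<epsilon> in at_right 0. gm H k \<theta> \<epsilon> r = h (shten r \<epsilon> \<theta> (kap \<phi>))"
   unfolding eventually_at_right_field
   using r gm_eq[OF H \<theta>, of _ r] by (intro exI[of _ "r * 2 powi k / 8"]) auto
 qed
 show ?thesis by (rule tendsto_unique[OF _ l[OF \<theta>(1)] l[OF \<theta>(2)]]) simp
qed

lemma RR_spec_indep:
 fixes \<theta> :: "'a => complex"
 assumes F: "locrep \<phi> p f F" and G: "locrep \<phi> p g G" and \<theta>: "spec1 j \<theta>" "spec1 k \<theta>" and t: "0 < t"
 shows "RR F G j t \<theta> = RR F G k t \<theta>"
proof -
 have e: "indicator {0<..<t} r *\<^sub>R Av G j r \<theta> = indicator {0<..<t} r *\<^sub>R Av G k r \<theta>" for r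
  using Av_spec_indep[OF G \<theta>, of r] by (simp add: indicator_def)
 show ?thesis unfolding RR_def Av_spec_indep[OF F \<theta> t] e ..
qed

lemma RR_linear:
 fixes \<theta> \<eta> :: "'a => complex"
 assumes F: "locrep \<phi> p f F" and G: "locrep \<phi> p g G" and t: "0 < t" and i: "set_integrable lborel {0<..<t} (\<gamma> G k)"
  and \<theta>: "schwartz \<theta>"
 shows "schwartz \<eta> ==> RR F G k t (%x. \<theta> x + \<eta> x) = RR F G k t \<theta> + RR F G k t \<eta>"
  and "RR F G k t (%x. c * \<theta> x) = c * RR F G k t \<theta>"
proof -
 obtain B where B: "0 < B" "\<And>w. norm (kap \<phi> w) <= B" using K_bound by blast
 have I: "integrable lborel (%z. H k (ll k r) (ll k r) z * \<theta> (stream r z))"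
  if H: "locrep \<phi> p h H" and \<theta>: "schwartz \<theta>" and r: "0 < r" for h H r and \<theta> :: "'a => complex"
 proof -
  obtain C where C: "0 < C" "\<And>w. norm (\<theta> w) <= C" using schwartz_sup[OF \<theta>] by blast
  show ?thesis by (rule gm_bound(3)[OF H \<theta> r B C])
 qed
 have J: "integrable lborel (%r. indicator {0<..<t} r *\<^sub>R Av G k r \<theta>)" if \<theta>: "schwartz \<theta>" for \<theta> :: "'a => complex"
 proof -
  obtain C where C: "0 < C" "\<And>w. norm (\<theta> w) <= C" using schwartz_sup[OF \<theta>] by blast
  show ?thesis by (rule Av_set_integrable(1)[OF G \<theta> i C])
 qed
 have sc: "Av H k r (%x. c * \<theta> x) = c * Av H k r \<theta>" for H r
  unfolding Av_def integral_mult_right_zero[symmetric] by (simp only: mult.left_commute)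
 have "(LINT r|lborel. indicator {0<..<t} r *\<^sub>R Av G k r (%x. c * \<theta> x)) = c * (LINT r|lborel. indicator {0<..<t} r *\<^sub>R Av G k r \<theta>)"
  unfolding sc integral_mult_right_zero[symmetric] by simp
 then show "RR F G k t (%x. c * \<theta> x) = c * RR F G k t \<theta>" unfolding RR_def sc by (simp add: distrib_left)
 assume \<eta>: "schwartz \<eta>"
 have ad: "Av H k r (%x. \<theta> x + \<eta> x) = Av H k r \<theta> + Av H k r \<eta>" if "locrep \<phi> p h H" "0 < r" for h H r
  unfolding Av_def distrib_left by (rule Bochner_Integration.integral_add[OF I[OF that(1) \<theta> that(2)] I[OF that(1) \<eta> that(2)]])
 have "indicator {0<..<t} r *\<^sub>R Av G k r (%x. \<theta> x + \<eta> x) = indicator {0<..<t} r *\<^sub>R Av G k r \<theta> + indicator {0<..<t} r *\<^sub>R Av G k r \<eta>" for r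
  using ad[OF G, of r] by (simp add: indicator_def)
 then show "RR F G k t (%x. \<theta> x + \<eta> x) = RR F G k t \<theta> + RR F G k t \<eta>"
  unfolding RR_def ad[OF F t] by (simp add: Bochner_Integration.integral_add[OF J[OF \<theta>] J[OF \<eta>]])
qed

lemma RR_norm:
 fixes \<theta> :: "'a => complex"
 assumes F: "locrep \<phi> p f F" and G: "locrep \<phi> p g G" and t: "0 < t" and fin: "BB p F G k t < top"
  and \<theta>: "schwartz \<theta>" and C: "\<And>x. sw (swN TYPE('a)) x * norm (\<theta> x) <= C"
 shows "norm (RR F G k t \<theta>) <= hc p (C * swc TYPE('a) + 1) (C + 1) * enn2real (BB p F G k t)"
proof -
 have C0: "0 <= C" using C[of 0] by (smt (verit) mult_nonneg_nonneg norm_ge_zero sw_nonneg)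
 have sup: "norm (\<theta> x) <= C + 1" for x
 proof -
  have "1 * norm (\<theta> x) <= sw (swN TYPE('a)) x * norm (\<theta> x)" by (intro mult_right_mono) auto
  then show ?thesis using C[of x] by simp
 qed
 obtain B where B: "0 < B" "\<And>w. norm (kap \<phi> w) <= B" using K_bound by blast
 have C1: "0 < C + 1" using C0 by simp
 note S = BB_finite[OF G fin]
 let ?h = "hc p (l1n \<theta>) (C + 1)"
 have "norm (RR F G k t \<theta>) <= norm (Av F k t \<theta>) + norm (LINT r|lborel. indicator {0<..<t} r *\<^sub>R Av G k r \<theta>)"
  unfolding RR_def by (rule norm_triangle_ineq)
 also have "\<dots> <= ?h * (t powr - dd p TYPE('a) * enn2real (mix p (F k (ll k t) (ll k t)))) + ?h * (LINT r:{0<..<t}|lborel. \<gamma> G k r)"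
  by (intro add_mono gm_bound(2)[OF F \<theta> t B C1 sup] Av_set_integrable(2)[OF G \<theta> S(1) C1 sup])
 also have "\<dots> = ?h * enn2real (BB p F G k t)" unfolding S(2) by (simp add: distrib_left)
 also have "\<dots> <= hc p (C * swc TYPE('a) + 1) (C + 1) * enn2real (BB p F G k t)"
 proof (intro mult_right_mono)
  have "l1n \<theta> <= C * swc TYPE('a) + 1" unfolding l1n_def using weight_bound_integrable(3)[OF schwartz_measurable[OF \<theta>] C] by simp
  then show "?h <= hc p (C * swc TYPE('a) + 1) (C + 1)" unfolding hc_def
   using l1n(1)[OF schwartz_integrable[OF \<theta>]] conj_exp_le_1[OF p] by (intro mult_right_mono mult_left_mono powr_mono2) auto
 qed simp
 finally show ?thesis .
qed

text \<open>The blocks of a function with spectrum in the k-th annulus are independent of the index used for the representatives,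
and they add up to the function.\<close>

lemma RR_resum:
 fixes \<eta> :: "'a => complex"
 assumes F: "locrep \<phi> p f F" and G: "locrep \<phi> p g G" and t: "0 < t" and i: "set_integrable lborel {0<..<t} (\<gamma> G k)"
  and \<eta>: "schwartz \<eta>"
 shows "(\<Sum>j=k-6..k+6. RR F G j t (LP j (LP k \<eta>))) = RR F G k t (LP k \<eta>)"
proof -
 let ?\<eta> = "LP k \<eta>"
 note lb = lpm_bmul[OF lp]
 have \<eta>s: "schwartz ?\<eta>" by (rule fmul_schwartz[OF lb \<eta>])
 have sum: "RR F G k t (%x. \<Sum>j\<in>I. LP j ?\<eta> x) = (\<Sum>j\<in>I. RR F G k t (LP j ?\<eta>))" if "finite I" for I
  using that
 proof (induction I)
  case empty
  show ?case using RR_linear(2)[OF F G t i schwartz_zero, of 0] by simp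
 next
  case (insert j I)
  have "RR F G k t (%x. LP j ?\<eta> x + (\<Sum>j\<in>I. LP j ?\<eta> x)) = RR F G k t (LP j ?\<eta>) + RR F G k t (%x. \<Sum>j\<in>I. LP j ?\<eta> x)"
   by (rule RR_linear(1)[OF F G t i]) (intro schwartz_sum fmul_schwartz lb \<eta>s insert)+
  then show ?case using insert by simp
 qed
 have "(\<Sum>j=k-6..k+6. RR F G j t (LP j ?\<eta>)) = (\<Sum>j=k-6..k+6. RR F G k t (LP j ?\<eta>))"
 proof (intro sum.cong refl)
  fix j
  show "RR F G j t (LP j ?\<eta>) = RR F G k t (LP j ?\<eta>)"
   by (rule RR_spec_indep[OF F G spec1_block[OF \<eta>s] spec1_fmul[OF spec1_block[OF \<eta>] lb] t])
 qed
 also have "\<dots> = RR F G k t (%x. \<Sum>j=k-6..k+6. LP j ?\<eta> x)" by (rule sum[symmetric]) simp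
 also have "(%x. \<Sum>j=k-6..k+6. LP j ?\<eta> x) = ?\<eta>"
 proof -
  have "(%x. \<Sum>j=k-6..k+6. LP j ?\<eta> x) = fourier (%\<zeta>. \<Sum>j=k-6..k+6. lpm \<phi> j \<zeta> * inv_fourier ?\<eta> \<zeta>)"
   unfolding fmul_def[of _ ?\<eta>] by (rule fourier_sum[symmetric]) (auto intro: bmul_schwartz_mult lb inv_fourier_schwartz \<eta>s)
  also have "(%\<zeta>. \<Sum>j=k-6..k+6. lpm \<phi> j \<zeta> * inv_fourier ?\<eta> \<zeta>) = inv_fourier ?\<eta>"
  proof
   fix \<zeta>
   have e: "(\<Sum>j=k-6..k+6. lpm \<phi> j \<zeta> * inv_fourier ?\<eta> \<zeta>) = lpsum \<phi> k k \<zeta> * inv_fourier ?\<eta> \<zeta>"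
    by (simp add: lpsum_def sum_distrib_right)
   show "(\<Sum>j=k-6..k+6. lpm \<phi> j \<zeta> * inv_fourier ?\<eta> \<zeta>) = inv_fourier ?\<eta> \<zeta>"
   proof (cases "inv_fourier ?\<eta> \<zeta> = 0")
    case False
    then have z: "2 powi (k - 1) <= norm \<zeta>" "norm \<zeta> <= 2 powi (k + 1)" using spec1_block[OF \<eta>, of k] unfolding spec1_def by blast+
    have "(2::real) powi (k - 5) <= 2 powi (k - 1)" "(2::real) powi (k + 1) <= 2 powi (k + 5)"
     by (simp_all add: power_int_increasing)
    then have "lpsum \<phi> k k \<zeta> = 1" using z by (intro lpsum_eq_1[OF lp]) linarith+
    then show ?thesis using e by simp
   qed (simp add: e)
  qed
  finally show ?thesis by (simp add: fourier_inv_fourier[OF \<eta>s])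
 qed
 finally show ?thesis .
qed

lemma has_v_integral_unique:
 fixes T :: "('a \<times> 'a) distr"
 assumes "has_v_integral T R" "has_v_integral T R'" "schwartz \<eta>"
 shows "R \<eta> = R' \<eta>"
proof (rule tendsto_unique)
 show "((%\<epsilon>. T (%(x, v). \<eta> x * kap \<phi> (\<epsilon> *\<^sub>R v))) \<longlongrightarrow> R \<eta>) (at_right (0::real))"
  using assms(1,3) kap_schwartz[OF lp] kap_0[OF lp] unfolding has_v_integral_def by blast
 show "((%\<epsilon>. T (%(x, v). \<eta> x * kap \<phi> (\<epsilon> *\<^sub>R v))) \<longlongrightarrow> R' \<eta>) (at_right (0::real))"
  using assms(2,3) kap_schwartz[OF lp] kap_0[OF lp] unfolding has_v_integral_def by blast
qed simp

text \<open>In both cases of the definition of the average the formula holds for every \<open>t > 0\<close>, so t may be chosen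
depending on k.\<close>

lemma velocity_average_block:
 assumes tr: "transport_eq f g" and f: "tempered f" and g: "tempered g" and F: "locrep \<phi> p f F" and G: "locrep \<phi> p g G"
  and i: "\<And>k t. 0 < t ==> set_integrable lborel {0<..<t} (\<gamma> G k)"
  and \<rho>: "velocity_average \<phi> f g \<rho>" and t: "0 < t" and \<eta>: "schwartz \<eta>"
 shows "block \<phi> (2 powi k) \<rho> \<eta> = RR F G k t (LP k \<eta>)"
proof (cases "\<exists>u. v_integrable u f")
 case True
 then obtain u where u: "v_integrable u f" and r: "represents (%x. LINT v|lborel. u (x, v)) \<rho>"
  using \<rho> unfolding velocity_average_def by auto
 let ?\<theta> = "LP k \<eta>"
 have \<theta>: "schwartz ?\<theta>" by (rule fmul_schwartz[OF lpm_bmul[OF lp] \<eta>])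
 have "block \<phi> (2 powi k) \<rho> \<eta> = (LINT x|lborel. (LINT v|lborel. u (x, v)) * ?\<theta> x)"
  unfolding block_lpm using r \<theta> by (simp add: represents_def)
 also have "\<dots> = (LINT z|lborel. u z * ?\<theta> (fst z))" by (rule v_integral_pairing(2)[OF u \<theta>])
 also have "\<dots> = RR F G k t ?\<theta>" by (rule v_integrable_RR[OF tr f g F G spec1_block[OF \<eta>] t i[OF t] u])
 finally show ?thesis .
next
 case False
 then have "v_average_block \<phi> f g \<rho> k t" using \<rho> t by (simp add: velocity_average_def)
 then obtain F' G' where F': "has_v_integral (shear t (block_v \<phi> (t * 2 powi k) f)) F'"
  and G': "\<And>r. r \<in> {0<..<t} ==> has_v_integral (shear r (block_v \<phi> (r * 2 powi k) g)) (G' r)"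
  and b: "block \<phi> (2 powi k) \<rho> \<eta> = F' \<eta> + (LINT r:{0<..<t}|lborel. G' r \<eta>)"
  using \<eta> unfolding v_average_block_def by blast
 have "F' \<eta> = Av F k t (LP k \<eta>)"
  by (rule has_v_integral_unique[OF F' has_v_integral_Av[OF f F t] \<eta>])
 moreover have e: "indicator {0<..<t} r *\<^sub>R G' r \<eta> = indicator {0<..<t} r *\<^sub>R Av G k r (LP k \<eta>)" for r
 proof (cases "r \<in> {0<..<t}")
  case True
  then have "0 < r" by simp
  from has_v_integral_unique[OF G'[OF True] has_v_integral_Av[OF g G this] \<eta>] show ?thesis by simp
 qed simp
 ultimately show ?thesis unfolding b RR_def set_lebesgue_integral_def e by simp
qed

text \<open>The blocks are prescribed at \<open>t = 1\<close>; the formula for other t follows from \<open>RR_indep\<close>.\<close>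

lemma velocity_average_exists:
 assumes tr: "transport_eq f g" and f: "tempered f" and g: "tempered g" and F: "locrep \<phi> p f F" and G: "locrep \<phi> p g G"
  and fin: "\<And>k t. 0 < t ==> BB p F G k t < top" and gr: "\<And>k. enn2real (BB p F G k 1) <= Kb * 2 ^ (\<sigma> * nat \<bar>k\<bar>)"
 shows "\<exists>\<rho>. velocity_average \<phi> f g \<rho>"
proof (cases "\<exists>u. v_integrable u f")
 case True
 then obtain u where u: "v_integrable u f" by blast
 with v_integrable_average[OF u] show ?thesis unfolding velocity_average_def by auto
next
 case False
 note i = BB_finite(1)[OF G fin]
 have fin1: "BB p F G k 1 < top" for k by (rule fin) simp
 have i1: "set_integrable lborel {0<..<1} (\<gamma> G k)" for k by (rule i) simp
 have "\<exists>\<rho>. tempered \<rho> \<and> (\<forall>k \<eta>. schwartz \<eta> -->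
   \<rho> (LP k \<eta>) = (\<Sum>j=k-6..k+6. RR F G j 1 (LP j (LP k \<eta>))))"
 proof (rule realize[OF lp, where \<sigma>=\<sigma>])
  show "RR F G k 1 (%x. f x + g x) = RR F G k 1 f + RR F G k 1 g" if "schwartz f" "schwartz g" for k f g
   by (rule RR_linear(1)[OF F G zero_less_one i1 that])
  show "RR F G k 1 (%x. c * f x) = c * RR F G k 1 f" if "schwartz f" for k c f
   by (rule RR_linear(2)[OF F G zero_less_one i1 that])
  fix C
  have "norm (RR F G k 1 \<theta>) <= hc p (C * swc TYPE('a) + 1) (C + 1) * Kb * 2 ^ (\<sigma> * nat \<bar>k\<bar>)"
   if \<theta>: "schwartz \<theta>" "\<forall>x. sw (swN TYPE('a)) x * norm (\<theta> x) <= C" for k and \<theta> :: "'a => complex"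
  proof -
   have "norm (RR F G k 1 \<theta>) <= hc p (C * swc TYPE('a) + 1) (C + 1) * enn2real (BB p F G k 1)"
    by (rule RR_norm[OF F G zero_less_one fin1 \<theta>(1)]) (use \<theta>(2) in blast)
   also have "\<dots> <= hc p (C * swc TYPE('a) + 1) (C + 1) * (Kb * 2 ^ (\<sigma> * nat \<bar>k\<bar>))"
    by (intro mult_left_mono gr hc_nonneg)
   finally show ?thesis by (simp only: mult.assoc)
  qed
  then show "\<exists>B. \<forall>k \<theta>. schwartz \<theta> --> (\<forall>x. sw (swN TYPE('a)) x * norm (\<theta> x) <= C) --> norm (RR F G k 1 \<theta>) <= B * 2 ^ (\<sigma> * nat \<bar>k\<bar>)"
   by blast
 qed
 then obtain \<rho> where \<rho>: "tempered \<rho>" and e: "\<And>k \<eta>. schwartz \<eta> ==>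
   \<rho> (LP k \<eta>) = (\<Sum>j=k-6..k+6. RR F G j 1 (LP j (LP k \<eta>)))" by blast
 have "v_average_block \<phi> f g \<rho> k t" if t: "0 < t" for k t
  unfolding v_average_block_def
 proof (intro exI conjI ballI allI impI)
  show "has_v_integral (shear t (block_v \<phi> (t * 2 powi k) f)) (%\<eta>. Av F k t (LP k \<eta>))"
   by (rule has_v_integral_Av[OF f F t])
  show "has_v_integral (shear r (block_v \<phi> (r * 2 powi k) g)) ((%r \<eta>. Av G k r (LP k \<eta>)) r)" if "r \<in> {0<..<t}" for r
   using has_v_integral_Av[OF g G, of r k] that by simp
  fix \<eta> :: "'a => complex" assume \<eta>: "schwartz \<eta>"
  let ?\<theta> = "LP k \<eta>"
  have \<theta>: "schwartz ?\<theta>" by (rule fmul_schwartz[OF lpm_bmul[OF lp] \<eta>])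
  obtain C where C: "0 < C" "\<And>w. norm (?\<theta> w) <= C" using schwartz_sup[OF \<theta>] by blast
  show "set_integrable lborel {0<..<t} (%r. (%r \<eta>. Av G k r (LP k \<eta>)) r \<eta>)"
   unfolding set_integrable_def by (rule Av_set_integrable(1)[OF G \<theta> i[OF t] C])
  have "block \<phi> (2 powi k) \<rho> \<eta> = RR F G k 1 ?\<theta>"
   unfolding block_lpm e[OF \<eta>] by (rule RR_resum[OF F G zero_less_one i1 \<eta>])
  also have "\<dots> = RR F G k t ?\<theta>"
   by (rule RR_indep[OF tr f g F G spec1_block[OF \<eta>] i t zero_less_one])
  finally show "block \<phi> (2 powi k) \<rho> \<eta> = Av F k t ?\<theta> + (LINT r:{0<..<t}|lborel. (%r \<eta>. Av G k r (LP k \<eta>)) r \<eta>)"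
   by (simp add: RR_def set_lebesgue_integral_def)
 qed
 then have "velocity_average \<phi> f g \<rho>" using \<rho> False by (auto simp: velocity_average_def)
 then show ?thesis by blast
qed

lemma averaging_estimate:
 fixes a b \<alpha> \<beta> s d :: real and q :: ennreal
 assumes q: "1 <= q" and d: "d = dd p TYPE('a)" and \<alpha>: "\<alpha> > - d" and \<beta>: "\<beta> + d <= 1" "q ~= 1 ==> \<beta> + d < 1"
  and s: "s = (1 + b - a) * ((\<alpha> + d) / (1 + \<alpha> - \<beta>)) + a - d"
 shows "\<exists>C>0. \<forall>f g.
    f \<in> besov_xv \<phi> a \<alpha> 1 p q \<and> g \<in> besov_xv \<phi> b \<beta> 1 p q \<and> transport_eq f g -->
     (\<exists>\<rho>. velocity_average \<phi> f g \<rho>) \<and>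
     (\<forall>\<rho>. velocity_average \<phi> f g \<rho> -->
       \<rho> \<in> besov \<phi> s p q \<and>
       besov_norm \<phi> s p q \<rho> <=
        ennreal C * epowr (besov_xv_norm \<phi> a \<alpha> 1 p q f) ((1 - \<beta> - d) / (1 + \<alpha> - \<beta>))
             * epowr (besov_xv_norm \<phi> b \<beta> 1 p q g) ((\<alpha> + d) / (1 + \<alpha> - \<beta>)))"
proof -
 define e \<delta> where "e = \<alpha> + d" and "\<delta> = 1 - d - \<beta>"
 \<comment> \<open>The slope for which the weights in k cancel in both sequence estimates.\<close>
 define m where "m = (1 + b - a) / (e + \<delta>)"
 have e\<delta>: "0 < e" "0 <= \<delta>" "q ~= 1 ==> 0 < \<delta>" "1 + \<alpha> - \<beta> = e + \<delta>" "1 - \<beta> - d = \<delta>" using \<alpha> \<beta> by (auto simp: e_def \<delta>_def)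
 have m: "m * (e + \<delta>) = 1 + b - a" using e\<delta> by (simp add: m_def)
 have sm: "s = m * e + a - d" unfolding s e\<delta>(4) m_def e_def[symmetric] by simp
 have s1: "s + d - a = m * (\<alpha> + d)" by (simp add: sm e_def)
 have s2: "s - b - 1 + d + m * \<delta> = 0" using m by (simp add: sm algebra_simps)
 obtain C0 where C0: "0 <= C0" and W: "\<And>f g. f \<in> besov_xv \<phi> a \<alpha> 1 p q ==> g \<in> besov_xv \<phi> b \<beta> 1 p q ==>
  (\<exists>F G. locrep \<phi> p f F \<and> locrep \<phi> p g G \<and>
   (\<forall>L. lq q (%k. wt2 k s * BB p F G k (2 powr (L + m * of_int k - of_int k)))
    <= ennreal (C0 * (2 powr (- (e * L)) * enn2real (besov_xv_norm \<phi> a \<alpha> 1 p q f)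
       + 2 powr (\<delta> * L) * enn2real (besov_xv_norm \<phi> b \<beta> 1 p q g)))))"
  using weighted_bound[OF q \<delta>_def[unfolded d] e\<delta>(2,3) s1[unfolded d] s2[unfolded d]] unfolding e_def d by blast
 have D0: "0 < DC" unfolding DC_def by (rule l1n(1)[OF schwartz_integrable[OF kk_schwartz[OF lp]]])
 define C1 where "C1 = 2 * (16 * DC + 1) * C0"
 have C1: "0 <= C1" using C0 D0 by (simp add: C1_def)
 show ?thesis
 proof (intro exI[of _ "2 * C1 + 1"] conjI allI impI)
  show "0 < 2 * C1 + 1" using C1 by simp
  fix f g assume A: "f \<in> besov_xv \<phi> a \<alpha> 1 p q \<and> g \<in> besov_xv \<phi> b \<beta> 1 p q \<and> transport_eq f g"
  then have tr: "transport_eq f g" and tf: "tempered f" "tempered g" by (auto simp: besov_xv_def)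
  define X Y where "X = enn2real (besov_xv_norm \<phi> a \<alpha> 1 p q f)" and "Y = enn2real (besov_xv_norm \<phi> b \<beta> 1 p q g)"
  have X: "besov_xv_norm \<phi> a \<alpha> 1 p q f = ennreal X" "besov_xv_norm \<phi> b \<beta> 1 p q g = ennreal Y" "0 <= X" "0 <= Y"
   using A by (auto simp: X_def Y_def besov_xv_def)
  obtain F G where F: "locrep \<phi> p f F" and G: "locrep \<phi> p g G"
   and B: "\<And>L. lq q (%k. wt2 k s * BB p F G k (2 powr (L + m * of_int k - of_int k)))
    <= ennreal (C0 * (2 powr (- (e * L)) * X + 2 powr (\<delta> * L) * Y))"
   using W[of f g] A unfolding X_def Y_def by blast
  \<comment> \<open>A single term of the sequence; L is chosen below to reach a given t.\<close>
  have pt: "wt2 k s * BB p F G k (2 powr (L + m * of_int k - of_int k)) <= ennreal (C0 * (2 powr (- (e * L)) * X + 2 powr (\<delta> * L) * Y))" for k L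
   using Lp_norm_ge_point[OF q, of "%k. wt2 k s * BB p F G k (2 powr (L + m * of_int k - of_int k))" k] B[of L]
   by (rule order_trans)
  have fin: "BB p F G k t < top" if t: "0 < t" for k t
  proof -
   have "wt2 k s * BB p F G k t < top"
    using pt[of k "log 2 t + of_int k - m * of_int k"] t by (auto intro: le_less_trans)
   then show ?thesis by (auto simp: ennreal_mult_less_top)
  qed
  \<comment> \<open>At \<open>t = 1\<close>, that is \<open>L = k - m k\<close>, the weights are exponentials in k; this rate majorizes all of them.\<close>
  define \<sigma> where "\<sigma> = nat \<lceil>\<bar>s\<bar> + \<bar>e * (1 - m)\<bar> + \<bar>\<delta> * (1 - m)\<bar>\<rceil>"
  have \<sigma>: "\<bar>s\<bar> + \<bar>e * (1 - m)\<bar> + \<bar>\<delta> * (1 - m)\<bar> <= real \<sigma>" unfolding \<sigma>_def by linarith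
  have gr: "enn2real (BB p F G k 1) <= C0 * (X + Y) * 2 ^ (\<sigma> * nat \<bar>k\<bar>)" for k
  proof -
   let ?L = "of_int k - m * of_int k" and ?bb = "enn2real (BB p F G k 1)" and ?P = "2 ^ (\<sigma> * nat \<bar>k\<bar>) :: real"
   have b: "BB p F G k 1 = ennreal ?bb" using fin[of 1 k] by simp
   have "ennreal (2 powr (of_int k * s) * ?bb) <= ennreal (C0 * (2 powr (- (e * ?L)) * X + 2 powr (\<delta> * ?L) * Y))"
    using pt[of k ?L] b by (simp add: ennreal_mult)
   then have 1: "2 powr (of_int k * s) * ?bb <= C0 * (2 powr (- (e * ?L)) * X + 2 powr (\<delta> * ?L) * Y)"
    using C0 X(3,4) by (subst (asm) ennreal_le_iff) auto
   have "?bb = 2 powr (- (of_int k * s)) * (2 powr (of_int k * s) * ?bb)" by (simp add: mult.assoc[symmetric] powr_add[symmetric])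
   also have "\<dots> <= 2 powr (- (of_int k * s)) * (C0 * (2 powr (- (e * ?L)) * X + 2 powr (\<delta> * ?L) * Y))"
    by (intro mult_left_mono 1) simp
   also have "\<dots> = C0 * (2 powr ((- s - e * (1 - m)) * of_int k) * X + 2 powr ((- s + \<delta> * (1 - m)) * of_int k) * Y)"
   proof -
    have "- (real_of_int k * s) + - (e * ?L) = (- s - e * (1 - m)) * of_int k" "- (real_of_int k * s) + \<delta> * ?L = (- s + \<delta> * (1 - m)) * of_int k"
     by (simp_all add: algebra_simps)
    then have q: "2 powr (- (of_int k * s)) * 2 powr (- (e * ?L)) = 2 powr ((- s - e * (1 - m)) * of_int k)"
     "2 powr (- (of_int k * s)) * 2 powr (\<delta> * ?L) = 2 powr ((- s + \<delta> * (1 - m)) * of_int k)"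
     by (simp_all only: powr_add[symmetric])
    show ?thesis unfolding q[symmetric] by (simp add: distrib_left mult_ac)
   qed
   also have "\<dots> <= C0 * (?P * X + ?P * Y)"
    using C0 X(3,4) \<sigma> by (intro mult_left_mono add_mono mult_right_mono powr_le_power_nat) linarith+
   finally show ?thesis by (simp add: algebra_simps)
  qed
  show "\<exists>\<rho>. velocity_average \<phi> f g \<rho>" by (rule velocity_average_exists[OF tr tf F G fin gr])
  fix \<rho> assume \<rho>: "velocity_average \<phi> f g \<rho>"
  have "besov_norm \<phi> s p q \<rho> <= ennreal (C1 * (2 powr (- (e * L)) * X + 2 powr (\<delta> * L) * Y))" for L
  proof -
   have "besov_norm \<phi> s p q \<rho> <= lq q (%k. ennreal (16 * DC) *
     (wt2 k s * BB p F G k (2 powr (L + m * of_int k - of_int k))))"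
    unfolding besov_norm_def
   proof (rule Lp_norm_mono_AE[OF _ _ q])
    have "wt2 k s * Lp_norm_distr p (block \<phi> (2 powi k) \<rho>)
     <= ennreal (16 * DC) * (wt2 k s * BB p F G k (2 powr (L + m * of_int k - of_int k)))" for k
    proof -
     let ?t = "2 powr (L + m * of_int k - of_int k)"
     have t: "0 < ?t" by simp
     have "Lp_norm_distr p (block \<phi> (2 powi k) \<rho>) <= ennreal (16 * DC) * BB p F G k ?t" unfolding BB_def
      by (rule block_bound[OF F G t]) (rule velocity_average_block[OF tr tf F G BB_finite(1)[OF G fin] \<rho> t])
     from mult_left_mono[OF this, of "wt2 k s"] show ?thesis by (simp add: mult.left_commute)
    qed
    then show "AE k in count_space UNIV. wt2 k s * Lp_norm_distr p (block \<phi> (2 powi k) \<rho>)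
     <= ennreal (16 * DC) * (wt2 k s * BB p F G k (2 powr (L + m * of_int k - of_int k)))" by simp
   qed simp
   also have "\<dots> <= ennreal (2 * (16 * DC + 1)) * lq q (%k. wt2 k s * BB p F G k (2 powr (L + m * of_int k - of_int k)))"
    by (rule Lp_norm_cmult[OF sigma_finite_count_int _ q]) (use D0 in auto)
   also have "\<dots> <= ennreal (2 * (16 * DC + 1)) * ennreal (C0 * (2 powr (- (e * L)) * X + 2 powr (\<delta> * L) * Y))"
    by (intro mult_left_mono B) simp
   also have "\<dots> = ennreal (2 * (16 * DC + 1) * (C0 * (2 powr (- (e * L)) * X + 2 powr (\<delta> * L) * Y)))"
    by (rule ennreal_mult'[symmetric]) (use D0 in simp)
   finally show ?thesis by (simp add: C1_def mult.assoc)
  qed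
  from interpolate[OF X(3,4) C1 e\<delta>(1,2) this]
  have le: "besov_norm \<phi> s p q \<rho> <= ennreal (2 * C1) * epowr (ennreal X) (\<delta> / (e + \<delta>)) * epowr (ennreal Y) (e / (e + \<delta>))" .
  also have "\<dots> <= ennreal (2 * C1 + 1) * epowr (ennreal X) (\<delta> / (e + \<delta>)) * epowr (ennreal Y) (e / (e + \<delta>))"
   by (intro mult_right_mono ennreal_leI) auto
  finally show "besov_norm \<phi> s p q \<rho> <= ennreal (2 * C1 + 1) * epowr (besov_xv_norm \<phi> a \<alpha> 1 p q f) ((1 - \<beta> - d) / (1 + \<alpha> - \<beta>))
             * epowr (besov_xv_norm \<phi> b \<beta> 1 p q g) ((\<alpha> + d) / (1 + \<alpha> - \<beta>))"
   unfolding X(1,2) e\<delta>(4,5) e_def[symmetric] .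
  have ef: "epowr (ennreal x) c < top" for x c by (simp add: epowr_def)
  have "ennreal (2 * C1) * epowr (ennreal X) (\<delta> / (e + \<delta>)) * epowr (ennreal Y) (e / (e + \<delta>)) < top"
   by (simp add: ennreal_mult_less_top ef)
  with le have "besov_norm \<phi> s p q \<rho> < top" by (rule le_less_trans)
  moreover have "tempered \<rho>" using \<rho> by (simp add: velocity_average_def)
  ultimately show "\<rho> \<in> besov \<phi> s p q" by (simp add: besov_def)
 qed
qed

end

theorem theorem3p4:
  fixes \<psi> \<phi> :: "'a::euclidean_space \<Rightarrow> real"
    and p q :: ennreal
    and a b \<alpha> d :: real
    and s \<theta>\<^sub>f \<theta>\<^sub>g :: "real \<Rightarrow> real"
  assumes lp: "littlewood_paley \<psi> \<phi>"
    and p: "1 \<le> p"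
    and q: "1 \<le> q"
    and d: "d = real DIM('a) * (1 - enn2real (1 / p))"
    and ab: "b \<ge> a - 1"
    and \<alpha>: "\<alpha> > - d"
    and s: "\<And>\<beta>. s \<beta> = (1 + b - a) * ((\<alpha> + d) / (1 + \<alpha> - \<beta>)) + a - d"
    and \<theta>\<^sub>f: "\<And>\<beta>. \<theta>\<^sub>f \<beta> = (1 - \<beta> - d) / (1 + \<alpha> - \<beta>)"
    and \<theta>\<^sub>g: "\<And>\<beta>. \<theta>\<^sub>g \<beta> = (\<alpha> + d) / (1 + \<alpha> - \<beta>)"
  shows
    "(\<forall>\<beta> < 1 - d. \<exists>C>0. \<forall>f g.
        f \<in> besov_xv \<phi> a \<alpha> 1 p q \<and> g \<in> besov_xv \<phi> b \<beta> 1 p q \<and> transport_eq f g \<longrightarrow>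
          (\<exists>\<rho>. velocity_average \<phi> f g \<rho>) \<and>
          (\<forall>\<rho>. velocity_average \<phi> f g \<rho> \<longrightarrow>
             \<rho> \<in> besov \<phi> (s \<beta>) p q \<and>
             besov_norm \<phi> (s \<beta>) p q \<rho> \<le>
               ennreal C * epowr (besov_xv_norm \<phi> a \<alpha> 1 p q f) (\<theta>\<^sub>f \<beta>)
                         * epowr (besov_xv_norm \<phi> b \<beta> 1 p q g) (\<theta>\<^sub>g \<beta>)))
     \<and>
     (\<forall>\<beta>. \<beta> + d = 1 \<longrightarrow> (\<exists>C>0. \<forall>f g.
        f \<in> besov_xv \<phi> a \<alpha> 1 p 1 \<and> g \<in> besov_xv \<phi> b \<beta> 1 p 1 \<and> transport_eq f g \<longrightarrow>
          (\<exists>\<rho>. velocity_average \<phi> f g \<rho>) \<and>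
          (\<forall>\<rho>. velocity_average \<phi> f g \<rho> \<longrightarrow>
             \<rho> \<in> besov \<phi> (s \<beta>) p 1 \<and>
             besov_norm \<phi> (s \<beta>) p 1 \<rho> \<le>
               ennreal C * epowr (besov_xv_norm \<phi> a \<alpha> 1 p 1 f) (\<theta>\<^sub>f \<beta>)
                         * epowr (besov_xv_norm \<phi> b \<beta> 1 p 1 g) (\<theta>\<^sub>g \<beta>))))"
proof (intro conjI allI impI, goal_cases)
  case (1 \<beta>)
  then have \<beta>: "\<beta> + d \<le> 1" "\<beta> + d < 1" by linarith+
  show ?case unfolding \<theta>\<^sub>f \<theta>\<^sub>g by (rule averaging_estimate[OF lp p q _ \<alpha> \<beta> s]) (simp add: d dd_def)
next
  case (2 \<beta>)
  then have \<beta>: "\<beta> + d \<le> 1" "(1::ennreal) \<noteq> 1 \<Longrightarrow> \<beta> + d < 1" by auto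
  show ?case unfolding \<theta>\<^sub>f \<theta>\<^sub>g by (rule averaging_estimate[OF lp p order_refl _ \<alpha> \<beta> s]) (simp add: d dd_def)
qed

end
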